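(* Let $d,n\geq 1$ and work over $K=\mathbb{C}[u^{\pm1},v]$. The affine Yokonuma--Hecke algebra $\widehat{Y}_{d,n}$ is isomorphic, as a $K$-algebra, to $\bigoplus_{\mu}\operatorname{Mat}_{m_{\mu}}(\widehat{H}^{\mu})$, where the direct sum is over all $d$-compositions $\mu$ of $n$. An isomorphism $\Psi_{d,n}$ is given on the basis $\{E_{\chi}X^{\lambda}g_{w^{-1}}\}$ of $\widehat{Y}_{d,n}$ by $$\Psi_{d,n}\ :\ E_{\chi}X^{\lambda}g_{w^{-1}}\ \longmapsto\ u^{\ell(w^{-1})-\ell(\pi_{\chi}^{-1}w^{-1}\pi_{w(\chi)})}\,\boldsymbol{1}_{\chi,w(\chi)}\,\overline{X}^{\,\pi_{\chi}^{-1}(\lambda)}\,\overline{g}_{\pi_{\chi}^{-1}w^{-1}\pi_{w(\chi)}}\ ,$$ for all $\chi\in\operatorname{Irr}(\mathcal{T}_{d,n})$, $\lambda\in\mathbb{Z}^n$ and $w\in\mathfrak{S}_n$, where $\ell$ is the length function on $\mathfrak{S}_n$.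
   Context: Let $u,v$ be indeterminates, $K=\mathbb{C}[u^{\pm1},v]$, $\mathfrak{S}_n$ the symmetric group, $s_i=(i,i+1)$. Affine Yokonuma--Hecke algebra: $\widehat{Y}_{d,n}$ is the unital associative $K$-algebra generated by $g_1,\dots,g_{n-1},X_1^{\pm1},t_1,\dots,t_n$ with relations: $g_ig_j=g_jg_i$ for $|i-j|>1$; $g_ig_{i+1}g_i=g_{i+1}g_ig_{i+1}$; $X_1g_1X_1g_1=g_1X_1g_1X_1$; $X_1g_i=g_iX_1$ for $i\geq2$; $t_it_j=t_jt_i$; $g_it_j=t_{s_i(j)}g_i$; $t_j^d=1$; $X_1t_j=t_jX_1$; $g_i^2=u^2+v\,e_ig_i$, where $e_i=\frac1d\sum_{s=1}^{d}t_i^st_{i+1}^{-s}$. For $w\in\mathfrak{S}_n$ with reduced expression $s_{i_1}\cdots s_{i_r}$, $g_w=g_{i_1}\cdots g_{i_r}$. Set $X_{i+1}=u^{-2}g_iX_ig_i$; the $X_i$ commute with each other and with all $t_j$. For $\lambda\in\mathbb{Z}^n$, $X^{\lambda}=X_1^{\lambda_1}\cdots X_n^{\lambda_n}$. The affine Hecke algebra is $\widehat{H}_n=\widehat{Y}_{1,n}$ (so $t_j=1$, $e_i=1$), with generators written $\overline{g}_i,\overline{X}_1^{\pm1}$, and $\overline{X}_i$, $\overline{g}_w$, $\overline{X}^{\lambda}$ defined in the same way. Convention: $\widehat{H}_0=K$. A $d$-composition of $n$ is $\mu=(\mu_1,\dots,\mu_d)\in\mathbb{Z}_{\geq0}^d$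 with $\sum_a\mu_a=n$. The Young subgroup $\mathfrak{S}^{\mu}=\mathfrak{S}_{\mu_1}\times\dots\times\mathfrak{S}_{\mu_d}\subset\mathfrak{S}_n$ permutes the consecutive blocks of letters of sizes $\mu_1,\dots,\mu_d$; put $m_{\mu}=\frac{n!}{\mu_1!\cdots\mu_d!}$. Put $\widehat{H}^{\mu}=\widehat{H}_{\mu_1}\otimes\dots\otimes\widehat{H}_{\mu_d}$; it is identified with the subalgebra of $\widehat{H}_n$ generated by $\overline{X}_1^{\pm1},\dots,\overline{X}_n^{\pm1}$ and the $\overline{g}_i$ with $s_i\in\mathfrak{S}^{\mu}$, which is free with basis $\{\overline{X}^{\lambda}\overline{g}_w : \lambda\in\mathbb{Z}^n, w\in\mathfrak{S}^{\mu}\}$. Characters: $\mathcal{T}_{d,n}=\langle t_1,\dots,t_n\rangle\subset\widehat{Y}_{d,n}$ is isomorphic to the group algebra of $(\mathbb{Z}/d\mathbb{Z})^n$. Let $\xi_1,\dots,\xi_d$ be the $d$-th roots of unity. $\operatorname{Irr}(\mathcal{T}_{d,n})$ is the set of complex characters of $(\mathbb{Z}/d\mathbb{Z})^n$, each determined by the values $\chi(t_j)\in\{\xi_1,\dots,\xi_d\}$; $E_{\chi}$ is the primitive idempotent of $\mathcal{T}_{d,n}$ attached to $\chi$ (so $t_jE_{\chi}=\chi(t_j)E_{\chi}$). The set $\{E_{\chi}X^{\lambda}g_w : \chi\in\operatorname{Irr}(\mathcal{T}_{d,n}),\lambda\in\mathbb{Z}^n,w\in\mathfrak{S}_n\}$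 is a $K$-basis of $\widehat{Y}_{d,n}$. $\operatorname{Comp}(\chi)=\mu$ is the $d$-composition with $\mu_a=\#\{j:\chi(t_j)=\xi_a\}$. $\mathfrak{S}_n$ acts by $w(\chi)(t_i)=\chi(t_{w^{-1}(i)})$. For a $d$-composition $\mu$, $\chi_0^{\mu}$ is the character taking the value $\xi_1$ on the first $\mu_1$ of the $t_j$, $\xi_2$ on the next $\mu_2$, and so on; its stabilizer is $\mathfrak{S}^{\mu}$. For $\chi$ with $\operatorname{Comp}(\chi)=\mu$, $\pi_{\chi}\in\mathfrak{S}_n$ is the unique element of minimal length with $\pi_{\chi}(\chi_0^{\mu})=\chi$. The rows and columns of matrices in $\operatorname{Mat}_{m_{\mu}}(\widehat{H}^{\mu})$ are indexed by the $m_{\mu}$ characters $\chi$ with $\operatorname{Comp}(\chi)=\mu$; $\boldsymbol{1}_{\chi,\chi'}$ is the matrix with $1$ in row $\chi$ and column $\chi'$ and $0$ elsewhere. $\mathfrak{S}_n$ acts on $\mathbb{Z}^n$ by $w(\lambda)_i=\lambda_{w^{-1}(i)}$, so that $\overline{X}^{\,\pi_\chi^{-1}(\lambda)}=\prod_j\overline{X}_{\pi_{\chi}^{-1}(j)}^{\lambda_j}$. *)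

theory Defs
  imports
    Complex_Main
    "HOL-Library.Poly_Mapping"
    "HOL-Library.Product_Plus"
    "HOL-Combinatorics.Permutations"
    "HOL-Algebra.QuotRing"
    "HOL-Algebra.Module"
    "HOL-Algebra.Product_Groups"
begin

section \<open>The base ring\<close>

text \<open>The ring of polynomials in \<open>u\<close>, its inverse, and \<open>v\<close> with complex coefficients, as the
  monoid algebra of \<open>\<int> \<times> \<nat>\<close>: the key \<open>(a, b)\<close> stands for the monomial \<open>u\<^sup>a v\<^sup>b\<close>.\<close>

type_synonym K = "(int \<times> nat) \<Rightarrow>\<^sub>0 complex"

definition const :: "complex \<Rightarrow> K" where
  "const c = Poly_Mapping.single (0, 0) c"

definition u_pow :: "int \<Rightarrow> K" where
  "u_pow k = Poly_Mapping.single (k, 0) 1"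

definition v :: K where
  "v = Poly_Mapping.single (0, 1) 1"


section \<open>Algebras over a commutative ring\<close>

text \<open>An algebra is a ring together with a scalar multiplication, in the library record
  \<^typ>\<open>('k, 'a) module\<close>; the scalars are all elements of the type \<^typ>\<open>'k\<close>. (The library
  locale for algebras only covers commutative ones.)\<close>

definition alg_iso :: "('k, 'a) module \<Rightarrow> ('k, 'b) module \<Rightarrow> ('a \<Rightarrow> 'b) set" where
  "alg_iso A B =
     {h \<in> ring_iso A B. \<forall>c. \<forall>x\<in>carrier A. h (c \<odot>\<^bsub>A\<^esub> x) = c \<odot>\<^bsub>B\<^esub> h x}"

definition monoid_algebra ::
    "('m, 'e) monoid_scheme \<Rightarrow> ('k::comm_ring_1, 'm \<Rightarrow>\<^sub>0 'k) module" where
  "monoid_algebra M =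
     \<lparr>carrier = {f. Poly_Mapping.keys f \<subseteq> carrier M},
      mult = (\<lambda>f g. \<Sum>x\<in>Poly_Mapping.keys f. \<Sum>y\<in>Poly_Mapping.keys g.
                Poly_Mapping.single (x \<otimes>\<^bsub>M\<^esub> y) (Poly_Mapping.lookup f x * Poly_Mapping.lookup g y)),
      one = Poly_Mapping.single \<one>\<^bsub>M\<^esub> 1,
      zero = 0,
      add = (+),
      smult = (\<lambda>c. Poly_Mapping.map ((*) c))\<rparr>"

definition free_monoid :: "'g set \<Rightarrow> 'g list monoid" where
  "free_monoid S = \<lparr>carrier = lists S, mult = (@), one = []\<rparr>"

definition free_algebra :: "'g set \<Rightarrow> ('k::comm_ring_1, 'g list \<Rightarrow>\<^sub>0 'k) module" where
  "free_algebra S = monoid_algebra (free_monoid S)"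

definition alg_quot :: "('k, 'a) module \<Rightarrow> 'a set \<Rightarrow> ('k, 'a set) module" where
  "alg_quot A I =
     ring.extend (A Quot I) (module.fields (\<lambda>c X. \<Union>x\<in>X. I +>\<^bsub>A\<^esub> (c \<odot>\<^bsub>A\<^esub> x)))"

definition list_prod :: "('a, 'e) monoid_scheme \<Rightarrow> 'a list \<Rightarrow> 'a" where
  "list_prod M xs = foldr (\<lambda>x y. x \<otimes>\<^bsub>M\<^esub> y) xs \<one>\<^bsub>M\<^esub>"


subsection \<open>Tensor products of finite families\<close>

text \<open>The free module on the pure tensors is the monoid algebra of the product of the
  multiplicative monoids. The span of the relators below is closed under multiplication by pure
  tensors, so dividing by the two-sided ideal they generate gives the usual tensor product of
  modules, with its factorwise multiplication.\<close>

inductive_set tensor_relators ::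
    "'i set \<Rightarrow> ('i \<Rightarrow> ('k::comm_ring_1, 'a) module) \<Rightarrow> (('i \<Rightarrow> 'a) \<Rightarrow>\<^sub>0 'k) set"
  for I :: "'i set" and A :: "'i \<Rightarrow> ('k::comm_ring_1, 'a) module" where
  additive:
    "\<lbrakk>x \<in> (\<Pi>\<^sub>E i\<in>I. carrier (A i)); a \<in> I; p \<in> carrier (A a); q \<in> carrier (A a)\<rbrakk> \<Longrightarrow>
     Poly_Mapping.single (x(a := p \<oplus>\<^bsub>A a\<^esub> q)) 1
       - Poly_Mapping.single (x(a := p)) 1 - Poly_Mapping.single (x(a := q)) 1
     \<in> tensor_relators I A"
| homogeneous:
    "\<lbrakk>x \<in> (\<Pi>\<^sub>E i\<in>I. carrier (A i)); a \<in> I; p \<in> carrier (A a)\<rbrakk> \<Longrightarrow>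
     Poly_Mapping.single (x(a := c \<odot>\<^bsub>A a\<^esub> p)) 1 - Poly_Mapping.single (x(a := p)) c
     \<in> tensor_relators I A"

definition tensor_ideal ::
    "'i set \<Rightarrow> ('i \<Rightarrow> ('k::comm_ring_1, 'a) module) \<Rightarrow> (('i \<Rightarrow> 'a) \<Rightarrow>\<^sub>0 'k) set" where
  "tensor_ideal I A = Idl\<^bsub>monoid_algebra (product_group I A)\<^esub> (tensor_relators I A)"

definition tensor_algebra ::
    "'i set \<Rightarrow> ('i \<Rightarrow> ('k::comm_ring_1, 'a) module) \<Rightarrow> ('k, (('i \<Rightarrow> 'a) \<Rightarrow>\<^sub>0 'k) set) module" where
  "tensor_algebra I A = alg_quot (monoid_algebra (product_group I A)) (tensor_ideal I A)"

definition tensor_factor ::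
    "'i set \<Rightarrow> ('i \<Rightarrow> ('k::comm_ring_1, 'a) module) \<Rightarrow> 'i \<Rightarrow> 'a \<Rightarrow> (('i \<Rightarrow> 'a) \<Rightarrow>\<^sub>0 'k) set" where
  \<comment> \<open>the pure tensor with \<open>x\<close> in position \<open>a\<close> and ones elsewhere\<close>
  "tensor_factor I A a x =
     tensor_ideal I A +>\<^bsub>monoid_algebra (product_group I A)\<^esub>
       Poly_Mapping.single (\<lambda>i\<in>I. if i = a then x else \<one>\<^bsub>A i\<^esub>) 1"


subsection \<open>Matrix algebras and finite direct sums\<close>

definition mat_algebra :: "'i set \<Rightarrow> ('k, 'a) module \<Rightarrow> ('k, 'i \<times> 'i \<Rightarrow> 'a) module" where
  "mat_algebra I A =
     \<lparr>carrier = I \<times> I \<rightarrow>\<^sub>E carrier A,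
      mult = (\<lambda>M N. \<lambda>(i, j)\<in>I \<times> I. \<Oplus>\<^bsub>A\<^esub>k\<in>I. M (i, k) \<otimes>\<^bsub>A\<^esub> N (k, j)),
      one = (\<lambda>(i, j)\<in>I \<times> I. if i = j then \<one>\<^bsub>A\<^esub> else \<zero>\<^bsub>A\<^esub>),
      zero = (\<lambda>_\<in>I \<times> I. \<zero>\<^bsub>A\<^esub>),
      add = (\<lambda>M N. \<lambda>p\<in>I \<times> I. M p \<oplus>\<^bsub>A\<^esub> N p),
      smult = (\<lambda>c M. \<lambda>p\<in>I \<times> I. c \<odot>\<^bsub>A\<^esub> M p)\<rparr>"

definition elem_mat :: "'i set \<Rightarrow> ('k, 'a) module \<Rightarrow> 'i \<Rightarrow> 'i \<Rightarrow> 'a \<Rightarrow> ('i \<times> 'i \<Rightarrow> 'a)" where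
  "elem_mat I A i j x = (\<lambda>p\<in>I \<times> I. if p = (i, j) then x else \<zero>\<^bsub>A\<^esub>)"

text \<open>The direct sum, for a finite index set.\<close>

definition direct_sum_algebra ::
    "'i set \<Rightarrow> ('i \<Rightarrow> ('k, 'a) module) \<Rightarrow> ('k, 'i \<Rightarrow> 'a) module" where
  "direct_sum_algebra I A =
     \<lparr>carrier = (\<Pi>\<^sub>E i\<in>I. carrier (A i)),
      mult = (\<lambda>x y. \<lambda>i\<in>I. x i \<otimes>\<^bsub>A i\<^esub> y i),
      one = (\<lambda>i\<in>I. \<one>\<^bsub>A i\<^esub>),
      zero = (\<lambda>i\<in>I. \<zero>\<^bsub>A i\<^esub>),
      add = (\<lambda>x y. \<lambda>i\<in>I. x i \<oplus>\<^bsub>A i\<^esub> y i),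
      smult = (\<lambda>c x. \<lambda>i\<in>I. c \<odot>\<^bsub>A i\<^esub> x i)\<rparr>"

definition direct_sum_embed ::
    "'i set \<Rightarrow> ('i \<Rightarrow> ('k, 'a) module) \<Rightarrow> 'i \<Rightarrow> 'a \<Rightarrow> ('i \<Rightarrow> 'a)" where
  "direct_sum_embed I A i x = (\<lambda>j\<in>I. if j = i then x else \<zero>\<^bsub>A j\<^esub>)"


section \<open>The symmetric group\<close>

text \<open>Elements of the symmetric group are the functions \<open>w\<close> with \<open>w permutes {1..n}\<close>; the
  product is composition. Words in the \<open>s\<^sub>i\<close> are lists of indices.\<close>

definition simple_refl :: "nat \<Rightarrow> nat \<Rightarrow> nat" where
  "simple_refl i = Transposition.transpose i (Suc i)"

definition word_perm :: "nat list \<Rightarrow> nat \<Rightarrow> nat" where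
  "word_perm is = foldr (\<lambda>i p. simple_refl i \<circ> p) is id"

definition perm_length :: "nat \<Rightarrow> (nat \<Rightarrow> nat) \<Rightarrow> nat" where
  "perm_length n w = (LEAST r. \<exists>is \<in> lists {1..<n}. word_perm is = w \<and> length is = r)"

text \<open>A choice of reduced expression; by the braid relations the elements \<open>g\<^sub>w\<close> below do not
  depend on it.\<close>

definition reduced_word :: "nat \<Rightarrow> (nat \<Rightarrow> nat) \<Rightarrow> nat list" where
  "reduced_word n w =
     (SOME is. is \<in> lists {1..<n} \<and> word_perm is = w \<and> length is = perm_length n w)"

text \<open>The action by place permutation, both on \<open>\<int>\<^sup>n\<close> and on characters.\<close>

definition perm_act :: "(nat \<Rightarrow> nat) \<Rightarrow> (nat \<Rightarrow> 'a) \<Rightarrow> nat \<Rightarrow> 'a" where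
  "perm_act w f = (\<lambda>i. f (inv_into UNIV w i))"


section \<open>The affine Yokonuma--Hecke algebra\<close>

datatype yh_gen = G nat | X1 | X1_inv | T nat

text \<open>For \<open>n = 0\<close> there are no generators, so that the algebra is the base ring.\<close>

definition yh_gens :: "nat \<Rightarrow> yh_gen set" where
  "yh_gens n = G ` {1..<n} \<union> T ` {1..n} \<union> (if n = 0 then {} else {X1, X1_inv})"

abbreviation word :: "yh_gen list \<Rightarrow> yh_gen list \<Rightarrow>\<^sub>0 K" where
  "word xs \<equiv> Poly_Mapping.single xs 1"

text \<open>Each rule states that (left-hand side) - (right-hand side) is a relator. In the
  quadratic relation, \<open>t\<^sub>i\<^sub>+\<^sub>1\<^sup>-\<^sup>s\<close> is written as the power of \<open>t\<^sub>i\<^sub>+\<^sub>1\<close> with exponent \<open>d - s\<close>,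
  by \<open>t\<^sub>j\<^sup>d = 1\<close>.\<close>

inductive_set yh_relators :: "nat \<Rightarrow> nat \<Rightarrow> (yh_gen list \<Rightarrow>\<^sub>0 K) set"
  for d n :: nat where
  gg_far: "\<lbrakk>i \<in> {1..<n}; j \<in> {1..<n}; Suc i < j \<or> Suc j < i\<rbrakk> \<Longrightarrow>
     word [G i, G j] - word [G j, G i] \<in> yh_relators d n"
| ggg: "\<lbrakk>i \<in> {1..<n}; Suc i \<in> {1..<n}\<rbrakk> \<Longrightarrow>
     word [G i, G (Suc i), G i] - word [G (Suc i), G i, G (Suc i)] \<in> yh_relators d n"
| XgXg: "1 < n \<Longrightarrow>
     word [X1, G 1, X1, G 1] - word [G 1, X1, G 1, X1] \<in> yh_relators d n"
| Xg: "i \<in> {2..<n} \<Longrightarrow>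
     word [X1, G i] - word [G i, X1] \<in> yh_relators d n"
| tt: "\<lbrakk>i \<in> {1..n}; j \<in> {1..n}\<rbrakk> \<Longrightarrow>
     word [T i, T j] - word [T j, T i] \<in> yh_relators d n"
| gt: "\<lbrakk>i \<in> {1..<n}; j \<in> {1..n}\<rbrakk> \<Longrightarrow>
     word [G i, T j] - word [T (simple_refl i j), G i] \<in> yh_relators d n"
| t_order: "j \<in> {1..n} \<Longrightarrow>
     word (replicate d (T j)) - word [] \<in> yh_relators d n"
| Xt: "j \<in> {1..n} \<Longrightarrow>
     word [X1, T j] - word [T j, X1] \<in> yh_relators d n"
| X_inv_right: "1 \<le> n \<Longrightarrow> word [X1, X1_inv] - word [] \<in> yh_relators d n"
| X_inv_left: "1 \<le> n \<Longrightarrow> word [X1_inv, X1] - word [] \<in> yh_relators d n"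
| quadratic: "i \<in> {1..<n} \<Longrightarrow>
     word [G i, G i]
     - (Poly_Mapping.single [] (u_pow 2)
        + (\<Sum>s=1..d. Poly_Mapping.single
             (replicate s (T i) @ replicate (d - s) (T (Suc i)) @ [G i])
             (v * const (1 / of_nat d))))
     \<in> yh_relators d n"

definition yh_ideal :: "nat \<Rightarrow> nat \<Rightarrow> (yh_gen list \<Rightarrow>\<^sub>0 K) set" where
  "yh_ideal d n = Idl\<^bsub>free_algebra (yh_gens n) :: (K, _) module\<^esub> (yh_relators d n)"

definition YH :: "nat \<Rightarrow> nat \<Rightarrow> (K, (yh_gen list \<Rightarrow>\<^sub>0 K) set) module" where
  "YH d n = alg_quot (free_algebra (yh_gens n)) (yh_ideal d n)"

definition yh_elt :: "nat \<Rightarrow> nat \<Rightarrow> yh_gen \<Rightarrow> (yh_gen list \<Rightarrow>\<^sub>0 K) set" where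
  "yh_elt d n a = yh_ideal d n +>\<^bsub>free_algebra (yh_gens n) :: (K, _) module\<^esub> word [a]"

text \<open>\<open>X\<^sub>i\<close> for \<open>i \<ge> 1\<close>; the value at 0 is irrelevant.\<close>

fun yh_X :: "nat \<Rightarrow> nat \<Rightarrow> nat \<Rightarrow> (yh_gen list \<Rightarrow>\<^sub>0 K) set" where
  "yh_X d n 0 = \<one>\<^bsub>YH d n\<^esub>"
| "yh_X d n (Suc 0) = yh_elt d n X1"
| "yh_X d n (Suc (Suc i)) =
     u_pow (-2) \<odot>\<^bsub>YH d n\<^esub>
       (yh_elt d n (G (Suc i)) \<otimes>\<^bsub>YH d n\<^esub> yh_X d n (Suc i) \<otimes>\<^bsub>YH d n\<^esub> yh_elt d n (G (Suc i)))"

definition yh_X_power :: "nat \<Rightarrow> nat \<Rightarrow> (nat \<Rightarrow> int) \<Rightarrow> (yh_gen list \<Rightarrow>\<^sub>0 K) set" where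
  "yh_X_power d n l =
     list_prod (YH d n) (map (\<lambda>j. yh_X d n j [^]\<^bsub>YH d n\<^esub> l j) [1..<Suc n])"

definition yh_g :: "nat \<Rightarrow> nat \<Rightarrow> (nat \<Rightarrow> nat) \<Rightarrow> (yh_gen list \<Rightarrow>\<^sub>0 K) set" where
  "yh_g d n w = list_prod (YH d n) (map (\<lambda>i. yh_elt d n (G i)) (reduced_word n w))"


section \<open>Characters and compositions\<close>

text \<open>The group generated by the \<open>t\<^sub>j\<close> is the direct product of \<open>n\<close> cyclic groups of order \<open>d\<close>,
  so a character amounts to an arbitrary family of values \<open>\<chi> j = \<chi>(t\<^sub>j)\<close> among the \<open>d\<close>-th roots
  of unity.\<close>

definition Irr_T :: "nat \<Rightarrow> nat \<Rightarrow> (nat \<Rightarrow> complex) set" where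
  "Irr_T d n = {1..n} \<rightarrow>\<^sub>E {z. z ^ d = 1}"

text \<open>The usual group algebra idempotent, the average of \<open>\<chi>(t)\<^sup>-\<^sup>1 t\<close> over all \<open>t\<close>, factored
  according to the cyclic factors.\<close>

definition yh_E :: "nat \<Rightarrow> nat \<Rightarrow> (nat \<Rightarrow> complex) \<Rightarrow> (yh_gen list \<Rightarrow>\<^sub>0 K) set" where
  "yh_E d n \<chi> = list_prod (YH d n)
     (map (\<lambda>j. const (1 / of_nat d) \<odot>\<^bsub>YH d n\<^esub>
             (\<Oplus>\<^bsub>YH d n\<^esub>s\<in>{0..<d}. const (inverse (\<chi> j ^ s)) \<odot>\<^bsub>YH d n\<^esub>
                (yh_elt d n (T j) [^]\<^bsub>YH d n\<^esub> s)))
        [1..<Suc n])"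

definition compositions :: "nat \<Rightarrow> nat \<Rightarrow> (nat \<Rightarrow> nat) set" where
  "compositions d n = {\<mu> \<in> {1..d} \<rightarrow>\<^sub>E UNIV. (\<Sum>a=1..d. \<mu> a) = n}"

text \<open>\<open>\<xi>\<close> is a fixed enumeration by \<open>{1..d}\<close> of the \<open>d\<close>-th roots of unity.\<close>

definition Comp :: "nat \<Rightarrow> nat \<Rightarrow> (nat \<Rightarrow> complex) \<Rightarrow> (nat \<Rightarrow> complex) \<Rightarrow> nat \<Rightarrow> nat" where
  "Comp d n \<xi> \<chi> = (\<lambda>a\<in>{1..d}. card {j \<in> {1..n}. \<chi> j = \<xi> a})"

definition chars_of_comp ::
    "nat \<Rightarrow> nat \<Rightarrow> (nat \<Rightarrow> complex) \<Rightarrow> (nat \<Rightarrow> nat) \<Rightarrow> (nat \<Rightarrow> complex) set" where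
  "chars_of_comp d n \<xi> \<mu> = {\<chi> \<in> Irr_T d n. Comp d n \<xi> \<chi> = \<mu>}"

text \<open>The index of the consecutive block of \<open>\<mu>\<close> containing the letter \<open>j\<close>, and the position of
  \<open>j\<close> (counted from 1) within that block.\<close>

definition block :: "(nat \<Rightarrow> nat) \<Rightarrow> nat \<Rightarrow> nat" where
  "block \<mu> j = (LEAST a. j \<le> (\<Sum>b=1..a. \<mu> b))"

definition block_pos :: "(nat \<Rightarrow> nat) \<Rightarrow> nat \<Rightarrow> nat" where
  "block_pos \<mu> j = j - (\<Sum>b=1..<block \<mu> j. \<mu> b)"

definition chi0 :: "nat \<Rightarrow> (nat \<Rightarrow> complex) \<Rightarrow> (nat \<Rightarrow> nat) \<Rightarrow> nat \<Rightarrow> complex" where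
  "chi0 n \<xi> \<mu> = (\<lambda>j\<in>{1..n}. \<xi> (block \<mu> j))"

definition pi_chi ::
    "nat \<Rightarrow> nat \<Rightarrow> (nat \<Rightarrow> complex) \<Rightarrow> (nat \<Rightarrow> complex) \<Rightarrow> nat \<Rightarrow> nat" where
  "pi_chi d n \<xi> \<chi> =
     (THE p. is_arg_min (perm_length n)
        (\<lambda>p. p permutes {1..n} \<and> perm_act p (chi0 n \<xi> (Comp d n \<xi> \<chi>)) = \<chi>) p)"


section \<open>The algebras attached to compositions\<close>

definition H_mu ::
    "nat \<Rightarrow> (nat \<Rightarrow> nat) \<Rightarrow> (K, ((nat \<Rightarrow> (yh_gen list \<Rightarrow>\<^sub>0 K) set) \<Rightarrow>\<^sub>0 K) set) module" where
  "H_mu d \<mu> = tensor_algebra {1..d} (\<lambda>a. YH 1 (\<mu> a))"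

text \<open>Under the identification with a subalgebra of the affine Hecke algebra on \<open>n\<close> letters, the
  \<open>k\<close>-th \<open>X\<close>-generator of the tensor factor \<open>a\<close> is \<open>X\<^sub>j\<close>, where \<open>j\<close> is the \<open>k\<close>-th letter of the
  \<open>a\<close>-th block. Likewise the \<open>k\<close>-th \<open>g\<close>-generator of that factor is \<open>g\<^sub>j\<close>, where now \<open>j\<close> and \<open>j+1\<close>
  both lie in the \<open>a\<close>-th block, that is, \<open>s\<^sub>j\<close> lies in the Young subgroup.\<close>

definition H_mu_X ::
    "nat \<Rightarrow> (nat \<Rightarrow> nat) \<Rightarrow> nat \<Rightarrow> ((nat \<Rightarrow> (yh_gen list \<Rightarrow>\<^sub>0 K) set) \<Rightarrow>\<^sub>0 K) set" where
  "H_mu_X d \<mu> j =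
     tensor_factor {1..d} (\<lambda>a. YH 1 (\<mu> a)) (block \<mu> j)
       (yh_X 1 (\<mu> (block \<mu> j)) (block_pos \<mu> j))"

definition H_mu_gen ::
    "nat \<Rightarrow> (nat \<Rightarrow> nat) \<Rightarrow> nat \<Rightarrow> ((nat \<Rightarrow> (yh_gen list \<Rightarrow>\<^sub>0 K) set) \<Rightarrow>\<^sub>0 K) set" where
  "H_mu_gen d \<mu> j =
     tensor_factor {1..d} (\<lambda>a. YH 1 (\<mu> a)) (block \<mu> j)
       (yh_elt 1 (\<mu> (block \<mu> j)) (G (block_pos \<mu> j)))"

definition H_mu_X_power ::
    "nat \<Rightarrow> nat \<Rightarrow> (nat \<Rightarrow> nat) \<Rightarrow> (nat \<Rightarrow> int) \<Rightarrow>
     ((nat \<Rightarrow> (yh_gen list \<Rightarrow>\<^sub>0 K) set) \<Rightarrow>\<^sub>0 K) set" where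
  "H_mu_X_power d n \<mu> l =
     list_prod (H_mu d \<mu>) (map (\<lambda>j. H_mu_X d \<mu> j [^]\<^bsub>H_mu d \<mu>\<^esub> l j) [1..<Suc n])"

text \<open>Meaningful for \<open>w\<close> in the Young subgroup of \<open>\<mu>\<close>: every reduced expression of such a \<open>w\<close> in
  the full symmetric group only involves \<open>s\<^sub>j\<close> from the Young subgroup.\<close>

definition H_mu_g ::
    "nat \<Rightarrow> nat \<Rightarrow> (nat \<Rightarrow> nat) \<Rightarrow> (nat \<Rightarrow> nat) \<Rightarrow>
     ((nat \<Rightarrow> (yh_gen list \<Rightarrow>\<^sub>0 K) set) \<Rightarrow>\<^sub>0 K) set" where
  "H_mu_g d n \<mu> w = list_prod (H_mu d \<mu>) (map (H_mu_gen d \<mu>) (reduced_word n w))"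

definition mat_H ::
    "nat \<Rightarrow> nat \<Rightarrow> (nat \<Rightarrow> complex) \<Rightarrow> (nat \<Rightarrow> nat) \<Rightarrow>
     (K, (nat \<Rightarrow> complex) \<times> (nat \<Rightarrow> complex) \<Rightarrow>
         ((nat \<Rightarrow> (yh_gen list \<Rightarrow>\<^sub>0 K) set) \<Rightarrow>\<^sub>0 K) set) module" where
  "mat_H d n \<xi> \<mu> = mat_algebra (chars_of_comp d n \<xi> \<mu>) (H_mu d \<mu>)"

end

theory Submission
  imports Defs
begin

text \<open>The defining relations of the affine Yokonuma--Hecke algebra are checked for the matrices that the
  formula assigns to the generators: \<open>t\<^sub>j\<close> and \<open>X\<^sub>j\<close> become diagonal, and \<open>g\<^sub>i\<close> becomes \<open>u\<close> times the
  permutation of \<open>\<chi>\<close> and \<open>s\<^sub>i(\<chi>)\<close> where these differ and a generator of the Hecke algebra where they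
  agree. This yields the homomorphism \<open>\<Psi>\<close>, and its value on a basis element is found by following a
  reduced word of \<open>w\<close>: each letter either moves \<open>\<chi>\<close>, contributing a factor \<open>u\<close>, or fixes it,
  contributing a letter of a reduced word of \<open>\<pi>\<^sub>\<chi>\<^sup>-\<^sup>1 w\<^sup>-\<^sup>1 \<pi>\<^bsub>w(\<chi>)\<^esub>\<close>.

  No basis theorem enters. Surjectivity holds because the image contains enough matrix units and, in the
  corner of the sorted character \<open>\<chi>\<^sub>0\<close>, the generators of the Hecke algebra. For injectivity, the
  relations give a homomorphism \<open>\<phi>\<close> from the Hecke algebra of \<open>\<mu>\<close> back into the corner of the idempotent
  \<open>E\<^sub>0\<close> of \<open>\<chi>\<^sub>0\<close>. Multiplying \<open>E\<^sub>0\<close> by products of the \<open>u\<^sup>-\<^sup>1 g\<^sub>i\<close> along words that sort \<open>\<chi>\<close> gives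
  elements \<open>G\<^sub>\<chi>\<close>, independent of the word by Matsumoto's theorem, with
  \<open>y G\<^bsub>\<chi>'\<^esub> = \<Sum>\<^sub>\<chi> G\<^sub>\<chi> \<phi>(\<Psi>(y)\<^bsub>\<chi>,\<chi>'\<^esub>)\<close>. Since \<open>G\<^sub>\<chi>\<close> is \<open>E\<^sub>\<chi>\<close> times a unit, \<open>\<Psi>(y) = 0\<close> forces
  \<open>y E\<^sub>\<chi> = 0\<close> for all \<open>\<chi>\<close>, so \<open>y = 0\<close>.\<close>

section \<open>Algebras\<close>

text \<open>The spectrum of the t_j suggests the images of the generators. On E_\<chi> the element
  e_i acts as 1 if \<chi>(t_i) = \<chi>(t_{i+1}) and as 0 otherwise, so g_i obeys the Hecke relation
  in the first case and only g_i^2 = u^2 in the second. The entry \<open>u\<close> of a moving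
  letter splits this u^2 evenly between a swap and its reverse. The obstacle is that all algebras
  here are quotients of free algebras: equations follow from relations, but linear independence
  cannot be read off. Hence every homomorphism leaves its source through a universal property, of a
  presentation or of a tensor product. The combinatorial device is to replace a character by its
  colouring, j being coloured by the index a with \<chi>(t_j) = \<xi>_a. The inverse of \<pi>_\<chi>
  is then stable sorting by colour, and whether a letter moves a character is a comparison of two
  neighbouring colours. Permutations and colourings are both treated by one notion of sorting word,
  which records descents instead of minimal length.\<close>

locale kalgebra = ring A for A :: "('k::comm_ring_1, 'a) module" (structure) +
  assumes smult_closed [simp, intro]: "x \<in> carrier A \<Longrightarrow> c \<odot> x \<in> carrier A"
    and smult_add_left: "x \<in> carrier A \<Longrightarrow> (c + e) \<odot> x = c \<odot> x \<oplus> e \<odot> x"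
    and smult_add_right:
      "\<lbrakk>x \<in> carrier A; y \<in> carrier A\<rbrakk> \<Longrightarrow> c \<odot> (x \<oplus> y) = c \<odot> x \<oplus> c \<odot> y"
    and smult_smult [simp]: "x \<in> carrier A \<Longrightarrow> c \<odot> (e \<odot> x) = (c * e) \<odot> x"
    and smult_one [simp]: "x \<in> carrier A \<Longrightarrow> 1 \<odot> x = x"
    and smult_mult_left [simp]:
      "\<lbrakk>x \<in> carrier A; y \<in> carrier A\<rbrakk> \<Longrightarrow> (c \<odot> x) \<otimes> y = c \<odot> (x \<otimes> y)"
    and smult_mult_right [simp]:
      "\<lbrakk>x \<in> carrier A; y \<in> carrier A\<rbrakk> \<Longrightarrow> x \<otimes> (c \<odot> y) = c \<odot> (x \<otimes> y)"
begin

lemma smult_zero_left [simp]: "x \<in> carrier A \<Longrightarrow> 0 \<odot> x = \<zero>"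
  using smult_add_left[of x 0 0] add.l_cancel_one[of "0 \<odot> x" "0 \<odot> x"] by simp

lemma smult_zero_right [simp]: "c \<odot> \<zero> = \<zero>"
  using smult_add_right[of \<zero> \<zero> c] add.l_cancel_one[of "c \<odot> \<zero>" "c \<odot> \<zero>"] by simp

lemma smult_minus_one: "x \<in> carrier A \<Longrightarrow> (-1) \<odot> x = \<ominus> x"
  using smult_add_left[of x "-1" 1] by (simp add: minus_equality)

lemma smult_finsum:
  "f \<in> I \<rightarrow> carrier A \<Longrightarrow> c \<odot> (\<Oplus>i\<in>I. f i) = (\<Oplus>i\<in>I. c \<odot> f i)"
  by (induct I rule: infinite_finite_induct) (auto simp: Pi_def smult_add_right)

lemma smult_sum: "x \<in> carrier A \<Longrightarrow> (\<Sum>i\<in>I. c i) \<odot> x = (\<Oplus>i\<in>I. c i \<odot> x)"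
  by (induct I rule: infinite_finite_induct) (auto simp: Pi_def smult_add_left)

lemma finsum_swap:
  assumes "finite I" "finite J" "\<And>i j. \<lbrakk>i \<in> I; j \<in> J\<rbrakk> \<Longrightarrow> f i j \<in> carrier A"
  shows "(\<Oplus>i\<in>I. \<Oplus>j\<in>J. f i j) = (\<Oplus>j\<in>J. \<Oplus>i\<in>I. f i j)"
  using assms(1,3)
proof (induct I)
  case (insert i I)
  then have "(\<Oplus>j\<in>J. \<Oplus>i\<in>insert i I. f i j) = (\<Oplus>j\<in>J. f i j \<oplus> (\<Oplus>i\<in>I. f i j))"
    by (intro finsum_cong') (auto simp: Pi_def)
  with insert show ?case
    by (simp add: finsum_addf Pi_def)
qed simp

lemma finsum_single:
  assumes "finite I" "i \<in> I" "f i \<in> carrier A" "\<And>j. \<lbrakk>j \<in> I; j \<noteq> i\<rbrakk> \<Longrightarrow> f j = \<zero>"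
  shows "(\<Oplus>j\<in>I. f j) = f i"
proof -
  have "(\<Oplus>j\<in>I. f j) = (\<Oplus>j\<in>I. if i = j then f j else \<zero>)"
    using assms by (intro finsum_cong') auto
  also have "\<dots> = (\<Oplus>j\<in>I. if i = j then f i else \<zero>)"
    using assms by (intro finsum_cong') auto
  also have "\<dots> = f i"
    using assms finsum_singleton[of i I "\<lambda>_. f i"] by auto
  finally show ?thesis .
qed

lemma Units_nat_pow: "z \<in> Units A \<Longrightarrow> z [^] (k::nat) \<in> Units A"
  by (induct k) auto

lemma list_prod_closed [simp]: "set xs \<subseteq> carrier A \<Longrightarrow> list_prod A xs \<in> carrier A"
  by (induct xs) (auto simp: list_prod_def)

lemma list_prod_append:
  "\<lbrakk>set xs \<subseteq> carrier A; set ys \<subseteq> carrier A\<rbrakk> \<Longrightarrow>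
   list_prod A (xs @ ys) = list_prod A xs \<otimes> list_prod A ys"
proof (induct xs)
  case (Cons x xs)
  then show ?case
    using m_assoc[of x "list_prod A xs" "list_prod A ys"] list_prod_closed[of xs]
      list_prod_closed[of ys] by (simp add: list_prod_def)
next
  case Nil
  then show ?case
    using list_prod_closed[of ys] by (simp add: list_prod_def)
qed

end

lemma list_prod_Nil [simp]: "list_prod A [] = \<one>\<^bsub>A\<^esub>"
  by (simp add: list_prod_def)

lemma list_prod_Cons [simp]: "list_prod A (x # xs) = x \<otimes>\<^bsub>A\<^esub> list_prod A xs"
  by (simp add: list_prod_def)

text \<open>Negatives come from the scalars: \<open>(-1) \<odot> x\<close> is an additive inverse of
  \<open>x\<close>, by distributivity together with \<open>1 \<odot> x = x\<close> and
  \<open>0 \<odot> x = \<zero>\<close>.\<close>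

lemma kalgebraI:
  fixes A :: "('k::comm_ring_1, 'a) module" (structure)
  assumes "\<zero> \<in> carrier A" "\<one> \<in> carrier A"
    "\<And>x y. \<lbrakk>x \<in> carrier A; y \<in> carrier A\<rbrakk> \<Longrightarrow> x \<oplus> y \<in> carrier A"
    "\<And>x y. \<lbrakk>x \<in> carrier A; y \<in> carrier A\<rbrakk> \<Longrightarrow> x \<otimes> y \<in> carrier A"
    "\<And>c x. x \<in> carrier A \<Longrightarrow> c \<odot> x \<in> carrier A"
    "\<And>x y z. \<lbrakk>x \<in> carrier A; y \<in> carrier A; z \<in> carrier A\<rbrakk> \<Longrightarrow> x \<oplus> y \<oplus> z = x \<oplus> (y \<oplus> z)"
    "\<And>x y. \<lbrakk>x \<in> carrier A; y \<in> carrier A\<rbrakk> \<Longrightarrow> x \<oplus> y = y \<oplus> x"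
    "\<And>x. x \<in> carrier A \<Longrightarrow> \<zero> \<oplus> x = x"
    "\<And>x y z. \<lbrakk>x \<in> carrier A; y \<in> carrier A; z \<in> carrier A\<rbrakk> \<Longrightarrow> x \<otimes> y \<otimes> z = x \<otimes> (y \<otimes> z)"
    "\<And>x. x \<in> carrier A \<Longrightarrow> \<one> \<otimes> x = x" "\<And>x. x \<in> carrier A \<Longrightarrow> x \<otimes> \<one> = x"
    "\<And>x y z. \<lbrakk>x \<in> carrier A; y \<in> carrier A; z \<in> carrier A\<rbrakk> \<Longrightarrow> (x \<oplus> y) \<otimes> z = x \<otimes> z \<oplus> y \<otimes> z"
    "\<And>x y z. \<lbrakk>x \<in> carrier A; y \<in> carrier A; z \<in> carrier A\<rbrakk> \<Longrightarrow> z \<otimes> (x \<oplus> y) = z \<otimes> x \<oplus> z \<otimes> y"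
    "\<And>c e x. x \<in> carrier A \<Longrightarrow> (c + e) \<odot> x = c \<odot> x \<oplus> e \<odot> x"
    "\<And>c x y. \<lbrakk>x \<in> carrier A; y \<in> carrier A\<rbrakk> \<Longrightarrow> c \<odot> (x \<oplus> y) = c \<odot> x \<oplus> c \<odot> y"
    "\<And>c e x. x \<in> carrier A \<Longrightarrow> c \<odot> (e \<odot> x) = (c * e) \<odot> x"
    "\<And>x. x \<in> carrier A \<Longrightarrow> 1 \<odot> x = x" "\<And>x. x \<in> carrier A \<Longrightarrow> 0 \<odot> x = \<zero>"
    "\<And>c x y. \<lbrakk>x \<in> carrier A; y \<in> carrier A\<rbrakk> \<Longrightarrow> (c \<odot> x) \<otimes> y = c \<odot> (x \<otimes> y)"
    "\<And>c x y. \<lbrakk>x \<in> carrier A; y \<in> carrier A\<rbrakk> \<Longrightarrow> x \<otimes> (c \<odot> y) = c \<odot> (x \<otimes> y)"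
  shows "kalgebra A"
proof -
  have inv: "\<exists>y\<in>carrier A. y \<oplus> x = \<zero>" if "x \<in> carrier A" for x
    using that assms(5)[of x "-1"] assms(14)[of x "-1" 1] assms(17,18)[of x] by force
  have "abelian_group A"
    by (rule abelian_groupI) (fact assms inv)+
  moreover have "monoid A"
    by unfold_locales (fact assms)+
  ultimately have "ring A"
    by (rule ringI) (fact assms)+
  then show ?thesis
    by (rule kalgebra.intro[OF _ kalgebra_axioms.intro]) (fact assms)+
qed

section \<open>Algebra homomorphisms and what they preserve\<close>

definition alg_hom :: "('k, 'a) module \<Rightarrow> ('k, 'b) module \<Rightarrow> ('a \<Rightarrow> 'b) set" where
  "alg_hom A B =
     {h \<in> ring_hom A B. \<forall>c. \<forall>x\<in>carrier A. h (c \<odot>\<^bsub>A\<^esub> x) = c \<odot>\<^bsub>B\<^esub> h x}"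

lemma alg_homI:
  assumes "\<And>x. x \<in> carrier A \<Longrightarrow> h x \<in> carrier B"
    "\<And>x y. \<lbrakk>x \<in> carrier A; y \<in> carrier A\<rbrakk> \<Longrightarrow> h (x \<otimes>\<^bsub>A\<^esub> y) = h x \<otimes>\<^bsub>B\<^esub> h y"
    "\<And>x y. \<lbrakk>x \<in> carrier A; y \<in> carrier A\<rbrakk> \<Longrightarrow> h (x \<oplus>\<^bsub>A\<^esub> y) = h x \<oplus>\<^bsub>B\<^esub> h y"
    "h \<one>\<^bsub>A\<^esub> = \<one>\<^bsub>B\<^esub>"
    "\<And>c x. x \<in> carrier A \<Longrightarrow> h (c \<odot>\<^bsub>A\<^esub> x) = c \<odot>\<^bsub>B\<^esub> h x"
  shows "h \<in> alg_hom A B"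
  using assms by (auto simp: alg_hom_def ring_hom_def)

locale kalgebra_hom = A: kalgebra A + B: kalgebra B
  for A :: "('k::comm_ring_1, 'a) module" (structure)
    and B :: "('k, 'b) module" (structure) +
  fixes h
  assumes h: "h \<in> alg_hom A B"
begin

lemma closed [simp, intro]: "x \<in> carrier A \<Longrightarrow> h x \<in> carrier B"
  using h by (auto simp: alg_hom_def ring_hom_def)

lemma mult [simp]: "\<lbrakk>x \<in> carrier A; y \<in> carrier A\<rbrakk> \<Longrightarrow> h (x \<otimes>\<^bsub>A\<^esub> y) = h x \<otimes>\<^bsub>B\<^esub> h y"
  using h by (auto simp: alg_hom_def ring_hom_def)

lemma add [simp]: "\<lbrakk>x \<in> carrier A; y \<in> carrier A\<rbrakk> \<Longrightarrow> h (x \<oplus>\<^bsub>A\<^esub> y) = h x \<oplus>\<^bsub>B\<^esub> h y"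
  using h by (auto simp: alg_hom_def ring_hom_def)

lemma one [simp]: "h \<one>\<^bsub>A\<^esub> = \<one>\<^bsub>B\<^esub>"
  using h by (auto simp: alg_hom_def ring_hom_def)

lemma smult [simp]: "x \<in> carrier A \<Longrightarrow> h (c \<odot>\<^bsub>A\<^esub> x) = c \<odot>\<^bsub>B\<^esub> h x"
  using h by (auto simp: alg_hom_def)

lemma zero [simp]: "h \<zero>\<^bsub>A\<^esub> = \<zero>\<^bsub>B\<^esub>"
  using smult[of "\<zero>\<^bsub>A\<^esub>" 0] by simp

lemma uminus [simp]: "x \<in> carrier A \<Longrightarrow> h (\<ominus>\<^bsub>A\<^esub> x) = \<ominus>\<^bsub>B\<^esub> h x"
  using smult[of x "-1"] by (simp add: A.smult_minus_one B.smult_minus_one)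

lemma finsum:
  "f \<in> I \<rightarrow> carrier A \<Longrightarrow> h (\<Oplus>\<^bsub>A\<^esub>i\<in>I. f i) = (\<Oplus>\<^bsub>B\<^esub>i\<in>I. h (f i))"
  by (induct I rule: infinite_finite_induct) (auto simp: Pi_def)

lemma list_prod: "set xs \<subseteq> carrier A \<Longrightarrow> h (list_prod A xs) = list_prod B (map h xs)"
  by (induct xs) auto

lemma inv_Units:
  assumes "x \<in> Units A"
  shows "h x \<otimes>\<^bsub>B\<^esub> h (inv\<^bsub>A\<^esub> x) = \<one>\<^bsub>B\<^esub>" "h (inv\<^bsub>A\<^esub> x) \<otimes>\<^bsub>B\<^esub> h x = \<one>\<^bsub>B\<^esub>"
  using assms mult[of x "inv\<^bsub>A\<^esub> x"] mult[of "inv\<^bsub>A\<^esub> x" x]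
  by (simp_all add: A.Units_closed A.Units_inv_closed A.Units_r_inv A.Units_l_inv)

lemma Units:
  assumes "x \<in> Units A"
  shows "h x \<in> Units B"
  unfolding Units_def using assms inv_Units
  by (intro CollectI conjI bexI[of _ "h (inv\<^bsub>A\<^esub> x)"]) (simp_all add: A.Units_closed)

lemma inv: "x \<in> Units A \<Longrightarrow> h (inv\<^bsub>A\<^esub> x) = inv\<^bsub>B\<^esub> h x"
  by (rule B.inv_char[symmetric]) (simp_all add: A.Units_closed inv_Units)

lemma nat_pow: "x \<in> carrier A \<Longrightarrow> h (x [^]\<^bsub>A\<^esub> (k::nat)) = h x [^]\<^bsub>B\<^esub> k"
  by (induct k) simp_all

lemma int_pow: "x \<in> Units A \<Longrightarrow> h (x [^]\<^bsub>A\<^esub> (k::int)) = h x [^]\<^bsub>B\<^esub> k"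
  by (cases "k < 0")
    (simp_all only: int_pow_def2 nat_pow inv A.Units_closed A.Units_nat_pow if_True if_False)

end

subsection \<open>Monoid algebras\<close>

text \<open>Splitting off the term at one key leaves a mapping whose keys are the remaining ones, so
  induction on the set of keys works. Keeping all summands supported in \<open>S\<close> means that
  the induction never leaves the carrier of a monoid algebra.\<close>

lemma poly_mapping_keys_induct [consumes 1, case_names zero single add]:
  fixes f :: "'a \<Rightarrow>\<^sub>0 'b::ab_group_add"
  assumes "Poly_Mapping.keys f \<subseteq> S" "P 0" "\<And>x a. x \<in> S \<Longrightarrow> P (Poly_Mapping.single x a)"
    "\<And>f g. \<lbrakk>Poly_Mapping.keys f \<subseteq> S; Poly_Mapping.keys g \<subseteq> S; P f; P g\<rbrakk> \<Longrightarrow> P (f + g)"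
  shows "P f"
proof -
  have "finite X \<Longrightarrow> \<forall>f. Poly_Mapping.keys f = X \<longrightarrow> X \<subseteq> S \<longrightarrow> P f" for X
  proof (induct X rule: finite_induct)
    case (insert x X)
    show ?case
    proof (intro allI impI)
      fix f :: "'a \<Rightarrow>\<^sub>0 'b" assume f: "Poly_Mapping.keys f = insert x X" "insert x X \<subseteq> S"
      define r where "r = f - Poly_Mapping.single x (Poly_Mapping.lookup f x)"
      have "Poly_Mapping.keys r = X"
        unfolding r_def using f insert(2)
        by (auto simp: in_keys_iff lookup_minus lookup_single when_def set_eq_iff)
      then have "P (Poly_Mapping.single x (Poly_Mapping.lookup f x) + r)"
        using insert f by (intro assms(3,4)) auto
      then show "P f"
        by (simp add: r_def)
    qed
  qed (use assms(2) in auto)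
  from this[of "Poly_Mapping.keys f"] show ?thesis
    using assms(1) by simp
qed

lemma lookup_map_times [simp]: "Poly_Mapping.lookup (Poly_Mapping.map ((*) c) f) x = c * Poly_Mapping.lookup f x"
  for c :: "'k::comm_ring_1"
  by (simp add: map.rep_eq when_def)

lemma map_times_simps [simp]:
  fixes c :: "'k::comm_ring_1"
  shows "Poly_Mapping.map ((*) c) (f + g) = Poly_Mapping.map ((*) c) f + Poly_Mapping.map ((*) c) g"
    "Poly_Mapping.map ((*) c) (Poly_Mapping.single x a) = Poly_Mapping.single x (c * a)"
    "Poly_Mapping.map ((*) c) 0 = 0"
    "Poly_Mapping.map ((*) (c + e)) f = Poly_Mapping.map ((*) c) f + Poly_Mapping.map ((*) e) f"
    "Poly_Mapping.map ((*) c) (Poly_Mapping.map ((*) e) f) = Poly_Mapping.map ((*) (c * e)) f"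
    "Poly_Mapping.map ((*) 1) f = f" "Poly_Mapping.map ((*) 0) f = 0"
  by (rule poly_mapping_eqI; simp add: lookup_add lookup_single when_def algebra_simps)+

lemma monoid_algebra_simps [simp]:
  "carrier (monoid_algebra M) = {f. Poly_Mapping.keys f \<subseteq> carrier M}"
  "\<one>\<^bsub>monoid_algebra M\<^esub> = Poly_Mapping.single \<one>\<^bsub>M\<^esub> 1"
  "\<zero>\<^bsub>monoid_algebra M\<^esub> = 0"
  "f \<oplus>\<^bsub>monoid_algebra M\<^esub> g = f + g"
  "c \<odot>\<^bsub>monoid_algebra M\<^esub> f = Poly_Mapping.map ((*) c) f"
  by (simp_all add: monoid_algebra_def)

text \<open>A sum may have fewer keys than its summands together, because coefficients cancel.
  Summing over any common finite superset removes this dependence, and bilinearity can then be read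
  off termwise.\<close>

lemma monoid_algebra_mult_superset:
  assumes "finite S" "finite U" "Poly_Mapping.keys f \<subseteq> S" "Poly_Mapping.keys g \<subseteq> U"
  shows "f \<otimes>\<^bsub>monoid_algebra M\<^esub> g =
    (\<Sum>x\<in>S. \<Sum>y\<in>U. Poly_Mapping.single (x \<otimes>\<^bsub>M\<^esub> y) (Poly_Mapping.lookup f x * Poly_Mapping.lookup g y))"
proof -
  have "f \<otimes>\<^bsub>monoid_algebra M\<^esub> g =
      (\<Sum>x\<in>Poly_Mapping.keys f. \<Sum>y\<in>U. Poly_Mapping.single (x \<otimes>\<^bsub>M\<^esub> y) (Poly_Mapping.lookup f x * Poly_Mapping.lookup g y))"
    unfolding monoid_algebra_def monoid.simps using assms(2,4)
    by (intro sum.cong refl sum.mono_neutral_left ballI) (simp_all add: in_keys_iff)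
  also have "\<dots> = (\<Sum>x\<in>S. \<Sum>y\<in>U. Poly_Mapping.single (x \<otimes>\<^bsub>M\<^esub> y) (Poly_Mapping.lookup f x * Poly_Mapping.lookup g y))"
    using assms by (intro sum.mono_neutral_left) (auto simp: in_keys_iff)
  finally show ?thesis .
qed

lemma monoid_algebra_mult_simps [simp]:
  "Poly_Mapping.single x a \<otimes>\<^bsub>monoid_algebra M\<^esub> Poly_Mapping.single y b =
     Poly_Mapping.single (x \<otimes>\<^bsub>M\<^esub> y) (a * b)"
  "0 \<otimes>\<^bsub>monoid_algebra M\<^esub> f = 0" "f \<otimes>\<^bsub>monoid_algebra M\<^esub> 0 = 0"
  "(f + g) \<otimes>\<^bsub>monoid_algebra M\<^esub> h = (f \<otimes>\<^bsub>monoid_algebra M\<^esub> h) + (g \<otimes>\<^bsub>monoid_algebra M\<^esub> h)"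
  "h \<otimes>\<^bsub>monoid_algebra M\<^esub> (f + g) = (h \<otimes>\<^bsub>monoid_algebra M\<^esub> f) + (h \<otimes>\<^bsub>monoid_algebra M\<^esub> g)"
proof -
  show "Poly_Mapping.single x a \<otimes>\<^bsub>monoid_algebra M\<^esub> Poly_Mapping.single y b =
     Poly_Mapping.single (x \<otimes>\<^bsub>M\<^esub> y) (a * b)"
    by (subst monoid_algebra_mult_superset[of "{x}" "{y}"]) auto
  show "0 \<otimes>\<^bsub>monoid_algebra M\<^esub> f = 0" "f \<otimes>\<^bsub>monoid_algebra M\<^esub> 0 = 0"
    by (simp_all add: monoid_algebra_def)
  have *: "Poly_Mapping.keys f \<subseteq> Poly_Mapping.keys f \<union> Poly_Mapping.keys g" "Poly_Mapping.keys g \<subseteq> Poly_Mapping.keys f \<union> Poly_Mapping.keys g"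
    "Poly_Mapping.keys (f + g) \<subseteq> Poly_Mapping.keys f \<union> Poly_Mapping.keys g"
    by (auto dest: set_mp[OF Poly_Mapping.keys_add])
  show "(f + g) \<otimes>\<^bsub>monoid_algebra M\<^esub> h = (f \<otimes>\<^bsub>monoid_algebra M\<^esub> h) + (g \<otimes>\<^bsub>monoid_algebra M\<^esub> h)"
    by (simp add: monoid_algebra_mult_superset[OF _ _ *(1) order_refl]
        monoid_algebra_mult_superset[OF _ _ *(2) order_refl]
        monoid_algebra_mult_superset[OF _ _ *(3) order_refl]
        lookup_add distrib_right single_add sum.distrib)
  show "h \<otimes>\<^bsub>monoid_algebra M\<^esub> (f + g) = (h \<otimes>\<^bsub>monoid_algebra M\<^esub> f) + (h \<otimes>\<^bsub>monoid_algebra M\<^esub> g)"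
    by (simp add: monoid_algebra_mult_superset[OF _ _ order_refl *(1)]
        monoid_algebra_mult_superset[OF _ _ order_refl *(2)]
        monoid_algebra_mult_superset[OF _ _ order_refl *(3)]
        lookup_add distrib_left single_add sum.distrib)
qed

lemma keys_single_subset: "x \<in> S \<Longrightarrow> Poly_Mapping.keys (Poly_Mapping.single x a) \<subseteq> S"
  by auto

lemma keys_add_subset: "\<lbrakk>Poly_Mapping.keys f \<subseteq> S; Poly_Mapping.keys g \<subseteq> S\<rbrakk> \<Longrightarrow> Poly_Mapping.keys (f + g) \<subseteq> S"
  by (meson Poly_Mapping.keys_add Un_least order_trans)

lemma keys_map_times_subset: "Poly_Mapping.keys f \<subseteq> S \<Longrightarrow> Poly_Mapping.keys (Poly_Mapping.map ((*) c) f) \<subseteq> S"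
  for c :: "'k::comm_ring_1"
  by (metis in_keys_iff lookup_map_times mult_zero_right subset_iff)

context monoid
begin

lemma monoid_algebra_mult_closed:
  assumes "Poly_Mapping.keys f \<subseteq> carrier G" "Poly_Mapping.keys g \<subseteq> carrier G"
  shows "Poly_Mapping.keys (f \<otimes>\<^bsub>monoid_algebra G\<^esub> g) \<subseteq> carrier G"
  using assms(1)
proof (induct rule: poly_mapping_keys_induct)
  case (single x a)
  from assms(2) show ?case
    by (induct rule: poly_mapping_keys_induct)
      (use single in \<open>simp_all add: keys_single_subset keys_add_subset\<close>)
qed (simp_all add: keys_add_subset)

text \<open>Both sides of a law are additive in every argument, so induction on the keys reduces it
  to monomials, where it is a law of the monoid and of the scalars.\<close>

lemma kalgebra_monoid_algebra: "kalgebra (monoid_algebra G :: ('k::comm_ring_1, _) module)"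
proof (rule kalgebraI, goal_cases)
  case (9 x y z)
  let ?A = "monoid_algebra G :: ('k, _) module"
  from 9 have "Poly_Mapping.keys x \<subseteq> carrier G" "Poly_Mapping.keys y \<subseteq> carrier G" "Poly_Mapping.keys z \<subseteq> carrier G" by auto
  then show ?case
  proof (induct rule: poly_mapping_keys_induct)
    case (single a s)
    from single(2,3,1) show ?case
    proof (induct rule: poly_mapping_keys_induct)
      case (single b t)
      from single(2,1,3) show ?case
        by (induct rule: poly_mapping_keys_induct) (simp_all add: m_assoc mult.assoc)
    qed simp_all
  qed simp_all
next
  case (10 x)
  then have "Poly_Mapping.keys x \<subseteq> carrier G" by simp
  then show ?case
    by (induct rule: poly_mapping_keys_induct) simp_all
next
  case (11 x)
  then have "Poly_Mapping.keys x \<subseteq> carrier G" by simp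
  then show ?case
    by (induct rule: poly_mapping_keys_induct) simp_all
next
  case (19 c x y)
  then have "Poly_Mapping.keys x \<subseteq> carrier G" "Poly_Mapping.keys y \<subseteq> carrier G" by simp_all
  then show ?case
  proof (induct rule: poly_mapping_keys_induct)
    case (single a s)
    from single(2,1) show ?case
      by (induct rule: poly_mapping_keys_induct) (simp_all add: mult.assoc)
  qed simp_all
next
  case (20 c x y)
  then have "Poly_Mapping.keys x \<subseteq> carrier G" "Poly_Mapping.keys y \<subseteq> carrier G" by simp_all
  then show ?case
  proof (induct rule: poly_mapping_keys_induct)
    case (single a s)
    from single(2,1) show ?case
      by (induct rule: poly_mapping_keys_induct) (simp_all add: mult_ac)
  qed simp_all
qed (simp_all add: monoid_algebra_mult_closed keys_add_subset keys_map_times_subset ac_simps)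

end

definition lin_ext :: "('k::comm_ring_1, 'b) module \<Rightarrow> ('m \<Rightarrow> 'b) \<Rightarrow> ('m \<Rightarrow>\<^sub>0 'k) \<Rightarrow> 'b" where
  "lin_ext B \<phi> f = (\<Oplus>\<^bsub>B\<^esub>x\<in>Poly_Mapping.keys f. Poly_Mapping.lookup f x \<odot>\<^bsub>B\<^esub> \<phi> x)"

context kalgebra
begin

lemma lin_ext_superset:
  assumes "finite U" "Poly_Mapping.keys f \<subseteq> U" "\<phi> \<in> U \<rightarrow> carrier A"
  shows "lin_ext A \<phi> f = (\<Oplus>x\<in>U. Poly_Mapping.lookup f x \<odot> \<phi> x)"
  unfolding lin_ext_def
  using assms by (intro add.finprod_mono_neutral_cong_left) (auto simp: in_keys_iff Pi_def)

lemma lin_ext_closed: "\<phi> \<in> S \<rightarrow> carrier A \<Longrightarrow> Poly_Mapping.keys f \<subseteq> S \<Longrightarrow> lin_ext A \<phi> f \<in> carrier A"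
  unfolding lin_ext_def by (intro finsum_closed) (auto simp: Pi_def)

lemma lin_ext_zero [simp]: "lin_ext A \<phi> 0 = \<zero>"
  by (simp add: lin_ext_def)

lemma lin_ext_single [simp]: "\<phi> x \<in> carrier A \<Longrightarrow> lin_ext A \<phi> (Poly_Mapping.single x c) = c \<odot> \<phi> x"
  by (subst lin_ext_superset[of "{x}"]) auto

lemma lin_ext_add:
  assumes "\<phi> \<in> S \<rightarrow> carrier A" "Poly_Mapping.keys f \<subseteq> S" "Poly_Mapping.keys g \<subseteq> S"
  shows "lin_ext A \<phi> (f + g) = lin_ext A \<phi> f \<oplus> lin_ext A \<phi> g"
proof -
  let ?U = "Poly_Mapping.keys f \<union> Poly_Mapping.keys g"
  have \<phi>: "\<phi> \<in> ?U \<rightarrow> carrier A" using assms by auto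
  have "lin_ext A \<phi> (f + g) = (\<Oplus>x\<in>?U. Poly_Mapping.lookup (f + g) x \<odot> \<phi> x)"
    using \<phi> by (intro lin_ext_superset Poly_Mapping.keys_add) auto
  also have "\<dots> = (\<Oplus>x\<in>?U. Poly_Mapping.lookup f x \<odot> \<phi> x \<oplus> Poly_Mapping.lookup g x \<odot> \<phi> x)"
    using \<phi> by (intro finsum_cong') (auto simp: lookup_add Pi_iff intro!: smult_add_left)
  also have "\<dots> = (\<Oplus>x\<in>?U. Poly_Mapping.lookup f x \<odot> \<phi> x) \<oplus> (\<Oplus>x\<in>?U. Poly_Mapping.lookup g x \<odot> \<phi> x)"
    using \<phi> by (intro finsum_addf) auto
  also have "\<dots> = lin_ext A \<phi> f \<oplus> lin_ext A \<phi> g"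
    using \<phi> by (simp add: lin_ext_superset[of ?U])
  finally show ?thesis .
qed

text \<open>Universal property of the monoid algebra: bilinearity reduces multiplicativity to single
  keys. It serves twice, for the free monoid and for the product monoid behind the tensor
  product.\<close>

lemma lin_ext_alg_hom:
  assumes "monoid M" "\<phi> \<in> carrier M \<rightarrow> carrier A"
    "\<And>x y. \<lbrakk>x \<in> carrier M; y \<in> carrier M\<rbrakk> \<Longrightarrow> \<phi> (x \<otimes>\<^bsub>M\<^esub> y) = \<phi> x \<otimes> \<phi> y" "\<phi> \<one>\<^bsub>M\<^esub> = \<one>"
  shows "lin_ext A \<phi> \<in> alg_hom (monoid_algebra M) A"
proof (rule alg_homI)
  interpret M: monoid M by fact
  note cl = lin_ext_closed[OF assms(2)]
  have \<phi>: "\<phi> x \<in> carrier A" if "x \<in> carrier M" for x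
    using assms(2) that by auto
  fix f :: "_ \<Rightarrow>\<^sub>0 'k" assume "f \<in> carrier (monoid_algebra M)"
  then have f: "Poly_Mapping.keys f \<subseteq> carrier M" by simp
  show "lin_ext A \<phi> f \<in> carrier A" using f by (rule cl)
  show "lin_ext A \<phi> (c \<odot>\<^bsub>monoid_algebra M\<^esub> f) = c \<odot> lin_ext A \<phi> f" for c
    using f
    by (induct rule: poly_mapping_keys_induct)
      (simp_all add: \<phi> lin_ext_add[OF assms(2)] keys_map_times_subset cl smult_add_right
        keys_single_subset)
  fix g :: "_ \<Rightarrow>\<^sub>0 'k" assume "g \<in> carrier (monoid_algebra M)"
  then have g: "Poly_Mapping.keys g \<subseteq> carrier M" by simp
  show "lin_ext A \<phi> (f \<oplus>\<^bsub>monoid_algebra M\<^esub> g) = lin_ext A \<phi> f \<oplus> lin_ext A \<phi> g"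
    using lin_ext_add[OF assms(2) f g] by simp
  show "lin_ext A \<phi> (f \<otimes>\<^bsub>monoid_algebra M\<^esub> g) = lin_ext A \<phi> f \<otimes> lin_ext A \<phi> g"
    using f
  proof (induct rule: poly_mapping_keys_induct)
    case (single x a)
    from g show ?case
      by (induct rule: poly_mapping_keys_induct)
        (use single in \<open>simp_all add: \<phi> assms(3) M.monoid_algebra_mult_closed keys_single_subset
            lin_ext_add[OF assms(2)] cl r_distr mult.commute del: keys_single\<close>)
  qed (simp_all add: g cl lin_ext_add[OF assms(2)] l_distr M.monoid_algebra_mult_closed)
next
  show "lin_ext A \<phi> \<one>\<^bsub>monoid_algebra M\<^esub> = \<one>" using assms by simp
qed

end

subsection \<open>Quotients and presentations\<close>

lemma alg_quot_simps:
  "carrier (alg_quot A I) = a_rcosets\<^bsub>A\<^esub> I"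
  "mult (alg_quot A I) = rcoset_mult A I"
  "add (alg_quot A I) = (\<lambda>x y. x <+>\<^bsub>A\<^esub> y)"
  "\<one>\<^bsub>alg_quot A I\<^esub> = I +>\<^bsub>A\<^esub> \<one>\<^bsub>A\<^esub>"
  "\<zero>\<^bsub>alg_quot A I\<^esub> = I"
  "c \<odot>\<^bsub>alg_quot A I\<^esub> X = (\<Union>x\<in>X. I +>\<^bsub>A\<^esub> (c \<odot>\<^bsub>A\<^esub> x))"
  by (simp_all add: alg_quot_def FactRing_def ring.extend_def module.fields_def fun_eq_iff)

locale kalgebra_ideal = kalgebra A + ideal I A
  for A :: "('k::comm_ring_1, 'a) module" (structure) and I
begin

abbreviation "Q \<equiv> alg_quot A I"

text \<open>Scalar multiples are ring multiples,
  \<open>c \<odot> x = (c \<odot> \<one>) \<otimes> x\<close>, so a ring ideal is automatically a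
  submodule.\<close>

lemma smult_mem: "x \<in> I \<Longrightarrow> c \<odot> x \<in> I"
  using I_l_closed[of x "c \<odot> \<one>"] smult_mult_left[of \<one> x c] a_subset by force

lemma coset_eq_iff:
  assumes "x \<in> carrier A" "y \<in> carrier A"
  shows "I +> x = I +> y \<longleftrightarrow> x \<ominus> y \<in> I"
  using assms quotient_eq_iff_same_a_r_cos[OF is_ideal] by auto

lemma coset_simps [simp]:
  assumes "x \<in> carrier A"
  shows "I +> x \<in> carrier Q" "c \<odot>\<^bsub>Q\<^esub> (I +> x) = I +> (c \<odot> x)"
    "y \<in> carrier A \<Longrightarrow> (I +> x) \<otimes>\<^bsub>Q\<^esub> (I +> y) = I +> (x \<otimes> y)"
    "y \<in> carrier A \<Longrightarrow> (I +> x) \<oplus>\<^bsub>Q\<^esub> (I +> y) = I +> (x \<oplus> y)"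
proof -
  show "I +> x \<in> carrier Q"
    using assms by (auto simp: alg_quot_simps A_RCOSETS_def')
  \<comment> \<open>The scalar action on a coset is a union over all its representatives
    \<open>z\<close>; it is a single coset because each of them yields the same one.\<close>
  have "I +> (c \<odot> z) = I +> (c \<odot> x)" if "z \<in> I +> x" for z
  proof -
    from that obtain i where i: "i \<in> I" "z = i \<oplus> x"
      by (auto simp: a_r_coset_def')
    then have "i \<in> carrier A" using a_subset by auto
    then have "c \<odot> z \<ominus> c \<odot> x = c \<odot> i"
      using assms i by (simp add: smult_add_right minus_eq a_assoc r_neg)
    then show ?thesis
      using assms i \<open>i \<in> carrier A\<close> by (simp add: coset_eq_iff smult_mem)
  qed
  moreover have "x \<in> I +> x"
    using assms by (rule a_rcos_self)
  ultimately show "c \<odot>\<^bsub>Q\<^esub> (I +> x) = I +> (c \<odot> x)"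
    unfolding alg_quot_simps by blast
  assume "y \<in> carrier A"
  then show "(I +> x) \<otimes>\<^bsub>Q\<^esub> (I +> y) = I +> (x \<otimes> y)"
    "(I +> x) \<oplus>\<^bsub>Q\<^esub> (I +> y) = I +> (x \<oplus> y)"
    using assms by (simp_all add: alg_quot_simps rcoset_mult_add a_rcos_sum)
qed

lemma coset_zero: "\<zero>\<^bsub>Q\<^esub> = I +> \<zero>"
  by (simp add: alg_quot_simps a_coset_add_zero a_subset)

lemma coset_one: "\<one>\<^bsub>Q\<^esub> = I +> \<one>"
  by (simp add: alg_quot_simps)

lemma coset_cases:
  assumes "X \<in> carrier Q" obtains x where "x \<in> carrier A" "X = I +> x"
  using assms by (auto simp: alg_quot_simps A_RCOSETS_def')

lemma kalgebra_alg_quot: "kalgebra Q"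
proof (rule kalgebraI, goal_cases)
  case (6 x y z)
  then show ?case by (auto elim!: coset_cases simp: a_assoc)
next
  case (7 x y)
  then show ?case by (auto elim!: coset_cases simp: a_comm)
next
  case (9 x y z)
  then show ?case by (auto elim!: coset_cases simp: m_assoc)
next
  case (12 x y z)
  then show ?case by (auto elim!: coset_cases simp: l_distr)
next
  case (13 x y z)
  then show ?case by (auto elim!: coset_cases simp: r_distr)
next
  case (14 c e x)
  then show ?case by (auto elim!: coset_cases simp: smult_add_left)
next
  case (15 c x y)
  then show ?case by (auto elim!: coset_cases simp: smult_add_right)
qed (auto elim!: coset_cases simp: coset_zero coset_one)

lemma coset_hom: "(\<lambda>x. I +> x) \<in> alg_hom A Q"
  by (rule alg_homI) (auto simp: coset_one)

end

lemma (in kalgebra) kalgebra_idealI: "ideal I A \<Longrightarrow> kalgebra_ideal A I"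
  by (intro kalgebra_ideal.intro kalgebra_axioms)

text \<open>The induced map evaluates \<open>h\<close> at a chosen representative; two
  representatives differ by an element of \<open>I\<close>, on which \<open>h\<close>
  vanishes.\<close>

lemma alg_quot_hom:
  assumes "kalgebra_ideal A I" "kalgebra_hom A B h" "\<And>x. x \<in> I \<Longrightarrow> h x = \<zero>\<^bsub>B\<^esub>"
  shows "\<exists>h'\<in>alg_hom (alg_quot A I) B. \<forall>x\<in>carrier A. h' (I +>\<^bsub>A\<^esub> x) = h x"
proof -
  interpret kalgebra_ideal A I by fact
  interpret kalgebra_hom A B h by fact
  define h' where "h' X = h (SOME x. x \<in> carrier A \<and> X = I +>\<^bsub>A\<^esub> x)" for X
  have *: "h' (I +>\<^bsub>A\<^esub> x) = h x" if "x \<in> carrier A" for x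
  proof -
    define y where "y = (SOME y. y \<in> carrier A \<and> I +>\<^bsub>A\<^esub> x = I +>\<^bsub>A\<^esub> y)"
    have y: "y \<in> carrier A \<and> I +>\<^bsub>A\<^esub> x = I +>\<^bsub>A\<^esub> y"
      unfolding y_def by (rule someI[of _ x]) (use that in simp)
    then have "x \<ominus>\<^bsub>A\<^esub> y \<in> I" using that coset_eq_iff by blast
    then have "h x \<oplus>\<^bsub>B\<^esub> \<ominus>\<^bsub>B\<^esub> h y = \<zero>\<^bsub>B\<^esub>"
      using assms(3)[of "x \<ominus>\<^bsub>A\<^esub> y"] that y by (simp add: a_minus_def)
    then have "h x = h y"
      using that y B.minus_equality[of "h x" "\<ominus>\<^bsub>B\<^esub> h y"] by simp
    then show ?thesis by (simp add: h'_def y_def)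
  qed
  show ?thesis
  proof (intro bexI[of _ h'] ballI *)
    show "h' \<in> alg_hom Q B"
      by (rule alg_homI) (auto elim!: coset_cases simp: * coset_one)
  qed
qed

text \<open>The kernel of \<open>h\<close> is an ideal containing \<open>S\<close>, hence contains
  the ideal generated by \<open>S\<close>; so a check on relators is enough.\<close>

lemma (in kalgebra_hom) vanish_Idl:
  assumes "S \<subseteq> carrier A" "\<And>x. x \<in> S \<Longrightarrow> h x = \<zero>\<^bsub>B\<^esub>" "x \<in> Idl\<^bsub>A\<^esub> S"
  shows "h x = \<zero>\<^bsub>B\<^esub>"
proof -
  have "ring_hom_ring A B h"
    by (intro ring_hom_ringI2 A.ring_axioms B.ring_axioms) (use h in \<open>auto simp: alg_hom_def\<close>)
  then have "ideal (a_kernel A B h) A"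
    by (rule ring_hom_ring.kernel_is_ideal)
  then have "Idl\<^bsub>A\<^esub> S \<subseteq> a_kernel A B h"
    by (rule A.genideal_minimal) (use assms in \<open>auto simp: a_kernel_def'\<close>)
  then show ?thesis using assms(3) by (auto simp: a_kernel_def')
qed

section \<open>Free algebras and algebras given by generators and relations\<close>

lemma monoid_free_monoid: "monoid (free_monoid S)"
  by unfold_locales (auto simp: free_monoid_def)

lemma kalgebra_free_algebra: "kalgebra (free_algebra S)"
  unfolding free_algebra_def by (rule monoid.kalgebra_monoid_algebra[OF monoid_free_monoid])

lemma free_algebra_simps [simp]:
  "carrier (free_algebra S) = {f. Poly_Mapping.keys f \<subseteq> lists S}"
  "\<one>\<^bsub>free_algebra S\<^esub> = Poly_Mapping.single [] 1"
  "\<zero>\<^bsub>free_algebra S\<^esub> = 0"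
  "f \<oplus>\<^bsub>free_algebra S\<^esub> g = f + g"
  "c \<odot>\<^bsub>free_algebra S\<^esub> f = Poly_Mapping.map ((*) c) f"
  "Poly_Mapping.single xs a \<otimes>\<^bsub>free_algebra S\<^esub> Poly_Mapping.single ys b =
     Poly_Mapping.single (xs @ ys) (a * b)"
  by (simp_all add: free_algebra_def) (simp_all add: free_monoid_def)

definition word_ext :: "('k::comm_ring_1, 'b) module \<Rightarrow> ('g \<Rightarrow> 'b) \<Rightarrow> ('g list \<Rightarrow>\<^sub>0 'k) \<Rightarrow> 'b" where
  "word_ext B f = lin_ext B (\<lambda>xs. list_prod B (map f xs))"

lemma (in kalgebra) word_ext_hom:
  assumes "f \<in> S \<rightarrow> carrier A"
  shows "word_ext A f \<in> alg_hom (free_algebra S) A"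
  unfolding word_ext_def free_algebra_def
proof (rule lin_ext_alg_hom[OF monoid_free_monoid])
  have *: "set (map f xs) \<subseteq> carrier A" if "xs \<in> lists S" for xs
    using that assms by (induct xs) auto
  then show "(\<lambda>xs. list_prod A (map f xs)) \<in> carrier (free_monoid S) \<rightarrow> carrier A"
    by (auto simp: free_monoid_def simp del: set_map)
  show "list_prod A (map f (x \<otimes>\<^bsub>free_monoid S\<^esub> y)) =
      list_prod A (map f x) \<otimes>\<^bsub>A\<^esub> list_prod A (map f y)"
    if "x \<in> carrier (free_monoid S)" "y \<in> carrier (free_monoid S)" for x y
    using that *[of x] *[of y] by (simp add: free_monoid_def list_prod_append)
qed (simp add: free_monoid_def)

definition presented :: "'g set \<Rightarrow> ('g list \<Rightarrow>\<^sub>0 'k) set \<Rightarrow> ('k::comm_ring_1, ('g list \<Rightarrow>\<^sub>0 'k) set) module"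
  where "presented S R = alg_quot (free_algebra S) (Idl\<^bsub>free_algebra S\<^esub> R)"

definition pres_gen :: "'g set \<Rightarrow> ('g list \<Rightarrow>\<^sub>0 'k::comm_ring_1) set \<Rightarrow> 'g \<Rightarrow> ('g list \<Rightarrow>\<^sub>0 'k) set" where
  "pres_gen S R s = (Idl\<^bsub>free_algebra S :: ('k, _) module\<^esub> R) +>\<^bsub>free_algebra S :: ('k, _) module\<^esub> Poly_Mapping.single [s] 1"

locale presentation =
  fixes S :: "'g set" and R :: "('g list \<Rightarrow>\<^sub>0 'k::comm_ring_1) set"
  assumes R: "\<And>r. r \<in> R \<Longrightarrow> Poly_Mapping.keys r \<subseteq> lists S"
begin

sublocale F: kalgebra "free_algebra S :: ('k, 'g list \<Rightarrow>\<^sub>0 'k) module"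
  by (rule kalgebra_free_algebra)

abbreviation "rel_ideal \<equiv> Idl\<^bsub>free_algebra S :: ('k, 'g list \<Rightarrow>\<^sub>0 'k) module\<^esub> R"

lemma R_carrier: "R \<subseteq> carrier (free_algebra S)"
  using R by auto

sublocale I: kalgebra_ideal "free_algebra S :: ('k, 'g list \<Rightarrow>\<^sub>0 'k) module" rel_ideal
  by (intro F.kalgebra_idealI F.genideal_ideal R_carrier)

sublocale P: kalgebra "presented S R"
  unfolding presented_def by (rule I.kalgebra_alg_quot)

sublocale proj: kalgebra_hom "free_algebra S :: ('k, 'g list \<Rightarrow>\<^sub>0 'k) module" "presented S R"
    "\<lambda>x. rel_ideal +>\<^bsub>free_algebra S\<^esub> x"
  by unfold_locales (simp add: presented_def I.coset_hom)

lemma gen_closed [simp]: "s \<in> S \<Longrightarrow> pres_gen S R s \<in> carrier (presented S R)"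
  unfolding pres_gen_def by (rule proj.closed) simp

text \<open>Universal property of a presentation: \<open>word_ext\<close> extends \<open>f\<close>
  to the free algebra and kills the whole relator ideal as soon as it kills
  \<open>R\<close>.\<close>

lemma hom_exists:
  fixes B :: "('k, 'b) module"
  assumes "kalgebra B" "f \<in> S \<rightarrow> carrier B" "\<And>r. r \<in> R \<Longrightarrow> word_ext B f r = \<zero>\<^bsub>B\<^esub>"
  obtains h where "h \<in> alg_hom (presented S R) B" "\<And>s. s \<in> S \<Longrightarrow> h (pres_gen S R s) = f s"
proof -
  interpret B: kalgebra B by fact
  interpret W: kalgebra_hom "free_algebra S" B "word_ext B f"
    by unfold_locales (rule B.word_ext_hom[OF assms(2)])
  from alg_quot_hom[OF I.kalgebra_ideal_axioms W.kalgebra_hom_axioms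
      W.vanish_Idl[OF R_carrier assms(3)]]
  obtain h where h: "h \<in> alg_hom (presented S R) B"
    "\<And>x. x \<in> carrier (free_algebra S) \<Longrightarrow> h (rel_ideal +>\<^bsub>free_algebra S\<^esub> x) = word_ext B f x"
    unfolding presented_def by blast
  have "h (pres_gen S R s) = f s" if "s \<in> S" for s
  proof -
    have "f s \<in> carrier B" using that assms(2) by auto
    then show ?thesis
      using that unfolding pres_gen_def by (subst h(2)) (auto simp: word_ext_def)
  qed
  with h(1) show ?thesis by (rule that)
qed

lemma word_coset:
  assumes "xs \<in> lists S"
  shows "rel_ideal +>\<^bsub>free_algebra S\<^esub> Poly_Mapping.single xs c =
    c \<odot>\<^bsub>presented S R\<^esub> list_prod (presented S R) (map (pres_gen S R) xs)"
proof -
  have *: "Poly_Mapping.single xs 1 \<in> carrier (free_algebra S :: ('k, _) module)"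
    "Poly_Mapping.single [x] (1::'k) \<in> carrier (free_algebra S)"
    if "x \<in> S" "xs \<in> lists S" for x xs
    using that by auto
  have "rel_ideal +>\<^bsub>free_algebra S\<^esub> Poly_Mapping.single xs 1 =
      list_prod (presented S R) (map (pres_gen S R) xs)"
    using assms
  proof (induct xs)
    case Nil
    show ?case using proj.one by simp
  next
    case (Cons x xs)
    then show ?case
      using proj.mult[OF *(2)[of x xs] *(1)[of x xs]] by (simp add: pres_gen_def)
  qed
  then show ?thesis
    using proj.smult[of "Poly_Mapping.single xs 1" c] assms by (simp add: keys_single_subset)
qed

text \<open>Every element is the coset of a combination of words, and a word is a product of
  generators. The zero element is covered as \<open>0 \<odot> \<one>\<close>.\<close>

lemma induct_gen [consumes 1, case_names one gen smult add mult]: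
  assumes "x \<in> carrier (presented S R)" "P \<one>\<^bsub>presented S R\<^esub>"
    and gen: "\<And>s. s \<in> S \<Longrightarrow> P (pres_gen S R s)"
    and smult: "\<And>c x. \<lbrakk>x \<in> carrier (presented S R); P x\<rbrakk> \<Longrightarrow> P (c \<odot>\<^bsub>presented S R\<^esub> x)"
    and add: "\<And>x y. \<lbrakk>x \<in> carrier (presented S R); y \<in> carrier (presented S R); P x; P y\<rbrakk> \<Longrightarrow>
      P (x \<oplus>\<^bsub>presented S R\<^esub> y)"
    and mult: "\<And>x y. \<lbrakk>x \<in> carrier (presented S R); y \<in> carrier (presented S R); P x; P y\<rbrakk> \<Longrightarrow>
      P (x \<otimes>\<^bsub>presented S R\<^esub> y)"
  shows "P x"
proof -
  have cl: "set (map (pres_gen S R) xs) \<subseteq> carrier (presented S R)" if "xs \<in> lists S" for xs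
    using that by (induct xs) auto
  from assms(1) obtain f where f: "Poly_Mapping.keys f \<subseteq> lists S"
      "x = rel_ideal +>\<^bsub>free_algebra S\<^esub> f"
    unfolding presented_def by (auto elim: I.coset_cases)
  from f(1) have "P (rel_ideal +>\<^bsub>free_algebra S\<^esub> f)"
  proof (induct rule: poly_mapping_keys_induct)
    case zero
    show ?case
      using smult[OF P.one_closed assms(2), of 0] proj.zero by simp
  next
    case (single xs a)
    have "P (list_prod (presented S R) (map (pres_gen S R) xs))"
      using single cl[of xs] by (induct xs) (use cl in \<open>auto intro!: assms(2) gen mult P.list_prod_closed\<close>)
    then show ?case
      using single cl[of xs] by (auto simp: word_coset intro!: smult P.list_prod_closed)
  next
    case (add f g)
    then show ?case using proj.add[of f g] by (auto intro!: assms(5) proj.closed)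
  qed
  with f(2) show ?thesis by simp
qed

lemma relation:
  assumes "r - s \<in> R" "Poly_Mapping.keys r \<subseteq> lists S" "Poly_Mapping.keys s \<subseteq> lists S"
  shows "rel_ideal +>\<^bsub>free_algebra S\<^esub> r = rel_ideal +>\<^bsub>free_algebra S\<^esub> s"
proof -
  have "r \<ominus>\<^bsub>free_algebra S\<^esub> s = r - s"
  proof -
    have "Poly_Mapping.map ((*) (-1)) s = - s"
      by (rule poly_mapping_eqI) simp
    then show ?thesis
      using F.smult_minus_one[of s] assms(3) by (simp add: a_minus_def)
  qed
  moreover have "r - s \<in> rel_ideal"
    using assms(1) F.genideal_self[OF R_carrier] by auto
  ultimately show ?thesis
    using assms by (subst I.coset_eq_iff) auto
qed

end

subsection \<open>Corners, matrices and direct sums\<close>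

text \<open>The Peirce corner e A e. For an idempotent \<open>e\<close> the fixed-point condition
  cuts out exactly these elements, and the operations of \<open>A\<close> are kept.\<close>

definition corner :: "('k, 'a) module \<Rightarrow> 'a \<Rightarrow> ('k, 'a) module" where
  "corner A e = A\<lparr>carrier := {x \<in> carrier A. e \<otimes>\<^bsub>A\<^esub> x = x \<and> x \<otimes>\<^bsub>A\<^esub> e = x}, one := e\<rparr>"

lemma corner_simps [simp]:
  "carrier (corner A e) = {x \<in> carrier A. e \<otimes>\<^bsub>A\<^esub> x = x \<and> x \<otimes>\<^bsub>A\<^esub> e = x}"
  "\<one>\<^bsub>corner A e\<^esub> = e" "\<zero>\<^bsub>corner A e\<^esub> = \<zero>\<^bsub>A\<^esub>"
  "mult (corner A e) = mult A" "add (corner A e) = add A" "smult (corner A e) = smult A"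
  by (simp_all add: corner_def)

lemma (in kalgebra) kalgebra_corner:
  assumes "e \<in> carrier A" "e \<otimes> e = e"
  shows "kalgebra (corner A e)"
  by (rule kalgebraI)
    (use assms in \<open>auto simp: l_distr r_distr smult_add_left smult_add_right a_ac m_assoc
      simp flip: m_assoc[of e]\<close>)

lemma mat_algebra_simps [simp]:
  "carrier (mat_algebra I A) = I \<times> I \<rightarrow>\<^sub>E carrier A"
  "(M \<otimes>\<^bsub>mat_algebra I A\<^esub> N) = (\<lambda>(i, j)\<in>I \<times> I. \<Oplus>\<^bsub>A\<^esub>k\<in>I. M (i, k) \<otimes>\<^bsub>A\<^esub> N (k, j))"
  "\<one>\<^bsub>mat_algebra I A\<^esub> = (\<lambda>(i, j)\<in>I \<times> I. if i = j then \<one>\<^bsub>A\<^esub> else \<zero>\<^bsub>A\<^esub>)"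
  "\<zero>\<^bsub>mat_algebra I A\<^esub> = (\<lambda>_\<in>I \<times> I. \<zero>\<^bsub>A\<^esub>)"
  "(M \<oplus>\<^bsub>mat_algebra I A\<^esub> N) = (\<lambda>p\<in>I \<times> I. M p \<oplus>\<^bsub>A\<^esub> N p)"
  "c \<odot>\<^bsub>mat_algebra I A\<^esub> M = (\<lambda>p\<in>I \<times> I. c \<odot>\<^bsub>A\<^esub> M p)"
  by (simp_all add: mat_algebra_def)

lemma direct_sum_algebra_simps [simp]:
  "carrier (direct_sum_algebra I A) = (\<Pi>\<^sub>E i\<in>I. carrier (A i))"
  "x \<otimes>\<^bsub>direct_sum_algebra I A\<^esub> y = (\<lambda>i\<in>I. x i \<otimes>\<^bsub>A i\<^esub> y i)"
  "\<one>\<^bsub>direct_sum_algebra I A\<^esub> = (\<lambda>i\<in>I. \<one>\<^bsub>A i\<^esub>)"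
  "\<zero>\<^bsub>direct_sum_algebra I A\<^esub> = (\<lambda>i\<in>I. \<zero>\<^bsub>A i\<^esub>)"
  "x \<oplus>\<^bsub>direct_sum_algebra I A\<^esub> y = (\<lambda>i\<in>I. x i \<oplus>\<^bsub>A i\<^esub> y i)"
  "c \<odot>\<^bsub>direct_sum_algebra I A\<^esub> x = (\<lambda>i\<in>I. c \<odot>\<^bsub>A i\<^esub> x i)"
  by (simp_all add: direct_sum_algebra_def)

lemma kalgebra_direct_sum_algebra:
  assumes "\<And>i. i \<in> I \<Longrightarrow> kalgebra (A i)"
  shows "kalgebra (direct_sum_algebra I A)"
proof -
  have pt: "(x :: 'a \<Rightarrow> 'b) = y" if "x \<in> extensional I" "y \<in> extensional I"
    "\<And>i. \<lbrakk>i \<in> I; kalgebra (A i)\<rbrakk> \<Longrightarrow> x i = y i" for x y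
    using that assms by (intro extensionalityI[of x I y]) auto
  note r = ring.ring_simprules[OF kalgebra.axioms(1)]
  show ?thesis
    by (rule kalgebraI; (rule pt)?)
      (use assms in \<open>auto simp: PiE_iff r monoid.r_one[OF ring.is_monoid[OF kalgebra.axioms(1)]] kalgebra.smult_add_left kalgebra.smult_add_right
        kalgebra.smult_smult kalgebra.smult_one kalgebra.smult_zero_left kalgebra.smult_mult_left
        kalgebra.smult_mult_right kalgebra.smult_closed\<close>)
qed

text \<open>Associativity is the interchange of two finite sums, and the unit laws leave a single
  nonzero summand; the other laws hold entrywise or by splitting or scaling one sum.\<close>

lemma (in kalgebra) kalgebra_mat_algebra:
  fixes I :: "'i set"
  assumes "finite I"
  shows "kalgebra (mat_algebra I A)"
proof -
  have pt: "M = N" if "M \<in> extensional (I \<times> I)" "N \<in> extensional (I \<times> I)"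
    "\<And>i j. \<lbrakk>i \<in> I; j \<in> I\<rbrakk> \<Longrightarrow> M (i, j) = N (i, j)" for M N :: "'i \<times> 'i \<Rightarrow> 'a"
    using that by (intro extensionalityI[of M "I \<times> I" N]) auto
  have cl: "M (i, j) \<in> carrier A" if "M \<in> I \<times> I \<rightarrow>\<^sub>E carrier A" "i \<in> I" "j \<in> I" for M i j
    using that by auto
  have sum_cl: "(\<lambda>k. M (i, k) \<otimes> N (k, j)) \<in> I \<rightarrow> carrier A"
    if "M \<in> I \<times> I \<rightarrow>\<^sub>E carrier A" "N \<in> I \<times> I \<rightarrow>\<^sub>E carrier A" "i \<in> I" "j \<in> I" for M N i j
    using that by (auto simp: PiE_iff)
  show ?thesis
  proof (rule kalgebraI, goal_cases)
    case (4 x y)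
    then show ?case by (auto intro!: finsum_closed sum_cl)
  next
    case (9 x y z)
    then have M: "x \<in> I \<times> I \<rightarrow>\<^sub>E carrier A" "y \<in> I \<times> I \<rightarrow>\<^sub>E carrier A" "z \<in> I \<times> I \<rightarrow>\<^sub>E carrier A"
      by simp_all
    note cls = cl[OF M(1)] cl[OF M(2)] cl[OF M(3)]
    show ?case
    proof (rule pt)
      fix i j assume ij: "i \<in> I" "j \<in> I"
      have "(\<Oplus>k\<in>I. (x \<otimes>\<^bsub>mat_algebra I A\<^esub> y) (i, k) \<otimes> z (k, j)) =
          (\<Oplus>k\<in>I. \<Oplus>l\<in>I. x (i, l) \<otimes> y (l, k) \<otimes> z (k, j))"
        using ij by (intro finsum_cong') (auto simp: finsum_ldistr[OF assms] sum_cl[OF M(1,2)]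
          intro!: assms finsum_closed sum_cl[OF M(1,2)] sum_cl[OF M(2,3)] simp: cls)
      also have "\<dots> = (\<Oplus>l\<in>I. \<Oplus>k\<in>I. x (i, l) \<otimes> y (l, k) \<otimes> z (k, j))"
        using ij by (intro finsum_swap) (auto intro!: assms simp: cls)
      also have "\<dots> = (\<Oplus>l\<in>I. \<Oplus>k\<in>I. x (i, l) \<otimes> (y (l, k) \<otimes> z (k, j)))"
        using ij by (intro finsum_cong' m_assoc) (auto intro!: assms finsum_closed simp: cls)
      also have "\<dots> = (\<Oplus>l\<in>I. x (i, l) \<otimes> (y \<otimes>\<^bsub>mat_algebra I A\<^esub> z) (l, j))"
        using ij by (intro finsum_cong') (auto simp: finsum_rdistr[OF assms] sum_cl[OF M(2,3)]
          intro!: assms finsum_closed sum_cl[OF M(1,2)] sum_cl[OF M(2,3)] simp: cls)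
      finally show "(x \<otimes>\<^bsub>mat_algebra I A\<^esub> y \<otimes>\<^bsub>mat_algebra I A\<^esub> z) (i, j) =
          (x \<otimes>\<^bsub>mat_algebra I A\<^esub> (y \<otimes>\<^bsub>mat_algebra I A\<^esub> z)) (i, j)"
        using ij by simp
    qed simp_all
  next
    case (10 x)
    then have M: "x \<in> I \<times> I \<rightarrow>\<^sub>E carrier A" by simp
    show ?case
    proof (rule pt)
      fix i j assume ij: "i \<in> I" "j \<in> I"
      have "(\<Oplus>k\<in>I. \<one>\<^bsub>mat_algebra I A\<^esub> (i, k) \<otimes> x (k, j)) = \<one>\<^bsub>mat_algebra I A\<^esub> (i, i) \<otimes> x (i, j)"
        using ij by (intro finsum_single) (auto simp: cl[OF M] assms)
      then show "(\<one>\<^bsub>mat_algebra I A\<^esub> \<otimes>\<^bsub>mat_algebra I A\<^esub> x) (i, j) = x (i, j)"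
        using ij cl[OF M ij] by simp
    qed (use M in \<open>auto simp: PiE_iff\<close>)
  next
    case (11 x)
    then have M: "x \<in> I \<times> I \<rightarrow>\<^sub>E carrier A" by simp
    show ?case
    proof (rule pt)
      fix i j assume ij: "i \<in> I" "j \<in> I"
      have "(\<Oplus>k\<in>I. x (i, k) \<otimes> \<one>\<^bsub>mat_algebra I A\<^esub> (k, j)) = x (i, j) \<otimes> \<one>\<^bsub>mat_algebra I A\<^esub> (j, j)"
        using ij by (intro finsum_single) (auto simp: cl[OF M] assms)
      then show "(x \<otimes>\<^bsub>mat_algebra I A\<^esub> \<one>\<^bsub>mat_algebra I A\<^esub>) (i, j) = x (i, j)"
        using ij cl[OF M ij] by simp
    qed (use M in \<open>auto simp: PiE_iff\<close>)
  next
    case (12 x y z)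
    then have M: "x \<in> I \<times> I \<rightarrow>\<^sub>E carrier A" "y \<in> I \<times> I \<rightarrow>\<^sub>E carrier A" "z \<in> I \<times> I \<rightarrow>\<^sub>E carrier A"
      by simp_all
    show ?case
    proof (rule pt)
      fix i j assume ij: "i \<in> I" "j \<in> I"
      have "(\<Oplus>k\<in>I. (x \<oplus>\<^bsub>mat_algebra I A\<^esub> y) (i, k) \<otimes> z (k, j)) =
          (\<Oplus>k\<in>I. x (i, k) \<otimes> z (k, j) \<oplus> y (i, k) \<otimes> z (k, j))"
        using ij by (intro finsum_cong') (auto simp: l_distr cl[OF M(1)] cl[OF M(2)] cl[OF M(3)])
      also have "\<dots> = (\<Oplus>k\<in>I. x (i, k) \<otimes> z (k, j)) \<oplus> (\<Oplus>k\<in>I. y (i, k) \<otimes> z (k, j))"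
        using ij by (intro finsum_addf sum_cl M)
      finally show "((x \<oplus>\<^bsub>mat_algebra I A\<^esub> y) \<otimes>\<^bsub>mat_algebra I A\<^esub> z) (i, j) =
          (x \<otimes>\<^bsub>mat_algebra I A\<^esub> z \<oplus>\<^bsub>mat_algebra I A\<^esub> y \<otimes>\<^bsub>mat_algebra I A\<^esub> z) (i, j)"
        using ij by simp
    qed simp_all
  next
    case (13 x y z)
    then have M: "x \<in> I \<times> I \<rightarrow>\<^sub>E carrier A" "y \<in> I \<times> I \<rightarrow>\<^sub>E carrier A" "z \<in> I \<times> I \<rightarrow>\<^sub>E carrier A"
      by simp_all
    show ?case
    proof (rule pt)
      fix i j assume ij: "i \<in> I" "j \<in> I"
      have "(\<Oplus>k\<in>I. z (i, k) \<otimes> (x \<oplus>\<^bsub>mat_algebra I A\<^esub> y) (k, j)) =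
          (\<Oplus>k\<in>I. z (i, k) \<otimes> x (k, j) \<oplus> z (i, k) \<otimes> y (k, j))"
        using ij by (intro finsum_cong') (auto simp: r_distr cl[OF M(1)] cl[OF M(2)] cl[OF M(3)])
      also have "\<dots> = (\<Oplus>k\<in>I. z (i, k) \<otimes> x (k, j)) \<oplus> (\<Oplus>k\<in>I. z (i, k) \<otimes> y (k, j))"
        using ij by (intro finsum_addf sum_cl M)
      finally show "(z \<otimes>\<^bsub>mat_algebra I A\<^esub> (x \<oplus>\<^bsub>mat_algebra I A\<^esub> y)) (i, j) =
          (z \<otimes>\<^bsub>mat_algebra I A\<^esub> x \<oplus>\<^bsub>mat_algebra I A\<^esub> z \<otimes>\<^bsub>mat_algebra I A\<^esub> y) (i, j)"
        using ij by simp
    qed simp_all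
  next
    case (19 c x y)
    then have M: "x \<in> I \<times> I \<rightarrow>\<^sub>E carrier A" "y \<in> I \<times> I \<rightarrow>\<^sub>E carrier A" by simp_all
    show ?case
    proof (rule pt)
      fix i j assume ij: "i \<in> I" "j \<in> I"
      have "(\<Oplus>k\<in>I. (c \<odot>\<^bsub>mat_algebra I A\<^esub> x) (i, k) \<otimes> y (k, j)) = (\<Oplus>k\<in>I. c \<odot> (x (i, k) \<otimes> y (k, j)))"
        using ij by (intro finsum_cong') (auto simp: cl[OF M(1)] cl[OF M(2)])
      then show "(c \<odot>\<^bsub>mat_algebra I A\<^esub> x \<otimes>\<^bsub>mat_algebra I A\<^esub> y) (i, j) =
          (c \<odot>\<^bsub>mat_algebra I A\<^esub> (x \<otimes>\<^bsub>mat_algebra I A\<^esub> y)) (i, j)"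
        using ij by (simp add: smult_finsum[OF sum_cl[OF M]])
    qed simp_all
  next
    case (20 c x y)
    then have M: "x \<in> I \<times> I \<rightarrow>\<^sub>E carrier A" "y \<in> I \<times> I \<rightarrow>\<^sub>E carrier A" by simp_all
    show ?case
    proof (rule pt)
      fix i j assume ij: "i \<in> I" "j \<in> I"
      have "(\<Oplus>k\<in>I. x (i, k) \<otimes> (c \<odot>\<^bsub>mat_algebra I A\<^esub> y) (k, j)) = (\<Oplus>k\<in>I. c \<odot> (x (i, k) \<otimes> y (k, j)))"
        using ij by (intro finsum_cong') (auto simp: cl[OF M(1)] cl[OF M(2)])
      then show "(x \<otimes>\<^bsub>mat_algebra I A\<^esub> (c \<odot>\<^bsub>mat_algebra I A\<^esub> y)) (i, j) =
          (c \<odot>\<^bsub>mat_algebra I A\<^esub> (x \<otimes>\<^bsub>mat_algebra I A\<^esub> y)) (i, j)"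
        using ij by (simp add: smult_finsum[OF sum_cl[OF M]])
    qed simp_all
  next
    case (7 x y)
    then have M: "x \<in> I \<times> I \<rightarrow>\<^sub>E carrier A" "y \<in> I \<times> I \<rightarrow>\<^sub>E carrier A" by simp_all
    show ?case
      by (rule pt) (auto simp: cl[OF M(1)] cl[OF M(2)] intro: a_comm)
  next case 1 then show ?case by (auto simp: PiE_iff)
  next case 2 then show ?case by (auto simp: PiE_iff)
  next case 3 then show ?case by (auto simp: PiE_iff)
  next case 5 then show ?case by (auto simp: PiE_iff)
  next case (6 x y z) then show ?case by (intro pt) (auto simp: PiE_iff a_assoc)
  next case (8 x) then show ?case by (intro pt) (auto simp: PiE_iff)
  next case (14 c e x) then show ?case by (intro pt) (auto simp: PiE_iff smult_add_left)
  next case (15 c x y) then show ?case by (intro pt) (auto simp: PiE_iff smult_add_right)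
  next case (16 c e x) then show ?case by (intro pt) (auto simp: PiE_iff)
  next case (17 x) then show ?case by (intro pt) (auto simp: PiE_iff)
  next case (18 x) then show ?case by (intro pt) (auto simp: PiE_iff)
  qed
qed

subsection \<open>Tensor products\<close>

context kalgebra
begin

lemma comm_left:
  "\<lbrakk>x \<otimes> y = y \<otimes> x; x \<in> carrier A; y \<in> carrier A; z \<in> carrier A\<rbrakk> \<Longrightarrow>
   x \<otimes> (y \<otimes> z) = y \<otimes> (x \<otimes> z)"
  by (metis m_assoc)

lemma comm_mult:
  "\<lbrakk>x \<otimes> y = y \<otimes> x; x \<otimes> z = z \<otimes> x; x \<in> carrier A; y \<in> carrier A; z \<in> carrier A\<rbrakk> \<Longrightarrow>
   x \<otimes> (y \<otimes> z) = y \<otimes> z \<otimes> x"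
  by (metis m_assoc)

lemma comm_list_prod:
  "\<lbrakk>x \<in> carrier A; set ys \<subseteq> carrier A; \<And>y. y \<in> set ys \<Longrightarrow> x \<otimes> y = y \<otimes> x\<rbrakk> \<Longrightarrow>
   x \<otimes> list_prod A ys = list_prod A ys \<otimes> x"
  by (induct ys) (auto intro!: comm_mult list_prod_closed)

text \<open>Each \<open>g i\<close> has to be carried past the later factors \<open>f j\<close>, so
  commutation is asked for different indices. This makes an ordered product over tensor slots
  multiplicative.\<close>

lemma list_prod_mult_commuting:
  assumes "distinct is" "f \<in> set is \<rightarrow> carrier A" "g \<in> set is \<rightarrow> carrier A"
    "\<And>i j. \<lbrakk>i \<in> set is; j \<in> set is; i \<noteq> j\<rbrakk> \<Longrightarrow> f i \<otimes> g j = g j \<otimes> f i"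
  shows "list_prod A (map (\<lambda>i. f i \<otimes> g i) is) =
    list_prod A (map f is) \<otimes> list_prod A (map g is)"
  using assms
proof (induct "is")
  case (Cons i "is")
  have cl: "f i \<in> carrier A" "g i \<in> carrier A" "list_prod A (map f is) \<in> carrier A"
    "list_prod A (map g is) \<in> carrier A"
    using Cons(3,4) by (auto intro!: list_prod_closed)
  have "g i \<otimes> list_prod A (map f is) = list_prod A (map f is) \<otimes> g i"
    by (rule comm_list_prod) (use Cons cl in \<open>auto intro!: Cons(5)[symmetric]\<close>)
  moreover have "list_prod A (map (\<lambda>i. f i \<otimes> g i) is) =
      list_prod A (map f is) \<otimes> list_prod A (map g is)"
    using Cons by (intro Cons(1)) auto
  ultimately show ?case
    using cl by (simp add: m_assoc comm_left[of "g i"])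
qed simp

lemma list_prod_one: "set xs \<subseteq> {\<one>} \<Longrightarrow> list_prod A xs = \<one>"
  by (induct xs) auto

end

locale tensor_family =
  fixes I :: "'i set" and A :: "'i \<Rightarrow> ('k::comm_ring_1, 'a) module"
  assumes kalg: "i \<in> I \<Longrightarrow> kalgebra (A i)"
begin

lemma factor_monoid: "i \<in> I \<Longrightarrow> monoid (A i)"
  using kalg kalgebra.axioms(1) ring.is_monoid by blast

lemma monoid_product: "monoid (product_group I A)"
  by unfold_locales
    (auto simp: PiE_iff monoid.m_closed[OF factor_monoid] monoid.one_closed[OF factor_monoid]
      monoid.m_assoc[OF factor_monoid] monoid.l_one[OF factor_monoid]
      monoid.r_one[OF factor_monoid] fun_eq_iff extensional_def)

abbreviation MA :: "('k, ('i \<Rightarrow> 'a) \<Rightarrow>\<^sub>0 'k) module" where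
  "MA \<equiv> monoid_algebra (product_group I A)"

sublocale M: kalgebra MA
  by (rule monoid.kalgebra_monoid_algebra[OF monoid_product])

lemma minus_MA:
  assumes "f \<in> carrier MA" "g \<in> carrier MA"
  shows "f \<ominus>\<^bsub>MA\<^esub> g = f - g"
proof -
  have "Poly_Mapping.map ((*) (-1)) g = - g"
    by (rule poly_mapping_eqI) simp
  then show ?thesis
    using M.smult_minus_one[OF assms(2)] by (simp add: a_minus_def)
qed

lemma upd_closed: "\<lbrakk>x \<in> (\<Pi>\<^sub>E i\<in>I. carrier (A i)); a \<in> I; p \<in> carrier (A a)\<rbrakk> \<Longrightarrow>
    x(a := p) \<in> (\<Pi>\<^sub>E i\<in>I. carrier (A i))"
  by (auto simp: PiE_iff extensional_def)

lemma relators_closed: "tensor_relators I A \<subseteq> carrier MA"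
proof
  have diff: "Poly_Mapping.keys (f - g) \<subseteq> S" if "Poly_Mapping.keys f \<subseteq> S" "Poly_Mapping.keys g \<subseteq> S"
    for f g :: "('i \<Rightarrow> 'a) \<Rightarrow>\<^sub>0 'k" and S
    using that by (meson Poly_Mapping.keys_diff Un_least order_trans)
  fix r assume "r \<in> tensor_relators I A"
  then show "r \<in> carrier MA"
  proof cases
    case (additive x a p q)
    then show ?thesis
      unfolding additive(1) monoid_algebra_simps mem_Collect_eq carrier_product_group
      by (intro diff keys_single_subset upd_closed)
        (simp_all add: ring.ring_simprules(1)[OF kalgebra.axioms(1)[OF kalg]])
  next
    case (homogeneous x a p c)
    then show ?thesis
      unfolding homogeneous(1) monoid_algebra_simps mem_Collect_eq carrier_product_group
      by (intro diff keys_single_subset upd_closed)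
        (simp_all add: kalgebra.smult_closed[OF kalg])
  qed
qed

abbreviation "TA \<equiv> tensor_algebra I A"

abbreviation "J \<equiv> tensor_ideal I A"

sublocale I: kalgebra_ideal MA J
  unfolding tensor_ideal_def by (intro M.kalgebra_idealI M.genideal_ideal relators_closed)

sublocale T: kalgebra TA
  unfolding tensor_algebra_def by (rule I.kalgebra_alg_quot)

sublocale proj: kalgebra_hom MA TA "\<lambda>x. J +>\<^bsub>MA\<^esub> x"
  by unfold_locales (simp add: tensor_algebra_def I.coset_hom)

definition pure :: "('i \<Rightarrow> 'a) \<Rightarrow> (('i \<Rightarrow> 'a) \<Rightarrow>\<^sub>0 'k) set" where
  "pure x = J +>\<^bsub>MA\<^esub> Poly_Mapping.single x 1"

lemma pure_closed [simp]: "x \<in> (\<Pi>\<^sub>E i\<in>I. carrier (A i)) \<Longrightarrow> pure x \<in> carrier TA"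
  unfolding pure_def by (rule proj.closed) simp

lemma pure_mult:
  "\<lbrakk>x \<in> (\<Pi>\<^sub>E i\<in>I. carrier (A i)); y \<in> (\<Pi>\<^sub>E i\<in>I. carrier (A i))\<rbrakk> \<Longrightarrow>
    pure x \<otimes>\<^bsub>TA\<^esub> pure y = pure (\<lambda>i\<in>I. x i \<otimes>\<^bsub>A i\<^esub> y i)"
  unfolding pure_def by (subst proj.mult[symmetric]) auto

lemma pure_add:
  assumes "x \<in> (\<Pi>\<^sub>E i\<in>I. carrier (A i))" "a \<in> I" "p \<in> carrier (A a)" "q \<in> carrier (A a)"
  shows "pure (x(a := p \<oplus>\<^bsub>A a\<^esub> q)) = pure (x(a := p)) \<oplus>\<^bsub>TA\<^esub> pure (x(a := q))"
proof -
  let ?s = "\<lambda>z. Poly_Mapping.single (x(a := z)) (1::'k)"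
  have cl: "?s z \<in> carrier MA" if "z \<in> carrier (A a)" for z
    using assms that upd_closed[OF assms(1,2) that] by simp
  have pq: "p \<oplus>\<^bsub>A a\<^esub> q \<in> carrier (A a)"
    using assms by (simp add: ring.ring_simprules(1)[OF kalgebra.axioms(1)[OF kalg]])
  have "?s (p \<oplus>\<^bsub>A a\<^esub> q) - (?s p + ?s q) \<in> J"
    using M.genideal_self[OF relators_closed] tensor_relators.additive[OF assms]
    unfolding tensor_ideal_def by (auto simp: algebra_simps)
  moreover have "?s (p \<oplus>\<^bsub>A a\<^esub> q) \<ominus>\<^bsub>MA\<^esub> (?s p + ?s q) = ?s (p \<oplus>\<^bsub>A a\<^esub> q) - (?s p + ?s q)"
    by (rule minus_MA[OF cl[OF pq]]) (use M.a_closed[OF cl cl, OF assms(3,4)] in simp)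
  ultimately have "J +>\<^bsub>MA\<^esub> ?s (p \<oplus>\<^bsub>A a\<^esub> q) = J +>\<^bsub>MA\<^esub> (?s p \<oplus>\<^bsub>MA\<^esub> ?s q)"
    by (subst I.coset_eq_iff[OF cl[OF pq] M.a_closed[OF cl cl, OF assms(3,4)]]) simp
  then show ?thesis
    unfolding pure_def by (simp only: proj.add[OF cl cl, OF assms(3,4)])
qed

lemma pure_smult:
  assumes "x \<in> (\<Pi>\<^sub>E i\<in>I. carrier (A i))" "a \<in> I" "p \<in> carrier (A a)"
  shows "pure (x(a := c \<odot>\<^bsub>A a\<^esub> p)) = c \<odot>\<^bsub>TA\<^esub> pure (x(a := p))"
proof -
  let ?s = "\<lambda>z. Poly_Mapping.single (x(a := z))"
  have cl: "?s z c \<in> carrier MA" if "z \<in> carrier (A a)" for z c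
    using assms that upd_closed[OF assms(1,2) that] by simp
  have cp: "c \<odot>\<^bsub>A a\<^esub> p \<in> carrier (A a)"
    using assms by (simp add: kalgebra.smult_closed[OF kalg])
  have "?s (c \<odot>\<^bsub>A a\<^esub> p) 1 - ?s p c \<in> J"
    using M.genideal_self[OF relators_closed] tensor_relators.homogeneous[OF assms]
    unfolding tensor_ideal_def by auto
  moreover have "?s (c \<odot>\<^bsub>A a\<^esub> p) 1 \<ominus>\<^bsub>MA\<^esub> ?s p c = ?s (c \<odot>\<^bsub>A a\<^esub> p) 1 - ?s p c"
    by (rule minus_MA[OF cl[OF cp] cl[OF assms(3)]])
  ultimately have "J +>\<^bsub>MA\<^esub> ?s (c \<odot>\<^bsub>A a\<^esub> p) 1 = J +>\<^bsub>MA\<^esub> ?s p c"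
    by (subst I.coset_eq_iff[OF cl[OF cp] cl[OF assms(3)]]) simp
  then show ?thesis
    unfolding pure_def using proj.smult[OF cl[OF assms(3), of 1], of c] by simp
qed

lemma induct_pure [consumes 1, case_names pure smult add]:
  assumes "x \<in> carrier TA" "\<And>x. x \<in> (\<Pi>\<^sub>E i\<in>I. carrier (A i)) \<Longrightarrow> P (pure x)"
    and smult: "\<And>c x. \<lbrakk>x \<in> carrier TA; P x\<rbrakk> \<Longrightarrow> P (c \<odot>\<^bsub>TA\<^esub> x)"
    and add: "\<And>x y. \<lbrakk>x \<in> carrier TA; y \<in> carrier TA; P x; P y\<rbrakk> \<Longrightarrow> P (x \<oplus>\<^bsub>TA\<^esub> y)"
  shows "P x"
proof -
  obtain f where f: "Poly_Mapping.keys f \<subseteq> (\<Pi>\<^sub>E i\<in>I. carrier (A i))" "x = J +>\<^bsub>MA\<^esub> f"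
    using assms(1) unfolding tensor_algebra_def by (auto elim: I.coset_cases)
  have P0: "P \<zero>\<^bsub>TA\<^esub>"
  proof -
    have "(\<lambda>i\<in>I. \<one>\<^bsub>A i\<^esub>) \<in> (\<Pi>\<^sub>E i\<in>I. carrier (A i))"
      using monoid.one_closed[OF monoid_product] by simp
    then show ?thesis
      using smult[of "pure (\<lambda>i\<in>I. \<one>\<^bsub>A i\<^esub>)" 0] assms(2) by simp
  qed
  from f(1) have "P (J +>\<^bsub>MA\<^esub> f)"
  proof (induct rule: poly_mapping_keys_induct)
    case zero
    then show ?case using P0 proj.zero by simp
  next
    case (single y a)
    then have "J +>\<^bsub>MA\<^esub> Poly_Mapping.single y a = a \<odot>\<^bsub>TA\<^esub> pure y"
      unfolding pure_def by (subst proj.smult[symmetric]) auto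
    then show ?case using single by (simp add: assms(2) smult)
  next
    case (add f g)
    then show ?case using proj.add[of f g] by (auto intro!: assms(4) proj.closed)
  qed
  with f(2) show ?thesis by simp
qed

definition unit_at :: "'i \<Rightarrow> 'a \<Rightarrow> 'i \<Rightarrow> 'a" where
  "unit_at a p = (\<lambda>i\<in>I. if i = a then p else \<one>\<^bsub>A i\<^esub>)"

lemma unit_at_closed: "p \<in> carrier (A a) \<Longrightarrow> unit_at a p \<in> (\<Pi>\<^sub>E i\<in>I. carrier (A i))"
  by (auto simp: unit_at_def monoid.one_closed[OF factor_monoid])

text \<open>Written as an update of the all-ones family, a tensor with one free slot has the form in
  which the relators, and so \<open>pure_add\<close> and \<open>pure_smult\<close>, are
  stated.\<close>

lemma unit_at_upd: "a \<in> I \<Longrightarrow> unit_at a p = (\<lambda>i\<in>I. \<one>\<^bsub>A i\<^esub>)(a := p)"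
  by (auto simp: unit_at_def fun_eq_iff)

lemma tensor_factor_pure: "tensor_factor I A a p = pure (unit_at a p)"
  by (simp add: tensor_factor_def pure_def unit_at_def)

lemma one_closed: "(\<lambda>i\<in>I. \<one>\<^bsub>A i\<^esub>) \<in> (\<Pi>\<^sub>E i\<in>I. carrier (A i))"
  using monoid.one_closed[OF monoid_product] by simp

lemma pure_one: "pure (\<lambda>i\<in>I. \<one>\<^bsub>A i\<^esub>) = \<one>\<^bsub>TA\<^esub>"
  unfolding pure_def using proj.one by simp

lemma tensor_factor_hom:
  assumes "a \<in> I"
  shows "tensor_factor I A a \<in> alg_hom (A a) TA"
proof (rule alg_homI)
  show "tensor_factor I A a \<one>\<^bsub>A a\<^esub> = \<one>\<^bsub>TA\<^esub>"
    using assms by (simp add: tensor_factor_pure unit_at_upd fun_upd_idem flip: pure_one)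
  fix p q c assume pq: "p \<in> carrier (A a)"
  show "tensor_factor I A a p \<in> carrier TA"
    using pq by (simp add: tensor_factor_pure unit_at_closed)
  show "tensor_factor I A a (c \<odot>\<^bsub>A a\<^esub> p) = c \<odot>\<^bsub>TA\<^esub> tensor_factor I A a p"
    using assms pure_smult[OF one_closed assms pq] by (simp add: tensor_factor_pure unit_at_upd)
  assume "q \<in> carrier (A a)"
  with pq assms show "tensor_factor I A a (p \<oplus>\<^bsub>A a\<^esub> q) = tensor_factor I A a p \<oplus>\<^bsub>TA\<^esub> tensor_factor I A a q"
    using pure_add[OF one_closed assms, of p q] by (simp add: tensor_factor_pure unit_at_upd)
  have "unit_at a (p \<otimes>\<^bsub>A a\<^esub> q) = (\<lambda>i\<in>I. unit_at a p i \<otimes>\<^bsub>A i\<^esub> unit_at a q i)"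
    by (auto simp: unit_at_def fun_eq_iff monoid.l_one[OF factor_monoid]
        monoid.one_closed[OF factor_monoid])
  then show "tensor_factor I A a (p \<otimes>\<^bsub>A a\<^esub> q) = tensor_factor I A a p \<otimes>\<^bsub>TA\<^esub> tensor_factor I A a q"
    unfolding tensor_factor_pure
    by (simp only: pure_mult[OF unit_at_closed unit_at_closed, OF pq \<open>q \<in> carrier (A a)\<close>])
qed

text \<open>In each slot at least one of the two entries is the identity, so the slotwise products
  agree in both orders.\<close>

lemma tensor_factor_commute:
  assumes "a \<noteq> b" "p \<in> carrier (A a)" "q \<in> carrier (A b)"
  shows "tensor_factor I A a p \<otimes>\<^bsub>TA\<^esub> tensor_factor I A b q =
    tensor_factor I A b q \<otimes>\<^bsub>TA\<^esub> tensor_factor I A a p"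
proof -
  have "(\<lambda>i\<in>I. unit_at a p i \<otimes>\<^bsub>A i\<^esub> unit_at b q i) = (\<lambda>i\<in>I. unit_at b q i \<otimes>\<^bsub>A i\<^esub> unit_at a p i)"
    using assms by (auto simp: unit_at_def fun_eq_iff monoid.l_one[OF factor_monoid]
        monoid.r_one[OF factor_monoid] monoid.one_closed[OF factor_monoid])
  then show ?thesis
    unfolding tensor_factor_pure
    by (simp only: pure_mult[OF unit_at_closed unit_at_closed, OF assms(2,3)]
        pure_mult[OF unit_at_closed unit_at_closed, OF assms(3,2)])
qed

text \<open>Partial products are tensors that carry the entries of the slots visited so far and ones
  elsewhere. In consequence the tensor product is generated by its factors.\<close>

lemma pure_list_prod:
  assumes "set is = I" "distinct is" "x \<in> (\<Pi>\<^sub>E i\<in>I. carrier (A i))"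
  shows "pure x = list_prod TA (map (\<lambda>i. tensor_factor I A i (x i)) is)"
proof -
  have x: "x i \<in> carrier (A i)" if "i \<in> I" for i using assms that by auto
  have "distinct js \<Longrightarrow> set js \<subseteq> I \<Longrightarrow> list_prod TA (map (\<lambda>i. tensor_factor I A i (x i)) js) =
      pure (\<lambda>i\<in>I. if i \<in> set js then x i else \<one>\<^bsub>A i\<^esub>)" for js
  proof (induct js)
    case (Cons j js)
    let ?y = "\<lambda>i\<in>I. if i \<in> set js then x i else \<one>\<^bsub>A i\<^esub>"
    have y: "?y \<in> (\<Pi>\<^sub>E i\<in>I. carrier (A i))"
      by (auto simp: x monoid.one_closed[OF factor_monoid])
    have "list_prod TA (map (\<lambda>i. tensor_factor I A i (x i)) (j # js)) =
        pure (unit_at j (x j)) \<otimes>\<^bsub>TA\<^esub> pure ?y"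
      using Cons.hyps Cons.prems
      by (simp only: list.map list_prod_Cons tensor_factor_pure distinct.simps list.set insert_subset)
    also have "\<dots> = pure (\<lambda>i\<in>I. unit_at j (x j) i \<otimes>\<^bsub>A i\<^esub> ?y i)"
      using Cons y by (intro pure_mult unit_at_closed x) auto
    also have "(\<lambda>i\<in>I. unit_at j (x j) i \<otimes>\<^bsub>A i\<^esub> ?y i) =
        (\<lambda>i\<in>I. if i \<in> set (j # js) then x i else \<one>\<^bsub>A i\<^esub>)"
      using Cons x by (auto simp: unit_at_def fun_eq_iff monoid.l_one[OF factor_monoid]
          monoid.r_one[OF factor_monoid] monoid.one_closed[OF factor_monoid])
    finally show ?case .
  qed (simp add: pure_one)
  from this[of "is"] have "list_prod TA (map (\<lambda>i. tensor_factor I A i (x i)) is) =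
      pure (\<lambda>i\<in>I. if i \<in> set is then x i else \<one>\<^bsub>A i\<^esub>)"
    using assms(1,2) by blast
  also have "(\<lambda>i\<in>I. if i \<in> set is then x i else \<one>\<^bsub>A i\<^esub>) = x"
    using assms by (auto simp: fun_eq_iff PiE_iff extensional_def)
  finally show ?thesis by simp
qed

text \<open>Universal property of the tensor product for a noncommutative target: homomorphisms with
  pairwise commuting images multiply to one homomorphism. The order of the product is fixed by
  listing the finite index set.\<close>

lemma hom_exists:
  fixes B :: "('k, 'b) module"
  assumes B: "kalgebra B" and "finite I" and \<phi>: "\<And>a. a \<in> I \<Longrightarrow> \<phi> a \<in> alg_hom (A a) B"
    and comm: "\<And>a b p q. \<lbrakk>a \<in> I; b \<in> I; a \<noteq> b; p \<in> carrier (A a); q \<in> carrier (A b)\<rbrakk> \<Longrightarrow>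
      \<phi> a p \<otimes>\<^bsub>B\<^esub> \<phi> b q = \<phi> b q \<otimes>\<^bsub>B\<^esub> \<phi> a p"
  obtains h where "h \<in> alg_hom TA B"
    "\<And>a p. \<lbrakk>a \<in> I; p \<in> carrier (A a)\<rbrakk> \<Longrightarrow> h (tensor_factor I A a p) = \<phi> a p"
proof -
  interpret B: kalgebra B by fact
  obtain "is" where iss: "set is = I" "distinct is"
    using \<open>finite I\<close> finite_distinct_list by blast
  have hom: "kalgebra_hom (A a) B (\<phi> a)" if "a \<in> I" for a
    using that by (intro kalgebra_hom.intro kalg B kalgebra_hom_axioms.intro \<phi>)
  note \<phi>s = kalgebra_hom.closed[OF hom] kalgebra_hom.mult[OF hom] kalgebra_hom.one[OF hom]
    kalgebra_hom.add[OF hom] kalgebra_hom.smult[OF hom]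
  define \<theta> where "\<theta> x = list_prod B (map (\<lambda>a. \<phi> a (x a)) is)" for x
  have cl: "set (map (\<lambda>a. \<phi> a (x a)) js) \<subseteq> carrier B"
    if "x \<in> (\<Pi>\<^sub>E i\<in>I. carrier (A i))" "set js \<subseteq> I" for x js
    using that by (auto intro!: \<phi>s)
  have "lin_ext B \<theta> \<in> alg_hom MA B"
  proof (rule B.lin_ext_alg_hom[OF monoid_product])
    show "\<theta> \<in> carrier (product_group I A) \<rightarrow> carrier B"
      using cl iss by (auto simp: \<theta>_def intro!: B.list_prod_closed simp del: set_map)
    show "\<theta> \<one>\<^bsub>product_group I A\<^esub> = \<one>\<^bsub>B\<^esub>"
      unfolding \<theta>_def by (rule B.list_prod_one) (auto simp: \<phi>s iss)
    fix x y assume xy: "x \<in> carrier (product_group I A)" "y \<in> carrier (product_group I A)"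
    have "\<theta> (x \<otimes>\<^bsub>product_group I A\<^esub> y) = list_prod B (map (\<lambda>a. \<phi> a (x a) \<otimes>\<^bsub>B\<^esub> \<phi> a (y a)) is)"
      unfolding \<theta>_def using xy
      by (intro arg_cong[where f = "list_prod B"] map_cong refl) (auto simp: iss PiE_iff \<phi>s)
    also have "\<dots> = \<theta> x \<otimes>\<^bsub>B\<^esub> \<theta> y"
      unfolding \<theta>_def using xy iss
      by (intro B.list_prod_mult_commuting) (auto simp: PiE_iff \<phi>s intro!: comm)
    finally show "\<theta> (x \<otimes>\<^bsub>product_group I A\<^esub> y) = \<theta> x \<otimes>\<^bsub>B\<^esub> \<theta> y" .
  qed
  then interpret h: kalgebra_hom MA B "lin_ext B \<theta>"
    by unfold_locales
  \<comment> \<open>As a function of the entry in slot \<open>a\<close> alone, the product is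
    \<open>u \<otimes> (\<phi> a p \<otimes> v)\<close> with fixed outer factors, hence linear in
    \<open>p\<close>; the relators measure exactly this.\<close>
  have split: "\<exists>u v. u \<in> carrier B \<and> v \<in> carrier B \<and>
      (\<forall>p\<in>carrier (A a). \<theta> (x(a := p)) = u \<otimes>\<^bsub>B\<^esub> (\<phi> a p \<otimes>\<^bsub>B\<^esub> v))"
    if x: "x \<in> (\<Pi>\<^sub>E i\<in>I. carrier (A i))" and aI: "a \<in> I" for x a
  proof -
    obtain us vs where uv: "is = us @ a # vs"
      using iss aI split_list[of a "is"] by blast
    then have a: "a \<notin> set us" "a \<notin> set vs" "set us \<subseteq> I" "set vs \<subseteq> I" using iss by auto
    show ?thesis
    proof (intro exI conjI ballI)
      show u: "list_prod B (map (\<lambda>i. \<phi> i (x i)) us) \<in> carrier B"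
        and v: "list_prod B (map (\<lambda>i. \<phi> i (x i)) vs) \<in> carrier B"
        using cl[OF x] a by (auto intro!: B.list_prod_closed simp del: set_map)
      fix p assume p: "p \<in> carrier (A a)"
      have eq: "map (\<lambda>i. \<phi> i ((x(a := p)) i)) us = map (\<lambda>i. \<phi> i (x i)) us"
        "map (\<lambda>i. \<phi> i ((x(a := p)) i)) vs = map (\<lambda>i. \<phi> i (x i)) vs"
        using a by auto
      have "\<theta> (x(a := p)) = list_prod B (map (\<lambda>i. \<phi> i ((x(a := p)) i)) us @
          \<phi> a p # map (\<lambda>i. \<phi> i ((x(a := p)) i)) vs)"
        by (simp add: \<theta>_def uv)
      also have "\<dots> = list_prod B (map (\<lambda>i. \<phi> i (x i)) us) \<otimes>\<^bsub>B\<^esub>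
          (\<phi> a p \<otimes>\<^bsub>B\<^esub> list_prod B (map (\<lambda>i. \<phi> i (x i)) vs))"
        unfolding eq using cl[OF x, of us] cl[OF x, of vs] a aI p
        by (subst B.list_prod_append) (auto simp: \<phi>s)
      finally show "\<theta> (x(a := p)) = list_prod B (map (\<lambda>i. \<phi> i (x i)) us) \<otimes>\<^bsub>B\<^esub>
          (\<phi> a p \<otimes>\<^bsub>B\<^esub> list_prod B (map (\<lambda>i. \<phi> i (x i)) vs))" .
    qed
  qed
  have \<theta>_cl: "\<theta> x \<in> carrier B" if "x \<in> (\<Pi>\<^sub>E i\<in>I. carrier (A i))" for x
    using cl[OF that, of "is"] iss by (auto simp: \<theta>_def intro!: B.list_prod_closed simp del: set_map)
  have van: "lin_ext B \<theta> r = \<zero>\<^bsub>B\<^esub>" if "r \<in> tensor_relators I A" for r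
    using that
  proof cases
    case (additive x a p q)
    have pq: "p \<oplus>\<^bsub>A a\<^esub> q \<in> carrier (A a)"
      using additive by (simp add: ring.ring_simprules(1)[OF kalgebra.axioms(1)[OF kalg]])
    obtain u v where uv: "u \<in> carrier B" "v \<in> carrier B"
      "\<And>p. p \<in> carrier (A a) \<Longrightarrow> \<theta> (x(a := p)) = u \<otimes>\<^bsub>B\<^esub> (\<phi> a p \<otimes>\<^bsub>B\<^esub> v)"
      using split[OF additive(2,3)] by blast
    let ?s = "\<lambda>p c. Poly_Mapping.single (x(a := p)) (c::'k)"
    have cls: "?s z c \<in> carrier MA" if "z \<in> carrier (A a)" for z c
      using that additive(2,3) by (simp add: upd_closed)
    have "lin_ext B \<theta> (?s z c) = c \<odot>\<^bsub>B\<^esub> \<theta> (x(a := z))" if "z \<in> carrier (A a)" for z c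
      by (rule B.lin_ext_single) (use additive that in \<open>auto intro!: \<theta>_cl upd_closed\<close>)
    \<comment> \<open>Subtraction is moved into the coefficients, so that the relator becomes a sum
      to which additivity of the extension applies.\<close>
    moreover have "r = ?s (p \<oplus>\<^bsub>A a\<^esub> q) 1 + (?s p (-1) + ?s q (-1))"
      by (simp add: additive(1) single_uminus)
    moreover have "\<theta> (x(a := p \<oplus>\<^bsub>A a\<^esub> q)) = \<theta> (x(a := p)) \<oplus>\<^bsub>B\<^esub> \<theta> (x(a := q))"
      using additive uv pq by (simp add: \<phi>s B.l_distr B.r_distr)
    moreover have "\<theta> (x(a := p)) \<in> carrier B" "\<theta> (x(a := q)) \<in> carrier B"
      using additive by (auto intro!: \<theta>_cl upd_closed)
    ultimately show ?thesis
      using h.add[OF cls[OF pq] M.a_closed[OF cls cls], OF additive(4,5), of 1 "-1" "-1"]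
        h.add[OF cls cls, OF additive(4,5), of "-1" "-1"] additive(4,5) pq
      by (simp add: B.smult_minus_one B.minus_add[symmetric] B.r_neg)
  next
    case (homogeneous x a p c)
    have pq: "c \<odot>\<^bsub>A a\<^esub> p \<in> carrier (A a)"
      using homogeneous by (simp add: kalgebra.smult_closed[OF kalg])
    obtain u v where uv: "u \<in> carrier B" "v \<in> carrier B"
      "\<And>p. p \<in> carrier (A a) \<Longrightarrow> \<theta> (x(a := p)) = u \<otimes>\<^bsub>B\<^esub> (\<phi> a p \<otimes>\<^bsub>B\<^esub> v)"
      using split[OF homogeneous(2,3)] by blast
    let ?s = "\<lambda>p c. Poly_Mapping.single (x(a := p)) (c::'k)"
    have cls: "?s z c \<in> carrier MA" if "z \<in> carrier (A a)" for z c
      using that homogeneous(2,3) by (simp add: upd_closed)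
    have "lin_ext B \<theta> (?s z c) = c \<odot>\<^bsub>B\<^esub> \<theta> (x(a := z))" if "z \<in> carrier (A a)" for z c
      by (rule B.lin_ext_single) (use homogeneous that in \<open>auto intro!: \<theta>_cl upd_closed\<close>)
    moreover have "r = ?s (c \<odot>\<^bsub>A a\<^esub> p) 1 + ?s p (-c)"
      by (simp add: homogeneous(1) single_uminus)
    moreover have "\<theta> (x(a := c \<odot>\<^bsub>A a\<^esub> p)) = c \<odot>\<^bsub>B\<^esub> \<theta> (x(a := p))"
      using homogeneous uv pq by (simp add: \<phi>s)
    moreover have cp: "\<theta> (x(a := p)) \<in> carrier B"
      using homogeneous by (auto intro!: \<theta>_cl upd_closed)
    ultimately show ?thesis
      using h.add[OF cls[OF pq] cls[OF homogeneous(4)], of 1 "-c"] homogeneous(4) pq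
        B.smult_add_left[OF cp, of c "-c"]
      by simp
  qed
  from alg_quot_hom[OF I.kalgebra_ideal_axioms h.kalgebra_hom_axioms
      h.vanish_Idl[OF relators_closed van], folded tensor_ideal_def]
  obtain f where f: "f \<in> alg_hom TA B"
    "\<And>x. x \<in> carrier MA \<Longrightarrow> f (J +>\<^bsub>MA\<^esub> x) = lin_ext B \<theta> x"
    unfolding tensor_algebra_def tensor_ideal_def by blast
  have "f (tensor_factor I A a p) = \<phi> a p" if a: "a \<in> I" and "p \<in> carrier (A a)" for a p
  proof -
    have u: "unit_at a p \<in> (\<Pi>\<^sub>E i\<in>I. carrier (A i))"
      using that by (simp add: unit_at_closed)
    have "f (tensor_factor I A a p) = lin_ext B \<theta> (Poly_Mapping.single (unit_at a p) 1)"
      unfolding tensor_factor_pure pure_def by (rule f(2)) (use u in simp)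
    also have "\<dots> = \<theta> (unit_at a p)"
      using \<theta>_cl[OF u] by simp
    also have "\<dots> = \<phi> a p"
    proof -
      obtain us vs where uv: "is = us @ a # vs"
        using iss a split_list[of a "is"] by blast
      then have "list_prod B (map (\<lambda>i. \<phi> i (unit_at a p i)) us) = \<one>\<^bsub>B\<^esub>"
        "list_prod B (map (\<lambda>i. \<phi> i (unit_at a p i)) vs) = \<one>\<^bsub>B\<^esub>"
        using iss by (auto intro!: B.list_prod_one simp: unit_at_def \<phi>s)
      moreover have "\<theta> (unit_at a p) = list_prod B (map (\<lambda>i. \<phi> i (unit_at a p i)) us) \<otimes>\<^bsub>B\<^esub>
          list_prod B (\<phi> a p # map (\<lambda>i. \<phi> i (unit_at a p i)) vs)"
        unfolding \<theta>_def uv using cl[OF u, of us] cl[OF u, of vs] uv iss that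
        by (subst B.list_prod_append[symmetric]) (auto simp: \<phi>s unit_at_def)
      ultimately show ?thesis using that by (simp add: \<phi>s)
    qed
    finally show ?thesis .
  qed
  with f(1) show ?thesis by (rule that)
qed

end

declare One_nat_def [simp del]

section \<open>Sorting words\<close>

lemma simple_refl_simps [simp]:
  "simple_refl i i = Suc i" "simple_refl i (Suc i) = i" "simple_refl i (simple_refl i j) = j"
  "simple_refl i \<circ> simple_refl i = id"
  by (auto simp: simple_refl_def)

lemma simple_refl_other: "\<lbrakk>j \<noteq> i; j \<noteq> Suc i\<rbrakk> \<Longrightarrow> simple_refl i j = j"
  by (simp add: simple_refl_def)

lemma simple_refl_comp_simps [simp]: "f \<circ> simple_refl i \<circ> simple_refl i = f"
  by (simp add: comp_assoc)

lemma simple_refl_permutes: "i \<in> {1..<n} \<Longrightarrow> simple_refl i permutes {1..n}"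
  unfolding simple_refl_def by (intro permutes_swap_id) auto

lemma bij_simple_refl [simp]: "bij (simple_refl i)"
  by (simp add: simple_refl_def)

lemma inv_simple_refl [simp]: "inv_into UNIV (simple_refl i) = simple_refl i"
  by (simp add: simple_refl_def)

lemma simple_refl_in: "i \<in> {1..<n} \<Longrightarrow> simple_refl i j \<in> {1..n} \<longleftrightarrow> j \<in> {1..n}"
  using permutes_in_image[OF simple_refl_permutes] .

lemma simple_refl_less: "\<lbrakk>p < q; (p, q) \<noteq> (i, Suc i)\<rbrakk> \<Longrightarrow> simple_refl i p < simple_refl i q"
  by (auto simp: simple_refl_def transpose_def)

lemma simple_refl_far: "Suc i < j \<Longrightarrow> simple_refl i \<circ> simple_refl j = simple_refl j \<circ> simple_refl i"
  by (auto simp: simple_refl_def transpose_def fun_eq_iff)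

lemma simple_refl_braid:
  "simple_refl i \<circ> simple_refl (Suc i) \<circ> simple_refl i =
   simple_refl (Suc i) \<circ> simple_refl i \<circ> simple_refl (Suc i)"
  by (auto simp: simple_refl_def transpose_def fun_eq_iff)

text \<open>For a permutation \<open>f\<close> these are the reduced words of its inverse. Ties are
  allowed so that colourings, which repeat values, are sorted by the same relation; demanding a
  descent at each letter replaces minimality of length by a local condition.\<close>

inductive sorts :: "nat \<Rightarrow> (nat \<Rightarrow> 'a::linorder) \<Rightarrow> nat list \<Rightarrow> bool" for n where
  Nil: "(\<And>i. i \<in> {1..<n} \<Longrightarrow> f i \<le> f (Suc i)) \<Longrightarrow> sorts n f []"
| Cons: "\<lbrakk>i \<in> {1..<n}; f (Suc i) < f i; sorts n (f \<circ> simple_refl i) is\<rbrakk> \<Longrightarrow> sorts n f (i # is)"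

lemma sorts_induct [consumes 1, case_names Nil Cons]:
  assumes "sorts n f is"
    "\<And>f. (\<And>i. i \<in> {1..<n} \<Longrightarrow> f i \<le> f (Suc i)) \<Longrightarrow> P f []"
    "\<And>i f is. \<lbrakk>i \<in> {1..<n}; f (Suc i) < f i; sorts n (f \<circ> simple_refl i) is; P (f \<circ> simple_refl i) is\<rbrakk>
      \<Longrightarrow> P f (i # is)"
  shows "P f is"
  using assms by (rule sorts.induct) (simp_all add: comp_def)

inductive_cases sorts_ConsE: "sorts n f (i # is)"

lemma sorts_set: "sorts n f is \<Longrightarrow> set is \<subseteq> {1..<n}"
  by (induct rule: sorts_induct) auto

definition inversions :: "nat \<Rightarrow> (nat \<Rightarrow> 'a::linorder) \<Rightarrow> (nat \<times> nat) set" where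
  "inversions n f = {(i, j). 1 \<le> i \<and> i < j \<and> j \<le> n \<and> f j < f i}"

lemma finite_inversions [simp]: "finite (inversions n f)"
  by (rule finite_subset[of _ "{..n} \<times> {..n}"]) (auto simp: inversions_def)

text \<open>The swap carries the inversions of the swapped sequence injectively to inversions of
  \<open>f\<close>, and misses only \<open>(i, Suc i)\<close>, the one pair of positions whose order
  it reverses.\<close>

lemma card_inversions_descent:
  assumes "i \<in> {1..<n}" "f (Suc i) < f i"
  shows "card (inversions n f) = Suc (card (inversions n (f \<circ> simple_refl i)))"
proof -
  let ?s = "simple_refl i"
  \<comment> \<open>The sequence is left arbitrary because, \<open>simple_refl i\<close> being an
    involution, the same fact then gives both inclusions.\<close>
  have step: "(?s p, ?s q) \<in> inversions n f' \<and> (?s p, ?s q) \<noteq> (i, Suc i)"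
    if "(p, q) \<in> inversions n (f' \<circ> ?s)" "(p, q) \<noteq> (i, Suc i)" for p q and f' :: "nat \<Rightarrow> 'a"
  proof -
    have "p \<in> {1..n}" "q \<in> {1..n}" "p < q" "f' (?s q) < f' (?s p)"
      using that(1) by (auto simp: inversions_def)
    moreover have "(?s p, ?s q) \<noteq> (i, Suc i)"
      using \<open>p < q\<close> by (metis Suc_n_not_le_n less_imp_le_nat Pair_inject simple_refl_simps(1-3))
    moreover have "?s p \<in> {1..n}" "?s q \<in> {1..n}"
      using calculation(1,2) simple_refl_in[OF assms(1)] by blast+
    ultimately show ?thesis
      using simple_refl_less[OF _ that(2)] by (auto simp: inversions_def)
  qed
  have "inversions n f = insert (i, Suc i) (map_prod ?s ?s ` inversions n (f \<circ> ?s))"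
    (is "?L = insert _ (_ ` ?R)")
  proof (intro equalityI subsetI)
    fix x assume x: "x \<in> ?L"
    obtain p q where pq: "x = (p, q)" by (cases x)
    show "x \<in> insert (i, Suc i) (map_prod ?s ?s ` ?R)"
    proof (cases "(p, q) = (i, Suc i)")
      case False
      then have "(?s p, ?s q) \<in> ?R"
        using step[of p q "f \<circ> ?s"] x pq by simp
      then show ?thesis
        unfolding pq by (intro insertI2 rev_image_eqI[of "(?s p, ?s q)"]) auto
    qed (simp add: pq)
  next
    fix x assume "x \<in> insert (i, Suc i) (map_prod ?s ?s ` ?R)"
    moreover have "(i, Suc i) \<in> ?L"
      using assms by (auto simp: inversions_def)
    moreover have "(i, Suc i) \<notin> ?R"
      using assms by (auto simp: inversions_def)
    ultimately show "x \<in> ?L"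
      using step[of _ _ f] by force
  qed
  moreover have "(i, Suc i) \<notin> map_prod ?s ?s ` ?R"
  proof
    assume "(i, Suc i) \<in> map_prod ?s ?s ` ?R"
    then obtain p q where "(p, q) \<in> ?R" "?s p = i" "?s q = Suc i" by auto
    then have "p = Suc i" "q = i" "p < q"
      by (metis simple_refl_simps(1-3)) (metis \<open>?s q = Suc i\<close> simple_refl_simps(1-3),
        use \<open>(p, q) \<in> ?R\<close> in \<open>auto simp: inversions_def\<close>)
    then show False by simp
  qed
  moreover have "inj_on (map_prod ?s ?s) ?R"
    by (rule inj_onI) (metis Pair_inject map_prod_simp prod.exhaust simple_refl_simps(3))
  ultimately show ?thesis
    by (simp add: card_image)
qed

lemma card_inversions_swap:
  assumes "i \<in> {1..<n}" "f (Suc i) \<noteq> f i"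
  shows "if f (Suc i) < f i then card (inversions n f) = Suc (card (inversions n (f \<circ> simple_refl i)))
    else card (inversions n (f \<circ> simple_refl i)) = Suc (card (inversions n f))"
  using assms card_inversions_descent[of i n f]
    card_inversions_descent[of i n "f \<circ> simple_refl i"] by auto

lemma sorted_nat_mono:
  assumes "\<And>i. i \<in> {1..<n} \<Longrightarrow> f i \<le> f (Suc i)" "1 \<le> i" "i \<le> j" "j \<le> n"
  shows "f i \<le> (f j :: 'a::linorder)"
  using assms(3,4)
proof (induct j rule: dec_induct)
  case (step k)
  then have "f i \<le> f k" by simp
  also have "f k \<le> f (Suc k)" using step assms(1,2) by simp
  finally show ?case .
qed simp

text \<open>Each letter removes exactly one inversion and a sorted sequence has none; so all sorting
  words of \<open>f\<close> are equally long.\<close>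

lemma sorts_length: "sorts n f is \<Longrightarrow> length is = card (inversions n f)"
proof (induct rule: sorts_induct)
  case (Nil f)
  have "inversions n f = {}"
  proof -
    have "\<not> f j < f i" if "1 \<le> i" "i < j" "j \<le> n" for i j
      using sorted_nat_mono[of n f i j] Nil that by fastforce
    then show ?thesis by (auto simp: inversions_def)
  qed
  then show ?case by simp
qed (simp add: card_inversions_descent comp_def)

lemma sorts_exists: "\<exists>is. sorts n f is"
proof (induct "card (inversions n f)" arbitrary: f rule: less_induct)
  case less
  show ?case
  proof (cases "\<exists>i\<in>{1..<n}. f (Suc i) < f i")
    case True
    then obtain i where i: "i \<in> {1..<n}" "f (Suc i) < f i" by blast
    then obtain js where "sorts n (f \<circ> simple_refl i) js"
      using less card_inversions_descent[of i n f] by fastforce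
    with i show ?thesis using sorts.Cons by blast
  next
    case False
    then have "f i \<le> f (Suc i)" if "i \<in> {1..<n}" for i
      using that leI by blast
    then show ?thesis using sorts.Nil[of n f] by blast
  qed
qed

text \<open>Matsumoto's theorem in the form of a diamond argument: two descents of a sequence can be
  completed to sorting words that agree after a commutation or a braid move. The predicate \<open>P\<close>
  confines the argument to generators indexed by \<open>J\<close>.\<close>

lemma (in kalgebra) sorts_unique:
  assumes P: "\<And>f i. \<lbrakk>P f; i \<in> {1..<n}; f (Suc i) < f i\<rbrakk> \<Longrightarrow> i \<in> J \<and> P (f \<circ> simple_refl i)"
    and cl: "\<tau> \<in> J \<rightarrow> carrier A"
    and far: "\<And>i j. \<lbrakk>i \<in> J; j \<in> J; Suc i < j\<rbrakk> \<Longrightarrow> \<tau> i \<otimes> \<tau> j = \<tau> j \<otimes> \<tau> i"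
    and braid: "\<And>i. \<lbrakk>i \<in> J; Suc i \<in> J\<rbrakk> \<Longrightarrow> \<tau> i \<otimes> (\<tau> (Suc i) \<otimes> \<tau> i) = \<tau> (Suc i) \<otimes> (\<tau> i \<otimes> \<tau> (Suc i))"
    and "sorts n f is" "sorts n f js" "P (f :: nat \<Rightarrow> 'b::linorder)"
  shows "list_prod A (map \<tau> is) = list_prod A (map \<tau> js)"
proof -
  have sJ: "set (map \<tau> is) \<subseteq> carrier A" if "sorts n f is" "P f" for f :: "nat \<Rightarrow> 'b" and "is"
    using that
  proof (induct rule: sorts_induct)
    case (Cons i f "is")
    then show ?case using P[OF Cons(5,1,2)] cl by (auto simp: Pi_iff comp_def)
  qed simp
  \<comment> \<open>The induction hypothesis is a premise because the fact is used for both orders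
    of the two first letters.\<close>
  have main: "list_prod A (map \<tau> (i # is)) = list_prod A (map \<tau> (j # js))"
    if IH: "\<And>g is js. \<lbrakk>card (inversions n g) < card (inversions n f); sorts n g is; sorts n g js; P g\<rbrakk>
        \<Longrightarrow> list_prod A (map \<tau> is) = list_prod A (map \<tau> js)"
      and i: "sorts n f (i # is)" and j: "sorts n f (j # js)" and "i < j" and Pf: "P f"
    for f :: "nat \<Rightarrow> 'b" and i j "is" js
  proof -
    from i have i1: "i \<in> {1..<n}" "f (Suc i) < f i" "sorts n (f \<circ> simple_refl i) is"
      by (auto elim: sorts_ConsE)
    from j have j1: "j \<in> {1..<n}" "f (Suc j) < f j" "sorts n (f \<circ> simple_refl j) js"
      by (auto elim: sorts_ConsE)
    note Pi = P[OF Pf i1(1,2)] note Pj = P[OF Pf j1(1,2)]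
    have ci: "card (inversions n (f \<circ> simple_refl i)) < card (inversions n f)"
      and cj: "card (inversions n (f \<circ> simple_refl j)) < card (inversions n f)"
      using card_inversions_descent[of i n f] card_inversions_descent[of j n f] i1 j1 by auto
    show ?thesis
    proof (cases "j = Suc i")
      case False
      then have ij: "Suc i < j" using \<open>i < j\<close> by simp
      \<comment> \<open>Far-apart descents survive each other's swap, so one common continuation
        serves \<open>j # ks\<close> after \<open>i\<close> as well as \<open>i # ks\<close> after
        \<open>j\<close>.\<close>
      obtain ks where ks: "sorts n (f \<circ> simple_refl i \<circ> simple_refl j) ks"
        using sorts_exists by blast
      have a: "sorts n (f \<circ> simple_refl i) (j # ks)"
        using ks j1 ij by - (rule sorts.Cons, auto simp: simple_refl_other)
      have b: "sorts n (f \<circ> simple_refl j) (i # ks)"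
        using ks i1 ij
        by - (rule sorts.Cons, auto simp: simple_refl_other comp_assoc simple_refl_far[of i j])
      have P2: "P (f \<circ> simple_refl i \<circ> simple_refl j)"
        using P[of "f \<circ> simple_refl i" j] Pi j1 ij by (simp add: simple_refl_other)
      note k = sJ[OF ks P2]
      have "list_prod A (map \<tau> (i # is)) = \<tau> i \<otimes> (\<tau> j \<otimes> list_prod A (map \<tau> ks))"
        using IH[OF ci i1(3) a] Pi by simp
      also have "\<dots> = \<tau> j \<otimes> (\<tau> i \<otimes> list_prod A (map \<tau> ks))"
        using k cl Pi Pj ij by (intro comm_left far list_prod_closed) auto
      also have "\<dots> = list_prod A (map \<tau> (j # js))"
        using IH[OF cj j1(3) b] Pj by simp
      finally show ?thesis .
    next
      case True
      \<comment> \<open>Neighbouring descents mean three strictly decreasing values.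
        \<open>?f\<close> reverses them by the longest element on three positions, which is reached
        along both sides of the braid relation.\<close>
      let ?f = "f \<circ> simple_refl i \<circ> simple_refl j \<circ> simple_refl i"
      obtain ks where ks: "sorts n ?f ks"
        using sorts_exists by blast
      have ii: "simple_refl i (Suc (Suc i)) = Suc (Suc i)" "simple_refl (Suc i) i = i"
        by (simp_all add: simple_refl_other)
      have f': "f \<circ> simple_refl j \<circ> simple_refl i \<circ> simple_refl j = ?f"
        using simple_refl_braid[of i] by (simp add: True comp_assoc)
      have "f (Suc (Suc i)) < f (Suc i)" "f (Suc (Suc i)) < f i" using i1 j1 True by auto
      note lt = this i1(2)
      have a': "sorts n (f \<circ> simple_refl i \<circ> simple_refl j) (i # ks)"
        using ks i1(1) lt True by - (rule sorts.Cons, auto simp: ii)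
      have a: "sorts n (f \<circ> simple_refl i) (j # i # ks)"
        using a' j1(1) lt True by - (rule sorts.Cons, auto simp: ii)
      have b': "sorts n (f \<circ> simple_refl j \<circ> simple_refl i) (j # ks)"
        using ks j1(1) lt True f' by - (rule sorts.Cons, auto simp: ii)
      have b: "sorts n (f \<circ> simple_refl j) (i # j # ks)"
        using b' i1(1) lt True by - (rule sorts.Cons, auto simp: ii)
      have P2: "P (f \<circ> simple_refl i \<circ> simple_refl j)"
        using P[of "f \<circ> simple_refl i" j] Pi j1(1) lt True by (simp add: ii)
      have P3: "P ?f"
        using P[OF P2, of i] i1(1) lt True by (simp add: ii)
      have k: "list_prod A (map \<tau> ks) \<in> carrier A"
        using sJ[OF ks P3] by (rule list_prod_closed)
      have t: "\<tau> i \<in> carrier A" "\<tau> j \<in> carrier A" using cl Pi Pj by auto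
      have br: "\<tau> i \<otimes> (\<tau> j \<otimes> \<tau> i) = \<tau> j \<otimes> (\<tau> i \<otimes> \<tau> j)"
        using braid[of i] Pi Pj True by simp
      have "list_prod A (map \<tau> (i # is)) = \<tau> i \<otimes> (\<tau> j \<otimes> (\<tau> i \<otimes> list_prod A (map \<tau> ks)))"
        using IH[OF ci i1(3) a] Pi by simp
      also have "\<dots> = \<tau> i \<otimes> (\<tau> j \<otimes> \<tau> i) \<otimes> list_prod A (map \<tau> ks)"
        using t k by (simp add: m_assoc)
      also have "\<dots> = \<tau> j \<otimes> (\<tau> i \<otimes> (\<tau> j \<otimes> list_prod A (map \<tau> ks)))"
        unfolding br using t k by (simp add: m_assoc)
      also have "\<dots> = list_prod A (map \<tau> (j # js))"
        using IH[OF cj j1(3) b] Pj by simp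
      finally show ?thesis .
    qed
  qed
  show ?thesis
    using assms(5-7)
  proof (induct "card (inversions n f)" arbitrary: f "is" js rule: less_induct)
    case less
    note IH = less(1)
    have len: "length is = length js"
      using sorts_length[OF less(2)] sorts_length[OF less(3)] by simp
    show ?case
    proof (cases "is")
      case (Cons i is')
      then obtain j js' where js: "js = j # js'" using len by (cases js) auto
      consider "i < j" | "i = j" | "j < i" by linarith
      then show ?thesis
      proof cases
        case 1
        then show ?thesis using main[of f i is' j js'] IH less(2-4) Cons js by metis
      next
        case 2
        have i: "i \<in> {1..<n}" "f (Suc i) < f i" "sorts n (f \<circ> simple_refl i) is'"
          "sorts n (f \<circ> simple_refl i) js'"
          using less(2,3) Cons js 2 by (auto elim: sorts_ConsE)
        show ?thesis
          using IH[OF _ i(3,4)] card_inversions_descent[of i n f] i P[OF less(4) i(1,2)] Cons js 2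
          by simp
      next
        case 3
        then show ?thesis using main[of f j js' i is'] IH less(2-4) Cons js by metis
      qed
    qed (use len in simp)
  qed
qed

subsection \<open>Ranks of coloured positions\<close>

text \<open>The order behind stable sorting: ties between colours are broken by position.\<close>

definition key_less :: "(nat \<Rightarrow> nat) \<Rightarrow> nat \<Rightarrow> nat \<Rightarrow> bool" where
  "key_less \<kappa> i j \<longleftrightarrow> \<kappa> i < \<kappa> j \<or> \<kappa> i = \<kappa> j \<and> i < j"

text \<open>The place of \<open>j\<close> after stable sorting by \<open>\<kappa>\<close>, counted
  from 1 because \<open>j\<close> itself belongs to the set. Outside \<open>{1..n}\<close> it is the
  identity, as \<open>permutes\<close> demands.\<close>

definition rank :: "nat \<Rightarrow> (nat \<Rightarrow> nat) \<Rightarrow> nat \<Rightarrow> nat" where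
  "rank n \<kappa> j = (if j \<in> {1..n} then card {i \<in> {1..n}. key_less \<kappa> i j \<or> i = j} else j)"

lemma rank_less:
  assumes "i \<in> {1..n}" "j \<in> {1..n}" "key_less \<kappa> i j"
  shows "rank n \<kappa> i < rank n \<kappa> j"
proof -
  have "{k \<in> {1..n}. key_less \<kappa> k i \<or> k = i} \<subset> {k \<in> {1..n}. key_less \<kappa> k j \<or> k = j}"
    using assms by (auto simp: key_less_def)
  then show ?thesis
    using assms by (simp add: rank_def psubset_card_mono)
qed

lemma rank_permutes: "rank n \<kappa> permutes {1..n}"
proof (rule bij_imp_permutes)
  have inj: "inj_on (rank n \<kappa>) {1..n}"
  proof (rule inj_onI, rule ccontr)
    fix i j assume ij: "i \<in> {1..n}" "j \<in> {1..n}" "rank n \<kappa> i = rank n \<kappa> j" "i \<noteq> j"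
    then have "key_less \<kappa> i j \<or> key_less \<kappa> j i" by (auto simp: key_less_def)
    then show False using rank_less[of i n j \<kappa>] rank_less[of j n i \<kappa>] ij by auto
  qed
  have "rank n \<kappa> j \<in> {1..n}" if "j \<in> {1..n}" for j
  proof -
    define S where "S = {i \<in> {1..n}. key_less \<kappa> i j \<or> i = j}"
    have "S \<noteq> {}" "finite S" using that by (auto simp: S_def)
    then have "card S > 0" by (simp add: card_gt_0_iff)
    moreover have "card S \<le> card {1..n}" unfolding S_def by (rule card_mono) auto
    moreover have "rank n \<kappa> j = card S" using that by (simp add: rank_def S_def)
    ultimately show ?thesis by auto
  qed
  then have "rank n \<kappa> ` {1..n} \<subseteq> {1..n}" by blast
  with inj show "bij_betw (rank n \<kappa>) {1..n} {1..n}"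
    by (simp add: bij_betw_def endo_inj_surj)
qed (auto simp: rank_def)

lemma rank_in: "rank n \<kappa> j \<in> {1..n} \<longleftrightarrow> j \<in> {1..n}"
  by (rule permutes_in_image[OF rank_permutes])

text \<open>A permutation increasing along the key order sends each \<open>j\<close> to the number
  of elements not above it. Identities between ranks are proved below by exhibiting such a
  permutation.\<close>

lemma rank_unique:
  assumes f: "f permutes {1..n}"
    and mono: "\<And>i j. \<lbrakk>i \<in> {1..n}; j \<in> {1..n}; key_less \<kappa> i j\<rbrakk> \<Longrightarrow> f i < f j"
  shows "f = rank n \<kappa>"
proof
  fix j show "f j = rank n \<kappa> j"
  proof (cases "j \<in> {1..n}")
    case True
    then have fj: "f j \<in> {1..n}" using permutes_in_image[OF f] by blast
    have "{i \<in> {1..n}. key_less \<kappa> i j \<or> i = j} = {i \<in> {1..n}. f i \<le> f j}" (is "?L = ?R")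
    proof (intro equalityI subsetI)
      fix i assume "i \<in> ?L" then show "i \<in> ?R" using mono[of i j] True by auto
    next
      fix i assume i: "i \<in> ?R"
      have "key_less \<kappa> i j \<or> i = j \<or> key_less \<kappa> j i" by (auto simp: key_less_def)
      then show "i \<in> ?L" using mono[of j i] True i by auto
    qed
    moreover have "f ` ?R = {1..f j}"
    proof (intro equalityI subsetI)
      fix k assume "k \<in> f ` ?R" then show "k \<in> {1..f j}"
        using permutes_in_image[OF f] by force
    next
      fix k assume k: "k \<in> {1..f j}"
      then have "k \<in> {1..n}" using fj by auto
      then have "k \<in> f ` {1..n}" using permutes_image[OF f] by simp
      then show "k \<in> f ` ?R" using k by auto
    qed
    moreover have "card (f ` ?R) = card ?R"
      using permutes_inj[OF f] by (intro card_image) (auto intro: inj_on_subset)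
    ultimately show ?thesis using True by (simp add: rank_def)
  next
    case False
    then show ?thesis using permutes_not_in[OF f, of j] by (auto simp: rank_def)
  qed
qed

lemma rank_sorted:
  assumes "\<And>i. i \<in> {1..<n} \<Longrightarrow> \<kappa> i \<le> \<kappa> (Suc i)"
  shows "rank n \<kappa> = id"
proof (rule rank_unique[symmetric])
  fix i j assume ij: "i \<in> {1..n}" "j \<in> {1..n}" "key_less \<kappa> i j"
  show "id i < id j"
  proof (rule ccontr)
    assume "\<not> id i < id j"
    then have "\<kappa> j \<le> \<kappa> i" using sorted_nat_mono[of n \<kappa> j i] assms ij by simp
    then show False using ij \<open>\<not> id i < id j\<close> by (auto simp: key_less_def)
  qed
qed (rule permutes_id)

text \<open>For a constant colouring the key order is the order of positions, so the uniqueness of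
  ranks applies.\<close>

lemma sorted_permutes_id:
  assumes "f permutes {1..n}" "\<And>i. i \<in> {1..<n} \<Longrightarrow> f i \<le> f (Suc i)"
  shows "f = id"
proof -
  have "f = rank n (\<lambda>_. 0)"
  proof (rule rank_unique[OF assms(1)])
    fix i j assume ij: "i \<in> {1..n}" "j \<in> {1..n}" "key_less (\<lambda>_. 0) i j"
    then have "f i \<le> f j" "f i \<noteq> f j"
      using sorted_nat_mono[of n f i j] assms(2) permutes_inj[OF assms(1)]
      by (auto simp: key_less_def dest: injD)
    then show "f i < f j" by simp
  qed
  then show ?thesis using rank_sorted[of n "\<lambda>_. 0"] by simp
qed

text \<open>The swap could disturb stable sorting only through the pair \<open>(i, Suc i)\<close>,
  and the order of that pair is decided by the colours rather than by the positions.\<close>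

lemma rank_swap:
  assumes "i \<in> {1..<n}" "\<kappa> i \<noteq> \<kappa> (Suc i)"
  shows "rank n (\<kappa> \<circ> simple_refl i) = rank n \<kappa> \<circ> simple_refl i"
proof (rule rank_unique[symmetric])
  show "rank n \<kappa> \<circ> simple_refl i permutes {1..n}"
    by (intro permutes_compose simple_refl_permutes rank_permutes assms)
  fix p q assume pq: "p \<in> {1..n}" "q \<in> {1..n}" "key_less (\<kappa> \<circ> simple_refl i) p q"
  then have "key_less \<kappa> (simple_refl i p) (simple_refl i q)"
    using assms(2) simple_refl_less[of p q i]
    by (cases "(p, q) = (i, Suc i)") (auto simp: key_less_def)
  then show "(rank n \<kappa> \<circ> simple_refl i) p < (rank n \<kappa> \<circ> simple_refl i) q"
    using pq simple_refl_in[OF assms(1)] by (auto intro!: rank_less simp del: atLeastAtMost_iff)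
qed

text \<open>No key lies strictly between those of two neighbours of one colour, so they stay
  neighbours after sorting. Hence a simple reflection inside a colour class becomes a simple
  reflection of sorted places.\<close>

lemma rank_Suc:
  assumes "i \<in> {1..<n}" "\<kappa> i = \<kappa> (Suc i)"
  shows "rank n \<kappa> (Suc i) = Suc (rank n \<kappa> i)"
proof -
  have "{k \<in> {1..n}. key_less \<kappa> k (Suc i) \<or> k = Suc i} =
      insert (Suc i) {k \<in> {1..n}. key_less \<kappa> k i \<or> k = i}"
    using assms by (auto simp: key_less_def)
  moreover have "Suc i \<notin> {k \<in> {1..n}. key_less \<kappa> k i \<or> k = i}"
    using assms by (auto simp: key_less_def)
  ultimately show ?thesis using assms by (simp add: rank_def)
qed

lemma rank_inj [simp]: "rank n \<kappa> i = rank n \<kappa> j \<longleftrightarrow> i = j"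
  using permutes_inj[OF rank_permutes] by (auto dest: injD)

subsection \<open>Reduced words\<close>

lemma word_perm_simps [simp]:
  "word_perm [] = id" "word_perm (i # is) = simple_refl i \<circ> word_perm is"
  by (simp_all add: word_perm_def)

lemma word_perm_permutes: "set is \<subseteq> {1..<n} \<Longrightarrow> word_perm is permutes {1..n}"
  by (induct "is") (auto intro!: permutes_compose simple_refl_permutes permutes_id)

text \<open>Removing descents multiplies \<open>f\<close> by the letters until the identity is
  reached, so the product of the letters is the inverse of \<open>f\<close>.\<close>

lemma sorts_word_perm:
  assumes "sorts n f is" "f permutes {1..n}"
  shows "word_perm is = inv_into UNIV f"
  using assms
proof (induct rule: sorts_induct)
  case (Nil f)
  then show ?case using sorted_permutes_id[of f n] by simp
next
  case (Cons i f "is")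
  have "inv_into UNIV (f \<circ> simple_refl i) = simple_refl i \<circ> inv_into UNIV f"
    using permutes_bij[OF Cons(5)] by (simp add: o_inv_distrib)
  moreover have "f \<circ> simple_refl i permutes {1..n}"
    by (intro permutes_compose simple_refl_permutes Cons)
  ultimately have "word_perm is = simple_refl i \<circ> inv_into UNIV f"
    using Cons(4) by (simp add: comp_def)
  then show ?case by (simp flip: comp_assoc)
qed

lemma inv_word_perm_Cons: "set is \<subseteq> {1..<n} \<Longrightarrow>
    inv_into UNIV (word_perm (i # is)) \<circ> simple_refl i = inv_into UNIV (word_perm is)"
  using permutes_bij[OF word_perm_permutes, of "is" n]
  by (simp add: o_inv_distrib)

text \<open>A letter changes the number of inversions by exactly one, up or down. Equality in the
  bound leaves no room for a wasted letter, so each one removes a descent.\<close>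

lemma word_inversions:
  assumes "set is \<subseteq> {1..<n}"
  shows "card (inversions n (inv_into UNIV (word_perm is))) \<le> length is"
    "card (inversions n (inv_into UNIV (word_perm is))) = length is \<Longrightarrow> sorts n (inv_into UNIV (word_perm is)) is"
  using assms
proof (induct "is")
  case Nil
  {
    case 1
    have "inversions n (inv_into UNIV (word_perm [])) = {}" by (auto simp: inversions_def)
    then show ?case by (metis card.empty le0)
  next
    case 2
    then show ?case by (auto intro: sorts.Nil)
  }
next
  case (Cons i "is")
  let ?f = "inv_into UNIV (word_perm (i # is))"
  {
    assume s: "set (i # is) \<subseteq> {1..<n}"
    have "inj ?f"
      using permutes_inj[OF permutes_inv[OF word_perm_permutes[OF s]]] .
    then have "?f (Suc i) \<noteq> ?f i" using injD[of ?f "Suc i" i] by linarith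
    have i: "i \<in> {1..<n}" and s': "set is \<subseteq> {1..<n}" using s by auto
    define g where "g = inv_into UNIV (word_perm is)"
    have g: "?f \<circ> simple_refl i = g"
      unfolding g_def by (rule inv_word_perm_Cons[OF s'])
    note IH = Cons(1)[OF s', folded g_def] Cons(2)[OF _ s', folded g_def]
    note sw = card_inversions_swap[of i n ?f, OF i \<open>?f (Suc i) \<noteq> ?f i\<close>, unfolded g]
    show "card (inversions n ?f) \<le> length (i # is)"
      using sw IH(1) by (simp only: list.size split: if_splits)
    assume len: "card (inversions n ?f) = length (i # is)"
    have "?f (Suc i) < ?f i \<and> card (inversions n g) = length is"
    proof (cases "?f (Suc i) < ?f i")
      case True
      then have "card (inversions n ?f) = Suc (card (inversions n g))"
        using sw by (simp only: if_True)
      then show ?thesis using len True by (metis length_Cons nat.inject)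
    next
      case False
      then have "card (inversions n g) = Suc (card (inversions n ?f))"
        using sw by (simp only: if_False)
      then show ?thesis using len IH(1) by (metis length_Cons Suc_n_not_le_n Suc_leD)
    qed
    then show "sorts n ?f (i # is)"
      using i g IH(2) by (simp only: sorts.Cons)
  }
qed

lemma perm_length_eq:
  assumes "w permutes {1..n}"
  shows "perm_length n w = card (inversions n (inv_into UNIV w))"
proof -
  obtain "is" where "is": "sorts n (inv_into UNIV w) is" using sorts_exists by blast
  have "word_perm is = w" "length is = card (inversions n (inv_into UNIV w))" "set is \<subseteq> {1..<n}"
    using sorts_word_perm[OF "is" permutes_inv[OF assms]] sorts_length[OF "is"] sorts_set[OF "is"]
      assms by (auto simp: permutes_inv_inv)
  moreover have "card (inversions n (inv_into UNIV w)) \<le> length js"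
    if "js \<in> lists {1..<n}" "word_perm js = w" for js
    using word_inversions(1)[of js n] that by auto
  ultimately show ?thesis
    unfolding perm_length_def by (intro Least_equality) auto
qed

text \<open>The word comes from a choice operator, so only its minimality is known; by the equality
  case of the inversion bound this already makes it a sorting word. All later statements about g_w
  rest on this.\<close>

lemma sorts_reduced_word:
  assumes "w permutes {1..n}"
  shows "sorts n (inv_into UNIV w) (reduced_word n w)"
proof -
  obtain "is" where "is": "sorts n (inv_into UNIV w) is" using sorts_exists by blast
  have "word_perm is = w" "length is = perm_length n w" "set is \<subseteq> {1..<n}"
    using sorts_word_perm[OF "is" permutes_inv[OF assms]] sorts_length[OF "is"] sorts_set[OF "is"]
      assms by (auto simp: permutes_inv_inv perm_length_eq)
  then have "\<exists>is. is \<in> lists {1..<n} \<and> word_perm is = w \<and> length is = perm_length n w"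
    by (intro exI[of _ "is"]) (simp add: in_lists_conv_set subset_iff)
  then have "reduced_word n w \<in> lists {1..<n} \<and> word_perm (reduced_word n w) = w \<and>
      length (reduced_word n w) = perm_length n w"
    unfolding reduced_word_def by (rule someI_ex)
  then have r: "set (reduced_word n w) \<subseteq> {1..<n}" "word_perm (reduced_word n w) = w"
      "length (reduced_word n w) = perm_length n w"
    by (simp_all add: in_lists_conv_set subset_iff)
  have "sorts n (inv_into UNIV (word_perm (reduced_word n w))) (reduced_word n w)"
    by (rule word_inversions(2)[OF r(1)]) (simp only: r perm_length_eq[OF assms])
  then show ?thesis by (simp only: r)
qed

lemma length_reduced_word: "w permutes {1..n} \<Longrightarrow> length (reduced_word n w) = perm_length n w"
  using sorts_length[OF sorts_reduced_word] perm_length_eq by metis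

text \<open>The part of a word that survives in the Hecke algebra of the colour classes. Letters
  exchanging different colours drop out and will contribute a scalar \<open>u\<close>; the others
  become simple reflections of sorted places, by \<open>rank_Suc\<close>.\<close>

fun colour_word :: "nat \<Rightarrow> (nat \<Rightarrow> nat) \<Rightarrow> nat list \<Rightarrow> nat list" where
  "colour_word n \<kappa> [] = []"
| "colour_word n \<kappa> (i # is) =
     (if \<kappa> i = \<kappa> (Suc i) then rank n \<kappa> i # colour_word n \<kappa> is
      else colour_word n (\<kappa> \<circ> simple_refl i) is)"

text \<open>Sorting on both sides turns \<open>f\<close> into a permutation of sorted places that
  respects colours. Dropped letters are absorbed by the change of \<open>rank\<close>, recorded
  letters remain descents; so what survives is again reduced, and its length is known.\<close>

lemma sorts_colour_word:
  assumes "sorts n f is" "f permutes {1..n}" "\<kappa>' \<circ> f = \<kappa>"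
  shows "sorts n (rank n \<kappa>' \<circ> f \<circ> inv_into UNIV (rank n \<kappa>)) (colour_word n \<kappa> is)"
  using assms
proof (induct arbitrary: \<kappa> rule: sorts_induct)
  case (Nil f)
  then have "f = id" using sorted_permutes_id by blast
  then have "rank n \<kappa>' \<circ> f \<circ> inv_into UNIV (rank n \<kappa>) = id"
    using Nil permutes_inv_o(1)[OF rank_permutes] by simp
  then show ?case
    unfolding colour_word.simps by (simp only:) (rule sorts.Nil, simp)
next
  case (Cons i f "is")
  let ?r = "rank n \<kappa>"
  have b: "bij ?r" using permutes_bij[OF rank_permutes] .
  have fs: "f \<circ> simple_refl i permutes {1..n}"
    by (intro permutes_compose simple_refl_permutes Cons)
  show ?case
  proof (cases "\<kappa> i = \<kappa> (Suc i)")
    case False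
    have eq: "rank n (\<kappa> \<circ> simple_refl i) = ?r \<circ> simple_refl i"
      using False Cons by (intro rank_swap) auto
    have "inv_into UNIV (?r \<circ> simple_refl i) = simple_refl i \<circ> inv_into UNIV ?r"
      using b by (simp add: o_inv_distrib)
    then have "rank n \<kappa>' \<circ> (f \<circ> simple_refl i) \<circ> inv_into UNIV (rank n (\<kappa> \<circ> simple_refl i)) =
        rank n \<kappa>' \<circ> f \<circ> inv_into UNIV ?r"
      unfolding eq by (simp add: fun_eq_iff)
    moreover have "sorts n (rank n \<kappa>' \<circ> (f \<circ> simple_refl i) \<circ> inv_into UNIV (rank n (\<kappa> \<circ> simple_refl i)))
        (colour_word n (\<kappa> \<circ> simple_refl i) is)"
      by (rule Cons(4)[OF fs]) (use Cons(6) in auto)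
    ultimately show ?thesis
      using False by (simp only: colour_word.simps if_False)
  next
    case True
    have \<kappa>: "\<kappa> \<circ> simple_refl i = \<kappa>"
      using True by (auto simp: fun_eq_iff simple_refl_def transpose_def)
    let ?F = "rank n \<kappa>' \<circ> f \<circ> inv_into UNIV ?r" and ?k = "rank n \<kappa> i"
    have Suc_k: "Suc ?k = ?r (Suc i)" using rank_Suc[OF Cons(1) True] by simp
    have inv_r: "inv_into UNIV ?r (?r j) = j" for j
      using b by (simp add: bij_is_inj)
    \<comment> \<open>Conjugation by the rank function carries the swap of \<open>i\<close> and
      \<open>Suc i\<close> to the swap of their ranks, which are consecutive.\<close>
    have "simple_refl ?k = ?r \<circ> simple_refl i \<circ> inv_into UNIV ?r"
    proof
      fix x
      obtain y where y: "x = ?r y" using b by (metis bij_pointE)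
      show "simple_refl ?k x = (?r \<circ> simple_refl i \<circ> inv_into UNIV ?r) x"
        unfolding y using Suc_k by (auto simp: inv_r simple_refl_def transpose_def)
    qed
    then have conj: "inv_into UNIV ?r \<circ> simple_refl ?k = simple_refl i \<circ> inv_into UNIV ?r"
      by (simp add: fun_eq_iff inv_r)
    have "sorts n (?F \<circ> simple_refl ?k) (colour_word n \<kappa> is)"
    proof -
      have "sorts n (rank n \<kappa>' \<circ> (f \<circ> simple_refl i) \<circ> inv_into UNIV (rank n \<kappa>)) (colour_word n \<kappa> is)"
        by (rule Cons(4)[OF fs]) (use Cons(6) \<kappa> in \<open>auto simp: fun_eq_iff\<close>)
      moreover have "rank n \<kappa>' \<circ> (f \<circ> simple_refl i) \<circ> inv_into UNIV (rank n \<kappa>) = ?F \<circ> simple_refl ?k"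
        unfolding comp_assoc conj ..
      ultimately show ?thesis by (simp only:)
    qed
    \<comment> \<open>The two values of \<open>f\<close> have the same colour under
      \<open>\<kappa>'\<close>, so their ranks are ordered as the values themselves and the descent
      survives.\<close>
    moreover have "?F (Suc ?k) < ?F ?k"
    proof -
      have "f i \<in> {1..n}" "f (Suc i) \<in> {1..n}"
        using Cons(1) permutes_in_image[OF Cons(5)] by auto
      moreover have "\<kappa>' (f i) = \<kappa>' (f (Suc i))" using True Cons(6) by auto
      ultimately have "rank n \<kappa>' (f (Suc i)) < rank n \<kappa>' (f i)"
        using Cons(2) by (intro rank_less) (auto simp: key_less_def)
      then show ?thesis by (simp add: Suc_k inv_r)
    qed
    moreover have "?k \<in> {1..<n}"
      using rank_in[of n \<kappa> i] rank_in[of n \<kappa> "Suc i"] Cons(1) Suc_k by auto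
    ultimately have "sorts n ?F (?k # colour_word n \<kappa> is)"
      using sorts.Cons by blast
    then show ?thesis
      unfolding colour_word.simps if_P[OF True] .
  qed
qed

section \<open>Compositions and characters\<close>

text \<open>The last letter before block \<open>a\<close>, so that the letters of the block are
  \<open>cum \<mu> a + k\<close> with \<open>1 \<le> k \<le> \<mu> a\<close>.\<close>

definition cum :: "(nat \<Rightarrow> nat) \<Rightarrow> nat \<Rightarrow> nat" where
  "cum \<mu> a = (\<Sum>b=1..<a. \<mu> b)"

lemma cum_add: "1 \<le> a \<Longrightarrow> cum \<mu> a + \<mu> a = (\<Sum>b=1..a. \<mu> b)"
  by (cases a) (simp_all add: cum_def atLeastLessThanSuc_atLeastAtMost sum.cl_ivl_Suc)

lemma sum_le_cum: "b < a \<Longrightarrow> (\<Sum>i=1..b. \<mu> i) \<le> cum \<mu> a" for \<mu> :: "nat \<Rightarrow> nat"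
  unfolding cum_def by (rule sum_mono2) auto

lemma block_cum:
  assumes "1 \<le> a" "1 \<le> k" "k \<le> \<mu> a"
  shows "block \<mu> (cum \<mu> a + k) = a" "block_pos \<mu> (cum \<mu> a + k) = k"
proof -
  show *: "block \<mu> (cum \<mu> a + k) = a"
    unfolding block_def
  proof (rule Least_equality)
    show "cum \<mu> a + k \<le> (\<Sum>b=1..a. \<mu> b)"
      using assms cum_add[of a \<mu>] by simp
    fix b assume "cum \<mu> a + k \<le> (\<Sum>i=1..b. \<mu> i)"
    then show "a \<le> b"
      using sum_le_cum[of b a \<mu>] assms(2) by (cases "b < a") auto
  qed
  show "block_pos \<mu> (cum \<mu> a + k) = k"
    unfolding block_pos_def * by (simp add: cum_def)
qed

lemma cum_cases:
  assumes "\<mu> \<in> compositions d n" "p \<in> {1..n}"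
  obtains a k where "a \<in> {1..d}" "k \<in> {1..\<mu> a}" "p = cum \<mu> a + k"
proof -
  have n: "n = (\<Sum>b=1..d. \<mu> b)" using assms(1) by (simp add: compositions_def)
  define a where "a = block \<mu> p"
  have p: "p \<le> (\<Sum>b=1..a. \<mu> b)"
    unfolding a_def block_def by (rule LeastI[of _ d]) (use assms(2) n in simp)
  have "a \<le> d"
    unfolding a_def block_def by (rule Least_le) (use assms(2) n in simp)
  have "a \<noteq> 0" using p assms(2) by (cases a) auto
  then obtain a' where a': "a = Suc a'" by (cases a) auto
  have "\<not> p \<le> (\<Sum>b=1..a'. \<mu> b)"
    using not_less_Least[of a' "\<lambda>a. p \<le> (\<Sum>b=1..a. \<mu> b)"] a' unfolding a_def block_def by simp
  moreover have "cum \<mu> a = (\<Sum>b=1..a'. \<mu> b)"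
    unfolding cum_def a' by (simp add: atLeastLessThanSuc_atLeastAtMost)
  ultimately have "cum \<mu> a < p" by simp
  moreover have "p \<le> cum \<mu> a + \<mu> a" using p a' cum_add[of a \<mu>] by simp
  ultimately have "p - cum \<mu> a \<in> {1..\<mu> a}" "p = cum \<mu> a + (p - cum \<mu> a)" by auto
  then show ?thesis
    using that[of a "p - cum \<mu> a"] \<open>a \<le> d\<close> a' by simp
qed

lemma cum_bound:
  assumes "\<mu> \<in> compositions d n" "a \<in> {1..d}"
  shows "cum \<mu> a + \<mu> a \<le> n"
proof -
  have "(\<Sum>b=1..a. \<mu> b) \<le> (\<Sum>b=1..d. \<mu> b)"
    by (rule sum_mono2) (use assms(2) in auto)
  then show ?thesis
    using assms cum_add[of a \<mu>] by (simp add: compositions_def)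
qed

lemma cum_mono: "a < b \<Longrightarrow> 1 \<le> a \<Longrightarrow> cum \<mu> a + \<mu> a \<le> cum \<mu> b"
  using sum_le_cum[of a b \<mu>] cum_add[of a \<mu>] by simp

lemma block_in: "\<mu> \<in> compositions d n \<Longrightarrow> p \<in> {1..n} \<Longrightarrow> block \<mu> p \<in> {1..d}"
  by (erule (1) cum_cases) (auto simp: block_cum)

lemma block_pos_in: "\<mu> \<in> compositions d n \<Longrightarrow> p \<in> {1..n} \<Longrightarrow> block_pos \<mu> p \<in> {1..\<mu> (block \<mu> p)}"
  by (erule (1) cum_cases) (auto simp: block_cum)

lemma cum_block: "\<mu> \<in> compositions d n \<Longrightarrow> p \<in> {1..n} \<Longrightarrow> cum \<mu> (block \<mu> p) + block_pos \<mu> p = p"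
  by (erule (1) cum_cases) (auto simp: block_cum)

lemma block_mono:
  assumes "\<mu> \<in> compositions d n" "p \<in> {1..n}" "q \<in> {1..n}" "p \<le> q"
  shows "block \<mu> p \<le> block \<mu> q"
proof (rule ccontr)
  assume "\<not> block \<mu> p \<le> block \<mu> q"
  then have "cum \<mu> (block \<mu> q) + \<mu> (block \<mu> q) \<le> cum \<mu> (block \<mu> p)"
    using block_in[OF assms(1,3)] by (intro cum_mono) auto
  then show False
    using cum_block[OF assms(1,2)] cum_block[OF assms(1,3)] block_pos_in[OF assms(1,2)]
      block_pos_in[OF assms(1,3)] assms(4) by auto
qed

text \<open>The simple reflections that generate the Young subgroup of \<open>\<mu>\<close>.\<close>

definition young :: "nat \<Rightarrow> (nat \<Rightarrow> nat) \<Rightarrow> nat set" where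
  "young n \<mu> = {p \<in> {1..<n}. block \<mu> p = block \<mu> (Suc p)}"

lemma young_block_pos:
  assumes "\<mu> \<in> compositions d n" "p \<in> young n \<mu>"
  shows "block_pos \<mu> (Suc p) = Suc (block_pos \<mu> p)" "block_pos \<mu> p \<in> {1..<\<mu> (block \<mu> p)}"
    "block \<mu> (Suc p) = block \<mu> p"
proof -
  have p: "p \<in> {1..n}" "Suc p \<in> {1..n}" "block \<mu> (Suc p) = block \<mu> p"
    using assms(2) by (auto simp: young_def)
  then show *: "block_pos \<mu> (Suc p) = Suc (block_pos \<mu> p)"
    using cum_block[OF assms(1) p(1)] cum_block[OF assms(1) p(2)] by simp
  show "block_pos \<mu> p \<in> {1..<\<mu> (block \<mu> p)}"
    using block_pos_in[OF assms(1) p(1)] block_pos_in[OF assms(1) p(2)] p * by auto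
  show "block \<mu> (Suc p) = block \<mu> p" by fact
qed

lemma cum_young:
  assumes "\<mu> \<in> compositions d n" "a \<in> {1..d}" "k \<in> {1..<\<mu> a}"
  shows "cum \<mu> a + k \<in> young n \<mu>"
  using assms block_cum(1)[of a k \<mu>] block_cum(1)[of a "Suc k" \<mu>] cum_bound[OF assms(1,2)]
  by (auto simp: young_def)

section \<open>Characters as colourings, and the minimal permutations that sort them\<close>

locale root_enumeration =
  fixes d n :: nat and \<xi> :: "nat \<Rightarrow> complex"
  assumes d: "d \<ge> 1" and n: "n \<ge> 1" and \<xi>: "bij_betw \<xi> {1..d} {z. z ^ d = 1}"
begin

text \<open>Passing from roots of unity to their indices supplies the linear order that sorting
  needs.\<close>

definition colour :: "(nat \<Rightarrow> complex) \<Rightarrow> nat \<Rightarrow> nat" where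
  "colour \<chi> = (\<lambda>j. inv_into {1..d} \<xi> (\<chi> j))"

abbreviation "Irr \<equiv> Irr_T d n"

abbreviation "comp_of \<equiv> Comp d n \<xi>"

lemma Irr_root: "\<chi> \<in> Irr \<Longrightarrow> j \<in> {1..n} \<Longrightarrow> \<chi> j ^ d = 1"
  by (auto simp: Irr_T_def)

lemma Irr_nonzero: "\<chi> \<in> Irr \<Longrightarrow> j \<in> {1..n} \<Longrightarrow> \<chi> j \<noteq> 0"
  using Irr_root[of \<chi> j] d by (auto simp: power_0_left)

lemma colour_in: "\<chi> \<in> Irr \<Longrightarrow> j \<in> {1..n} \<Longrightarrow> colour \<chi> j \<in> {1..d}"
  unfolding colour_def using Irr_root[of \<chi> j] bij_betw_imp_surj_on[OF \<xi>]
  by (intro inv_into_into) auto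

lemma \<xi>_colour: "\<chi> \<in> Irr \<Longrightarrow> j \<in> {1..n} \<Longrightarrow> \<xi> (colour \<chi> j) = \<chi> j"
  unfolding colour_def using Irr_root[of \<chi> j] bij_betw_imp_surj_on[OF \<xi>]
  by (intro f_inv_into_f) auto

lemma colour_eq_iff: "\<lbrakk>\<chi> \<in> Irr; i \<in> {1..n}; j \<in> {1..n}\<rbrakk> \<Longrightarrow> colour \<chi> i = colour \<chi> j \<longleftrightarrow> \<chi> i = \<chi> j"
  by (metis \<xi>_colour colour_def)

lemma colour_\<xi>: "a \<in> {1..d} \<Longrightarrow> inv_into {1..d} \<xi> (\<xi> a) = a"
  using bij_betw_imp_inj_on[OF \<xi>] by simp

lemma finite_Irr: "finite Irr"
proof -
  have "finite {z::complex. z ^ d = 1}" using bij_betw_finite[OF \<xi>] by simp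
  then show ?thesis unfolding Irr_T_def by (intro finite_PiE) auto
qed

lemma Comp_eq:
  assumes "\<chi> \<in> Irr" "a \<in> {1..d}"
  shows "comp_of \<chi> a = card {j \<in> {1..n}. colour \<chi> j = a}"
proof -
  have "\<chi> j = \<xi> a \<longleftrightarrow> colour \<chi> j = a" if "j \<in> {1..n}" for j
    using \<xi>_colour[OF assms(1) that] colour_\<xi>[OF assms(2)] by (auto simp: colour_def)
  then have "{j \<in> {1..n}. \<chi> j = \<xi> a} = {j \<in> {1..n}. colour \<chi> j = a}" by blast
  then show ?thesis using assms(2) by (simp add: Comp_def)
qed

lemma sum_Comp:
  assumes "\<chi> \<in> Irr" "a \<le> d"
  shows "(\<Sum>b=1..a. comp_of \<chi> b) = card {j \<in> {1..n}. colour \<chi> j \<le> a}"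
proof -
  have "(\<Sum>b=1..a. comp_of \<chi> b) = (\<Sum>b=1..a. card {j \<in> {1..n}. colour \<chi> j = b})"
    using assms by (intro sum.cong) (auto simp: Comp_eq)
  also have "\<dots> = card (\<Union>b\<in>{1..a}. {j \<in> {1..n}. colour \<chi> j = b})"
    by (rule card_UN_disjoint[symmetric]) auto
  also have "(\<Union>b\<in>{1..a}. {j \<in> {1..n}. colour \<chi> j = b}) = {j \<in> {1..n}. colour \<chi> j \<le> a}"
    using colour_in[OF assms(1)] by auto
  finally show ?thesis .
qed

lemma Comp_compositions:
  assumes "\<chi> \<in> Irr" shows "comp_of \<chi> \<in> compositions d n"
proof -
  have "{j \<in> {1..n}. colour \<chi> j \<le> d} = {1..n}" using colour_in[OF assms] by auto
  then have "(\<Sum>b=1..d. comp_of \<chi> b) = n" using sum_Comp[OF assms, of d] by simp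
  then show ?thesis by (simp add: compositions_def) (simp add: Comp_def)
qed

text \<open>The inverse of \<open>pi_chi\<close>, as \<open>pi_chi_eq\<close> shows; being defined
  by counting, it can be computed with directly.\<close>

definition pos :: "(nat \<Rightarrow> complex) \<Rightarrow> nat \<Rightarrow> nat" where
  "pos \<chi> = rank n (colour \<chi>)"

lemma pos_permutes: "pos \<chi> permutes {1..n}"
  by (simp add: pos_def rank_permutes)

lemma pos_in: "pos \<chi> j \<in> {1..n} \<longleftrightarrow> j \<in> {1..n}"
  by (simp only: pos_def rank_in)

text \<open>The rank of \<open>j\<close> exceeds the number of positions of smaller colour and is at
  most the number of positions of colour up to that of \<open>j\<close>. By \<open>sum_Comp\<close>
  these two counts are the boundaries of the block.\<close>

lemma block_pos_eq:
  assumes "\<chi> \<in> Irr" "j \<in> {1..n}"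
  shows "block (comp_of \<chi>) (pos \<chi> j) = colour \<chi> j"
  unfolding block_def
proof (rule Least_equality)
  have pos: "pos \<chi> j = card {i \<in> {1..n}. key_less (colour \<chi>) i j \<or> i = j}"
    using assms(2) by (simp add: pos_def rank_def)
  show "pos \<chi> j \<le> (\<Sum>b=1..colour \<chi> j. comp_of \<chi> b)"
    using colour_in[OF assms] sum_Comp[OF assms(1), of "colour \<chi> j"]
    by (auto simp: pos key_less_def intro!: card_mono)
  fix a assume a: "pos \<chi> j \<le> (\<Sum>b=1..a. comp_of \<chi> b)"
  show "colour \<chi> j \<le> a"
  proof (rule ccontr)
    assume "\<not> colour \<chi> j \<le> a"
    then have "{i \<in> {1..n}. colour \<chi> i \<le> a} \<subset> {i \<in> {1..n}. key_less (colour \<chi>) i j \<or> i = j}"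
      using assms(2) by (auto simp: key_less_def)
    then have "card {i \<in> {1..n}. colour \<chi> i \<le> a} < pos \<chi> j"
      unfolding pos by (rule psubset_card_mono[rotated]) simp
    then show False
      using a sum_Comp[OF assms(1), of a] \<open>\<not> colour \<chi> j \<le> a\<close> colour_in[OF assms] by simp
  qed
qed

lemma Irr_comp:
  assumes "\<chi> \<in> Irr" "f permutes {1..n}"
  shows "\<chi> \<circ> f \<in> Irr" "comp_of (\<chi> \<circ> f) = comp_of \<chi>" "colour (\<chi> \<circ> f) = colour \<chi> \<circ> f"
proof -
  show "\<chi> \<circ> f \<in> Irr"
    unfolding Irr_T_def
  proof (rule PiE_I)
    fix i assume "i \<in> {1..n}"
    then have "f i \<in> {1..n}" using permutes_in_image[OF assms(2)] by blast
    then show "(\<chi> \<circ> f) i \<in> {z. z ^ d = 1}" using Irr_root[OF assms(1)] by simp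
  next
    fix i assume "i \<notin> {1..n}"
    then show "(\<chi> \<circ> f) i = undefined"
      using permutes_not_in[OF assms(2), of i] assms(1) PiE_arb[of \<chi>] by (simp add: Irr_T_def)
  qed
  have "card {j \<in> {1..n}. \<chi> (f j) = z} = card {j \<in> {1..n}. \<chi> j = z}" for z
  proof -
    have "f ` {j \<in> {1..n}. \<chi> (f j) = z} = {j \<in> {1..n}. \<chi> j = z}"
    proof (intro equalityI subsetI)
      fix y assume "y \<in> {j \<in> {1..n}. \<chi> j = z}"
      then have y: "y \<in> f ` {1..n}" "\<chi> y = z" using permutes_image[OF assms(2)] by auto
      then show "y \<in> f ` {j \<in> {1..n}. \<chi> (f j) = z}" by blast
    next
      fix y assume "y \<in> f ` {j \<in> {1..n}. \<chi> (f j) = z}"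
      then show "y \<in> {j \<in> {1..n}. \<chi> j = z}"
        using permutes_in_image[OF assms(2)] by blast
    qed
    moreover have "inj_on f {j \<in> {1..n}. \<chi> (f j) = z}"
      using permutes_inj[OF assms(2)] by (rule inj_on_subset) simp
    ultimately show ?thesis using card_image[of f "{j \<in> {1..n}. \<chi> (f j) = z}"] by (simp only:)
  qed
  then show "comp_of (\<chi> \<circ> f) = comp_of \<chi>" by (simp add: Comp_def)
  show "colour (\<chi> \<circ> f) = colour \<chi> \<circ> f" by (simp add: colour_def comp_def)
qed

lemmas Irr_swap = Irr_comp[OF _ simple_refl_permutes]

lemma pos_swap:
  assumes "\<chi> \<in> Irr" "i \<in> {1..<n}" "\<chi> i \<noteq> \<chi> (Suc i)"
  shows "pos (\<chi> \<circ> simple_refl i) = pos \<chi> \<circ> simple_refl i"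
proof -
  have "colour \<chi> i \<noteq> colour \<chi> (Suc i)"
    using colour_eq_iff[OF assms(1), of i "Suc i"] assms by simp
  then show ?thesis
    unfolding pos_def Irr_swap(3)[OF assms(1,2)] by (intro rank_swap assms)
qed

lemma pos_Suc:
  assumes "\<chi> \<in> Irr" "i \<in> {1..<n}" "\<chi> i = \<chi> (Suc i)"
  shows "pos \<chi> (Suc i) = Suc (pos \<chi> i)" "pos \<chi> i \<in> young n (comp_of \<chi>)"
proof -
  have c: "colour \<chi> i = colour \<chi> (Suc i)" using assms by (simp add: colour_def)
  show S: "pos \<chi> (Suc i) = Suc (pos \<chi> i)"
    unfolding pos_def by (rule rank_Suc[where \<kappa> = "colour \<chi>"]) (use assms c in auto)
  have "pos \<chi> i \<in> {1..n}" "pos \<chi> (Suc i) \<in> {1..n}"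
    using assms pos_in[of \<chi> i] pos_in[of \<chi> "Suc i"] by auto
  then show "pos \<chi> i \<in> young n (comp_of \<chi>)"
    using block_pos_eq[OF assms(1), of i] block_pos_eq[OF assms(1), of "Suc i"] assms(2) c S
    by (simp add: young_def)
qed

lemma swap_same: "\<chi> i = \<chi> (Suc i) \<Longrightarrow> \<chi> \<circ> simple_refl i = \<chi>"
  by (auto simp: fun_eq_iff simple_refl_def transpose_def)

lemma chi0_Irr:
  assumes "\<mu> \<in> compositions d n"
  shows "chi0 n \<xi> \<mu> \<in> Irr" "\<And>j. j \<in> {1..n} \<Longrightarrow> colour (chi0 n \<xi> \<mu>) j = block \<mu> j"
    "comp_of (chi0 n \<xi> \<mu>) = \<mu>" "pos (chi0 n \<xi> \<mu>) = id"
proof -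
  let ?c = "chi0 n \<xi> \<mu>"
  show I: "?c \<in> Irr"
    using block_in[OF assms] bij_betwE[OF \<xi>] by (auto simp: chi0_def Irr_T_def)
  show col: "colour ?c j = block \<mu> j" if "j \<in> {1..n}" for j
    using that colour_\<xi>[OF block_in[OF assms that]] by (simp add: colour_def chi0_def)
  show "comp_of ?c = \<mu>"
  proof
    fix a
    show "comp_of ?c a = \<mu> a"
    proof (cases "a \<in> {1..d}")
      case True
      have "{j \<in> {1..n}. colour ?c j = a} = (\<lambda>k. cum \<mu> a + k) ` {1..\<mu> a}"
      proof (intro equalityI subsetI)
        fix j assume "j \<in> {j \<in> {1..n}. colour ?c j = a}"
        then have j: "j \<in> {1..n}" "block \<mu> j = a" using col by auto
        show "j \<in> (\<lambda>k. cum \<mu> a + k) ` {1..\<mu> a}"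
          using cum_block[OF assms j(1)] block_pos_in[OF assms j(1)] j(2)
          by (intro image_eqI[of _ _ "block_pos \<mu> j"]) auto
      next
        fix j assume "j \<in> (\<lambda>k. cum \<mu> a + k) ` {1..\<mu> a}"
        then obtain k where k: "k \<in> {1..\<mu> a}" "j = cum \<mu> a + k" by blast
        then have "j \<in> {1..n}" "block \<mu> j = a"
          using True cum_bound[OF assms True] block_cum[of a k \<mu>] by auto
        then show "j \<in> {j \<in> {1..n}. colour ?c j = a}" using col by auto
      qed
      then have "card {j \<in> {1..n}. colour ?c j = a} = \<mu> a"
        by (simp add: card_image)
      then show ?thesis using Comp_eq[OF I True] by simp
    next
      case False
      then show ?thesis using assms by (auto simp: Comp_def compositions_def PiE_iff extensional_def)
    qed
  qed
  show "pos ?c = id"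
    unfolding pos_def
  proof (rule rank_sorted)
    fix i assume "i \<in> {1..<n}"
    then show "colour ?c i \<le> colour ?c (Suc i)"
      using block_mono[OF assms, of i "Suc i"] by (simp add: col)
  qed
qed

lemma chi0_pos:
  assumes "\<chi> \<in> Irr" shows "chi0 n \<xi> (comp_of \<chi>) \<circ> pos \<chi> = \<chi>"
proof
  fix j show "(chi0 n \<xi> (comp_of \<chi>) \<circ> pos \<chi>) j = \<chi> j"
  proof (cases "j \<in> {1..n}")
    case True
    then show ?thesis
      using pos_in[of \<chi> j] block_pos_eq[OF assms True] \<xi>_colour[OF assms True]
      by (simp add: chi0_def)
  next
    case False
    then show ?thesis
      using assms pos_in[of \<chi> j] by (auto simp: chi0_def Irr_T_def PiE_iff extensional_def)
  qed
qed

lemma sorted_eq_chi0: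
  assumes "\<chi> \<in> Irr" "\<And>i. i \<in> {1..<n} \<Longrightarrow> colour \<chi> i \<le> colour \<chi> (Suc i)"
  shows "\<chi> = chi0 n \<xi> (comp_of \<chi>)"
  using chi0_pos[OF assms(1)] rank_sorted[of n "colour \<chi>"] assms(2) by (simp add: pos_def)

text \<open>Stable sorting reverses a pair exactly when the colours force it, which is why it has
  minimal length.\<close>

lemma inversions_pos: "inversions n (pos \<chi>) = inversions n (colour \<chi>)"
proof -
  have "pos \<chi> j < pos \<chi> i \<longleftrightarrow> colour \<chi> j < colour \<chi> i" if "i \<in> {1..n}" "j \<in> {1..n}" "i < j" for i j
    using rank_less[OF that(1,2), of "colour \<chi>"] rank_less[OF that(2,1), of "colour \<chi>"] that
    unfolding pos_def key_less_def by (metis less_asym linorder_neqE_nat)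
  then show ?thesis by (auto simp: inversions_def)
qed

text \<open>If \<open>p\<close> carries the sorted character to \<open>\<chi>\<close>, its inverse
  increases from smaller to larger colours and so has all inversions of the colouring. The minimum
  is attained when it has no others, that is, when it also increases inside each colour; this leaves
  only \<open>pos \<chi>\<close>.\<close>

lemma pi_chi_eq:
  assumes "\<chi> \<in> Irr" shows "pi_chi d n \<xi> \<chi> = inv_into UNIV (pos \<chi>)"
proof -
  let ?c = "chi0 n \<xi> (comp_of \<chi>)" and ?p = "inv_into UNIV (pos \<chi>)"
  note \<mu> = Comp_compositions[OF assms]
  have pos': "inv_into UNIV ?p = pos \<chi>" "?p permutes {1..n}"
    using permutes_inv_inv[OF pos_permutes] permutes_inv[OF pos_permutes] by auto
  have P: "?p permutes {1..n} \<and> perm_act ?p ?c = \<chi>"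
    using pos' chi0_pos[OF assms] unfolding perm_act_def pos'(1) comp_def by blast
  have mono: "inversions n (colour \<chi>) \<subseteq> inversions n f" "f permutes {1..n}"
    "\<And>i j. \<lbrakk>i \<in> {1..n}; j \<in> {1..n}; colour \<chi> i < colour \<chi> j\<rbrakk> \<Longrightarrow> f i < f j"
    if p: "p permutes {1..n} \<and> perm_act p ?c = \<chi>" and f: "f = inv_into UNIV p" for p f
  proof -
    show fp: "f permutes {1..n}" using p f permutes_inv by blast
    have "?c (f j) = \<chi> j" for j
      using fun_cong[OF conjunct2[OF p], of j] unfolding perm_act_def f .
    then have "colour ?c (f j) = colour \<chi> j" for j by (simp only: colour_def)
    then have blk: "block (comp_of \<chi>) (f j) = colour \<chi> j" "f j \<in> {1..n}" if "j \<in> {1..n}" for j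
      using that permutes_in_image[OF fp, of j] chi0_Irr(2)[OF \<mu>, of "f j"]
      by (simp_all del: atLeastAtMost_iff)
    show *: "f i < f j" if "i \<in> {1..n}" "j \<in> {1..n}" "colour \<chi> i < colour \<chi> j" for i j
      using block_mono[OF \<mu>, of "f j" "f i"] blk that by (metis not_le)
    then show "inversions n (colour \<chi>) \<subseteq> inversions n f"
      by (auto simp: inversions_def)
  qed
  have len: "perm_length n ?p = card (inversions n (colour \<chi>))"
    using perm_length_eq[OF pos'(2)] pos'(1) by (simp add: inversions_pos)
  have le: "perm_length n ?p \<le> perm_length n p" if "p permutes {1..n} \<and> perm_act p ?c = \<chi>" for p
    unfolding len perm_length_eq[OF conjunct1[OF that]]
    by (rule card_mono[OF finite_inversions mono(1)[OF that refl]])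
  show ?thesis
    unfolding pi_chi_def
  proof (rule the_equality)
    show "is_arg_min (perm_length n) (\<lambda>p. p permutes {1..n} \<and> perm_act p ?c = \<chi>) ?p"
      unfolding is_arg_min_def using P le leD by blast
    fix p assume "is_arg_min (perm_length n) (\<lambda>p. p permutes {1..n} \<and> perm_act p ?c = \<chi>) p"
    then have p: "p permutes {1..n} \<and> perm_act p ?c = \<chi>" and "\<not> perm_length n ?p < perm_length n p"
      unfolding is_arg_min_def using P by blast+
    then have plen: "perm_length n p = perm_length n ?p" using le[OF p] by linarith
    define f where "f = inv_into UNIV p"
    note m = mono[OF p f_def]
    have "card (inversions n f) = card (inversions n (colour \<chi>))"
      using plen len perm_length_eq[OF conjunct1[OF p]] unfolding f_def by linarith
    \<comment> \<open>A subset of the same finite cardinality is the whole set, so minimal length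
      excludes inversions inside a colour class.\<close>
    then have eq: "inversions n (colour \<chi>) = inversions n f"
      by (intro card_subset_eq m(1)) simp_all
    have "f = pos \<chi>"
      unfolding pos_def
    proof (rule rank_unique[OF m(2)])
      fix i j assume ij: "i \<in> {1..n}" "j \<in> {1..n}" "key_less (colour \<chi>) i j"
      show "f i < f j"
      proof (cases "colour \<chi> i < colour \<chi> j")
        case True
        then show ?thesis using m(3)[OF ij(1,2)] by simp
      next
        case False
        then have "colour \<chi> i = colour \<chi> j" "i < j" using ij(3) by (auto simp: key_less_def)
        then have "(i, j) \<notin> inversions n (colour \<chi>)" by (simp add: inversions_def)
        then have "(i, j) \<notin> inversions n f" unfolding eq .
        moreover have "f i \<noteq> f j" using permutes_inj[OF m(2)] \<open>i < j\<close> by (auto dest: injD)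
        ultimately show ?thesis using ij \<open>i < j\<close> by (auto simp: inversions_def)
      qed
    qed
    then show "p = ?p" using permutes_inv_inv[OF conjunct1[OF p]] unfolding f_def by metis
  qed
qed

end

section \<open>The affine Yokonuma--Hecke relations\<close>

lemma const_simps [simp]:
  "const 0 = 0" "const 1 = 1" "const a * const b = const (a * b)" "const a * (const b * c) = const (a * b) * c"
  by (simp_all add: const_def mult_single single_one flip: mult.assoc zero_prod_def)

lemma const_add: "const a + const b = const (a + b)"
  by (simp add: const_def single_add)

lemma const_sum: "const (\<Sum>i\<in>I. f i) = (\<Sum>i\<in>I. const (f i))"
  by (induct I rule: infinite_finite_induct) (simp_all flip: const_add)

lemma u_pow_simps [simp]:
  "u_pow 0 = 1" "u_pow a * u_pow b = u_pow (a + b)" "u_pow a * (u_pow b * c) = u_pow (a + b) * c"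
  by (simp_all add: u_pow_def mult_single single_one flip: mult.assoc zero_prod_def)

lemma root_of_unity_sum:
  fixes w :: complex
  assumes "w ^ d = 1" shows "(\<Sum>s<d. w ^ s) = (if w = 1 then of_nat d else 0)"
  using assms one_diff_power_eq[of w d] by auto

text \<open>The roots are the powers of the primitive root \<open>r 1\<close>, so the sum becomes a
  geometric sum in \<open>inverse (r s)\<close>, and \<open>r s = 1\<close> only for
  \<open>s = 0\<close> because \<open>s < d\<close>.\<close>

lemma sum_roots_of_unity:
  assumes "s < d"
  shows "(\<Sum>z | z ^ d = (1::complex). inverse (z ^ s)) = (if s = 0 then of_nat d else 0)"
proof -
  define r where "r k = cis (2 * pi * real k / real d)" for k
  have bij: "bij_betw r {..<d} {z. z ^ d = 1}"
    unfolding r_def using bij_betw_roots_unity[of d] assms by simp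
  have pow: "r k = r 1 ^ k" for k
    by (simp add: r_def DeMoivre mult.commute)
  have "(\<Sum>z | z ^ d = (1::complex). inverse (z ^ s)) = (\<Sum>k<d. inverse (r k ^ s))"
    using sum.reindex_bij_betw[OF bij, of "\<lambda>z. inverse (z ^ s)"] by simp
  also have "\<dots> = (\<Sum>k<d. inverse (r s) ^ k)"
    by (intro sum.cong refl) (metis pow power_inverse power_mult mult.commute)
  also have "\<dots> = (if inverse (r s) = 1 then of_nat d else 0)"
  proof (rule root_of_unity_sum)
    have "r s \<in> {z. z ^ d = 1}" using bij_betwE[OF bij] assms by blast
    then show "inverse (r s) ^ d = 1" by (simp add: power_inverse)
  qed
  also have "inverse (r s) = 1 \<longleftrightarrow> s = 0"
  proof -
    have "r 0 = 1" by (simp add: r_def)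
    then have "r s = 1 \<longleftrightarrow> s = 0"
      using bij_betw_imp_inj_on[OF bij] assms by (auto dest!: inj_onD[of r "{..<d}" s 0])
    then show ?thesis by simp
  qed
  finally show ?thesis .
qed

lemma (in kalgebra) comm_nat_pow:
  assumes "x \<otimes> y = y \<otimes> x" "x \<in> carrier A" "y \<in> carrier A"
  shows "x \<otimes> y [^] (k::nat) = y [^] k \<otimes> x"
  by (induct k) (use assms in \<open>auto intro!: comm_mult\<close>)

lemma (in kalgebra) list_prod_replicate: "y \<in> carrier A \<Longrightarrow> list_prod A (replicate k y) = y [^] k"
proof (induct k)
  case (Suc k)
  then show ?case by (simp add: comm_nat_pow)
qed simp

lemma (in kalgebra) list_prod_absorb_left:
  "\<lbrakk>y \<in> carrier A; set xs \<subseteq> carrier A; \<And>x. x \<in> set xs \<Longrightarrow> x \<otimes> y = y\<rbrakk> \<Longrightarrow> list_prod A xs \<otimes> y = y"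
  by (induct xs) (auto simp: m_assoc intro!: list_prod_closed)

lemma (in kalgebra) list_prod_absorb_right:
  "\<lbrakk>y \<in> carrier A; set xs \<subseteq> carrier A; \<And>x. x \<in> set xs \<Longrightarrow> y \<otimes> x = y\<rbrakk> \<Longrightarrow> y \<otimes> list_prod A xs = y"
proof (induct xs)
  case (Cons x xs)
  then have "y \<otimes> (x \<otimes> list_prod A xs) = y \<otimes> x \<otimes> list_prod A xs"
    by (subst m_assoc) (auto intro!: list_prod_closed)
  with Cons show ?case by simp
qed simp

text \<open>The relations are imposed on elements of an arbitrary algebra. Their consequences are
  thus available in the presented algebra, in its case d = 1 and in the matrix algebra, and an
  instance is also what defines a homomorphism into its algebra.\<close>

locale yokonuma = kalgebra A for A :: "(K, 'a) module" (structure) +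
  fixes d n :: nat and g t :: "nat \<Rightarrow> 'a" and x xi :: 'a
  assumes d: "1 \<le> d"
    and g_closed [simp]: "g i \<in> carrier A" and t_closed [simp]: "t i \<in> carrier A"
    and x_closed [simp]: "x \<in> carrier A" and xi_closed [simp]: "xi \<in> carrier A"
    and gg_far: "\<lbrakk>i \<in> {1..<n}; j \<in> {1..<n}; Suc i < j\<rbrakk> \<Longrightarrow> g i \<otimes> g j = g j \<otimes> g i"
    and ggg: "\<lbrakk>i \<in> {1..<n}; Suc i \<in> {1..<n}\<rbrakk> \<Longrightarrow>
      g i \<otimes> (g (Suc i) \<otimes> g i) = g (Suc i) \<otimes> (g i \<otimes> g (Suc i))"
    and xgxg: "1 < n \<Longrightarrow> x \<otimes> (g 1 \<otimes> (x \<otimes> g 1)) = g 1 \<otimes> (x \<otimes> (g 1 \<otimes> x))"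
    and xg: "i \<in> {2..<n} \<Longrightarrow> x \<otimes> g i = g i \<otimes> x"
    and tt: "\<lbrakk>i \<in> {1..n}; j \<in> {1..n}\<rbrakk> \<Longrightarrow> t i \<otimes> t j = t j \<otimes> t i"
    and gt: "\<lbrakk>i \<in> {1..<n}; j \<in> {1..n}\<rbrakk> \<Longrightarrow> g i \<otimes> t j = t (simple_refl i j) \<otimes> g i"
    and t_order: "j \<in> {1..n} \<Longrightarrow> t j [^] d = \<one>"
    and xt: "j \<in> {1..n} \<Longrightarrow> x \<otimes> t j = t j \<otimes> x"
    and x_inv: "1 \<le> n \<Longrightarrow> x \<otimes> xi = \<one>" "1 \<le> n \<Longrightarrow> xi \<otimes> x = \<one>"
    and quadratic: "i \<in> {1..<n} \<Longrightarrow> g i \<otimes> g i = u_pow 2 \<odot> \<one> \<oplus>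
      (\<Oplus>s\<in>{1..d}. (v * const (1 / of_nat d)) \<odot> (t i [^] s \<otimes> (t (Suc i) [^] (d - s) \<otimes> g i)))"
begin

fun X :: "nat \<Rightarrow> 'a" where
  "X 0 = \<one>"
| "X (Suc 0) = x"
| "X (Suc (Suc i)) = u_pow (-2) \<odot> (g (Suc i) \<otimes> X (Suc i) \<otimes> g (Suc i))"

lemma X_closed [simp]: "X i \<in> carrier A"
  by (induct i rule: X.induct) auto

lemma X_Suc: "1 \<le> i \<Longrightarrow> X (Suc i) = u_pow (-2) \<odot> (g i \<otimes> (X i \<otimes> g i))"
  by (cases i) (simp_all add: m_assoc)

lemma gXg: "1 \<le> i \<Longrightarrow> g i \<otimes> (X i \<otimes> g i) = u_pow 2 \<odot> X (Suc i)"
  by (simp add: X_Suc)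

lemma gg_far': "\<lbrakk>i \<in> {1..<n}; j \<in> {1..<n}; Suc i < j \<or> Suc j < i\<rbrakk> \<Longrightarrow> g i \<otimes> g j = g j \<otimes> g i"
  using gg_far[of i j] gg_far[of j i] by auto

text \<open>Induction along X_{k+1} = u^{-2} g_k X_k g_k. Either \<open>g j\<close> commutes with
  both \<open>g k\<close> and \<open>X k\<close>, or \<open>Suc j = k\<close>, and then a braid move
  is used.\<close>

lemma gX:
  assumes "i \<in> {1..n}" "j \<in> {1..<n}" "j \<noteq> i" "Suc j \<noteq> i"
  shows "g j \<otimes> X i = X i \<otimes> g j"
  using assms
proof (induct i arbitrary: j rule: less_induct)
  case (less i)
  show ?case
  proof (cases "i = 1")
    case True
    then show ?thesis using less xg[of j] by (simp add: One_nat_def)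
  next
    case False
    then obtain k where k: "i = Suc k" "1 \<le> k" "k \<in> {1..<n}" using less(2) by (cases i) auto
    show ?thesis
    proof (cases "Suc j = k")
      case False
      have "g j \<otimes> g k = g k \<otimes> g j" using less k False by (intro gg_far') auto
      moreover have "g j \<otimes> X k = X k \<otimes> g j" using less k False by (intro less(1)) auto
      ultimately show ?thesis
        using k by (simp add: X_Suc comm_mult)
    next
      case True
      then have j: "1 \<le> j" "j \<in> {1..<n}" using less by auto
      have c: "g k \<otimes> X j = X j \<otimes> g k" using True k j by (intro less(1)) auto
      have b: "g j \<otimes> (g k \<otimes> g j) = g k \<otimes> (g j \<otimes> g k)" using ggg[of j] True j k by simp
      \<comment> \<open>Up to a scalar, \<open>X i\<close> is here the product of
        \<open>g k\<close>, \<open>g j\<close>, \<open>X j\<close>, \<open>g j\<close>,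
        \<open>g k\<close>. The braid relation takes \<open>g j\<close> through the left pair as
        \<open>g k\<close>, which passes \<open>X j\<close> and leaves the right pair as
        \<open>g j\<close>.\<close>
      have "g j \<otimes> (g k \<otimes> (g j \<otimes> (X j \<otimes> (g j \<otimes> g k)))) = g j \<otimes> (g k \<otimes> g j) \<otimes> (X j \<otimes> (g j \<otimes> g k))"
        by (simp add: m_assoc)
      also have "\<dots> = g k \<otimes> (g j \<otimes> (g k \<otimes> (X j \<otimes> (g j \<otimes> g k))))"
        unfolding b by (simp add: m_assoc)
      also have "\<dots> = g k \<otimes> (g j \<otimes> (X j \<otimes> (g k \<otimes> (g j \<otimes> g k))))"
        by (simp add: comm_left[OF c])
      also have "\<dots> = g k \<otimes> (g j \<otimes> (X j \<otimes> (g j \<otimes> (g k \<otimes> g j))))"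
        by (simp add: b)
      finally show ?thesis
        using X_Suc[OF j(1)] True k by (simp add: X_Suc m_assoc)
    qed
  qed
qed

text \<open>The relation between the first \<open>X\<close> and \<open>g 1\<close> is carried up the
  chain. Up to a power of u it says that \<open>X i\<close> commutes with \<open>X (Suc i)\<close>,
  which is the starting point for \<open>XX\<close>.\<close>

lemma XgXg:
  assumes "i \<in> {1..<n}"
  shows "X i \<otimes> (g i \<otimes> (X i \<otimes> g i)) = g i \<otimes> (X i \<otimes> (g i \<otimes> X i))"
  using assms
proof (induct i)
  case (Suc i)
  show ?case
  proof (cases "i = 0")
    case True
    then show ?thesis using xgxg Suc by (simp add: One_nat_def)
  next
    case False
    then have i: "1 \<le> i" "i \<in> {1..<n}" "Suc i \<in> {1..<n}" using Suc by auto
    let ?a = "g i" and ?b = "g (Suc i)" and ?x = "X i"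
    have IH: "?x \<otimes> (?a \<otimes> (?x \<otimes> ?a)) = ?a \<otimes> (?x \<otimes> (?a \<otimes> ?x))" using Suc i by simp
    have br: "?a \<otimes> (?b \<otimes> ?a) = ?b \<otimes> (?a \<otimes> ?b)" using ggg i by simp
    have br': "?a \<otimes> (?b \<otimes> (?a \<otimes> y)) = ?b \<otimes> (?a \<otimes> (?b \<otimes> y))" if "y \<in> carrier A" for y
      using arg_cong[OF br, of "\<lambda>z. z \<otimes> y"] that by (simp add: m_assoc)
    have c: "?b \<otimes> ?x = ?x \<otimes> ?b" using i by (intro gX) auto
    note c' = comm_left[OF c]
    have IH': "?x \<otimes> (?a \<otimes> (?x \<otimes> (?a \<otimes> y))) = ?a \<otimes> (?x \<otimes> (?a \<otimes> (?x \<otimes> y)))"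
      if "y \<in> carrier A" for y
      using arg_cong[OF IH, of "\<lambda>z. z \<otimes> y"] that by (simp add: m_assoc)
    \<comment> \<open>With \<open>X (Suc i)\<close> expanded this is an identity in
      \<open>?a\<close>, \<open>?b\<close>, \<open>?x\<close>. Braid moves and the commutation of
      \<open>?b\<close> with \<open>?x\<close> expose the pattern of the induction hypothesis in the
      middle.\<close>
    have "?a \<otimes> (?x \<otimes> (?a \<otimes> (?b \<otimes> (?a \<otimes> (?x \<otimes> (?a \<otimes> ?b)))))) =
        ?a \<otimes> (?x \<otimes> (?b \<otimes> (?a \<otimes> (?b \<otimes> (?x \<otimes> (?a \<otimes> ?b))))))"
      by (simp add: br')
    also have "\<dots> = ?a \<otimes> (?b \<otimes> (?x \<otimes> (?a \<otimes> (?x \<otimes> (?b \<otimes> (?a \<otimes> ?b))))))"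
      by (simp add: c')
    also have "\<dots> = ?a \<otimes> (?b \<otimes> (?x \<otimes> (?a \<otimes> (?x \<otimes> (?a \<otimes> (?b \<otimes> ?a))))))"
      by (simp add: br)
    also have "\<dots> = ?b \<otimes> (?a \<otimes> (?b \<otimes> (?x \<otimes> (?a \<otimes> (?x \<otimes> (?b \<otimes> ?a))))))"
      by (simp add: IH' br')
    also have "\<dots> = ?b \<otimes> (?a \<otimes> (?x \<otimes> (?b \<otimes> (?a \<otimes> (?b \<otimes> (?x \<otimes> ?a))))))"
      by (simp add: c')
    also have "\<dots> = ?b \<otimes> (?a \<otimes> (?x \<otimes> (?a \<otimes> (?b \<otimes> (?a \<otimes> (?x \<otimes> ?a))))))"
      by (simp add: br')
    finally show ?thesis
      using i by (simp add: X_Suc[of i] m_assoc)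
  qed
qed simp

lemma XX:
  assumes "i \<in> {1..n}" "j \<in> {1..n}"
  shows "X i \<otimes> X j = X j \<otimes> X i"
proof -
  have "X i \<otimes> X j = X j \<otimes> X i" if i1: "1 \<le> i" and "i < j" "j \<le> n" for i j
    using that(2,3)
  proof (induct j rule: less_induct)
    case (less j)
    then obtain k where k: "j = Suc k" "1 \<le> k" "k \<in> {1..<n}" using i1 by (cases j) auto
    show ?case
    proof (cases "i = k")
      case True
      then show ?thesis using XgXg[OF k(3)] k by (simp add: X_Suc m_assoc)
    next
      case False
      then have "X i \<otimes> X k = X k \<otimes> X i" using less k by (intro less(1)) auto
      moreover have "X i \<otimes> g k = g k \<otimes> X i"
        using k False less i1 by (intro gX[symmetric]) auto
      ultimately show ?thesis using k by (simp add: X_Suc comm_mult)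
    qed
  qed
  from this[of i j] this[of j i] assms show ?thesis
    by (cases i j rule: linorder_cases) auto
qed

lemma tg:
  assumes "i \<in> {1..<n}" "j \<in> {1..n}"
  shows "t j \<otimes> g i = g i \<otimes> t (simple_refl i j)"
  using gt[OF assms(1), of "simple_refl i j"] simple_refl_in[OF assms(1), of j] assms(2) by simp

text \<open>Passing \<open>t j\<close> through the first \<open>g i\<close> replaces
  \<open>j\<close> by \<open>simple_refl i j\<close>, and passing the second one undoes
  this.\<close>

lemma tX:
  assumes "i \<in> {1..n}" "j \<in> {1..n}" shows "t j \<otimes> X i = X i \<otimes> t j"
  using assms
proof (induct i arbitrary: j rule: nat_induct)
  case (Suc i)
  show ?case
  proof (cases "i = 0")
    case True
    then show ?thesis using xt[of j] Suc by (simp add: One_nat_def)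
  next
    case False
    then have i: "1 \<le> i" "i \<in> {1..<n}" "i \<in> {1..n}" using Suc by auto
    let ?k = "simple_refl i j"
    have k: "?k \<in> {1..n}" using simple_refl_in[OF i(2), of j] Suc by blast
    have "t j \<otimes> (g i \<otimes> (X i \<otimes> g i)) = g i \<otimes> (t ?k \<otimes> (X i \<otimes> g i))"
      using tg[OF i(2) Suc(3)] by (simp flip: m_assoc)
    also have "t ?k \<otimes> (X i \<otimes> g i) = X i \<otimes> (t ?k \<otimes> g i)"
      using comm_left[OF Suc(1)[OF i(3) k]] by simp
    also have "t ?k \<otimes> g i = g i \<otimes> t j"
      using tg[OF i(2) k] by simp
    finally show ?thesis using i by (simp add: X_Suc m_assoc)
  qed
qed simp

definition e :: "nat \<Rightarrow> nat \<Rightarrow> 'a" where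
  "e i j = (\<Oplus>s\<in>{1..d}. const (1 / of_nat d) \<odot> (t i [^] s \<otimes> t j [^] (d - s)))"

lemma e_closed [simp]: "e i j \<in> carrier A"
  by (simp add: e_def)

lemma quadratic_e: "i \<in> {1..<n} \<Longrightarrow> g i \<otimes> g i = u_pow 2 \<odot> \<one> \<oplus> v \<odot> (e i (Suc i) \<otimes> g i)"
  unfolding e_def
  by (simp add: quadratic smult_finsum finsum_ldistr m_assoc)

lemma g_pow: "\<lbrakk>i \<in> {1..<n}; j \<in> {1..n}\<rbrakk> \<Longrightarrow> g i \<otimes> t j [^] (k::nat) = t (simple_refl i j) [^] k \<otimes> g i"
proof (induct k)
  case (Suc k)
  then have "g i \<otimes> (t j [^] k \<otimes> t j) = t (simple_refl i j) [^] k \<otimes> (g i \<otimes> t j)"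
    by (simp add: m_assoc[symmetric])
  also have "\<dots> = t (simple_refl i j) [^] k \<otimes> (t (simple_refl i j) \<otimes> g i)"
    using Suc by (simp add: gt)
  finally show ?case by (simp add: m_assoc)
qed simp

text \<open>Crossing \<open>g i\<close> interchanges the two \<open>t\<close>. The two forms of
  \<open>e\<close> supply the left and the right inverse of \<open>g i\<close>.\<close>

lemma ge:
  assumes "i \<in> {1..<n}"
  shows "e i (Suc i) \<otimes> g i = g i \<otimes> e (Suc i) i"
proof -
  have i: "i \<in> {1..n}" "Suc i \<in> {1..n}" using assms by auto
  have "g i \<otimes> (t (Suc i) [^] s \<otimes> t i [^] (d - s)) = t i [^] s \<otimes> t (Suc i) [^] (d - s) \<otimes> g i" for s
    using g_pow[OF assms i(2), of s] g_pow[OF assms i(1), of "d - s"]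
    by (simp flip: m_assoc) (simp add: m_assoc)
  then show ?thesis
    unfolding e_def by (simp add: finsum_ldistr finsum_rdistr)
qed

lemma Units_two_sided:
  assumes "a \<in> carrier A" "b \<in> carrier A" "c \<in> carrier A" "b \<otimes> a = \<one>" "a \<otimes> c = \<one>"
  shows "a \<in> Units A"
proof -
  have "b = c" using assms m_assoc[of b a c] by simp
  then show ?thesis using assms unfolding Units_def by auto
qed

text \<open>The quadratic relation is solved for the identity: u^{-2} (g_i - v e) inverts g_i, with
  \<open>e i (Suc i)\<close> from the left and \<open>e (Suc i) i\<close> from the right, and
  one-sided inverses on both sides coincide.\<close>

lemma g_Units: "i \<in> {1..<n} \<Longrightarrow> g i \<in> Units A"
proof -
  assume i: "i \<in> {1..<n}"
  let ?b = "\<lambda>y. u_pow (-2) \<odot> (g i \<oplus> (- v) \<odot> y)"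
  have neg: "(a \<oplus> v \<odot> y) \<oplus> (- v) \<odot> y = a" if "a \<in> carrier A" "y \<in> carrier A" for a y
    using that smult_add_left[of y v "-v"] by (simp add: a_assoc)
  show "g i \<in> Units A"
  proof (rule Units_two_sided[of _ "?b (e i (Suc i))" "?b (e (Suc i) i)"])
    show "?b (e i (Suc i)) \<otimes> g i = \<one>"
      using neg[of "u_pow 2 \<odot> \<one>" "e i (Suc i) \<otimes> g i"]
      by (simp add: l_distr quadratic_e[OF i])
    show "g i \<otimes> ?b (e (Suc i) i) = \<one>"
      using neg[of "u_pow 2 \<odot> \<one>" "e i (Suc i) \<otimes> g i"]
      by (simp add: r_distr quadratic_e[OF i] flip: ge[OF i])
  qed simp_all
qed

lemma smult_Units: "y \<in> Units A \<Longrightarrow> u_pow k \<odot> y \<in> Units A"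
  using Units_two_sided[of "u_pow k \<odot> y" "u_pow (-k) \<odot> inv y" "u_pow (-k) \<odot> inv y"]
  by (simp add: Units_closed)

lemma X_Units: "i \<in> {1..n} \<Longrightarrow> X i \<in> Units A"
proof (induct i rule: nat_induct)
  case (Suc i)
  show ?case
  proof (cases "i = 0")
    case True
    then show ?thesis using Suc x_inv unfolding Units_def by auto
  next
    case False
    then show ?thesis
      using Suc by (simp add: X_Suc smult_Units Units_m_closed g_Units)
  qed
qed simp

subsection \<open>Idempotents\<close>

text \<open>The projector onto the eigenspace of \<open>t j\<close> for the root of unity
  \<open>z\<close>.\<close>

definition P :: "nat \<Rightarrow> complex \<Rightarrow> 'a" where
  "P j z = const (1 / of_nat d) \<odot> (\<Oplus>s\<in>{0..<d}. const (inverse (z ^ s)) \<odot> t j [^] s)"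

lemma P_closed [simp]: "P j z \<in> carrier A"
  by (simp add: P_def)

lemma t_pow_eigen:
  assumes "t j \<otimes> y = const z \<odot> y" "y \<in> carrier A"
  shows "t j [^] (s::nat) \<otimes> y = const (z ^ s) \<odot> y"
  by (induct s) (use assms in \<open>simp_all add: m_assoc mult.commute\<close>)

lemma t_pow_eigen':
  assumes "y \<otimes> t j = const z \<odot> y" "y \<in> carrier A"
  shows "y \<otimes> t j [^] (s::nat) = const (z ^ s) \<odot> y"
  by (induct s) (use assms in \<open>simp_all add: mult.commute flip: m_assoc\<close>)

lemma const_average: "(\<Sum>s = 0..<d. const (inverse (w ^ s)) * const (z ^ s)) = const (\<Sum>s<d. (z / w) ^ s)"
  by (simp add: const_sum power_mult_distrib power_inverse divide_inverse atLeast0LessThan mult.commute)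

lemma P_eigen:
  assumes "t j \<otimes> y = const z \<odot> y" "y \<in> carrier A" "z ^ d = 1" "w ^ d = 1"
  shows "P j w \<otimes> y = (if w = z then y else \<zero>)"
proof -
  have w: "w \<noteq> 0" using assms(4) d by (auto simp: power_0_left)
  have "P j w \<otimes> y = const (1 / of_nat d) \<odot> (\<Oplus>s\<in>{0..<d}. (const (inverse (w ^ s)) * const (z ^ s)) \<odot> y)"
    unfolding P_def using assms(2) by (simp add: finsum_ldistr t_pow_eigen[OF assms(1,2)])
  also have "\<dots> = (const (1 / of_nat d) * const (\<Sum>s<d. (z / w) ^ s)) \<odot> y"
    using assms(2) by (simp only: smult_sum[symmetric] const_average smult_smult)
  also have "\<dots> = (if w = z then y else \<zero>)"
    using assms w d root_of_unity_sum[of "z / w" d] by (auto simp: power_divide)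
  finally show ?thesis .
qed

lemma P_eigen':
  assumes "y \<otimes> t j = const z \<odot> y" "y \<in> carrier A" "z ^ d = 1"
  shows "y \<otimes> P j z = y"
proof -
  have w: "z \<noteq> 0" using assms(3) d by (auto simp: power_0_left)
  have "y \<otimes> P j z = const (1 / of_nat d) \<odot> (\<Oplus>s\<in>{0..<d}. (const (inverse (z ^ s)) * const (z ^ s)) \<odot> y)"
    unfolding P_def using assms(2) by (simp add: finsum_rdistr t_pow_eigen'[OF assms(1,2)])
  also have "\<dots> = (const (1 / of_nat d) * const (\<Sum>s<d. (z / z) ^ s)) \<odot> y"
    using assms(2) by (simp only: smult_sum[symmetric] const_average smult_smult)
  also have "\<dots> = y" using assms w d by simp
  finally show ?thesis .
qed

text \<open>Multiplication by \<open>t j\<close> shifts the summation index by one at the cost of a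
  factor \<open>z\<close>; the shift is cyclic since the terms for \<open>d\<close> and 0
  agree.\<close>

lemma tP:
  assumes "j \<in> {1..n}" "z ^ d = 1"
  shows "t j \<otimes> P j z = const z \<odot> P j z"
proof -
  have z: "z \<noteq> 0" using assms(2) d by (auto simp: power_0_left)
  define f where "f s = const (inverse (z ^ s)) \<odot> t j [^] s" for s
  have f: "f s \<in> carrier A" for s by (simp add: f_def)
  have step: "t j \<otimes> f s = const z \<odot> f (Suc s)" for s
  proof -
    have "t j \<otimes> t j [^] s = t j [^] Suc s" by (simp add: comm_nat_pow)
    then show ?thesis using z by (simp add: f_def mult.assoc[symmetric])
  qed
  have fd: "f d = f 0" using assms t_order[OF assms(1)] by (simp add: f_def)
  have "(\<Oplus>s\<in>{0..<d}. f (Suc s)) = (\<Oplus>s\<in>{0..<d}. f s)"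
  proof -
    have "(\<Oplus>s\<in>{0..<d}. f (Suc s)) = finsum A f (Suc ` {0..<d})"
      using finsum_reindex[of f Suc "{0..<d}"] f by simp
    also have "Suc ` {0..<d} = insert d {1..<d}"
      using d by (auto simp: image_iff)
    also have "finsum A f (insert d {1..<d}) = f 0 \<oplus> finsum A f {1..<d}"
      using f fd by simp
    also have "\<dots> = finsum A f (insert 0 {1..<d})" using f by simp
    also have "insert 0 {1..<d} = {0..<d}" using d by auto
    finally show ?thesis .
  qed
  then have "t j \<otimes> (\<Oplus>s\<in>{0..<d}. f s) = const z \<odot> (\<Oplus>s\<in>{0..<d}. f s)"
    using f by (simp add: finsum_rdistr step smult_finsum flip: smult_finsum)
  then show ?thesis
    using f unfolding P_def f_def[symmetric] by (simp add: mult.commute)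
qed

lemma t_comm_P: "\<lbrakk>i \<in> {1..n}; j \<in> {1..n}\<rbrakk> \<Longrightarrow> t i \<otimes> P j z = P j z \<otimes> t i"
  unfolding P_def by (simp add: finsum_ldistr finsum_rdistr comm_nat_pow[OF tt])

text \<open>After exchanging the summations, the sum of the inverse s-th powers of all roots of
  unity vanishes except for s = 0.\<close>

lemma P_sum:
  assumes "j \<in> {1..n}"
  shows "(\<Oplus>z\<in>{z. z ^ d = 1}. P j z) = \<one>"
proof -
  have fin: "finite {z::complex. z ^ d = 1}"
    using d by (intro finite_roots_unity) auto
  have "(\<Oplus>z\<in>{z. z ^ d = 1}. P j z) =
      const (1 / of_nat d) \<odot> (\<Oplus>z\<in>{z. z ^ d = 1}. \<Oplus>s\<in>{0..<d}. const (inverse (z ^ s)) \<odot> t j [^] s)"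
    unfolding P_def by (subst smult_finsum) auto
  also have "(\<Oplus>z\<in>{z. z ^ d = 1}. \<Oplus>s\<in>{0..<d}. const (inverse (z ^ s)) \<odot> t j [^] s) =
      (\<Oplus>s\<in>{0..<d}. \<Oplus>z\<in>{z. z ^ d = 1}. const (inverse (z ^ s)) \<odot> t j [^] s)"
    using fin by (intro finsum_swap) auto
  also have "\<dots> = (\<Oplus>s\<in>{0..<d}. const (if s = 0 then of_nat d else 0) \<odot> t j [^] s)"
    by (intro finsum_cong')
      (auto simp: smult_sum[symmetric] const_sum[symmetric] sum_roots_of_unity simp del: const_simps)
  also have "\<dots> = const (of_nat d) \<odot> \<one>"
    using d by (subst finsum_single[of _ 0]) auto
  finally show ?thesis using d by simp
qed

definition E :: "(nat \<Rightarrow> complex) \<Rightarrow> 'a" where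
  "E \<chi> = list_prod A (map (\<lambda>j. P j (\<chi> j)) [1..<Suc n])"

lemma E_closed [simp]: "E \<chi> \<in> carrier A"
  unfolding E_def by (rule list_prod_closed) auto

lemma Irr_pow: "\<chi> \<in> Irr_T d n \<Longrightarrow> j \<in> {1..n} \<Longrightarrow> \<chi> j ^ d = 1"
  by (auto simp: Irr_T_def)

text \<open>A simultaneous eigenvector is fixed by each projector. This turns commutation rules for
  \<open>E \<chi>\<close> into eigenvalue computations.\<close>

lemma E_absorb_left:
  assumes "\<chi> \<in> Irr_T d n" "y \<in> carrier A" "\<And>j. j \<in> {1..n} \<Longrightarrow> t j \<otimes> y = const (\<chi> j) \<odot> y"
  shows "E \<chi> \<otimes> y = y"
  unfolding E_def using assms
  by (intro list_prod_absorb_left) (auto simp: P_eigen Irr_pow)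

lemma E_absorb_right:
  assumes "\<chi> \<in> Irr_T d n" "y \<in> carrier A" "\<And>j. j \<in> {1..n} \<Longrightarrow> y \<otimes> t j = const (\<chi> j) \<odot> y"
  shows "y \<otimes> E \<chi> = y"
  unfolding E_def using assms
  by (intro list_prod_absorb_right) (auto simp: P_eigen' Irr_pow)

lemma Et: "j \<in> {1..n} \<Longrightarrow> t j \<otimes> E \<chi> = E \<chi> \<otimes> t j"
  unfolding E_def by (rule comm_list_prod) (auto simp: t_comm_P)

lemma tE:
  assumes "\<chi> \<in> Irr_T d n" "j \<in> {1..n}"
  shows "t j \<otimes> E \<chi> = const (\<chi> j) \<odot> E \<chi>" "E \<chi> \<otimes> t j = const (\<chi> j) \<odot> E \<chi>"
proof -
  have "j \<in> set [1..<Suc n]" using assms(2) by auto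
  then obtain us vs where uv: "[1..<Suc n] = us @ j # vs" using split_list by metis
  have "set us \<union> set vs \<subseteq> set [1..<Suc n]" unfolding uv by auto
  then have "set us \<subseteq> {1..n}" "set vs \<subseteq> {1..n}" by (auto simp del: upt_Suc)
  let ?u = "list_prod A (map (\<lambda>j. P j (\<chi> j)) us)" and ?v = "list_prod A (map (\<lambda>j. P j (\<chi> j)) vs)"
  have cl: "?u \<in> carrier A" "?v \<in> carrier A" by (rule list_prod_closed; auto)+
  have E: "E \<chi> = ?u \<otimes> (P j (\<chi> j) \<otimes> ?v)"
    unfolding E_def uv by (simp add: list_prod_append cl image_subset_iff)
  have "t j \<otimes> ?u = ?u \<otimes> t j"
    using \<open>set us \<subseteq> {1..n}\<close> assms(2) by (intro comm_list_prod) (auto simp: t_comm_P)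
  then have "t j \<otimes> E \<chi> = ?u \<otimes> (t j \<otimes> (P j (\<chi> j) \<otimes> ?v))"
    unfolding E using cl by (intro comm_left) auto
  also have "t j \<otimes> (P j (\<chi> j) \<otimes> ?v) = const (\<chi> j) \<odot> (P j (\<chi> j) \<otimes> ?v)"
    using cl tP[OF assms(2) Irr_pow[OF assms]] by (simp flip: m_assoc)
  finally show "t j \<otimes> E \<chi> = const (\<chi> j) \<odot> E \<chi>"
    unfolding E using cl by simp
  then show "E \<chi> \<otimes> t j = const (\<chi> j) \<odot> E \<chi>" using Et assms by simp
qed

lemma EE: "\<chi> \<in> Irr_T d n \<Longrightarrow> E \<chi> \<otimes> E \<chi> = E \<chi>"
  by (rule E_absorb_left) (auto simp: tE)

text \<open>Both products equal \<open>E \<chi> \<otimes> X i \<otimes> E \<chi>\<close>, because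
  \<open>X i\<close> preserves eigenspaces from either side.\<close>

lemma EX:
  assumes "\<chi> \<in> Irr_T d n" "i \<in> {1..n}"
  shows "E \<chi> \<otimes> X i = X i \<otimes> E \<chi>"
proof -
  have "E \<chi> \<otimes> (X i \<otimes> E \<chi>) = X i \<otimes> E \<chi>"
    using assms by (intro E_absorb_left) (simp_all add: comm_left[OF tX] tE)
  moreover have "E \<chi> \<otimes> X i \<otimes> E \<chi> = E \<chi> \<otimes> X i"
    using assms by (intro E_absorb_right) (simp_all add: m_assoc tX[symmetric], simp flip: m_assoc add: tE)
  ultimately show ?thesis by (simp add: m_assoc)
qed

text \<open>The same two-sided absorption, with \<open>g i\<close> permuting the
  eigenvalues.\<close>

lemma gE:
  assumes "\<chi> \<in> Irr_T d n" "\<chi> \<circ> simple_refl i \<in> Irr_T d n" "i \<in> {1..<n}"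
  shows "g i \<otimes> E \<chi> = E (\<chi> \<circ> simple_refl i) \<otimes> g i"
proof -
  let ?\<psi> = "\<chi> \<circ> simple_refl i"
  have s: "simple_refl i j \<in> {1..n}" if "j \<in> {1..n}" for j
    using simple_refl_in[OF assms(3)] that by blast
  have "E ?\<psi> \<otimes> (g i \<otimes> E \<chi>) = g i \<otimes> E \<chi>"
  proof (rule E_absorb_left[OF assms(2)])
    fix j assume j: "j \<in> {1..n}"
    have "t j \<otimes> (g i \<otimes> E \<chi>) = g i \<otimes> (t (simple_refl i j) \<otimes> E \<chi>)"
      using tg[OF assms(3) j] by (simp flip: m_assoc)
    then show "t j \<otimes> (g i \<otimes> E \<chi>) = const (?\<psi> j) \<odot> (g i \<otimes> E \<chi>)"
      using tE(1)[OF assms(1) s[OF j]] by simp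
  qed simp
  moreover have "E ?\<psi> \<otimes> g i \<otimes> E \<chi> = E ?\<psi> \<otimes> g i"
  proof (rule E_absorb_right[OF assms(1)])
    fix j assume j: "j \<in> {1..n}"
    have "E ?\<psi> \<otimes> g i \<otimes> t j = E ?\<psi> \<otimes> t (simple_refl i j) \<otimes> g i"
      using gt[OF assms(3) j] by (simp add: m_assoc)
    then show "E ?\<psi> \<otimes> g i \<otimes> t j = const (\<chi> j) \<odot> (E ?\<psi> \<otimes> g i)"
      using tE(2)[OF assms(2) s[OF j]] by simp
  qed simp
  ultimately show ?thesis by (simp add: m_assoc)
qed

text \<open>\<open>e i (Suc i)\<close> averages the powers of a quotient of two eigenvalues, so it
  acts as 1 if they agree and as 0 if not. Here the quadratic relation splits into a Hecke relation
  and g_i^2 = u^2.\<close>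

lemma ggE:
  assumes "\<chi> \<in> Irr_T d n" "\<chi> \<circ> simple_refl i \<in> Irr_T d n" "i \<in> {1..<n}"
  shows "g i \<otimes> (g i \<otimes> E \<chi>) =
    (if \<chi> i = \<chi> (Suc i) then u_pow 2 \<odot> E \<chi> \<oplus> v \<odot> (g i \<otimes> E \<chi>) else u_pow 2 \<odot> E \<chi>)"
proof -
  \<comment> \<open>In \<open>quadratic_e\<close> the idempotent stands to the left of
    \<open>g i\<close>, so it meets \<open>E \<chi>\<close> only after \<open>gE\<close> has turned
    this into \<open>E \<psi>\<close>.\<close>
  define \<psi> where "\<psi> = \<chi> \<circ> simple_refl i"
  have \<psi>: "\<psi> \<in> Irr_T d n" "\<psi> i = \<chi> (Suc i)" "\<psi> (Suc i) = \<chi> i"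
    using assms(2) by (simp_all add: \<psi>_def)
  note gE = gE[OF assms, folded \<psi>_def]
  have i: "i \<in> {1..n}" "Suc i \<in> {1..n}" using assms(3) by auto
  let ?z = "\<psi> i" and ?w = "\<psi> (Suc i)"
  have zw: "?z ^ d = 1" "?w ^ d = 1" using Irr_pow[OF \<psi>(1) i(1)] Irr_pow[OF \<psi>(1) i(2)] .
  then have w0: "?w \<noteq> 0" using d by (auto simp: power_0_left simp del: comp_apply)
  have "t i [^] s \<otimes> t (Suc i) [^] (d - s) \<otimes> E \<psi> = const ((?z / ?w) ^ s) \<odot> E \<psi>" if "s \<le> d" for s
  proof -
    have "?w ^ s * ?w ^ (d - s) = 1" using zw that by (simp flip: power_add)
    then have "?w ^ (d - s) * ?z ^ s = (?z / ?w) ^ s"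
      using w0 by (simp add: power_divide field_simps)
    then show ?thesis
      by (simp add: m_assoc t_pow_eigen[OF tE(1)[OF \<psi>(1) i(1)]]
          t_pow_eigen[OF tE(1)[OF \<psi>(1) i(2)]])
  qed
  then have "e i (Suc i) \<otimes> E \<psi> = (\<Oplus>s\<in>{1..d}. (const (1 / of_nat d) * const ((?z / ?w) ^ s)) \<odot> E \<psi>)"
    unfolding e_def by (simp add: finsum_ldistr Pi_iff cong: finsum_cong)
  also have "\<dots> = (const (1 / of_nat d) * const (\<Sum>s=1..d. (?z / ?w) ^ s)) \<odot> E \<psi>"
    by (simp only: smult_sum[symmetric] E_closed const_sum sum_distrib_left)
  \<comment> \<open>The index runs over 1..d rather than 0..d-1; the shift costs a factor
    \<open>?z / ?w\<close>, which is 1 in the only case that does not vanish.\<close>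
  also have "(\<Sum>s=1..d. (?z / ?w) ^ s) = (if ?z = ?w then of_nat d else 0)"
  proof -
    have "(?z / ?w) ^ d = 1" using zw by (simp add: power_divide)
    have "(\<Sum>s=1..d. (?z / ?w) ^ s) = (\<Sum>s<d. (?z / ?w) ^ Suc s)"
      by (rule sum.reindex_bij_witness[of _ Suc "\<lambda>s. s - 1"]) auto
    also have "\<dots> = ?z / ?w * (\<Sum>s<d. (?z / ?w) ^ s)" by (simp add: sum_distrib_left)
    also have "\<dots> = (if ?z = ?w then of_nat d else 0)"
      using root_of_unity_sum[OF \<open>(?z / ?w) ^ d = 1\<close>] w0 by simp
    finally show ?thesis .
  qed
  finally have e: "e i (Suc i) \<otimes> E \<psi> = (if \<chi> i = \<chi> (Suc i) then E \<psi> else \<zero>)"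
    using d by (auto simp: \<psi>)
  have "g i \<otimes> (g i \<otimes> E \<chi>) = (u_pow 2 \<odot> \<one> \<oplus> v \<odot> (e i (Suc i) \<otimes> g i)) \<otimes> E \<chi>"
    using quadratic_e[OF assms(3)] by (simp flip: m_assoc)
  also have "\<dots> = u_pow 2 \<odot> E \<chi> \<oplus> v \<odot> (e i (Suc i) \<otimes> E \<psi> \<otimes> g i)"
    by (simp add: l_distr m_assoc gE)
  also have "\<dots> = (if \<chi> i = \<chi> (Suc i) then u_pow 2 \<odot> E \<chi> \<oplus> v \<odot> (g i \<otimes> E \<chi>) else u_pow 2 \<odot> E \<chi>)"
    by (simp add: e gE)
  finally show ?thesis .
qed

text \<open>The factors \<open>P j (\<chi> j)\<close> are stripped from the right: summing over all
  values at the last position replaces that factor by the identity. After \<open>n\<close> rounds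
  only \<open>y\<close> is left.\<close>

lemma E_separates:
  assumes "y \<in> carrier A" "\<And>\<chi>. \<chi> \<in> Irr_T d n \<Longrightarrow> y \<otimes> E \<chi> = \<zero>"
  shows "y = \<zero>"
proof -
  let ?L = "\<lambda>\<chi> k. list_prod A (map (\<lambda>j. P j (\<chi> j)) [1..<Suc k])"
  have cl: "?L \<chi> k \<in> carrier A" for \<chi> k by (rule list_prod_closed) auto
  have "k \<le> n \<Longrightarrow> \<forall>\<chi>\<in>Irr_T d n. y \<otimes> ?L \<chi> (n - k) = \<zero>" for k
  proof (induct k)
    case 0
    then show ?case using assms(2) by (simp add: E_def)
  next
    case (Suc k)
    let ?m = "n - Suc k"
    have m: "n - k = Suc ?m" "Suc ?m \<in> {1..n}" using Suc by auto
    show ?case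
    proof
      fix \<chi> assume \<chi>: "\<chi> \<in> Irr_T d n"
      have "y \<otimes> ?L \<chi> ?m \<otimes> P (Suc ?m) z = \<zero>" if "z ^ d = 1" for z
      proof -
        \<comment> \<open>Changing one value gives another character, to which the induction
          hypothesis applies; the earlier factors do not see the change.\<close>
        let ?\<chi> = "\<chi>(Suc ?m := z)"
        have "?\<chi> \<in> Irr_T d n"
          using \<chi> m(2) that by (auto simp: Irr_T_def PiE_iff extensional_def)
        then have "y \<otimes> ?L ?\<chi> (Suc ?m) = \<zero>" using Suc m by (metis Suc_leD)
        moreover have "?L ?\<chi> (Suc ?m) = ?L ?\<chi> ?m \<otimes> P (Suc ?m) z"
        proof -
          have "[1..<Suc (Suc ?m)] = [1..<Suc ?m] @ [Suc ?m]" by simp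
          then show ?thesis by (simp add: list_prod_append image_subset_iff del: upt_Suc)
        qed
        moreover have "?L ?\<chi> ?m = ?L \<chi> ?m"
          by (intro arg_cong[where f = "list_prod A"] map_cong) auto
        ultimately show ?thesis using assms(1) cl by (simp add: m_assoc del: upt_Suc)
      qed
      then have "y \<otimes> ?L \<chi> ?m \<otimes> (\<Oplus>z\<in>{z. z ^ d = 1}. P (Suc ?m) z) = \<zero>"
        using assms(1) cl[of \<chi> ?m] d
        by (subst finsum_rdistr)
          (auto intro!: finite_roots_unity add.finprod_one_eqI simp: Pi_iff simp del: upt_Suc)
      then show "y \<otimes> ?L \<chi> ?m = \<zero>"
        using P_sum[OF m(2)] assms(1) cl[of \<chi> ?m] by (simp del: upt_Suc)
    qed
  qed
  from this[of n] have "\<forall>\<chi>\<in>Irr_T d n. y = \<zero>" using assms(1) by simp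
  moreover have "(\<lambda>j\<in>{1..n}. 1) \<in> Irr_T d n" by (auto simp: Irr_T_def)
  ultimately show ?thesis by blast
qed

end

subsection \<open>The presented algebra\<close>

lemma keys_diff_subset: "\<lbrakk>Poly_Mapping.keys f \<subseteq> S; Poly_Mapping.keys g \<subseteq> S\<rbrakk> \<Longrightarrow> Poly_Mapping.keys (f - g) \<subseteq> S"
  by (meson Poly_Mapping.keys_diff Un_least order_trans)

lemma keys_sum_subset: "(\<And>i. i \<in> I \<Longrightarrow> Poly_Mapping.keys (f i) \<subseteq> S) \<Longrightarrow> Poly_Mapping.keys (\<Sum>i\<in>I. f i) \<subseteq> S"
  by (induct I rule: infinite_finite_induct) (simp_all add: keys_add_subset)

definition quadratic_rhs :: "nat \<Rightarrow> nat \<Rightarrow> yh_gen list \<Rightarrow>\<^sub>0 K" where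
  "quadratic_rhs d i = Poly_Mapping.single [] (u_pow 2)
    + (\<Sum>s=1..d. Poly_Mapping.single (replicate s (T i) @ replicate (d - s) (T (Suc i)) @ [G i])
         (v * const (1 / of_nat d)))"

lemma yh_gens_simps [simp]:
  "G i \<in> yh_gens n \<longleftrightarrow> i \<in> {1..<n}" "T i \<in> yh_gens n \<longleftrightarrow> i \<in> {1..n}"
  "X1 \<in> yh_gens n \<longleftrightarrow> 1 \<le> n" "X1_inv \<in> yh_gens n \<longleftrightarrow> 1 \<le> n"
  by (auto simp: yh_gens_def One_nat_def)

lemma quadratic_rhs_keys: "i \<in> {1..<n} \<Longrightarrow> Poly_Mapping.keys (quadratic_rhs d i) \<subseteq> lists (yh_gens n)"
  unfolding quadratic_rhs_def
  by (intro keys_add_subset keys_sum_subset keys_single_subset) (auto simp: in_lists_conv_set)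

lemma yh_relators_keys: "r \<in> yh_relators d n \<Longrightarrow> Poly_Mapping.keys r \<subseteq> lists (yh_gens n)"
proof (induct rule: yh_relators.induct)
  case (quadratic i)
  show ?case
    unfolding quadratic_rhs_def[symmetric]
    by (intro keys_diff_subset quadratic_rhs_keys keys_single_subset) (use quadratic in auto)
next
  case (gt i j)
  then show ?case
    using simple_refl_in[OF gt(1), of j] by (intro keys_diff_subset keys_single_subset) auto
qed (intro keys_diff_subset keys_single_subset; auto simp: in_lists_conv_set)+

lemma YH_presented: "YH d n = presented (yh_gens n) (yh_relators d n)"
  by (simp add: YH_def presented_def yh_ideal_def)

lemma yh_elt_pres: "yh_elt d n = pres_gen (yh_gens n) (yh_relators d n)"
  by (simp add: fun_eq_iff yh_elt_def pres_gen_def yh_ideal_def)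

lemma sum_free_algebra: "(\<Oplus>\<^bsub>free_algebra S :: ('k::comm_ring_1, _) module\<^esub>i\<in>I. f i) = (\<Sum>i\<in>I. f i)"
  if "\<And>i. i \<in> I \<Longrightarrow> Poly_Mapping.keys (f i) \<subseteq> lists S"
proof -
  interpret F: kalgebra "free_algebra S :: ('k, _) module" by (rule kalgebra_free_algebra)
  show ?thesis
    using that
  proof (induct I rule: infinite_finite_induct)
    case (insert x I)
    then show ?case by (subst F.finsum_insert) auto
  qed (auto simp: F.finsum_infinite)
qed

text \<open>Out of range the value is the identity, since \<open>yokonuma\<close> asks for families
  with all values in the carrier. The same convention holds for \<open>tY\<close>, \<open>xY\<close>
  and \<open>xiY\<close>.\<close>

definition gY :: "nat \<Rightarrow> nat \<Rightarrow> nat \<Rightarrow> (yh_gen list \<Rightarrow>\<^sub>0 K) set" where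
  "gY d n i = (if i \<in> {1..<n} then yh_elt d n (G i) else \<one>\<^bsub>YH d n\<^esub>)"

definition tY :: "nat \<Rightarrow> nat \<Rightarrow> nat \<Rightarrow> (yh_gen list \<Rightarrow>\<^sub>0 K) set" where
  "tY d n i = (if i \<in> {1..n} then yh_elt d n (T i) else \<one>\<^bsub>YH d n\<^esub>)"

definition xY :: "nat \<Rightarrow> nat \<Rightarrow> (yh_gen list \<Rightarrow>\<^sub>0 K) set" where
  "xY d n = (if 1 \<le> n then yh_elt d n X1 else \<one>\<^bsub>YH d n\<^esub>)"

definition xiY :: "nat \<Rightarrow> nat \<Rightarrow> (yh_gen list \<Rightarrow>\<^sub>0 K) set" where
  "xiY d n = (if 1 \<le> n then yh_elt d n X1_inv else \<one>\<^bsub>YH d n\<^esub>)"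

context
  fixes d n :: nat
begin

interpretation Y: presentation "yh_gens n" "yh_relators d n"
  rewrites "presented (yh_gens n) (yh_relators d n) = YH d n"
    and "pres_gen (yh_gens n) (yh_relators d n) = yh_elt d n"
proof -
  show "presentation (yh_gens n) (yh_relators d n)"
    by unfold_locales (rule yh_relators_keys)
qed (simp_all add: YH_presented yh_elt_pres)

lemma kalgebra_YH: "kalgebra (YH d n)"
  by (rule Y.P.kalgebra_axioms)

lemma yh_elt_closed: "s \<in> yh_gens n \<Longrightarrow> yh_elt d n s \<in> carrier (YH d n)"
  by (rule Y.gen_closed)

lemmas YH_hom_exists = Y.hom_exists

lemmas YH_induct [consumes 1, case_names one gen smult add mult] = Y.induct_gen

lemma yh_word_relation:
  assumes "word xs - word ys \<in> yh_relators d n" "xs \<in> lists (yh_gens n)" "ys \<in> lists (yh_gens n)"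
  shows "list_prod (YH d n) (map (yh_elt d n) xs) = list_prod (YH d n) (map (yh_elt d n) ys)"
proof -
  have cl: "list_prod (YH d n) (map (yh_elt d n) zs) \<in> carrier (YH d n)" if "zs \<in> lists (yh_gens n)" for zs
    using that by (intro Y.P.list_prod_closed) (auto simp: in_lists_conv_set)
  show ?thesis
    using Y.relation[OF assms(1)] assms(2,3) cl by (simp add: keys_single_subset Y.word_coset)
qed

text \<open>The one relator that is not a difference of two words; its right-hand side is pushed
  through the quotient map term by term.\<close>

lemma yh_quadratic_relation:
  assumes i: "i \<in> {1..<n}"
  shows "yh_elt d n (G i) \<otimes>\<^bsub>YH d n\<^esub> yh_elt d n (G i) = u_pow 2 \<odot>\<^bsub>YH d n\<^esub> \<one>\<^bsub>YH d n\<^esub> \<oplus>\<^bsub>YH d n\<^esub>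
    (\<Oplus>\<^bsub>YH d n\<^esub>s\<in>{1..d}. (v * const (1 / of_nat d)) \<odot>\<^bsub>YH d n\<^esub>
      (yh_elt d n (T i) [^]\<^bsub>YH d n\<^esub> s \<otimes>\<^bsub>YH d n\<^esub>
        (yh_elt d n (T (Suc i)) [^]\<^bsub>YH d n\<^esub> (d - s) \<otimes>\<^bsub>YH d n\<^esub> yh_elt d n (G i))))"
proof -
  let ?F = "free_algebra (yh_gens n) :: (K, _) module"
  let ?c = "v * const (1 / of_nat d)"
  let ?w = "\<lambda>s. replicate s (T i) @ replicate (d - s) (T (Suc i)) @ [G i]"
  have w: "?w s \<in> lists (yh_gens n)" for s
    using i by (auto simp: in_lists_conv_set)
  have gen: "yh_elt d n (T i) \<in> carrier (YH d n)" "yh_elt d n (T (Suc i)) \<in> carrier (YH d n)"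
    "yh_elt d n (G i) \<in> carrier (YH d n)"
    using i by auto
  have lw: "list_prod (YH d n) (map (yh_elt d n) (?w s)) = yh_elt d n (T i) [^]\<^bsub>YH d n\<^esub> s \<otimes>\<^bsub>YH d n\<^esub>
      (yh_elt d n (T (Suc i)) [^]\<^bsub>YH d n\<^esub> (d - s) \<otimes>\<^bsub>YH d n\<^esub> yh_elt d n (G i))" for s
    using gen by (simp add: Y.P.list_prod_append Y.P.list_prod_replicate set_replicate_conv_if)
  have "yh_elt d n (G i) \<otimes>\<^bsub>YH d n\<^esub> yh_elt d n (G i) = yh_ideal d n +>\<^bsub>?F\<^esub> word [G i, G i]"
    using Y.word_coset[of "[G i, G i]" 1] gen i by (simp add: yh_ideal_def)
  also have "\<dots> = yh_ideal d n +>\<^bsub>?F\<^esub> quadratic_rhs d i"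
    unfolding yh_ideal_def
    by (rule Y.relation) (use i yh_relators.quadratic[OF i, of d] in
        \<open>auto simp: quadratic_rhs_def[symmetric] quadratic_rhs_keys keys_single_subset\<close>)
  also have "quadratic_rhs d i = Poly_Mapping.single [] (u_pow 2) \<oplus>\<^bsub>?F\<^esub>
      (\<Oplus>\<^bsub>?F\<^esub>s\<in>{1..d}. Poly_Mapping.single (?w s) ?c)"
    using w by (subst sum_free_algebra) (auto simp: quadratic_rhs_def keys_single_subset)
  also have "yh_ideal d n +>\<^bsub>?F\<^esub> \<dots> = (yh_ideal d n +>\<^bsub>?F\<^esub> Poly_Mapping.single [] (u_pow 2)) \<oplus>\<^bsub>YH d n\<^esub>
      (\<Oplus>\<^bsub>YH d n\<^esub>s\<in>{1..d}. yh_ideal d n +>\<^bsub>?F\<^esub> Poly_Mapping.single (?w s) ?c)"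
  proof -
    have "(\<Oplus>\<^bsub>?F\<^esub>s\<in>{1..d}. Poly_Mapping.single (?w s) ?c) \<in> carrier ?F"
      by (intro Y.F.finsum_closed Pi_I) (use w in \<open>simp add: keys_single_subset\<close>)
    moreover have "Poly_Mapping.single [] (u_pow 2) \<in> carrier ?F" by simp
    moreover have "(\<lambda>s. Poly_Mapping.single (?w s) ?c) \<in> {1..d} \<rightarrow> carrier ?F"
      using w by (intro Pi_I) (simp add: keys_single_subset)
    ultimately show ?thesis
      unfolding yh_ideal_def by (simp only: Y.proj.add Y.proj.finsum)
  qed
  also have "(\<Oplus>\<^bsub>YH d n\<^esub>s\<in>{1..d}. yh_ideal d n +>\<^bsub>?F\<^esub> Poly_Mapping.single (?w s) ?c) =
      (\<Oplus>\<^bsub>YH d n\<^esub>s\<in>{1..d}. ?c \<odot>\<^bsub>YH d n\<^esub> (yh_elt d n (T i) [^]\<^bsub>YH d n\<^esub> s \<otimes>\<^bsub>YH d n\<^esub>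
        (yh_elt d n (T (Suc i)) [^]\<^bsub>YH d n\<^esub> (d - s) \<otimes>\<^bsub>YH d n\<^esub> yh_elt d n (G i))))"
    unfolding yh_ideal_def Y.word_coset[OF w] lw ..
  also have "yh_ideal d n +>\<^bsub>?F\<^esub> Poly_Mapping.single [] (u_pow 2) = u_pow 2 \<odot>\<^bsub>YH d n\<^esub> \<one>\<^bsub>YH d n\<^esub>"
    unfolding yh_ideal_def by (subst Y.word_coset) auto
  finally show ?thesis .
qed

lemma yokonuma_YH:
  assumes "1 \<le> d"
  shows "yokonuma (YH d n) d n (gY d n) (tY d n) (xY d n) (xiY d n)"
proof
  note [simp] = gY_def tY_def xY_def xiY_def
  show "1 \<le> d" by fact
  show "gY d n i \<in> carrier (YH d n)" "tY d n i \<in> carrier (YH d n)" "xY d n \<in> carrier (YH d n)"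
    "xiY d n \<in> carrier (YH d n)" for i by auto
  note rel = yh_word_relation
  {
    fix i j assume "i \<in> {1..<n}" "j \<in> {1..<n}" "Suc i < j"
    then show "gY d n i \<otimes>\<^bsub>YH d n\<^esub> gY d n j = gY d n j \<otimes>\<^bsub>YH d n\<^esub> gY d n i"
      using rel[OF yh_relators.gg_far[of i n j d]] by simp
  next
    fix i assume "i \<in> {1..<n}" "Suc i \<in> {1..<n}"
    then show "gY d n i \<otimes>\<^bsub>YH d n\<^esub> (gY d n (Suc i) \<otimes>\<^bsub>YH d n\<^esub> gY d n i) =
        gY d n (Suc i) \<otimes>\<^bsub>YH d n\<^esub> (gY d n i \<otimes>\<^bsub>YH d n\<^esub> gY d n (Suc i))"
      using rel[OF yh_relators.ggg[of i n d]] by simp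
  next
    assume "1 < n"
    then show "xY d n \<otimes>\<^bsub>YH d n\<^esub> (gY d n 1 \<otimes>\<^bsub>YH d n\<^esub> (xY d n \<otimes>\<^bsub>YH d n\<^esub> gY d n 1)) =
        gY d n 1 \<otimes>\<^bsub>YH d n\<^esub> (xY d n \<otimes>\<^bsub>YH d n\<^esub> (gY d n 1 \<otimes>\<^bsub>YH d n\<^esub> xY d n))"
      using rel[OF yh_relators.XgXg[of n d]] by simp
  next
    fix i assume "i \<in> {2..<n}"
    then show "xY d n \<otimes>\<^bsub>YH d n\<^esub> gY d n i = gY d n i \<otimes>\<^bsub>YH d n\<^esub> xY d n"
      using rel[OF yh_relators.Xg[of i n d]] by simp
  next
    fix i j assume "i \<in> {1..n}" "j \<in> {1..n}"
    then show "tY d n i \<otimes>\<^bsub>YH d n\<^esub> tY d n j = tY d n j \<otimes>\<^bsub>YH d n\<^esub> tY d n i"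
      using rel[OF yh_relators.tt[of i n j d]] by simp
  next
    fix i j assume "i \<in> {1..<n}" "j \<in> {1..n}"
    then show "gY d n i \<otimes>\<^bsub>YH d n\<^esub> tY d n j = tY d n (simple_refl i j) \<otimes>\<^bsub>YH d n\<^esub> gY d n i"
      using rel[OF yh_relators.gt[of i n j d]] simple_refl_in[of i n j] by simp
  next
    fix j assume "j \<in> {1..n}"
    then show "tY d n j [^]\<^bsub>YH d n\<^esub> d = \<one>\<^bsub>YH d n\<^esub>"
      using rel[OF yh_relators.t_order[of j n d]]
      by (simp add: Y.P.list_prod_replicate in_lists_conv_set)
  next
    fix j assume "j \<in> {1..n}"
    then show "xY d n \<otimes>\<^bsub>YH d n\<^esub> tY d n j = tY d n j \<otimes>\<^bsub>YH d n\<^esub> xY d n"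
      using rel[OF yh_relators.Xt[of j n d]] by simp
  next
    assume "1 \<le> n"
    then show "xY d n \<otimes>\<^bsub>YH d n\<^esub> xiY d n = \<one>\<^bsub>YH d n\<^esub>" "xiY d n \<otimes>\<^bsub>YH d n\<^esub> xY d n = \<one>\<^bsub>YH d n\<^esub>"
      using rel[OF yh_relators.X_inv_right[of n d]] rel[OF yh_relators.X_inv_left[of n d]] by simp_all
  next
    fix i assume i: "i \<in> {1..<n}"
    then show "gY d n i \<otimes>\<^bsub>YH d n\<^esub> gY d n i = u_pow 2 \<odot>\<^bsub>YH d n\<^esub> \<one>\<^bsub>YH d n\<^esub> \<oplus>\<^bsub>YH d n\<^esub>
      (\<Oplus>\<^bsub>YH d n\<^esub>s\<in>{1..d}. (v * const (1 / of_nat d)) \<odot>\<^bsub>YH d n\<^esub>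
      (tY d n i [^]\<^bsub>YH d n\<^esub> s \<otimes>\<^bsub>YH d n\<^esub> (tY d n (Suc i) [^]\<^bsub>YH d n\<^esub> (d - s) \<otimes>\<^bsub>YH d n\<^esub> gY d n i)))"
      using yh_quadratic_relation[OF i] by simp
  }
qed

end

section \<open>The universal property of the affine Yokonuma--Hecke algebra\<close>

lemma (in kalgebra) word_ext_diff:
  assumes "f \<in> S \<rightarrow> carrier A" "Poly_Mapping.keys r \<subseteq> lists S" "Poly_Mapping.keys s \<subseteq> lists S"
    "word_ext A f r = word_ext A f s"
  shows "word_ext A f (r - s) = \<zero>"
proof -
  interpret F: kalgebra "free_algebra S :: ('k, _) module" by (rule kalgebra_free_algebra)
  interpret W: kalgebra_hom "free_algebra S" A "word_ext A f"
    by unfold_locales (rule word_ext_hom[OF assms(1)])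
  have cl: "r - s \<in> carrier (free_algebra S)" "s \<in> carrier (free_algebra S)"
    using assms by (auto dest: set_mp[OF keys_diff_subset])
  have "word_ext A f (r - s) \<oplus> word_ext A f s = word_ext A f s"
    using W.add[OF cl] assms(4) by simp
  then show ?thesis
    using W.closed[OF cl(1)] W.closed[OF cl(2)] add.r_cancel_one[of "word_ext A f s"] by simp
qed

lemma (in kalgebra) word_ext_word:
  "f ` set xs \<subseteq> carrier A \<Longrightarrow> word_ext A f (Poly_Mapping.single xs c) = c \<odot> list_prod A (map f xs)"
  unfolding word_ext_def by (rule lin_ext_single) (auto intro!: list_prod_closed)

context yokonuma
begin

text \<open>Every relator is a difference, and the extension to words gives both of its sides the
  same value by the corresponding axiom of the locale.\<close>

lemma hom_exists:
  obtains h where "h \<in> alg_hom (YH d n) A" "\<And>i. i \<in> {1..<n} \<Longrightarrow> h (yh_elt d n (G i)) = g i"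
    "\<And>j. j \<in> {1..n} \<Longrightarrow> h (yh_elt d n (T j)) = t j"
    "1 \<le> n \<Longrightarrow> h (yh_elt d n X1) = x" "1 \<le> n \<Longrightarrow> h (yh_elt d n X1_inv) = xi"
proof -
  define f where "f = case_yh_gen g x xi t"
  have f_simps [simp]: "f (G i) = g i" "f (T i) = t i" "f X1 = x" "f X1_inv = xi" for i
    by (simp_all add: f_def)
  have fcl: "f a \<in> carrier A" for a by (cases a) simp_all
  then have f: "f \<in> yh_gens n \<rightarrow> carrier A" by simp
  have word: "word_ext A f (Poly_Mapping.single xs c) = c \<odot> list_prod A (map f xs)" for xs c
    by (rule word_ext_word) (use fcl in auto)
  have lcl: "list_prod A (map f xs) \<in> carrier A" for xs
    by (rule list_prod_closed) (use fcl in auto)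
  have ww: "word_ext A f (word xs - word ys) = \<zero>"
    if "xs \<in> lists (yh_gens n)" "ys \<in> lists (yh_gens n)" "list_prod A (map f xs) = list_prod A (map f ys)" for xs ys
    by (rule word_ext_diff[OF f]) (use that lcl in \<open>simp_all add: word keys_single_subset\<close>)
  note rels = gg_far' ggg tt gt t_order quadratic
  have van: "word_ext A f r = \<zero>" if "r \<in> yh_relators d n" for r
    using that
  proof (induct rule: yh_relators.induct)
    case (gg_far i j)
    then show ?case using rels(1)[of i j] by (intro ww) auto
  next
    case (ggg i)
    then show ?case using rels(2)[of i] by (intro ww) auto
  next
    case XgXg
    then show ?case using xgxg by (intro ww) auto
  next
    case (Xg i)
    then show ?case using xg[of i] by (intro ww) auto
  next
    case (tt i j)
    then show ?case using rels(3)[of i j] by (intro ww) auto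
  next
    case (gt i j)
    then show ?case using rels(4)[of i j] simple_refl_in[of i n j] by (intro ww) auto
  next
    case (t_order j)
    then show ?case using rels(5)[of j]
      by (intro ww) (auto simp: list_prod_replicate in_lists_conv_set)
  next
    case (Xt j)
    then show ?case using xt[of j] by (intro ww) auto
  next
    case X_inv_right
    then show ?case using x_inv by (intro ww) auto
  next
    case X_inv_left
    then show ?case using x_inv by (intro ww) auto
  next
    case (quadratic i)
    interpret W: kalgebra_hom "free_algebra (yh_gens n)" A "word_ext A f"
      by (intro kalgebra_hom.intro kalgebra_free_algebra kalgebra_axioms kalgebra_hom_axioms.intro
          word_ext_hom f)
    let ?F = "free_algebra (yh_gens n) :: (K, _) module"
    let ?c = "v * const (1 / of_nat d)"
    let ?w = "\<lambda>s. replicate s (T i) @ replicate (d - s) (T (Suc i)) @ [G i]"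
    have w: "?w s \<in> lists (yh_gens n)" for s
      using quadratic by (auto simp: in_lists_conv_set)
    have lw: "list_prod A (map f (?w s)) = t i [^] s \<otimes> (t (Suc i) [^] (d - s) \<otimes> g i)" for s
      by (simp add: list_prod_append list_prod_replicate set_replicate_conv_if)
    have q: "quadratic_rhs d i = Poly_Mapping.single [] (u_pow 2) \<oplus>\<^bsub>?F\<^esub>
        (\<Oplus>\<^bsub>?F\<^esub>s\<in>{1..d}. Poly_Mapping.single (?w s) ?c)"
      using w by (subst sum_free_algebra) (auto simp: quadratic_rhs_def keys_single_subset)
    have "word_ext A f (quadratic_rhs d i) = word_ext A f (Poly_Mapping.single [] (u_pow 2)) \<oplus>
        (\<Oplus>s\<in>{1..d}. word_ext A f (Poly_Mapping.single (?w s) ?c))"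
    proof -
      have "(\<Oplus>\<^bsub>?F\<^esub>s\<in>{1..d}. Poly_Mapping.single (?w s) ?c) \<in> carrier ?F"
        by (intro W.A.finsum_closed Pi_I) (use w in \<open>simp add: keys_single_subset\<close>)
      moreover have "Poly_Mapping.single [] (u_pow 2) \<in> carrier ?F" by simp
      moreover have "(\<lambda>s. Poly_Mapping.single (?w s) ?c) \<in> {1..d} \<rightarrow> carrier ?F"
        using w by (intro Pi_I) (simp add: keys_single_subset)
      ultimately show ?thesis
        unfolding q by (simp only: W.add W.finsum)
    qed
    also have "\<dots> = g i \<otimes> g i"
      unfolding word lw using rels(6)[OF quadratic] by simp
    finally show ?case
      unfolding quadratic_rhs_def[symmetric] using quadratic
      by (intro word_ext_diff[OF f]) (auto simp: word quadratic_rhs_keys keys_single_subset)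
  qed
  obtain h where "h \<in> alg_hom (YH d n) A" "\<And>s. s \<in> yh_gens n \<Longrightarrow> h (yh_elt d n s) = f s"
    using YH_hom_exists[OF kalgebra_axioms f van] by blast
  then show ?thesis by (intro that[of h]) auto
qed

end

lemma yh_X_eq:
  assumes "1 \<le> d" "i \<in> {1..n}"
  shows "yokonuma.X (YH d n) (gY d n) (xY d n) i = yh_X d n i"
proof -
  interpret yokonuma "YH d n" d n "gY d n" "tY d n" "xY d n" "xiY d n"
    by (rule yokonuma_YH[OF assms(1)])
  show ?thesis
    using assms(2)
  proof (induct i rule: X.induct)
    case 2
    then show ?case unfolding X.simps yh_X.simps by (simp add: xY_def)
  next
    case (3 i)
    have "X (Suc i) = yh_X d n (Suc i)"
      by (rule 3(1)) (use 3(2) in auto)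
    moreover have "gY d n (Suc i) = yh_elt d n (G (Suc i))"
      using 3(2) by (simp add: gY_def)
    ultimately show ?case unfolding X.simps yh_X.simps by simp
  qed simp
qed

lemma yh_E_eq:
  assumes "1 \<le> d"
  shows "yokonuma.E (YH d n) d n (tY d n) \<chi> = yh_E d n \<chi>"
proof -
  interpret yokonuma "YH d n" d n "gY d n" "tY d n" "xY d n" "xiY d n"
    by (rule yokonuma_YH[OF assms(1)])
  show ?thesis
    unfolding E_def yh_E_def P_def
    by (intro arg_cong[where f = "list_prod (YH d n)"] map_cong) (auto simp: tY_def)
qed

section \<open>The algebras of compositions\<close>

lemma (in kalgebra) nat_pow_one: "y \<in> carrier A \<Longrightarrow> y [^] (1::nat) = y"
  by (simp add: One_nat_def)

lemma (in yokonuma) X_one: "X 1 = x"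
  by (simp add: One_nat_def)

text \<open>For d = 1 the order relation itself makes each \<open>t\<close> trivial, which leaves
  the affine Hecke algebra.\<close>

lemma tY_one: "tY 1 n i = \<one>\<^bsub>YH 1 n\<^esub>"
proof (cases "i \<in> {1..n}")
  case True
  interpret yokonuma "YH 1 n" 1 n "gY 1 n" "tY 1 n" "xY 1 n" "xiY 1 n"
    by (rule yokonuma_YH) simp
  show ?thesis
    using t_order[OF True] nat_pow_one[OF t_closed[of i]] by simp
qed (auto simp: tY_def)

lemma YH_one_quadratic:
  assumes "k \<in> {1..<m}"
  shows "gY 1 m k \<otimes>\<^bsub>YH 1 m\<^esub> gY 1 m k =
    u_pow 2 \<odot>\<^bsub>YH 1 m\<^esub> \<one>\<^bsub>YH 1 m\<^esub> \<oplus>\<^bsub>YH 1 m\<^esub> v \<odot>\<^bsub>YH 1 m\<^esub> gY 1 m k"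
proof -
  interpret yokonuma "YH 1 m" 1 m "gY 1 m" "tY 1 m" "xY 1 m" "xiY 1 m"
    by (rule yokonuma_YH) simp
  show ?thesis using quadratic[OF assms] by (simp add: tY_one)
qed

text \<open>The elements whose images commute with \<open>w\<close> form a subalgebra, so testing
  generators suffices.\<close>

lemma YH_hom_commute:
  assumes B: "kalgebra B" and h: "h \<in> alg_hom (YH d n) B" and w: "w \<in> carrier B"
    and gens: "\<And>s. s \<in> yh_gens n \<Longrightarrow> w \<otimes>\<^bsub>B\<^esub> h (yh_elt d n s) = h (yh_elt d n s) \<otimes>\<^bsub>B\<^esub> w"
    and y: "y \<in> carrier (YH d n)"
  shows "w \<otimes>\<^bsub>B\<^esub> h y = h y \<otimes>\<^bsub>B\<^esub> w"
proof -
  interpret kalgebra_hom "YH d n" B h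
    by (intro kalgebra_hom.intro kalgebra_YH B kalgebra_hom_axioms.intro h)
  from y show ?thesis
  proof (induct rule: YH_induct)
    case (add x y)
    then show ?case using w by (simp add: B.l_distr B.r_distr)
  next
    case (mult x y)
    then show ?case using w by (simp add: B.comm_mult)
  qed (use w gens in simp_all)
qed

context
  fixes d n :: nat and \<mu> :: "nat \<Rightarrow> nat"
  assumes \<mu>: "\<mu> \<in> compositions d n"
begin

interpretation TF: tensor_family "{1..d}" "\<lambda>a. YH 1 (\<mu> a)"
  rewrites "tensor_algebra {1..d} (\<lambda>a. YH 1 (\<mu> a)) = H_mu d \<mu>"
proof -
  show "tensor_family {1..d} (\<lambda>a. YH 1 (\<mu> a))"
    by (rule tensor_family.intro) (rule kalgebra_YH)
qed (simp add: H_mu_def)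

lemma kalgebra_H_mu: "kalgebra (H_mu d \<mu>)"
  by (rule TF.T.kalgebra_axioms)

abbreviation "H \<equiv> H_mu d \<mu>"

abbreviation "tf \<equiv> tensor_factor {1..d} (\<lambda>a. YH 1 (\<mu> a))"

lemma tf_hom: "a \<in> {1..d} \<Longrightarrow> kalgebra_hom (YH 1 (\<mu> a)) H (tf a)"
  by (intro kalgebra_hom.intro kalgebra_YH kalgebra_H_mu kalgebra_hom_axioms.intro
      TF.tensor_factor_hom)

lemma H_mu_X_cum:
  assumes "a \<in> {1..d}" "k \<in> {1..\<mu> a}"
  shows "H_mu_X d \<mu> (cum \<mu> a + k) = tf a (yh_X 1 (\<mu> a) k)"
  using assms by (simp add: H_mu_X_def block_cum)

lemma H_mu_gen_cum:
  assumes "a \<in> {1..d}" "k \<in> {1..<\<mu> a}"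
  shows "H_mu_gen d \<mu> (cum \<mu> a + k) = tf a (yh_elt 1 (\<mu> a) (G k))"
  using assms by (simp add: H_mu_gen_def block_cum)

lemma H_mu_X_tf: "p \<in> {1..n} \<Longrightarrow> H_mu_X d \<mu> p =
    tf (block \<mu> p) (yokonuma.X (YH 1 (\<mu> (block \<mu> p))) (gY 1 (\<mu> (block \<mu> p))) (xY 1 (\<mu> (block \<mu> p))) (block_pos \<mu> p))"
  using block_pos_in[OF \<mu>, of p] by (simp add: H_mu_X_def yh_X_eq del: One_nat_def)

lemma H_mu_gen_tf: "p \<in> young n \<mu> \<Longrightarrow> H_mu_gen d \<mu> p = tf (block \<mu> p) (gY 1 (\<mu> (block \<mu> p)) (block_pos \<mu> p))"
  using young_block_pos(2)[OF \<mu>, of p] by (simp add: H_mu_gen_def gY_def)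

lemma young_in: "p \<in> young n \<mu> \<Longrightarrow> p \<in> {1..n}" "p \<in> young n \<mu> \<Longrightarrow> Suc p \<in> {1..n}"
  by (auto simp: young_def)

lemma YH1: "yokonuma (YH 1 m) 1 m (gY 1 m) (tY 1 m) (xY 1 m) (xiY 1 m)"
  by (rule yokonuma_YH) simp

lemma block_pos_diff:
  assumes "p \<in> {1..n}" "q \<in> {1..n}" "block \<mu> p = block \<mu> q"
  shows "int (block_pos \<mu> p) - int (block_pos \<mu> q) = int p - int q"
  using cum_block[OF \<mu> assms(1)] cum_block[OF \<mu> assms(2)] assms(3) by simp

lemma H_mu_closed [simp]:
  "p \<in> {1..n} \<Longrightarrow> H_mu_X d \<mu> p \<in> carrier H" "p \<in> young n \<mu> \<Longrightarrow> H_mu_gen d \<mu> p \<in> carrier H"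
  using kalgebra_hom.closed[OF tf_hom[OF block_in[OF \<mu>]]] yokonuma.X_closed[OF YH1]
    yokonuma.g_closed[OF YH1] young_in
  by (auto simp: H_mu_X_tf H_mu_gen_tf simp del: atLeastAtMost_iff)

text \<open>Letters of one block reduce to the relation inside the tensor factor of that block;
  letters of different blocks sit in different factors. The next two commutation rules are obtained
  in the same way.\<close>

lemma H_mu_X_comm:
  assumes "p \<in> {1..n}" "q \<in> {1..n}"
  shows "H_mu_X d \<mu> p \<otimes>\<^bsub>H\<^esub> H_mu_X d \<mu> q = H_mu_X d \<mu> q \<otimes>\<^bsub>H\<^esub> H_mu_X d \<mu> p"
proof (cases "block \<mu> p = block \<mu> q")
  case True
  let ?a = "block \<mu> q"
  interpret yokonuma "YH 1 (\<mu> ?a)" 1 "\<mu> ?a" "gY 1 (\<mu> ?a)" "tY 1 (\<mu> ?a)" "xY 1 (\<mu> ?a)" "xiY 1 (\<mu> ?a)"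
    by (rule YH1)
  interpret kalgebra_hom "YH 1 (\<mu> ?a)" H "tf ?a"
    by (rule tf_hom[OF block_in[OF \<mu> assms(2)]])
  show ?thesis
    unfolding H_mu_X_tf[OF assms(1)] H_mu_X_tf[OF assms(2)] True
    using XX[of "block_pos \<mu> p" "block_pos \<mu> q"] block_pos_in[OF \<mu> assms(1)]
      block_pos_in[OF \<mu> assms(2)] True by (simp flip: mult)
next
  case False
  show ?thesis
    unfolding H_mu_X_tf[OF assms(1)] H_mu_X_tf[OF assms(2)]
    by (rule TF.tensor_factor_commute[OF False]) (rule yokonuma.X_closed[OF YH1])+
qed

lemma H_mu_gen_X_comm:
  assumes "p \<in> young n \<mu>" "q \<in> {1..n}" "p \<noteq> q" "Suc p \<noteq> q"
  shows "H_mu_gen d \<mu> p \<otimes>\<^bsub>H\<^esub> H_mu_X d \<mu> q = H_mu_X d \<mu> q \<otimes>\<^bsub>H\<^esub> H_mu_gen d \<mu> p"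
proof (cases "block \<mu> p = block \<mu> q")
  case True
  let ?a = "block \<mu> q"
  interpret yokonuma "YH 1 (\<mu> ?a)" 1 "\<mu> ?a" "gY 1 (\<mu> ?a)" "tY 1 (\<mu> ?a)" "xY 1 (\<mu> ?a)" "xiY 1 (\<mu> ?a)"
    by (rule YH1)
  interpret kalgebra_hom "YH 1 (\<mu> ?a)" H "tf ?a"
    by (rule tf_hom[OF block_in[OF \<mu> assms(2)]])
  have "block_pos \<mu> p \<noteq> block_pos \<mu> q" "Suc (block_pos \<mu> p) \<noteq> block_pos \<mu> q"
    using block_pos_diff[OF young_in(1)[OF assms(1)] assms(2) True] assms(3,4) by auto
  then show ?thesis
    unfolding H_mu_X_tf[OF assms(2)] H_mu_gen_tf[OF assms(1)] True
    using gX[of "block_pos \<mu> q" "block_pos \<mu> p"] young_block_pos(2)[OF \<mu> assms(1)]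
      block_pos_in[OF \<mu> assms(2)] True by (simp flip: mult)
next
  case False
  show ?thesis
    unfolding H_mu_X_tf[OF assms(2)] H_mu_gen_tf[OF assms(1)]
    by (rule TF.tensor_factor_commute[OF False])
      (rule yokonuma.X_closed[OF YH1] yokonuma.g_closed[OF YH1])+
qed

lemma H_mu_gen_far:
  assumes "p \<in> young n \<mu>" "q \<in> young n \<mu>" "Suc p < q \<or> Suc q < p"
  shows "H_mu_gen d \<mu> p \<otimes>\<^bsub>H\<^esub> H_mu_gen d \<mu> q = H_mu_gen d \<mu> q \<otimes>\<^bsub>H\<^esub> H_mu_gen d \<mu> p"
proof (cases "block \<mu> p = block \<mu> q")
  case True
  let ?a = "block \<mu> q"
  interpret yokonuma "YH 1 (\<mu> ?a)" 1 "\<mu> ?a" "gY 1 (\<mu> ?a)" "tY 1 (\<mu> ?a)" "xY 1 (\<mu> ?a)" "xiY 1 (\<mu> ?a)"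
    by (rule YH1)
  interpret kalgebra_hom "YH 1 (\<mu> ?a)" H "tf ?a"
    by (rule tf_hom[OF block_in[OF \<mu> young_in(1)[OF assms(2)]]])
  have "Suc (block_pos \<mu> p) < block_pos \<mu> q \<or> Suc (block_pos \<mu> q) < block_pos \<mu> p"
    using block_pos_diff[OF young_in(1)[OF assms(1)] young_in(1)[OF assms(2)] True] assms(3) by auto
  then show ?thesis
    unfolding H_mu_gen_tf[OF assms(2)] H_mu_gen_tf[OF assms(1)] True
    using gg_far'[of "block_pos \<mu> q" "block_pos \<mu> p"] young_block_pos(2)[OF \<mu> assms(1)]
      young_block_pos(2)[OF \<mu> assms(2)] True by (auto simp flip: mult)
next
  case False
  show ?thesis
    unfolding H_mu_gen_tf[OF assms(2)] H_mu_gen_tf[OF assms(1)]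
    by (rule TF.tensor_factor_commute[OF False]) (rule yokonuma.g_closed[OF YH1])+
qed

context
  fixes p assumes p: "p \<in> young n \<mu>"
begin

interpretation Yp: yokonuma "YH 1 (\<mu> (block \<mu> p))" 1 "\<mu> (block \<mu> p)" "gY 1 (\<mu> (block \<mu> p))"
    "tY 1 (\<mu> (block \<mu> p))" "xY 1 (\<mu> (block \<mu> p))" "xiY 1 (\<mu> (block \<mu> p))"
  by (rule YH1)

interpretation tp: kalgebra_hom "YH 1 (\<mu> (block \<mu> p))" H "tf (block \<mu> p)"
  by (rule tf_hom[OF block_in[OF \<mu> young_in(1)[OF p]]])

lemma H_mu_gen_braid:
  assumes "Suc p \<in> young n \<mu>"
  shows "H_mu_gen d \<mu> p \<otimes>\<^bsub>H\<^esub> (H_mu_gen d \<mu> (Suc p) \<otimes>\<^bsub>H\<^esub> H_mu_gen d \<mu> p) =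
    H_mu_gen d \<mu> (Suc p) \<otimes>\<^bsub>H\<^esub> (H_mu_gen d \<mu> p \<otimes>\<^bsub>H\<^esub> H_mu_gen d \<mu> (Suc p))"
  using Yp.ggg[of "block_pos \<mu> p"] young_block_pos[OF \<mu> p] young_block_pos[OF \<mu> assms]
  unfolding H_mu_gen_tf[OF p] H_mu_gen_tf[OF assms] by (simp flip: tp.mult)

lemma H_mu_gen_quadratic:
  "H_mu_gen d \<mu> p \<otimes>\<^bsub>H\<^esub> H_mu_gen d \<mu> p = u_pow 2 \<odot>\<^bsub>H\<^esub> \<one>\<^bsub>H\<^esub> \<oplus>\<^bsub>H\<^esub> v \<odot>\<^bsub>H\<^esub> H_mu_gen d \<mu> p"
  unfolding H_mu_gen_tf[OF p] tp.mult[symmetric, OF Yp.g_closed Yp.g_closed]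
    YH_one_quadratic[OF young_block_pos(2)[OF \<mu> p]] by simp

lemma H_mu_gXg:
  "H_mu_gen d \<mu> p \<otimes>\<^bsub>H\<^esub> (H_mu_X d \<mu> p \<otimes>\<^bsub>H\<^esub> H_mu_gen d \<mu> p) = u_pow 2 \<odot>\<^bsub>H\<^esub> H_mu_X d \<mu> (Suc p)"
proof -
  note bp = young_block_pos[OF \<mu> p]
  have "1 \<le> block_pos \<mu> p" using bp(2) by simp
  from Yp.gXg[OF this] show ?thesis
    unfolding H_mu_gen_tf[OF p] H_mu_X_tf[OF young_in(1)[OF p]] H_mu_X_tf[OF young_in(2)[OF p]] bp(1,3)
    by (simp flip: tp.mult tp.smult)
qed

end

lemma H_mu_X_Units: "p \<in> {1..n} \<Longrightarrow> H_mu_X d \<mu> p \<in> Units H"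
  unfolding H_mu_X_tf
  by (rule kalgebra_hom.Units[OF tf_hom[OF block_in[OF \<mu>]] yokonuma.X_Units[OF YH1]])
    (use block_pos_in[OF \<mu>] in blast)+

text \<open>Pure tensors are products of factors, and each factor is generated by its own g, X and
  inverse of X. The inverses form a case of their own because the factors are presented with
  \<open>X1_inv\<close>; the generators \<open>T\<close> are trivial for d = 1.\<close>

lemma H_mu_induct [consumes 1, case_names one X X_inv gen smult add mult]:
  assumes "y \<in> carrier H" "Q \<one>\<^bsub>H\<^esub>"
    and X: "\<And>p. p \<in> {1..n} \<Longrightarrow> Q (H_mu_X d \<mu> p)" "\<And>p. p \<in> {1..n} \<Longrightarrow> Q (inv\<^bsub>H\<^esub> H_mu_X d \<mu> p)"
    and gen: "\<And>p. p \<in> young n \<mu> \<Longrightarrow> Q (H_mu_gen d \<mu> p)"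
    and smult: "\<And>c x. \<lbrakk>x \<in> carrier H; Q x\<rbrakk> \<Longrightarrow> Q (c \<odot>\<^bsub>H\<^esub> x)"
    and add: "\<And>x y. \<lbrakk>x \<in> carrier H; y \<in> carrier H; Q x; Q y\<rbrakk> \<Longrightarrow> Q (x \<oplus>\<^bsub>H\<^esub> y)"
    and mult: "\<And>x y. \<lbrakk>x \<in> carrier H; y \<in> carrier H; Q x; Q y\<rbrakk> \<Longrightarrow> Q (x \<otimes>\<^bsub>H\<^esub> y)"
  shows "Q y"
proof -
  have tf: "Q (tf a z) \<and> tf a z \<in> carrier H" if a: "a \<in> {1..d}" and z: "z \<in> carrier (YH 1 (\<mu> a))" for a z
  proof -
    interpret tf: kalgebra_hom "YH 1 (\<mu> a)" H "tf a" by (rule tf_hom[OF a])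
    interpret yokonuma "YH 1 (\<mu> a)" 1 "\<mu> a" "gY 1 (\<mu> a)" "tY 1 (\<mu> a)" "xY 1 (\<mu> a)" "xiY 1 (\<mu> a)"
      by (rule YH1)
    from z have "Q (tf a z)"
    proof (induct rule: YH_induct)
      case (gen s)
      show ?case
      proof (cases s)
        case (G k)
        then show ?thesis
          using gen a H_mu_gen_cum[OF a, of k] cum_young[OF \<mu> a, of k]
            \<open>\<And>p. p \<in> young n \<mu> \<Longrightarrow> Q (H_mu_gen d \<mu> p)\<close>[of "cum \<mu> a + k"] by simp
      next
        case (T k)
        then show ?thesis
          using gen tY_one[of "\<mu> a" k] assms(2) by (simp add: tY_def)
      next
        case X1
        then have m: "1 \<in> {1..\<mu> a}" using gen by simp
        moreover have "cum \<mu> a + 1 \<in> {1..n}" using m cum_bound[OF \<mu> a] by auto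
        ultimately show ?thesis
          using X1 H_mu_X_cum[OF a m] X(1)[of "cum \<mu> a + 1"] by (simp add: One_nat_def)
      next
        case X1_inv
        then have m: "1 \<in> {1..\<mu> a}" using gen by simp
        have c: "cum \<mu> a + 1 \<in> {1..n}" using m cum_bound[OF \<mu> a] by auto
        have x: "xY 1 (\<mu> a) = yh_X 1 (\<mu> a) 1" "xiY 1 (\<mu> a) = yh_elt 1 (\<mu> a) X1_inv"
          using m by (simp_all add: xY_def xiY_def One_nat_def)
        have "inv\<^bsub>YH 1 (\<mu> a)\<^esub> xY 1 (\<mu> a) = xiY 1 (\<mu> a)"
          using m x_inv by (intro tf.A.inv_char) auto
        moreover have "xY 1 (\<mu> a) \<in> Units (YH 1 (\<mu> a))"
          using X_Units[OF m] by (simp only: X_one)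
        ultimately have "tf a (yh_elt 1 (\<mu> a) X1_inv) = inv\<^bsub>H\<^esub> H_mu_X d \<mu> (cum \<mu> a + 1)"
          using tf.inv[of "xY 1 (\<mu> a)"] H_mu_X_cum[OF a m] x by simp
        then show ?thesis using X1_inv X(2)[OF c] by simp
      qed
    qed (use assms(2) smult add mult in auto)
    then show ?thesis using z by simp
  qed
  show ?thesis
    using assms(1)
  proof (induct rule: TF.induct_pure)
    case (pure z)
    define "is" where "is = [1..<Suc d]"
    have "set is = {1..d}" "distinct is" by (auto simp: is_def simp del: upt_Suc)
    then have eq: "TF.pure z = list_prod H (map (\<lambda>a. tf a (z a)) is)"
      using pure by (intro TF.pure_list_prod) auto
    have "set js \<subseteq> {1..d} \<Longrightarrow> Q (list_prod H (map (\<lambda>a. tf a (z a)) js)) \<and>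
        list_prod H (map (\<lambda>a. tf a (z a)) js) \<in> carrier H" for js
    proof (induct js)
      case Nil
      then show ?case using assms(2) by simp
    next
      case (Cons a js)
      then have "Q (tf a (z a)) \<and> tf a (z a) \<in> carrier H"
        using pure by (intro tf) auto
      then show ?case using Cons mult by simp
    qed
    then show ?case
      using eq \<open>set is = {1..d}\<close> by simp
  qed (use smult add in auto)
qed

text \<open>A factor homomorphism is fixed by its g and by the \<open>\<zeta>\<close> of the first
  letter of the block, and \<open>\<gamma>\<zeta>\<gamma>\<close> then forces the remaining
  \<open>\<zeta>\<close>. Prescribing all \<open>\<zeta>\<close> matches the relations that are at
  hand in the corner of the sorted idempotent.\<close>

lemma H_mu_hom_exists:
  fixes B :: "(K, 'b) module" and \<gamma> \<zeta> :: "nat \<Rightarrow> 'b"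
  assumes B: "kalgebra B"
    and \<gamma>: "\<And>p. p \<in> young n \<mu> \<Longrightarrow> \<gamma> p \<in> carrier B" and \<zeta>: "\<And>p. p \<in> {1..n} \<Longrightarrow> \<zeta> p \<in> Units B"
    and far: "\<And>p q. \<lbrakk>p \<in> young n \<mu>; q \<in> young n \<mu>; Suc p < q\<rbrakk> \<Longrightarrow> \<gamma> p \<otimes>\<^bsub>B\<^esub> \<gamma> q = \<gamma> q \<otimes>\<^bsub>B\<^esub> \<gamma> p"
    and braid: "\<And>p. \<lbrakk>p \<in> young n \<mu>; Suc p \<in> young n \<mu>\<rbrakk> \<Longrightarrow>
      \<gamma> p \<otimes>\<^bsub>B\<^esub> (\<gamma> (Suc p) \<otimes>\<^bsub>B\<^esub> \<gamma> p) = \<gamma> (Suc p) \<otimes>\<^bsub>B\<^esub> (\<gamma> p \<otimes>\<^bsub>B\<^esub> \<gamma> (Suc p))"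
    and quad: "\<And>p. p \<in> young n \<mu> \<Longrightarrow>
      \<gamma> p \<otimes>\<^bsub>B\<^esub> \<gamma> p = u_pow 2 \<odot>\<^bsub>B\<^esub> \<one>\<^bsub>B\<^esub> \<oplus>\<^bsub>B\<^esub> v \<odot>\<^bsub>B\<^esub> \<gamma> p"
    and \<zeta>\<zeta>: "\<And>p q. \<lbrakk>p \<in> {1..n}; q \<in> {1..n}\<rbrakk> \<Longrightarrow> \<zeta> p \<otimes>\<^bsub>B\<^esub> \<zeta> q = \<zeta> q \<otimes>\<^bsub>B\<^esub> \<zeta> p"
    and \<gamma>\<zeta>: "\<And>p q. \<lbrakk>p \<in> young n \<mu>; q \<in> {1..n}; p \<noteq> q; Suc p \<noteq> q\<rbrakk> \<Longrightarrow> \<gamma> p \<otimes>\<^bsub>B\<^esub> \<zeta> q = \<zeta> q \<otimes>\<^bsub>B\<^esub> \<gamma> p"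
    and \<gamma>\<zeta>\<gamma>: "\<And>p. p \<in> young n \<mu> \<Longrightarrow> \<gamma> p \<otimes>\<^bsub>B\<^esub> (\<zeta> p \<otimes>\<^bsub>B\<^esub> \<gamma> p) = u_pow 2 \<odot>\<^bsub>B\<^esub> \<zeta> (Suc p)"
  obtains \<phi> where "\<phi> \<in> alg_hom H B" "\<And>p. p \<in> young n \<mu> \<Longrightarrow> \<phi> (H_mu_gen d \<mu> p) = \<gamma> p"
    "\<And>p. p \<in> {1..n} \<Longrightarrow> \<phi> (H_mu_X d \<mu> p) = \<zeta> p"
proof -
  interpret B: kalgebra B by fact
  have \<zeta>c: "p \<in> {1..n} \<Longrightarrow> \<zeta> p \<in> carrier B" for p using \<zeta> by (simp add: B.Units_closed)
  define g where "g a k = (if k \<in> {1..<\<mu> a} then \<gamma> (cum \<mu> a + k) else \<one>\<^bsub>B\<^esub>)" for a k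
  define x where "x a = (if 1 \<le> \<mu> a then \<zeta> (cum \<mu> a + 1) else \<one>\<^bsub>B\<^esub>)" for a
  define xi where "xi a = (if 1 \<le> \<mu> a then inv\<^bsub>B\<^esub> \<zeta> (cum \<mu> a + 1) else \<one>\<^bsub>B\<^esub>)" for a
  have cin: "cum \<mu> a + k \<in> {1..n}" if "a \<in> {1..d}" "k \<in> {1..\<mu> a}" for a k
    using that cum_bound[OF \<mu> that(1)] by auto
  note yin = cum_young[OF \<mu>]
  have yok: "yokonuma B 1 (\<mu> a) (g a) (\<lambda>_. \<one>\<^bsub>B\<^esub>) (x a) (xi a)" if a: "a \<in> {1..d}" for a
  proof
    show gc: "g a i \<in> carrier B" for i using \<gamma> yin[OF a, of i] by (auto simp: g_def)
    show xc: "x a \<in> carrier B" and "xi a \<in> carrier B"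
      using \<zeta> cin[OF a, of 1] by (auto simp: x_def xi_def B.Units_closed)
    show "g a i \<otimes>\<^bsub>B\<^esub> \<one>\<^bsub>B\<^esub> = \<one>\<^bsub>B\<^esub> \<otimes>\<^bsub>B\<^esub> g a i" "x a \<otimes>\<^bsub>B\<^esub> \<one>\<^bsub>B\<^esub> = \<one>\<^bsub>B\<^esub> \<otimes>\<^bsub>B\<^esub> x a" for i
      using gc xc by simp_all
  next
    fix i j assume "i \<in> {1..<\<mu> a}" "j \<in> {1..<\<mu> a}" "Suc i < j"
    then show "g a i \<otimes>\<^bsub>B\<^esub> g a j = g a j \<otimes>\<^bsub>B\<^esub> g a i"
      using far[OF yin yin, OF a _ a, of i j] by (simp add: g_def)
  next
    fix i assume "i \<in> {1..<\<mu> a}" "Suc i \<in> {1..<\<mu> a}"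
    then show "g a i \<otimes>\<^bsub>B\<^esub> (g a (Suc i) \<otimes>\<^bsub>B\<^esub> g a i) = g a (Suc i) \<otimes>\<^bsub>B\<^esub> (g a i \<otimes>\<^bsub>B\<^esub> g a (Suc i))"
      using braid[OF yin[OF a, of i]] yin[OF a, of "Suc i"] by (simp add: g_def)
  next
    assume m: "1 < \<mu> a"
    then have y: "cum \<mu> a + 1 \<in> young n \<mu>" using yin[OF a, of 1] by simp
    have c: "cum \<mu> a + 1 \<in> {1..n}" "Suc (cum \<mu> a + 1) \<in> {1..n}"
      using cin[OF a, of 1] cin[OF a, of 2] m by auto
    have gx: "g a 1 = \<gamma> (cum \<mu> a + 1)" "x a = \<zeta> (cum \<mu> a + 1)" using m by (auto simp: g_def x_def)
    have cl: "g a 1 \<in> carrier B" "x a \<in> carrier B" unfolding gx using \<gamma>[OF y] \<zeta>c[OF c(1)] by auto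
    \<comment> \<open>The product of g, x, g is a multiple of the next \<open>\<zeta>\<close>, so
      this relation is the commutation of two \<open>\<zeta>\<close>.\<close>
    have "x a \<otimes>\<^bsub>B\<^esub> (g a 1 \<otimes>\<^bsub>B\<^esub> (x a \<otimes>\<^bsub>B\<^esub> g a 1)) = g a 1 \<otimes>\<^bsub>B\<^esub> (x a \<otimes>\<^bsub>B\<^esub> g a 1) \<otimes>\<^bsub>B\<^esub> x a"
      unfolding gx \<gamma>\<zeta>\<gamma>[OF y] using \<zeta>\<zeta>[OF c] \<zeta>c[OF c(1)] \<zeta>c[OF c(2)] by simp
    then show "x a \<otimes>\<^bsub>B\<^esub> (g a 1 \<otimes>\<^bsub>B\<^esub> (x a \<otimes>\<^bsub>B\<^esub> g a 1)) = g a 1 \<otimes>\<^bsub>B\<^esub> (x a \<otimes>\<^bsub>B\<^esub> (g a 1 \<otimes>\<^bsub>B\<^esub> x a))"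
      using cl by (simp add: B.m_assoc)
  next
    fix i assume i: "i \<in> {2..<\<mu> a}"
    then have "i \<in> {1..<\<mu> a}" "1 \<in> {1..\<mu> a}" by auto
    then show "x a \<otimes>\<^bsub>B\<^esub> g a i = g a i \<otimes>\<^bsub>B\<^esub> x a"
      using \<gamma>\<zeta>[OF yin[OF a, of i] cin[OF a, of 1]] i by (simp add: x_def g_def)
  next
    fix i assume i: "i \<in> {1..<\<mu> a}"
    have "\<gamma> (cum \<mu> a + i) \<in> carrier B" using \<gamma> yin[OF a i] by simp
    then show "g a i \<otimes>\<^bsub>B\<^esub> g a i = u_pow 2 \<odot>\<^bsub>B\<^esub> \<one>\<^bsub>B\<^esub> \<oplus>\<^bsub>B\<^esub>
       (\<Oplus>\<^bsub>B\<^esub>s\<in>{1..1::nat}. (v * const (1 / of_nat 1)) \<odot>\<^bsub>B\<^esub> (\<one>\<^bsub>B\<^esub> [^]\<^bsub>B\<^esub> s \<otimes>\<^bsub>B\<^esub> (\<one>\<^bsub>B\<^esub> [^]\<^bsub>B\<^esub> (1 - s) \<otimes>\<^bsub>B\<^esub> g a i)))"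
      using i quad[OF yin[OF a i]] by (simp add: g_def)
  next
    assume "1 \<le> \<mu> a"
    then show "x a \<otimes>\<^bsub>B\<^esub> xi a = \<one>\<^bsub>B\<^esub>" "xi a \<otimes>\<^bsub>B\<^esub> x a = \<one>\<^bsub>B\<^esub>"
      using \<zeta>[OF cin[OF a, of 1]] by (simp_all add: x_def xi_def)
  qed simp_all
  have "\<exists>h. h \<in> alg_hom (YH 1 (\<mu> a)) B \<and> (\<forall>i\<in>{1..<\<mu> a}. h (yh_elt 1 (\<mu> a) (G i)) = \<gamma> (cum \<mu> a + i)) \<and>
      (\<forall>i\<in>{1..\<mu> a}. h (yh_elt 1 (\<mu> a) (T i)) = \<one>\<^bsub>B\<^esub>) \<and>
      (1 \<le> \<mu> a \<longrightarrow> h (yh_elt 1 (\<mu> a) X1) = \<zeta> (cum \<mu> a + 1) \<and>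
        h (yh_elt 1 (\<mu> a) X1_inv) = inv\<^bsub>B\<^esub> \<zeta> (cum \<mu> a + 1))" if "a \<in> {1..d}" for a
    by (rule yokonuma.hom_exists[OF yok[OF that]]) (auto simp: g_def x_def xi_def)
  then have "\<forall>a\<in>{1..d}. \<exists>h. h \<in> alg_hom (YH 1 (\<mu> a)) B \<and>
      (\<forall>i\<in>{1..<\<mu> a}. h (yh_elt 1 (\<mu> a) (G i)) = \<gamma> (cum \<mu> a + i)) \<and>
      (\<forall>i\<in>{1..\<mu> a}. h (yh_elt 1 (\<mu> a) (T i)) = \<one>\<^bsub>B\<^esub>) \<and>
      (1 \<le> \<mu> a \<longrightarrow> h (yh_elt 1 (\<mu> a) X1) = \<zeta> (cum \<mu> a + 1) \<and>
        h (yh_elt 1 (\<mu> a) X1_inv) = inv\<^bsub>B\<^esub> \<zeta> (cum \<mu> a + 1))" by blast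
  from bchoice[OF this] obtain h where h: "\<And>a. a \<in> {1..d} \<Longrightarrow> h a \<in> alg_hom (YH 1 (\<mu> a)) B"
    "\<And>a i. \<lbrakk>a \<in> {1..d}; i \<in> {1..<\<mu> a}\<rbrakk> \<Longrightarrow> h a (yh_elt 1 (\<mu> a) (G i)) = \<gamma> (cum \<mu> a + i)"
    "\<And>a i. \<lbrakk>a \<in> {1..d}; i \<in> {1..\<mu> a}\<rbrakk> \<Longrightarrow> h a (yh_elt 1 (\<mu> a) (T i)) = \<one>\<^bsub>B\<^esub>"
    "\<And>a. \<lbrakk>a \<in> {1..d}; 1 \<le> \<mu> a\<rbrakk> \<Longrightarrow> h a (yh_elt 1 (\<mu> a) X1) = \<zeta> (cum \<mu> a + 1)"
    "\<And>a. \<lbrakk>a \<in> {1..d}; 1 \<le> \<mu> a\<rbrakk> \<Longrightarrow> h a (yh_elt 1 (\<mu> a) X1_inv) = inv\<^bsub>B\<^esub> \<zeta> (cum \<mu> a + 1)"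
    by blast
  have inv_comm: "w \<otimes>\<^bsub>B\<^esub> inv\<^bsub>B\<^esub> z = inv\<^bsub>B\<^esub> z \<otimes>\<^bsub>B\<^esub> w"
    if "w \<otimes>\<^bsub>B\<^esub> z = z \<otimes>\<^bsub>B\<^esub> w" "w \<in> carrier B" "z \<in> Units B" for w z
  proof -
    have z: "z \<in> carrier B" "inv\<^bsub>B\<^esub> z \<in> carrier B" "z \<otimes>\<^bsub>B\<^esub> inv\<^bsub>B\<^esub> z = \<one>\<^bsub>B\<^esub>" "inv\<^bsub>B\<^esub> z \<otimes>\<^bsub>B\<^esub> z = \<one>\<^bsub>B\<^esub>"
      using that(3) by (simp_all add: B.Units_closed)
    have "inv\<^bsub>B\<^esub> z \<otimes>\<^bsub>B\<^esub> (w \<otimes>\<^bsub>B\<^esub> z) \<otimes>\<^bsub>B\<^esub> inv\<^bsub>B\<^esub> z = inv\<^bsub>B\<^esub> z \<otimes>\<^bsub>B\<^esub> w"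
      using z that(2) by (simp add: B.m_assoc)
    moreover have "inv\<^bsub>B\<^esub> z \<otimes>\<^bsub>B\<^esub> (z \<otimes>\<^bsub>B\<^esub> w) \<otimes>\<^bsub>B\<^esub> inv\<^bsub>B\<^esub> z = w \<otimes>\<^bsub>B\<^esub> inv\<^bsub>B\<^esub> z"
      using z that(2) by (simp flip: B.m_assoc)
    ultimately show ?thesis using that(1) by simp
  qed
  have comm: "h a p \<otimes>\<^bsub>B\<^esub> h b q = h b q \<otimes>\<^bsub>B\<^esub> h a p"
    if ab: "a \<in> {1..d}" "b \<in> {1..d}" "a \<noteq> b" and p: "p \<in> carrier (YH 1 (\<mu> a))" and q: "q \<in> carrier (YH 1 (\<mu> b))"
    for a b p q
  proof -
    interpret ha: kalgebra_hom "YH 1 (\<mu> a)" B "h a"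
      by (intro kalgebra_hom.intro kalgebra_YH B kalgebra_hom_axioms.intro h ab)
    interpret hb: kalgebra_hom "YH 1 (\<mu> b)" B "h b"
      by (intro kalgebra_hom.intro kalgebra_YH B kalgebra_hom_axioms.intro h ab)
    have elt: "yh_elt 1 m s \<in> carrier (YH 1 m)" if "s \<in> yh_gens m" for m s
      using that yh_elt_closed by blast
    \<comment> \<open>Different blocks have different letters. Applied with \<open>Suc\<close> as
      well, this keeps the generators of two blocks at distance at least two.\<close>
    have blk: "cum \<mu> a + i \<noteq> cum \<mu> b + j" if "i \<in> {1..\<mu> a}" "j \<in> {1..\<mu> b}" for i j
      using block_cum(1)[of a i \<mu>] block_cum(1)[of b j \<mu>] that ab by auto
    have z1: "w \<otimes>\<^bsub>B\<^esub> h c (yh_elt 1 (\<mu> c) s) = h c (yh_elt 1 (\<mu> c) s) \<otimes>\<^bsub>B\<^esub> w"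
      if "w \<in> carrier B" "c \<in> {1..d}" "s \<in> yh_gens (\<mu> c)"
        "\<And>i. i \<in> {1..<\<mu> c} \<Longrightarrow> w \<otimes>\<^bsub>B\<^esub> \<gamma> (cum \<mu> c + i) = \<gamma> (cum \<mu> c + i) \<otimes>\<^bsub>B\<^esub> w"
        "1 \<le> \<mu> c \<Longrightarrow> w \<otimes>\<^bsub>B\<^esub> \<zeta> (cum \<mu> c + 1) = \<zeta> (cum \<mu> c + 1) \<otimes>\<^bsub>B\<^esub> w" for w c s
    proof -
      have "1 \<le> \<mu> c \<Longrightarrow> \<zeta> (cum \<mu> c + 1) \<in> Units B"
        using \<zeta>[OF cin[OF that(2), of 1]] by simp
      with that h show ?thesis
        by (cases s) (auto intro!: inv_comm simp del: atLeastAtMost_iff)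
    qed
    have gg: "\<gamma> (cum \<mu> a + i) \<otimes>\<^bsub>B\<^esub> \<gamma> (cum \<mu> b + j) = \<gamma> (cum \<mu> b + j) \<otimes>\<^bsub>B\<^esub> \<gamma> (cum \<mu> a + i)"
      if "i \<in> {1..<\<mu> a}" "j \<in> {1..<\<mu> b}" for i j
      using far[of "cum \<mu> a + i" "cum \<mu> b + j"] far[of "cum \<mu> b + j" "cum \<mu> a + i"]
        yin[OF ab(1) that(1)] yin[OF ab(2) that(2)] blk[of i j] blk[of "Suc i" j] blk[of i "Suc j"] that
      by (cases "cum \<mu> a + i < cum \<mu> b + j") auto
    have gz: "\<gamma> (cum \<mu> a + i) \<otimes>\<^bsub>B\<^esub> \<zeta> (cum \<mu> b + 1) = \<zeta> (cum \<mu> b + 1) \<otimes>\<^bsub>B\<^esub> \<gamma> (cum \<mu> a + i)"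
      if "i \<in> {1..<\<mu> a}" "1 \<le> \<mu> b" for i
      using \<gamma>\<zeta>[OF yin[OF ab(1) that(1)] cin[OF ab(2), of 1]] blk[of i 1] blk[of "Suc i" 1] that by auto
    have zg: "\<gamma> (cum \<mu> b + i) \<otimes>\<^bsub>B\<^esub> \<zeta> (cum \<mu> a + 1) = \<zeta> (cum \<mu> a + 1) \<otimes>\<^bsub>B\<^esub> \<gamma> (cum \<mu> b + i)"
      if "i \<in> {1..<\<mu> b}" "1 \<le> \<mu> a" for i
      using \<gamma>\<zeta>[OF yin[OF ab(2) that(1)] cin[OF ab(1), of 1]] blk[of 1 i] blk[of 1 "Suc i"] that by auto
    have zz: "\<zeta> (cum \<mu> a + 1) \<otimes>\<^bsub>B\<^esub> \<zeta> (cum \<mu> b + 1) = \<zeta> (cum \<mu> b + 1) \<otimes>\<^bsub>B\<^esub> \<zeta> (cum \<mu> a + 1)"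
      if "1 \<le> \<mu> a" "1 \<le> \<mu> b"
      using \<zeta>\<zeta>[OF cin[OF ab(1), of 1] cin[OF ab(2), of 1]] that by simp
    \<comment> \<open>Commutation is extended in two passes: from the generators of factor
      \<open>b\<close> to all its elements, then, with such an element fixed, from the generators of
      factor \<open>a\<close>.\<close>
    have A: "w \<otimes>\<^bsub>B\<^esub> h b q = h b q \<otimes>\<^bsub>B\<^esub> w"
      if "w \<in> carrier B" "\<And>i. i \<in> {1..<\<mu> b} \<Longrightarrow> w \<otimes>\<^bsub>B\<^esub> \<gamma> (cum \<mu> b + i) = \<gamma> (cum \<mu> b + i) \<otimes>\<^bsub>B\<^esub> w"
        "1 \<le> \<mu> b \<Longrightarrow> w \<otimes>\<^bsub>B\<^esub> \<zeta> (cum \<mu> b + 1) = \<zeta> (cum \<mu> b + 1) \<otimes>\<^bsub>B\<^esub> w" for w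
      by (rule YH_hom_commute[OF B h(1)[OF ab(2)] that(1) z1[OF that(1) ab(2) _ that(2,3)] q])
    have "h b q \<otimes>\<^bsub>B\<^esub> h a p = h a p \<otimes>\<^bsub>B\<^esub> h b q"
    proof (rule YH_hom_commute[OF B h(1)[OF ab(1)] _ z1[OF _ ab(1)] p])
      show "h b q \<in> carrier B" "h b q \<in> carrier B" using q by auto
      show "h b q \<otimes>\<^bsub>B\<^esub> \<gamma> (cum \<mu> a + i) = \<gamma> (cum \<mu> a + i) \<otimes>\<^bsub>B\<^esub> h b q" if "i \<in> {1..<\<mu> a}" for i
        by (rule A[symmetric]) (use that gg gz \<gamma> yin[OF ab(1) that] in auto)
      show "h b q \<otimes>\<^bsub>B\<^esub> \<zeta> (cum \<mu> a + 1) = \<zeta> (cum \<mu> a + 1) \<otimes>\<^bsub>B\<^esub> h b q" if "1 \<le> \<mu> a"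
        by (rule A[symmetric]) (use that zg zz \<zeta>c cin[OF ab(1), of 1] in auto)
    qed
    then show ?thesis by simp
  qed
  obtain \<phi> where \<phi>: "\<phi> \<in> alg_hom H B"
    "\<And>a p. \<lbrakk>a \<in> {1..d}; p \<in> carrier (YH 1 (\<mu> a))\<rbrakk> \<Longrightarrow> \<phi> (tf a p) = h a p"
    using TF.hom_exists[of B h] B h(1) comm by blast
  show ?thesis
  proof (rule that[OF \<phi>(1)])
    fix p assume p: "p \<in> young n \<mu>"
    let ?a = "block \<mu> p"
    have a: "?a \<in> {1..d}" using block_in[OF \<mu> young_in(1)[OF p]] .
    have "\<phi> (H_mu_gen d \<mu> p) = h ?a (yh_elt 1 (\<mu> ?a) (G (block_pos \<mu> p)))"
      unfolding H_mu_gen_def using young_block_pos(2)[OF \<mu> p] by (intro \<phi> a yh_elt_closed) simp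
    then show "\<phi> (H_mu_gen d \<mu> p) = \<gamma> p"
      using h(2)[OF a young_block_pos(2)[OF \<mu> p]] cum_block[OF \<mu> young_in(1)[OF p]] by simp
  next
    fix p assume p: "p \<in> {1..n}"
    let ?a = "block \<mu> p"
    have a: "?a \<in> {1..d}" using block_in[OF \<mu> p] .
    interpret ha: kalgebra_hom "YH 1 (\<mu> ?a)" B "h ?a"
      by (intro kalgebra_hom.intro kalgebra_YH B kalgebra_hom_axioms.intro h a)
    interpret yokonuma "YH 1 (\<mu> ?a)" 1 "\<mu> ?a" "gY 1 (\<mu> ?a)" "tY 1 (\<mu> ?a)" "xY 1 (\<mu> ?a)" "xiY 1 (\<mu> ?a)"
      by (rule YH1)
    \<comment> \<open>\<open>X\<close> is built recursively from the first letter of the block, and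
      \<open>\<gamma>\<zeta>\<gamma>\<close> reproduces this recursion for
      \<open>\<zeta>\<close>.\<close>
    have X: "h ?a (X k) = \<zeta> (cum \<mu> ?a + k)" if "k \<in> {1..\<mu> ?a}" for k
      using that
    proof (induct k rule: X.induct)
      case 2
      then have "h ?a (xY 1 (\<mu> ?a)) = \<zeta> (cum \<mu> ?a + 1)"
        using h(4)[OF a] by (simp add: xY_def)
      then show ?case unfolding X.simps(2) by (simp only: One_nat_def)
    next
      case (3 k)
      then have k: "Suc k \<in> {1..<\<mu> ?a}" by simp
      have "h ?a (gY 1 (\<mu> ?a) (Suc k)) = \<gamma> (cum \<mu> ?a + Suc k)"
        using h(2)[OF a k] k by (simp add: gY_def)
      then have "h ?a (X (Suc (Suc k))) = u_pow (-2) \<odot>\<^bsub>B\<^esub>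
          (\<gamma> (cum \<mu> ?a + Suc k) \<otimes>\<^bsub>B\<^esub> (\<zeta> (cum \<mu> ?a + Suc k) \<otimes>\<^bsub>B\<^esub> \<gamma> (cum \<mu> ?a + Suc k)))"
        using 3 \<gamma>[OF yin[OF a k]] \<zeta>c[OF cin[OF a, of "Suc k"]] by (simp add: X_Suc B.m_assoc)
      also have "\<dots> = \<zeta> (cum \<mu> ?a + Suc (Suc k))"
        using \<gamma>\<zeta>\<gamma>[OF yin[OF a k]] \<zeta>c[OF cin[OF a, of "Suc (Suc k)"]] 3 by simp
      finally show ?case .
    qed simp
    have "\<phi> (H_mu_X d \<mu> p) = h ?a (X (block_pos \<mu> p))"
      unfolding H_mu_X_tf[OF p] by (intro \<phi> a X_closed)
    then show "\<phi> (H_mu_X d \<mu> p) = \<zeta> p"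
      using X[OF block_pos_in[OF \<mu> p]] cum_block[OF \<mu> p] by simp
  qed
qed

text \<open>A descent of a block-preserving permutation cannot straddle two blocks, since values in
  a later block are larger. Sorting thus stays inside the Young subgroup, and the uniqueness of
  sorting products applies with \<open>J = young n \<mu>\<close>.\<close>

lemma H_mu_g_word:
  assumes "z permutes {1..n}" "\<And>j. j \<in> {1..n} \<Longrightarrow> block \<mu> (inv_into UNIV z j) = block \<mu> j"
    "sorts n (inv_into UNIV z) is"
  shows "list_prod H (map (H_mu_gen d \<mu>) is) = H_mu_g d n \<mu> z"
  unfolding H_mu_g_def
proof (rule kalgebra.sorts_unique[OF kalgebra_H_mu, where J = "young n \<mu>" and
      P = "\<lambda>f. f permutes {1..n} \<and> (\<forall>j\<in>{1..n}. block \<mu> (f j) = block \<mu> j)"])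
  fix f i assume f: "f permutes {1..n} \<and> (\<forall>j\<in>{1..n}. block \<mu> (f j) = block \<mu> j)"
    and i: "i \<in> {1..<n}" "f (Suc i) < f i"
  have ii: "i \<in> {1..n}" "Suc i \<in> {1..n}" using i(1) by auto
  then have fi: "f i \<in> {1..n}" "f (Suc i) \<in> {1..n}"
    using permutes_in_image[OF conjunct1[OF f]] by blast+
  have "block \<mu> (Suc i) \<le> block \<mu> i"
    using block_mono[OF \<mu> fi(2,1)] i(2) f ii by auto
  then have b: "block \<mu> (Suc i) = block \<mu> i"
    using block_mono[OF \<mu> ii] by simp
  then have y: "i \<in> young n \<mu>" using i(1) by (simp add: young_def)
  have "block \<mu> (simple_refl i j) = block \<mu> j" for j
    using b by (auto simp: simple_refl_def transpose_def)
  moreover have "f \<circ> simple_refl i permutes {1..n}"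
    using f i(1) by (intro permutes_compose simple_refl_permutes) auto
  ultimately show "i \<in> young n \<mu> \<and> (f \<circ> simple_refl i permutes {1..n} \<and>
      (\<forall>j\<in>{1..n}. block \<mu> ((f \<circ> simple_refl i) j) = block \<mu> j))"
    using f y simple_refl_in[OF i(1)] by (simp del: atLeastAtMost_iff)
next
  show "inv_into UNIV z permutes {1..n} \<and> (\<forall>j\<in>{1..n}. block \<mu> (inv_into UNIV z j) = block \<mu> j)"
    using assms(1,2) permutes_inv by blast
qed (use assms sorts_reduced_word[OF assms(1)] H_mu_gen_far H_mu_gen_braid in \<open>auto simp del: atLeastAtMost_iff\<close>)

end

section \<open>Monomial matrices\<close>

type_synonym tensor_elt = "((nat \<Rightarrow> (yh_gen list \<Rightarrow>\<^sub>0 K) set) \<Rightarrow>\<^sub>0 K) set"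

context kalgebra
begin

lemma inv_comm:
  assumes "w \<otimes> z = z \<otimes> w" "w \<in> carrier A" "z \<in> Units A"
  shows "w \<otimes> inv z = inv z \<otimes> w"
proof -
  have z: "z \<in> carrier A" "inv z \<in> carrier A" "z \<otimes> inv z = \<one>" "inv z \<otimes> z = \<one>"
    using assms(3) by (simp_all add: Units_closed)
  have "inv z \<otimes> (w \<otimes> z) \<otimes> inv z = inv z \<otimes> w"
    using z assms(2) by (simp add: m_assoc)
  moreover have "inv z \<otimes> (z \<otimes> w) \<otimes> inv z = w \<otimes> inv z"
    using z assms(2) by (simp flip: m_assoc)
  ultimately show ?thesis using assms(1) by simp
qed

lemma int_pow_closed: "z \<in> Units A \<Longrightarrow> z [^] (k::int) \<in> carrier A"
  using Units_nat_pow[of z "nat k"] Units_nat_pow[of z "nat (- k)"]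
  by (cases "k < 0") (simp_all only: int_pow_def2 if_True if_False Units_inv_closed Units_closed)

lemma comm_int_pow:
  assumes "w \<otimes> z = z \<otimes> w" "w \<in> carrier A" "z \<in> Units A"
  shows "w \<otimes> z [^] (k::int) = z [^] k \<otimes> w"
proof (cases "k < 0")
  case True
  then show ?thesis
    unfolding int_pow_def2 if_P[OF True]
    by (intro inv_comm comm_nat_pow assms Units_nat_pow) (simp add: assms Units_closed)
next
  case False
  then show ?thesis
    unfolding int_pow_def2 if_not_P[OF False]
    by (intro comm_nat_pow assms) (simp add: assms Units_closed)
qed

lemma list_prod_reorder:
  assumes "distinct xs" "distinct ys" "set xs = set ys" "f \<in> set xs \<rightarrow> carrier A"
    "\<And>x y. \<lbrakk>x \<in> set xs; y \<in> set xs\<rbrakk> \<Longrightarrow> f x \<otimes> f y = f y \<otimes> f x"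
  shows "list_prod A (map f xs) = list_prod A (map f ys)"
  using assms
proof (induct xs arbitrary: ys)
  case (Cons x xs)
  then obtain us vs where ys: "ys = us @ x # vs" by (metis list.set_intros(1) split_list)
  then have s: "set xs = set (us @ vs)" "distinct (us @ vs)" "set us \<subseteq> set xs" "set vs \<subseteq> set xs"
    using Cons(2-4) by auto
  have cl: "f x \<in> carrier A" "f ` set us \<subseteq> carrier A" "f ` set vs \<subseteq> carrier A"
    using Cons(5) s by auto
  note lcl = list_prod_closed[of "map f us"] list_prod_closed[of "map f vs"]
  have "list_prod A (map f xs) = list_prod A (map f (us @ vs))"
    by (rule Cons(1)) (use Cons(2-5) s in \<open>auto intro!: Cons(6)\<close>)
  moreover have "f x \<otimes> list_prod A (map f us) = list_prod A (map f us) \<otimes> f x"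
    using cl Cons(6) s by (intro comm_list_prod) auto
  ultimately show ?case
    using cl lcl by (simp add: ys list_prod_append comm_left)
qed simp

end

context root_enumeration
begin

abbreviation "chars \<equiv> chars_of_comp d n \<xi>"

abbreviation "Hc \<chi> \<equiv> H_mu d (comp_of \<chi>)"

abbreviation "B \<equiv> direct_sum_algebra (compositions d n) (mat_H d n \<xi>)"

lemma chars_iff: "\<chi> \<in> chars \<mu> \<longleftrightarrow> \<chi> \<in> Irr \<and> comp_of \<chi> = \<mu>"
  by (auto simp: chars_of_comp_def)

lemma finite_chars: "finite (chars \<mu>)"
  by (rule finite_subset[OF _ finite_Irr]) (auto simp: chars_iff)

lemma kalgebra_Hc: "\<chi> \<in> Irr \<Longrightarrow> kalgebra (Hc \<chi>)"
  by (rule kalgebra_H_mu[OF Comp_compositions])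

lemma kalgebra_B: "kalgebra B"
  unfolding mat_H_def
  by (intro kalgebra_direct_sum_algebra kalgebra.kalgebra_mat_algebra finite_chars)
    (rule kalgebra_H_mu)

sublocale B: kalgebra B
  by (rule kalgebra_B)

text \<open>All generators are sent to matrices with at most one nonzero entry in each row: row \<open>\<chi>\<close> has
  entry \<open>c \<chi>\<close> in column \<open>\<sigma> \<chi>\<close>.\<close>

definition monomial :: "((nat \<Rightarrow> complex) \<Rightarrow> nat \<Rightarrow> complex) \<Rightarrow>
    ((nat \<Rightarrow> complex) \<Rightarrow> tensor_elt) \<Rightarrow>
    (nat \<Rightarrow> nat) \<Rightarrow> (nat \<Rightarrow> complex) \<times> (nat \<Rightarrow> complex) \<Rightarrow> tensor_elt"
  where "monomial \<sigma> c = (\<lambda>\<mu>\<in>compositions d n. \<lambda>p\<in>chars \<mu> \<times> chars \<mu>.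
    if snd p = \<sigma> (fst p) then c (fst p) else \<zero>\<^bsub>H_mu d \<mu>\<^esub>)"

definition coeffs :: "((nat \<Rightarrow> complex) \<Rightarrow> tensor_elt) set" where
  "coeffs = {c. \<forall>\<chi>\<in>Irr. c \<chi> \<in> carrier (Hc \<chi>)}"

text \<open>Staying within one composition keeps the entry of a row inside its matrix block.\<close>

definition shifts :: "((nat \<Rightarrow> complex) \<Rightarrow> nat \<Rightarrow> complex) set" where
  "shifts = {\<sigma>. \<forall>\<chi>\<in>Irr. \<sigma> \<chi> \<in> Irr \<and> comp_of (\<sigma> \<chi>) = comp_of \<chi>}"

lemma id_shifts [simp]: "(\<lambda>\<chi>. \<chi>) \<in> shifts"
  by (simp add: shifts_def)

lemma coeffsD: "c \<in> coeffs \<Longrightarrow> \<chi> \<in> Irr \<Longrightarrow> c \<chi> \<in> carrier (Hc \<chi>)"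
  by (simp add: coeffs_def)

lemma shiftsD: "\<sigma> \<in> shifts \<Longrightarrow> \<chi> \<in> Irr \<Longrightarrow> \<sigma> \<chi> \<in> Irr" "\<sigma> \<in> shifts \<Longrightarrow> \<chi> \<in> Irr \<Longrightarrow> comp_of (\<sigma> \<chi>) = comp_of \<chi>"
  by (simp_all add: shifts_def)

lemma B_closedI:
  assumes "x \<in> extensional (compositions d n)"
    "\<And>\<mu>. \<mu> \<in> compositions d n \<Longrightarrow> x \<mu> \<in> extensional (chars \<mu> \<times> chars \<mu>)"
    "\<And>\<chi> \<psi>. \<lbrakk>\<chi> \<in> Irr; \<psi> \<in> Irr; comp_of \<psi> = comp_of \<chi>\<rbrakk> \<Longrightarrow> x (comp_of \<chi>) (\<chi>, \<psi>) \<in> carrier (Hc \<chi>)"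
  shows "x \<in> carrier B"
  unfolding direct_sum_algebra_simps mat_H_def mat_algebra_simps PiE_iff
proof (intro conjI ballI assms)
  fix \<mu> p assume "p \<in> chars \<mu> \<times> chars \<mu>"
  then obtain \<chi> \<psi> where "p = (\<chi>, \<psi>)" "\<chi> \<in> Irr" "\<psi> \<in> Irr" "comp_of \<psi> = comp_of \<chi>" "\<mu> = comp_of \<chi>"
    unfolding mem_Times_iff chars_iff by (metis prod.collapse)
  then show "x \<mu> p \<in> carrier (H_mu d \<mu>)" using assms(3) by blast
qed

lemma B_entry_closed:
  assumes "x \<in> carrier B" "\<chi> \<in> Irr" "\<psi> \<in> Irr" "comp_of \<psi> = comp_of \<chi>"
  shows "x (comp_of \<chi>) (\<chi>, \<psi>) \<in> carrier (Hc \<chi>)"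
proof -
  have "x (comp_of \<chi>) \<in> carrier (mat_H d n \<xi> (comp_of \<chi>))"
    using assms(1) Comp_compositions[OF assms(2)] unfolding direct_sum_algebra_simps by (rule PiE_mem)
  then show ?thesis
    unfolding mat_H_def mat_algebra_simps by (rule PiE_mem) (use assms in \<open>simp add: chars_iff\<close>)
qed

lemma B_ext:
  assumes "x \<in> carrier B" "y \<in> carrier B"
    "\<And>\<chi> \<psi>. \<lbrakk>\<chi> \<in> Irr; \<psi> \<in> Irr; comp_of \<psi> = comp_of \<chi>\<rbrakk> \<Longrightarrow> x (comp_of \<chi>) (\<chi>, \<psi>) = y (comp_of \<chi>) (\<chi>, \<psi>)"
  shows "x = y"
  using assms(1,2) unfolding direct_sum_algebra_simps
proof (rule PiE_ext)
  fix \<mu> assume \<mu>: "\<mu> \<in> compositions d n"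
  have "x \<mu> \<in> carrier (mat_H d n \<xi> \<mu>)" "y \<mu> \<in> carrier (mat_H d n \<xi> \<mu>)"
    using assms(1,2) PiE_mem[OF _ \<mu>] unfolding direct_sum_algebra_simps by blast+
  then show "x \<mu> = y \<mu>"
    unfolding mat_H_def mat_algebra_simps
  proof (rule PiE_ext)
    fix p assume "p \<in> chars \<mu> \<times> chars \<mu>"
    then obtain \<chi> \<psi> where "p = (\<chi>, \<psi>)" "\<chi> \<in> Irr" "\<psi> \<in> Irr" "comp_of \<psi> = comp_of \<chi>" "\<mu> = comp_of \<chi>"
      unfolding mem_Times_iff chars_iff by (metis prod.collapse)
    then show "x \<mu> p = y \<mu> p" using assms(3) by blast
  qed
qed

context
  fixes \<chi> \<psi> assumes \<chi>\<psi>: "\<chi> \<in> Irr" "\<psi> \<in> Irr" "comp_of \<psi> = comp_of \<chi>"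
begin

lemma B_mult_entry: "(x \<otimes>\<^bsub>B\<^esub> y) (comp_of \<chi>) (\<chi>, \<psi>) =
    (\<Oplus>\<^bsub>Hc \<chi>\<^esub>k\<in>chars (comp_of \<chi>). x (comp_of \<chi>) (\<chi>, k) \<otimes>\<^bsub>Hc \<chi>\<^esub> y (comp_of \<chi>) (k, \<psi>))"
  using \<chi>\<psi> Comp_compositions[of \<chi>] by (simp add: mat_H_def chars_iff)

lemma B_add_entry: "(x \<oplus>\<^bsub>B\<^esub> y) (comp_of \<chi>) (\<chi>, \<psi>) =
    x (comp_of \<chi>) (\<chi>, \<psi>) \<oplus>\<^bsub>Hc \<chi>\<^esub> y (comp_of \<chi>) (\<chi>, \<psi>)"
  using \<chi>\<psi> Comp_compositions[of \<chi>] by (simp add: mat_H_def chars_iff)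

lemma B_smult_entry: "(c \<odot>\<^bsub>B\<^esub> x) (comp_of \<chi>) (\<chi>, \<psi>) = c \<odot>\<^bsub>Hc \<chi>\<^esub> x (comp_of \<chi>) (\<chi>, \<psi>)"
  using \<chi>\<psi> Comp_compositions[of \<chi>] by (simp add: mat_H_def chars_iff)

lemma B_one_entry: "\<one>\<^bsub>B\<^esub> (comp_of \<chi>) (\<chi>, \<psi>) = (if \<psi> = \<chi> then \<one>\<^bsub>Hc \<chi>\<^esub> else \<zero>\<^bsub>Hc \<chi>\<^esub>)"
  using \<chi>\<psi> Comp_compositions[of \<chi>] by (simp add: mat_H_def chars_iff)

lemma B_zero_entry: "\<zero>\<^bsub>B\<^esub> (comp_of \<chi>) (\<chi>, \<psi>) = \<zero>\<^bsub>Hc \<chi>\<^esub>"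
  using \<chi>\<psi> Comp_compositions[of \<chi>] by (simp add: mat_H_def chars_iff)

lemma monomial_entry: "monomial \<sigma> c (comp_of \<chi>) (\<chi>, \<psi>) = (if \<psi> = \<sigma> \<chi> then c \<chi> else \<zero>\<^bsub>Hc \<chi>\<^esub>)"
  using \<chi>\<psi> Comp_compositions[of \<chi>] by (simp add: monomial_def chars_iff)

end

declare direct_sum_algebra_simps [simp del]

abbreviation "diag \<equiv> monomial (\<lambda>\<chi>. \<chi>)"

lemma monomial_closed [simp]: "c \<in> coeffs \<Longrightarrow> monomial \<sigma> c \<in> carrier B"
  by (rule B_closedI)
    (simp add: monomial_def, simp add: monomial_def, simp add: monomial_entry coeffs_def
      ring.ring_simprules(2)[OF kalgebra.axioms(1)[OF kalgebra_Hc]])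

lemma coeffs_ops [simp]:
  "(\<lambda>\<chi>. \<one>\<^bsub>Hc \<chi>\<^esub>) \<in> coeffs" "(\<lambda>\<chi>. \<zero>\<^bsub>Hc \<chi>\<^esub>) \<in> coeffs" "c \<in> coeffs \<Longrightarrow> (\<lambda>\<chi>. k \<chi> \<odot>\<^bsub>Hc \<chi>\<^esub> c \<chi>) \<in> coeffs"
  "\<lbrakk>c \<in> coeffs; e \<in> coeffs\<rbrakk> \<Longrightarrow> (\<lambda>\<chi>. c \<chi> \<oplus>\<^bsub>Hc \<chi>\<^esub> e \<chi>) \<in> coeffs"
  "\<lbrakk>c \<in> coeffs; e \<in> coeffs\<rbrakk> \<Longrightarrow> (\<lambda>\<chi>. c \<chi> \<otimes>\<^bsub>Hc \<chi>\<^esub> e \<chi>) \<in> coeffs"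
  by (simp_all add: coeffs_def kalgebra.smult_closed[OF kalgebra_Hc]
      ring.ring_simprules[OF kalgebra.axioms(1)[OF kalgebra_Hc]])

lemma coeffs_shift: "\<lbrakk>c \<in> coeffs; \<sigma> \<in> shifts\<rbrakk> \<Longrightarrow> (\<lambda>\<chi>. c (\<sigma> \<chi>)) \<in> coeffs"
  unfolding coeffs_def shifts_def by fastforce

text \<open>Where the coefficient vanishes the column is irrelevant. This freedom lets a matrix
  shaped like a swap, but with zero moving entries, be rewritten as a diagonal one.\<close>

lemma monomial_eqI:
  assumes "c \<in> coeffs" "\<And>\<chi>. \<chi> \<in> Irr \<Longrightarrow> c \<chi> = e \<chi> \<and> (\<sigma> \<chi> = \<rho> \<chi> \<or> c \<chi> = \<zero>\<^bsub>Hc \<chi>\<^esub>)"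
  shows "monomial \<sigma> c = monomial \<rho> e"
proof (rule B_ext)
  have ce: "c \<chi> = e \<chi>" "\<sigma> \<chi> = \<rho> \<chi> \<or> c \<chi> = \<zero>\<^bsub>Hc \<chi>\<^esub>" if "\<chi> \<in> Irr" for \<chi>
    using assms(2)[OF that] by blast+
  have "e \<in> coeffs" unfolding coeffs_def using coeffsD[OF assms(1)] ce(1) by fastforce
  then show "monomial \<sigma> c \<in> carrier B" "monomial \<rho> e \<in> carrier B" using assms(1) by simp_all
  fix \<chi> \<psi> assume \<chi>\<psi>: "\<chi> \<in> Irr" "\<psi> \<in> Irr" "comp_of \<psi> = comp_of \<chi>"
  show "monomial \<sigma> c (comp_of \<chi>) (\<chi>, \<psi>) = monomial \<rho> e (comp_of \<chi>) (\<chi>, \<psi>)"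
    unfolding monomial_entry[OF \<chi>\<psi>] using ce[OF \<chi>\<psi>(1)] by metis
qed

lemma monomial_one: "\<one>\<^bsub>B\<^esub> = diag (\<lambda>\<chi>. \<one>\<^bsub>Hc \<chi>\<^esub>)"
  by (rule B_ext) (simp_all add: monomial_entry B_one_entry)

lemma monomial_smult: "c \<in> coeffs \<Longrightarrow> k \<odot>\<^bsub>B\<^esub> monomial \<sigma> c = monomial \<sigma> (\<lambda>\<chi>. k \<odot>\<^bsub>Hc \<chi>\<^esub> c \<chi>)"
  by (rule B_ext) (simp_all add: monomial_entry B_smult_entry kalgebra.smult_zero_right[OF kalgebra_Hc]
     )

lemma monomial_add:
  assumes "c \<in> coeffs" "e \<in> coeffs"
  shows "monomial \<sigma> c \<oplus>\<^bsub>B\<^esub> monomial \<sigma> e = monomial \<sigma> (\<lambda>\<chi>. c \<chi> \<oplus>\<^bsub>Hc \<chi>\<^esub> e \<chi>)"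
  by (rule B_ext)
    (simp_all add: assms monomial_entry B_add_entry
      add: ring.ring_simprules[OF kalgebra.axioms(1)[OF kalgebra_Hc]])

lemma monomial_zero: "monomial \<sigma> (\<lambda>\<chi>. \<zero>\<^bsub>Hc \<chi>\<^esub>) = \<zero>\<^bsub>B\<^esub>"
  by (rule B_ext) (simp_all add: monomial_entry B_zero_entry)

lemma monomial_mult_entry:
  assumes \<sigma>: "\<sigma> \<in> shifts" and c: "c \<in> coeffs" and y: "y \<in> carrier B"
    and \<chi>\<psi>: "\<chi> \<in> Irr" "\<psi> \<in> Irr" "comp_of \<psi> = comp_of \<chi>"
  shows "(monomial \<sigma> c \<otimes>\<^bsub>B\<^esub> y) (comp_of \<chi>) (\<chi>, \<psi>) = c \<chi> \<otimes>\<^bsub>Hc \<chi>\<^esub> y (comp_of \<chi>) (\<sigma> \<chi>, \<psi>)"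
proof -
  interpret H: kalgebra "Hc \<chi>" by (rule kalgebra_Hc[OF \<chi>\<psi>(1)])
  have yc: "y (comp_of \<chi>) (k, \<psi>) \<in> carrier (Hc \<chi>)" if "k \<in> chars (comp_of \<chi>)" for k
    using B_entry_closed[OF y, of k \<psi>] that \<chi>\<psi> by (simp add: chars_iff)
  have s: "\<sigma> \<chi> \<in> chars (comp_of \<chi>)" using shiftsD[OF \<sigma> \<chi>\<psi>(1)] by (simp add: chars_iff)
  have cc: "c \<chi> \<in> carrier (Hc \<chi>)" using coeffsD[OF c \<chi>\<psi>(1)] .
  have e: "monomial \<sigma> c (comp_of \<chi>) (\<chi>, k) = (if k = \<sigma> \<chi> then c \<chi> else \<zero>\<^bsub>Hc \<chi>\<^esub>)" if "k \<in> chars (comp_of \<chi>)" for k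
    using monomial_entry[of \<chi> k] that \<chi>\<psi> by (simp add: chars_iff)
  have "(monomial \<sigma> c \<otimes>\<^bsub>B\<^esub> y) (comp_of \<chi>) (\<chi>, \<psi>) =
      monomial \<sigma> c (comp_of \<chi>) (\<chi>, \<sigma> \<chi>) \<otimes>\<^bsub>Hc \<chi>\<^esub> y (comp_of \<chi>) (\<sigma> \<chi>, \<psi>)"
    unfolding B_mult_entry[OF \<chi>\<psi>]
    by (intro H.finsum_single finite_chars s) (simp_all add: e yc s cc)
  then show ?thesis by (simp add: e s)
qed

text \<open>Row \<open>\<chi>\<close> of the product runs through \<open>\<sigma> \<chi>\<close>, so
  the second coefficient is read there.\<close>

lemma monomial_mult:
  assumes \<sigma>: "\<sigma> \<in> shifts" and c: "c \<in> coeffs" and e: "e \<in> coeffs"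
  shows "monomial \<sigma> c \<otimes>\<^bsub>B\<^esub> monomial \<rho> e = monomial (\<lambda>\<chi>. \<rho> (\<sigma> \<chi>)) (\<lambda>\<chi>. c \<chi> \<otimes>\<^bsub>Hc \<chi>\<^esub> e (\<sigma> \<chi>))"
proof (rule B_ext)
  have "(\<lambda>\<chi>. e (\<sigma> \<chi>)) \<in> coeffs" using coeffs_shift[OF e \<sigma>] .
  then show "monomial (\<lambda>\<chi>. \<rho> (\<sigma> \<chi>)) (\<lambda>\<chi>. c \<chi> \<otimes>\<^bsub>Hc \<chi>\<^esub> e (\<sigma> \<chi>)) \<in> carrier B"
    using c by (intro monomial_closed coeffs_ops)
  show "monomial \<sigma> c \<otimes>\<^bsub>B\<^esub> monomial \<rho> e \<in> carrier B" using c e by (intro B.m_closed monomial_closed)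
  fix \<chi> \<psi> assume \<chi>\<psi>: "\<chi> \<in> Irr" "\<psi> \<in> Irr" "comp_of \<psi> = comp_of \<chi>"
  note s = shiftsD[OF \<sigma> \<chi>\<psi>(1)]
  show "(monomial \<sigma> c \<otimes>\<^bsub>B\<^esub> monomial \<rho> e) (comp_of \<chi>) (\<chi>, \<psi>) =
      monomial (\<lambda>\<chi>. \<rho> (\<sigma> \<chi>)) (\<lambda>\<chi>. c \<chi> \<otimes>\<^bsub>Hc \<chi>\<^esub> e (\<sigma> \<chi>)) (comp_of \<chi>) (\<chi>, \<psi>)"
    using monomial_mult_entry[OF \<sigma> c monomial_closed[OF e] \<chi>\<psi>, of \<rho>] monomial_entry[of "\<sigma> \<chi>" \<psi> \<rho> e] \<chi>\<psi> s
      coeffsD[OF c \<chi>\<psi>(1)]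
    by (simp add: monomial_entry ring.ring_simprules[OF kalgebra.axioms(1)[OF kalgebra_Hc]]
       )
qed

lemma monomial_id_mult:
  "\<lbrakk>c \<in> coeffs; e \<in> coeffs\<rbrakk> \<Longrightarrow> diag c \<otimes>\<^bsub>B\<^esub> monomial \<rho> e = monomial \<rho> (\<lambda>\<chi>. c \<chi> \<otimes>\<^bsub>Hc \<chi>\<^esub> e \<chi>)"
  by (simp add: monomial_mult)

lemma monomial_finsum:
  assumes "\<And>s. s \<in> S \<Longrightarrow> c s \<in> coeffs"
  shows "(\<Oplus>\<^bsub>B\<^esub>s\<in>S. monomial \<sigma> (c s)) = monomial \<sigma> (\<lambda>\<chi>. \<Oplus>\<^bsub>Hc \<chi>\<^esub>s\<in>S. c s \<chi>)
    \<and> (\<lambda>\<chi>. \<Oplus>\<^bsub>Hc \<chi>\<^esub>s\<in>S. c s \<chi>) \<in> coeffs"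
proof -
  have cl: "(\<lambda>\<chi>. \<Oplus>\<^bsub>Hc \<chi>\<^esub>s\<in>S'. c s \<chi>) \<in> coeffs" if "S' \<subseteq> S" for S'
    unfolding coeffs_def
  proof (intro CollectI ballI)
    fix \<chi> assume \<chi>: "\<chi> \<in> Irr"
    interpret H: kalgebra "Hc \<chi>" by (rule kalgebra_Hc[OF \<chi>])
    show "(\<Oplus>\<^bsub>Hc \<chi>\<^esub>s\<in>S'. c s \<chi>) \<in> carrier (Hc \<chi>)"
      using coeffsD[OF assms \<chi>] that by (intro H.finsum_closed) auto
  qed
  have "S' \<subseteq> S \<Longrightarrow> (\<Oplus>\<^bsub>B\<^esub>s\<in>S'. monomial \<sigma> (c s)) = monomial \<sigma> (\<lambda>\<chi>. \<Oplus>\<^bsub>Hc \<chi>\<^esub>s\<in>S'. c s \<chi>)" for S'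
  proof (induct S' rule: infinite_finite_induct)
    case (infinite S')
    then have "monomial \<sigma> (\<lambda>\<chi>. \<Oplus>\<^bsub>Hc \<chi>\<^esub>s\<in>S'. c s \<chi>) = monomial \<sigma> (\<lambda>\<chi>. \<zero>\<^bsub>Hc \<chi>\<^esub>)"
      by (intro monomial_eqI cl)
        (simp_all add: abelian_monoid.finsum_infinite[OF abelian_group.axioms(1)[OF
          ring.is_abelian_group[OF kalgebra.axioms(1)[OF kalgebra_Hc]]]])
    with infinite show ?case by (simp add: monomial_zero B.finsum_infinite)
  next
    case empty
    have "monomial \<sigma> (\<lambda>\<chi>. \<Oplus>\<^bsub>Hc \<chi>\<^esub>s\<in>{}. c s \<chi>) = monomial \<sigma> (\<lambda>\<chi>. \<zero>\<^bsub>Hc \<chi>\<^esub>)"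
      by (intro monomial_eqI cl)
        (simp_all add: abelian_monoid.finsum_empty[OF abelian_group.axioms(1)[OF
          ring.is_abelian_group[OF kalgebra.axioms(1)[OF kalgebra_Hc]]]])
    then show ?case by (simp add: monomial_zero)
  next
    case (insert s S')
    have "(\<Oplus>\<^bsub>B\<^esub>s\<in>insert s S'. monomial \<sigma> (c s)) = monomial \<sigma> (c s) \<oplus>\<^bsub>B\<^esub> monomial \<sigma> (\<lambda>\<chi>. \<Oplus>\<^bsub>Hc \<chi>\<^esub>s\<in>S'. c s \<chi>)"
      using insert assms by (subst B.finsum_insert) auto
    also have "\<dots> = monomial \<sigma> (\<lambda>\<chi>. c s \<chi> \<oplus>\<^bsub>Hc \<chi>\<^esub> (\<Oplus>\<^bsub>Hc \<chi>\<^esub>s\<in>S'. c s \<chi>))"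
      using insert assms cl[of S'] by (intro monomial_add) auto
    also have "\<dots> = monomial \<sigma> (\<lambda>\<chi>. \<Oplus>\<^bsub>Hc \<chi>\<^esub>s\<in>insert s S'. c s \<chi>)"
    proof (rule monomial_eqI)
      show "(\<lambda>\<chi>. c s \<chi> \<oplus>\<^bsub>Hc \<chi>\<^esub> (\<Oplus>\<^bsub>Hc \<chi>\<^esub>s\<in>S'. c s \<chi>)) \<in> coeffs"
        using insert assms cl[of S'] by (intro coeffs_ops) auto
      fix \<chi> assume \<chi>: "\<chi> \<in> Irr"
      interpret H: kalgebra "Hc \<chi>" by (rule kalgebra_Hc[OF \<chi>])
      show "c s \<chi> \<oplus>\<^bsub>Hc \<chi>\<^esub> (\<Oplus>\<^bsub>Hc \<chi>\<^esub>s\<in>S'. c s \<chi>) = (\<Oplus>\<^bsub>Hc \<chi>\<^esub>s\<in>insert s S'. c s \<chi>) \<and>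
        (\<sigma> \<chi> = \<sigma> \<chi> \<or> c s \<chi> \<oplus>\<^bsub>Hc \<chi>\<^esub> (\<Oplus>\<^bsub>Hc \<chi>\<^esub>s\<in>S'. c s \<chi>) = \<zero>\<^bsub>Hc \<chi>\<^esub>)"
        using insert coeffsD[OF assms \<chi>] by (subst H.finsum_insert) auto
    qed
    finally show ?case .
  qed
  then show ?thesis using cl by blast
qed

lemma monomial_id_nat_pow:
  assumes "c \<in> coeffs"
  shows "diag c [^]\<^bsub>B\<^esub> (k::nat) = diag (\<lambda>\<chi>. c \<chi> [^]\<^bsub>Hc \<chi>\<^esub> k) \<and> (\<lambda>\<chi>. c \<chi> [^]\<^bsub>Hc \<chi>\<^esub> k) \<in> coeffs"
  by (induct k) (use assms in \<open>simp_all add: nat_pow_def monomial_one monomial_id_mult\<close>)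

lemma monomial_id_inv:
  assumes "\<And>\<chi>. \<chi> \<in> Irr \<Longrightarrow> c \<chi> \<in> Units (Hc \<chi>)"
  shows "diag c \<in> Units B" "inv\<^bsub>B\<^esub> diag c = diag (\<lambda>\<chi>. inv\<^bsub>Hc \<chi>\<^esub> c \<chi>)"
    "(\<lambda>\<chi>. inv\<^bsub>Hc \<chi>\<^esub> c \<chi>) \<in> coeffs"
proof -
  have m: "monoid (Hc \<chi>)" if "\<chi> \<in> Irr" for \<chi>
    using kalgebra.axioms(1)[OF kalgebra_Hc[OF that]] ring.is_monoid by blast
  have c: "c \<in> coeffs" unfolding coeffs_def using monoid.Units_closed[OF m assms] by blast
  show c': "(\<lambda>\<chi>. inv\<^bsub>Hc \<chi>\<^esub> c \<chi>) \<in> coeffs"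
    unfolding coeffs_def using monoid.Units_inv_closed[OF m assms] by blast
  have 1: "diag c \<otimes>\<^bsub>B\<^esub> diag (\<lambda>\<chi>. inv\<^bsub>Hc \<chi>\<^esub> c \<chi>) = \<one>\<^bsub>B\<^esub>"
    unfolding monomial_one monomial_id_mult[OF c c']
    by (rule monomial_eqI) (use c c' monoid.Units_r_inv[OF m assms] in auto)
  have 2: "diag (\<lambda>\<chi>. inv\<^bsub>Hc \<chi>\<^esub> c \<chi>) \<otimes>\<^bsub>B\<^esub> diag c = \<one>\<^bsub>B\<^esub>"
    unfolding monomial_one monomial_id_mult[OF c' c]
    by (rule monomial_eqI) (use c c' monoid.Units_l_inv[OF m assms] in auto)
  show "diag c \<in> Units B" unfolding Units_def
    using 1 2 monomial_closed[OF c] monomial_closed[OF c'] by blast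
  show "inv\<^bsub>B\<^esub> diag c = diag (\<lambda>\<chi>. inv\<^bsub>Hc \<chi>\<^esub> c \<chi>)"
    using 1 2 monomial_closed[OF c] monomial_closed[OF c'] by (intro B.inv_char) auto
qed

lemma monomial_id_int_pow:
  assumes "\<And>\<chi>. \<chi> \<in> Irr \<Longrightarrow> c \<chi> \<in> Units (Hc \<chi>)"
  shows "diag c [^]\<^bsub>B\<^esub> (k::int) = diag (\<lambda>\<chi>. c \<chi> [^]\<^bsub>Hc \<chi>\<^esub> k)"
proof -
  have c: "c \<in> coeffs"
    unfolding coeffs_def
    using monoid.Units_closed[OF ring.is_monoid[OF kalgebra.axioms(1)[OF kalgebra_Hc]] assms] by blast
  show ?thesis
  proof (cases "k < 0")
    case True
    have "c \<chi> [^]\<^bsub>Hc \<chi>\<^esub> m \<in> Units (Hc \<chi>)" if "\<chi> \<in> Irr" for \<chi> and m :: nat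
      by (rule kalgebra.Units_nat_pow[OF kalgebra_Hc[OF that] assms[OF that]])
    then show ?thesis
      using True monomial_id_nat_pow[OF c, of "nat (- k)"] monomial_id_inv(2)[of "\<lambda>\<chi>. c \<chi> [^]\<^bsub>Hc \<chi>\<^esub> nat (- k)"]
      by (simp only: int_pow_def2 if_True)
  next
    case False
    then show ?thesis
      using monomial_id_nat_pow[OF c, of "nat k"] by (simp only: int_pow_def2 if_False)
  qed
qed

lemma monomial_id_list_prod:
  assumes "\<And>j. j \<in> set js \<Longrightarrow> c j \<in> coeffs"
  shows "list_prod B (map (\<lambda>j. diag (c j)) js) = diag (\<lambda>\<chi>. list_prod (Hc \<chi>) (map (\<lambda>j. c j \<chi>) js))
    \<and> (\<lambda>\<chi>. list_prod (Hc \<chi>) (map (\<lambda>j. c j \<chi>) js)) \<in> coeffs"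
  using assms
  by (induct js) (simp_all add: monomial_one monomial_id_mult)

subsection \<open>Images of the generators\<close>

text \<open>The value u for differing values is chosen so that a swap followed by its reverse gives
  u^2, as g_i^2 does there; for equal values \<open>pos \<chi> i\<close> indexes a generator of the
  Young subgroup.\<close>

definition gc :: "nat \<Rightarrow> (nat \<Rightarrow> complex) \<Rightarrow> tensor_elt" where
  "gc i \<chi> = (if \<chi> i = \<chi> (Suc i) then H_mu_gen d (comp_of \<chi>) (pos \<chi> i) else u_pow 1 \<odot>\<^bsub>Hc \<chi>\<^esub> \<one>\<^bsub>Hc \<chi>\<^esub>)"

definition xc :: "nat \<Rightarrow> (nat \<Rightarrow> complex) \<Rightarrow> tensor_elt" where
  "xc j \<chi> = H_mu_X d (comp_of \<chi>) (pos \<chi> j)"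

definition tc :: "nat \<Rightarrow> (nat \<Rightarrow> complex) \<Rightarrow> tensor_elt" where
  "tc j \<chi> = const (\<chi> j) \<odot>\<^bsub>Hc \<chi>\<^esub> \<one>\<^bsub>Hc \<chi>\<^esub>"

abbreviation "sw i \<equiv> (\<lambda>\<chi>. \<chi> \<circ> simple_refl i)"

lemma sw_shifts: "i \<in> {1..<n} \<Longrightarrow> sw i \<in> shifts"
  by (simp add: shifts_def Irr_swap)

lemma Hc_one: "\<chi> \<in> Irr \<Longrightarrow> \<one>\<^bsub>Hc \<chi>\<^esub> \<in> carrier (Hc \<chi>)"
  using coeffsD[OF coeffs_ops(1)] .

lemma xc_Units: "\<chi> \<in> Irr \<Longrightarrow> j \<in> {1..n} \<Longrightarrow> xc j \<chi> \<in> Units (Hc \<chi>)"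
  unfolding xc_def using H_mu_X_Units[OF Comp_compositions] pos_in by blast

lemma xc_coeffs: "j \<in> {1..n} \<Longrightarrow> xc j \<in> coeffs"
  unfolding coeffs_def xc_def using H_mu_closed(1)[OF Comp_compositions] pos_in by blast

lemma tc_coeffs: "tc j \<in> coeffs"
  unfolding tc_def by (intro coeffs_ops)

lemma gc_closed: "i \<in> {1..<n} \<Longrightarrow> \<chi> \<in> Irr \<Longrightarrow> gc i \<chi> \<in> carrier (Hc \<chi>)"
  unfolding gc_def using H_mu_closed(2)[OF Comp_compositions pos_Suc(2)]
  by (simp add: kalgebra.smult_closed[OF kalgebra_Hc] Hc_one)

lemma gc_coeffs: "i \<in> {1..<n} \<Longrightarrow> gc i \<in> coeffs"
  using gc_closed by (simp add: coeffs_def)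

lemma pos_eq_iff [simp]: "pos \<chi> i = pos \<chi> j \<longleftrightarrow> i = j"
  by (simp add: pos_def)

lemma comp_sw: "i \<in> {1..<n} \<Longrightarrow> \<chi> \<in> Irr \<Longrightarrow> comp_of (\<chi> \<circ> simple_refl i) = comp_of \<chi>"
  using Irr_swap(2) by blast

lemma pos_sw:
  assumes "\<chi> \<in> Irr" "i \<in> {1..<n}" "\<chi> i \<noteq> \<chi> (Suc i) \<or> j \<noteq> i \<and> j \<noteq> Suc i"
  shows "pos (\<chi> \<circ> simple_refl i) j = pos \<chi> (simple_refl i j)"
proof (cases "\<chi> i = \<chi> (Suc i)")
  case True
  then show ?thesis using assms(3) swap_same[OF True] by (simp add: simple_refl_other)
next
  case False
  then show ?thesis using pos_swap[OF assms(1,2)] by simp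
qed

lemma gc_sw_far:
  assumes "\<chi> \<in> Irr" "i \<in> {1..<n}" "Suc i < j \<or> Suc j < i"
  shows "gc j (\<chi> \<circ> simple_refl i) = gc j \<chi>"
proof -
  have "simple_refl i j = j" "simple_refl i (Suc j) = Suc j"
    using assms(3) by (auto simp: simple_refl_other)
  moreover have "pos (\<chi> \<circ> simple_refl i) j = pos \<chi> j"
    using pos_sw[OF assms(1,2), of j] assms(3) calculation by auto
  ultimately show ?thesis
    unfolding gc_def comp_sw[OF assms(2,1)] by simp
qed

lemma gc_far:
  assumes \<chi>: "\<chi> \<in> Irr" and i: "i \<in> {1..<n}" and j: "j \<in> {1..<n}" and ij: "Suc i < j"
  shows "gc i \<chi> \<otimes>\<^bsub>Hc \<chi>\<^esub> gc j (\<chi> \<circ> simple_refl i) = gc j \<chi> \<otimes>\<^bsub>Hc \<chi>\<^esub> gc i (\<chi> \<circ> simple_refl j)"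
proof -
  interpret H: kalgebra "Hc \<chi>" by (rule kalgebra_Hc[OF \<chi>])
  have "gc i \<chi> \<otimes>\<^bsub>Hc \<chi>\<^esub> gc j \<chi> = gc j \<chi> \<otimes>\<^bsub>Hc \<chi>\<^esub> gc i \<chi>"
  proof (cases "\<chi> i = \<chi> (Suc i) \<and> \<chi> j = \<chi> (Suc j)")
    case True
    note y = pos_Suc[OF \<chi> i conjunct1[OF True]] pos_Suc[OF \<chi> j conjunct2[OF True]]
    have "pos \<chi> i \<noteq> pos \<chi> j" "pos \<chi> (Suc i) \<noteq> pos \<chi> j" "pos \<chi> i \<noteq> pos \<chi> (Suc j)"
      using ij by simp_all
    \<comment> \<open>Equal neighbours occupy consecutive places after sorting; two such disjoint
      pairs are at distance at least two, in one order or the other.\<close>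
    then have "Suc (pos \<chi> i) < pos \<chi> j \<or> Suc (pos \<chi> j) < pos \<chi> i"
      unfolding y(1,3) by linarith
    then show ?thesis
      using H_mu_gen_far[OF Comp_compositions[OF \<chi>] y(2,4)] True by (simp add: gc_def)
  next
    case False
    then show ?thesis
      using gc_closed[OF i \<chi>] gc_closed[OF j \<chi>] by (auto simp: gc_def)
  qed
  then show ?thesis using gc_sw_far[OF \<chi> i, of j] gc_sw_far[OF \<chi> j, of i] ij by simp
qed

lemma gc_eval:
  assumes "\<chi> \<in> Irr"
  shows "\<chi> i = \<chi> (Suc i) \<Longrightarrow> gc i \<chi> = H_mu_gen d (comp_of \<chi>) (pos \<chi> i)"
    "\<chi> i \<noteq> \<chi> (Suc i) \<Longrightarrow> gc i \<chi> = u_pow 1 \<odot>\<^bsub>Hc \<chi>\<^esub> \<one>\<^bsub>Hc \<chi>\<^esub>"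
  by (simp_all add: gc_def)

text \<open>Everything depends on which of three consecutive values coincide. If all do, this is the
  braid relation of the Hecke algebra; if exactly two do, each side is u^2 times one generator at
  the same sorted place; if none do, both sides are u^3.\<close>

lemma gc_braid:
  assumes \<chi>: "\<chi> \<in> Irr" and i: "i \<in> {1..<n}" and j: "Suc i \<in> {1..<n}"
  shows "gc i \<chi> \<otimes>\<^bsub>Hc \<chi>\<^esub> (gc (Suc i) (\<chi> \<circ> simple_refl i) \<otimes>\<^bsub>Hc \<chi>\<^esub> gc i (\<chi> \<circ> simple_refl i \<circ> simple_refl (Suc i))) =
    gc (Suc i) \<chi> \<otimes>\<^bsub>Hc \<chi>\<^esub> (gc i (\<chi> \<circ> simple_refl (Suc i)) \<otimes>\<^bsub>Hc \<chi>\<^esub> gc (Suc i) (\<chi> \<circ> simple_refl (Suc i) \<circ> simple_refl i))"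
proof -
  interpret H: kalgebra "Hc \<chi>" by (rule kalgebra_Hc[OF \<chi>])
  define s where "s = simple_refl i"
  define r where "r = simple_refl (Suc i)"
  define \<chi>1 where "\<chi>1 = \<chi> \<circ> s"
  define \<chi>2 where "\<chi>2 = \<chi> \<circ> r"
  define \<chi>3 where "\<chi>3 = \<chi> \<circ> s \<circ> r"
  define \<chi>4 where "\<chi>4 = \<chi> \<circ> r \<circ> s"
  have sr: "s i = Suc i" "s (Suc i) = i" "s (Suc (Suc i)) = Suc (Suc i)"
    "r i = i" "r (Suc i) = Suc (Suc i)" "r (Suc (Suc i)) = Suc i"
    by (simp_all add: s_def r_def simple_refl_other)
  have irr: "\<chi>1 \<in> Irr" "\<chi>2 \<in> Irr" "\<chi>3 \<in> Irr" "\<chi>4 \<in> Irr"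
    unfolding \<chi>1_def \<chi>2_def \<chi>3_def \<chi>4_def s_def r_def by (intro Irr_swap(1) \<chi> i j)+
  have cmp: "comp_of \<chi>1 = comp_of \<chi>" "comp_of \<chi>2 = comp_of \<chi>" "comp_of \<chi>3 = comp_of \<chi>" "comp_of \<chi>4 = comp_of \<chi>"
    using irr unfolding \<chi>1_def \<chi>2_def \<chi>3_def \<chi>4_def s_def r_def by (simp_all only: comp_sw i j \<chi> Irr_swap(1))
  have vals: "\<chi>1 i = \<chi> (Suc i)" "\<chi>1 (Suc i) = \<chi> i" "\<chi>1 (Suc (Suc i)) = \<chi> (Suc (Suc i))"
    "\<chi>2 i = \<chi> i" "\<chi>2 (Suc i) = \<chi> (Suc (Suc i))" "\<chi>2 (Suc (Suc i)) = \<chi> (Suc i)"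
    "\<chi>3 i = \<chi> (Suc i)" "\<chi>3 (Suc i) = \<chi> (Suc (Suc i))" "\<chi>3 (Suc (Suc i)) = \<chi> i"
    "\<chi>4 i = \<chi> (Suc (Suc i))" "\<chi>4 (Suc i) = \<chi> i" "\<chi>4 (Suc (Suc i)) = \<chi> (Suc i)"
    by (simp_all add: \<chi>1_def \<chi>2_def \<chi>3_def \<chi>4_def sr)
  have p1: "\<chi> i \<noteq> \<chi> (Suc i) \<Longrightarrow> pos \<chi>1 k = pos \<chi> (s k)" for k
    unfolding \<chi>1_def s_def by (rule pos_sw[OF \<chi> i]) simp
  have p2: "\<chi> (Suc i) \<noteq> \<chi> (Suc (Suc i)) \<Longrightarrow> pos \<chi>2 k = pos \<chi> (r k)" for k
    unfolding \<chi>2_def r_def by (rule pos_sw[OF \<chi> j]) simp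
  have p3: "\<chi> i \<noteq> \<chi> (Suc (Suc i)) \<Longrightarrow> pos \<chi>3 k = pos \<chi>1 (r k)" for k
    using pos_sw[OF irr(1) j, of k] vals by (simp add: \<chi>3_def \<chi>1_def r_def)
  have p4: "\<chi> i \<noteq> \<chi> (Suc (Suc i)) \<Longrightarrow> pos \<chi>4 k = pos \<chi>2 (s k)" for k
    using pos_sw[OF irr(2) i, of k] vals by (simp add: \<chi>4_def \<chi>2_def s_def)
  have e1: "\<chi> i = \<chi> (Suc i) \<Longrightarrow> \<chi>1 = \<chi>" and e2: "\<chi> (Suc i) = \<chi> (Suc (Suc i)) \<Longrightarrow> \<chi>2 = \<chi>"
    unfolding \<chi>1_def \<chi>2_def s_def r_def by (auto intro: swap_same)
  have e3: "\<chi> i = \<chi> (Suc (Suc i)) \<Longrightarrow> \<chi>3 = \<chi>1" and e4: "\<chi> i = \<chi> (Suc (Suc i)) \<Longrightarrow> \<chi>4 = \<chi>2"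
    using swap_same[of \<chi>1 "Suc i"] swap_same[of \<chi>2 i] vals
    by (simp_all add: \<chi>1_def \<chi>2_def \<chi>3_def \<chi>4_def s_def r_def)
  have g: "gc k \<psi> \<in> carrier (Hc \<chi>)" if "k \<in> {1..<n}" "\<psi> \<in> Irr" "comp_of \<psi> = comp_of \<chi>" for k \<psi>
    using gc_closed[OF that(1,2)] that(3) by simp
  have hcl: "H_mu_gen d (comp_of \<chi>) p \<in> carrier (Hc \<chi>)" if "p \<in> young n (comp_of \<chi>)" for p
    using H_mu_closed(2)[OF Comp_compositions[OF \<chi>] that] .
  note ev = gc_eval[OF irr(1)] gc_eval[OF irr(2)] gc_eval[OF irr(3)] gc_eval[OF irr(4)] gc_eval[OF \<chi>]
  have "gc i \<chi> \<otimes>\<^bsub>Hc \<chi>\<^esub> (gc (Suc i) \<chi>1 \<otimes>\<^bsub>Hc \<chi>\<^esub> gc i \<chi>3) = gc (Suc i) \<chi> \<otimes>\<^bsub>Hc \<chi>\<^esub> (gc i \<chi>2 \<otimes>\<^bsub>Hc \<chi>\<^esub> gc (Suc i) \<chi>4)"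
  proof -
    consider "\<chi> i = \<chi> (Suc i)" "\<chi> (Suc i) = \<chi> (Suc (Suc i))"
      | "\<chi> i = \<chi> (Suc i)" "\<chi> (Suc i) \<noteq> \<chi> (Suc (Suc i))"
      | "\<chi> i \<noteq> \<chi> (Suc i)" "\<chi> (Suc i) = \<chi> (Suc (Suc i))"
      | "\<chi> i \<noteq> \<chi> (Suc i)" "\<chi> (Suc i) \<noteq> \<chi> (Suc (Suc i))" "\<chi> i = \<chi> (Suc (Suc i))"
      | "\<chi> i \<noteq> \<chi> (Suc i)" "\<chi> (Suc i) \<noteq> \<chi> (Suc (Suc i))" "\<chi> i \<noteq> \<chi> (Suc (Suc i))"
      by blast
    then show ?thesis
    proof cases
      case 1
      then have "\<chi>1 = \<chi>" "\<chi>2 = \<chi>" "\<chi>3 = \<chi>" "\<chi>4 = \<chi>" using e1 e2 e3 e4 by auto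
      moreover note y = pos_Suc[OF \<chi> i 1(1)] pos_Suc[OF \<chi> j 1(2)]
      ultimately show ?thesis
        using H_mu_gen_braid[OF Comp_compositions[OF \<chi>] y(2)] 1 by (simp add: gc_def)
    next
      case 2
      have y: "pos \<chi> i \<in> young n (comp_of \<chi>)" using pos_Suc[OF \<chi> i 2(1)] by simp
      \<comment> \<open>The two swaps carry the equal pair one step to the right while its sorted
        place stays the same.\<close>
      have "pos \<chi>4 (Suc i) = pos \<chi> i" using 2 p2 p4 by (simp add: sr)
      then show ?thesis
        using 2 e1 hcl[OF y] vals by (simp add: ev cmp) 
    next
      case 3
      have y: "pos \<chi> (Suc i) \<in> young n (comp_of \<chi>)" using pos_Suc[OF \<chi> j 3(2)] by simp
      have "pos \<chi>3 i = pos \<chi> (Suc i)" using 3 p1 p3 by (simp add: sr)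
      then show ?thesis
        using 3 e2 hcl[OF y] vals by (simp add: ev cmp)
    next
      case 4
      \<comment> \<open>The equal values at distance two become neighbours after either swap, so the
        Hecke generator is the middle factor on both sides.\<close>
      have q: "pos \<chi>1 (Suc i) = pos \<chi> i" "pos \<chi>2 i = pos \<chi> i" using 4 p1 p2 by (simp_all add: sr)
      have "pos \<chi>2 i \<in> young n (comp_of \<chi>2)" using pos_Suc[OF irr(2) i] vals 4 by simp
      then have y: "pos \<chi> i \<in> young n (comp_of \<chi>)" using q cmp by simp
      show ?thesis
        using 4 e3 e4 hcl[OF y] vals q by (simp add: ev cmp)
    next
      case 5
      then show ?thesis using vals by (simp add: ev cmp)
    qed
  qed
  then show ?thesis by (simp add: \<chi>1_def \<chi>2_def \<chi>3_def \<chi>4_def s_def r_def)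
qed

text \<open>For equal values this is the recursion for X in the Hecke algebra; otherwise the two
  entries u give u^2, and the swap moves the sorted place of \<open>j\<close> to that of
  \<open>Suc j\<close>.\<close>

lemma gc_X_gc:
  assumes \<chi>: "\<chi> \<in> Irr" and j: "j \<in> {1..<n}"
  shows "gc j \<chi> \<otimes>\<^bsub>Hc \<chi>\<^esub> (xc j (\<chi> \<circ> simple_refl j) \<otimes>\<^bsub>Hc \<chi>\<^esub> gc j (\<chi> \<circ> simple_refl j)) = u_pow 2 \<odot>\<^bsub>Hc \<chi>\<^esub> xc (Suc j) \<chi>"
proof -
  interpret H: kalgebra "Hc \<chi>" by (rule kalgebra_Hc[OF \<chi>])
  have x: "xc (Suc j) \<chi> \<in> carrier (Hc \<chi>)" using coeffsD[OF xc_coeffs \<chi>] j by simp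
  show ?thesis
  proof (cases "\<chi> j = \<chi> (Suc j)")
    case True
    then show ?thesis
      using H_mu_gXg[OF Comp_compositions[OF \<chi>] pos_Suc(2)[OF \<chi> j True]] swap_same[OF True]
      by (simp add: gc_def xc_def pos_Suc(1)[OF \<chi> j True])
  next
    case False
    have "xc j (\<chi> \<circ> simple_refl j) = xc (Suc j) \<chi>"
      using pos_sw[OF \<chi> j, of j] False comp_sw[OF j \<chi>] by (simp add: xc_def)
    then show ?thesis
      using False x comp_sw[OF j \<chi>] by (simp add: gc_def)
  qed
qed

lemma gc_gc:
  assumes \<chi>: "\<chi> \<in> Irr" and i: "i \<in> {1..<n}"
  shows "gc i \<chi> \<otimes>\<^bsub>Hc \<chi>\<^esub> gc i (\<chi> \<circ> simple_refl i) =
    (if \<chi> i = \<chi> (Suc i) then u_pow 2 \<odot>\<^bsub>Hc \<chi>\<^esub> \<one>\<^bsub>Hc \<chi>\<^esub> \<oplus>\<^bsub>Hc \<chi>\<^esub> v \<odot>\<^bsub>Hc \<chi>\<^esub> gc i \<chi>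
     else u_pow 2 \<odot>\<^bsub>Hc \<chi>\<^esub> \<one>\<^bsub>Hc \<chi>\<^esub>)"
proof -
  interpret H: kalgebra "Hc \<chi>" by (rule kalgebra_Hc[OF \<chi>])
  show ?thesis
  proof (cases "\<chi> i = \<chi> (Suc i)")
    case True
    then show ?thesis
      using H_mu_gen_quadratic[OF Comp_compositions[OF \<chi>] pos_Suc(2)[OF \<chi> i True]] swap_same[OF True]
      by (simp add: gc_def)
  next
    case False
    then show ?thesis using comp_sw[OF i \<chi>] by (simp add: gc_def)
  qed
qed

section \<open>The defining relations for the matrix images of the generators\<close>

definition gB :: "nat \<Rightarrow> _" where "gB i = (if i \<in> {1..<n} then monomial (sw i) (gc i) else \<one>\<^bsub>B\<^esub>)"

definition tB :: "nat \<Rightarrow> _" where "tB j = diag (tc j)"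

definition xB where "xB = diag (xc 1)"

definition xiB where "xiB = diag (\<lambda>\<chi>. inv\<^bsub>Hc \<chi>\<^esub> xc 1 \<chi>)"

lemma in_one: "1 \<in> {1..n}" using n by simp

lemma xc_comm: "\<chi> \<in> Irr \<Longrightarrow> i \<in> {1..n} \<Longrightarrow> j \<in> {1..n} \<Longrightarrow> xc i \<chi> \<otimes>\<^bsub>Hc \<chi>\<^esub> xc j \<chi> = xc j \<chi> \<otimes>\<^bsub>Hc \<chi>\<^esub> xc i \<chi>"
  unfolding xc_def using H_mu_X_comm[OF Comp_compositions] pos_in by blast

text \<open>The multiplication rule with the resulting coefficients and columns as variables, so
  that a relation between matrices becomes an identity for each row.\<close>

lemma monomial_comp:
  assumes "\<sigma> \<in> shifts" "c \<in> coeffs" "e \<in> coeffs" "\<And>\<chi>. \<chi> \<in> Irr \<Longrightarrow> c \<chi> \<otimes>\<^bsub>Hc \<chi>\<^esub> e (\<sigma> \<chi>) = f \<chi>"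
    "\<And>\<chi>. \<chi> \<in> Irr \<Longrightarrow> \<rho> (\<sigma> \<chi>) = \<tau> \<chi>"
  shows "monomial \<sigma> c \<otimes>\<^bsub>B\<^esub> monomial \<rho> e = monomial \<tau> f" "f \<in> coeffs"
proof -
  have c: "(\<lambda>\<chi>. c \<chi> \<otimes>\<^bsub>Hc \<chi>\<^esub> e (\<sigma> \<chi>)) \<in> coeffs"
    by (rule coeffs_ops(5)[OF assms(2) coeffs_shift[OF assms(3,1)]])
  show "monomial \<sigma> c \<otimes>\<^bsub>B\<^esub> monomial \<rho> e = monomial \<tau> f"
    unfolding monomial_mult[OF assms(1-3)] by (rule monomial_eqI[OF c]) (use assms(4,5) in blast)
  show "f \<in> coeffs" unfolding coeffs_def
  proof (intro CollectI ballI)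
    fix \<chi> assume "\<chi> \<in> Irr" then show "f \<chi> \<in> carrier (Hc \<chi>)" using coeffsD[OF c] assms(4) by fastforce
  qed
qed

lemma diag_xc_gB:
  assumes i: "i \<in> {2..<n}"
  shows "xB \<otimes>\<^bsub>B\<^esub> gB i = gB i \<otimes>\<^bsub>B\<^esub> xB"
proof -
  have i': "i \<in> {1..<n}" using i by auto
  have "xc 1 \<chi> \<otimes>\<^bsub>Hc \<chi>\<^esub> gc i \<chi> = gc i \<chi> \<otimes>\<^bsub>Hc \<chi>\<^esub> xc 1 (\<chi> \<circ> simple_refl i)" if \<chi>: "\<chi> \<in> Irr" for \<chi>
  proof -
    interpret H: kalgebra "Hc \<chi>" by (rule kalgebra_Hc[OF \<chi>])
    have "simple_refl i 1 = 1" using i by (intro simple_refl_other) auto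
    then have "xc 1 (\<chi> \<circ> simple_refl i) = xc 1 \<chi>"
      using pos_sw[OF \<chi> i', of 1] i comp_sw[OF i' \<chi>] by (simp add: xc_def)
    moreover have "xc 1 \<chi> \<in> carrier (Hc \<chi>)" using coeffsD[OF xc_coeffs[OF in_one] \<chi>] .
    moreover have "xc 1 \<chi> \<otimes>\<^bsub>Hc \<chi>\<^esub> gc i \<chi> = gc i \<chi> \<otimes>\<^bsub>Hc \<chi>\<^esub> xc 1 \<chi>" if eq: "\<chi> i = \<chi> (Suc i)"
    proof -
      have "pos \<chi> i \<noteq> pos \<chi> 1" "pos \<chi> (Suc i) \<noteq> pos \<chi> 1" using i by simp_all
      moreover have "pos \<chi> 1 \<in> {1..n}" using pos_in in_one by blast
      ultimately show ?thesis
        using H_mu_gen_X_comm[OF Comp_compositions[OF \<chi>] pos_Suc(2)[OF \<chi> i' eq], of "pos \<chi> 1"]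
          pos_Suc(1)[OF \<chi> i' eq] eq by (simp add: gc_def xc_def)
    qed
    ultimately show ?thesis by (cases "\<chi> i = \<chi> (Suc i)") (simp_all add: gc_def)
  qed
  then have "xB \<otimes>\<^bsub>B\<^esub> gB i = monomial (sw i) (\<lambda>\<chi>. gc i \<chi> \<otimes>\<^bsub>Hc \<chi>\<^esub> xc 1 (\<chi> \<circ> simple_refl i))"
    using i' unfolding xB_def gB_def
    by (simp only: if_True) (rule monomial_comp(1); simp add: xc_coeffs[OF in_one] gc_coeffs)
  also have "\<dots> = gB i \<otimes>\<^bsub>B\<^esub> xB"
    using i' unfolding xB_def gB_def
    by (simp only: if_True) (rule monomial_comp(1)[symmetric]; simp add: xc_coeffs[OF in_one] gc_coeffs sw_shifts)
  finally show ?thesis .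
qed

text \<open>The diagonal matrices of \<open>xc\<close> satisfy the recursion that defines the X.
  Both the relation between X_1 and g_1 and the image of every X_j are read off from this.\<close>

lemma gB_diag_gB:
  assumes j: "j \<in> {1..<n}"
  shows "gB j \<otimes>\<^bsub>B\<^esub> (diag (xc j) \<otimes>\<^bsub>B\<^esub> gB j) = u_pow 2 \<odot>\<^bsub>B\<^esub> diag (xc (Suc j))"
proof -
  have j': "j \<in> {1..n}" "Suc j \<in> {1..n}" using j by auto
  have "diag (xc j) \<otimes>\<^bsub>B\<^esub> monomial (sw j) (gc j) = monomial (sw j) (\<lambda>\<chi>. xc j \<chi> \<otimes>\<^bsub>Hc \<chi>\<^esub> gc j \<chi>)"
    and c: "(\<lambda>\<chi>. xc j \<chi> \<otimes>\<^bsub>Hc \<chi>\<^esub> gc j \<chi>) \<in> coeffs"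
    by (rule monomial_comp; simp add: xc_coeffs[OF j'(1)] gc_coeffs[OF j])+
  moreover have "monomial (sw j) (gc j) \<otimes>\<^bsub>B\<^esub> monomial (sw j) (\<lambda>\<chi>. xc j \<chi> \<otimes>\<^bsub>Hc \<chi>\<^esub> gc j \<chi>) =
      diag (\<lambda>\<chi>. u_pow 2 \<odot>\<^bsub>Hc \<chi>\<^esub> xc (Suc j) \<chi>)"
  proof (rule monomial_comp(1)[OF sw_shifts[OF j] gc_coeffs[OF j] c])
    fix \<chi> assume \<chi>: "\<chi> \<in> Irr"
    show "gc j \<chi> \<otimes>\<^bsub>Hc \<chi>\<^esub> (xc j (\<chi> \<circ> simple_refl j) \<otimes>\<^bsub>Hc (\<chi> \<circ> simple_refl j)\<^esub> gc j (\<chi> \<circ> simple_refl j)) =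
        u_pow 2 \<odot>\<^bsub>Hc \<chi>\<^esub> xc (Suc j) \<chi>"
      unfolding comp_sw[OF j \<chi>] by (rule gc_X_gc[OF \<chi> j])
  qed simp
  ultimately show ?thesis
    using j by (simp add: gB_def monomial_smult[OF xc_coeffs[OF j'(2)]])
qed

lemma tc_pow:
  assumes "\<chi> \<in> Irr" shows "tc j \<chi> [^]\<^bsub>Hc \<chi>\<^esub> (k::nat) = const (\<chi> j ^ k) \<odot>\<^bsub>Hc \<chi>\<^esub> \<one>\<^bsub>Hc \<chi>\<^esub>"
proof -
  interpret H: kalgebra "Hc \<chi>" by (rule kalgebra_Hc[OF assms])
  show ?thesis by (induct k) (simp_all add: tc_def mult.commute)
qed

lemma tB_pow: "tB j [^]\<^bsub>B\<^esub> (k::nat) = diag (\<lambda>\<chi>. const (\<chi> j ^ k) \<odot>\<^bsub>Hc \<chi>\<^esub> \<one>\<^bsub>Hc \<chi>\<^esub>)"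
  using monomial_id_nat_pow[OF tc_coeffs, of j k] unfolding tB_def
  by (metis (mono_tags, lifting) monomial_eqI tc_pow)

lemma gB_quadratic:
  assumes i: "i \<in> {1..<n}"
  shows "gB i \<otimes>\<^bsub>B\<^esub> gB i = u_pow 2 \<odot>\<^bsub>B\<^esub> \<one>\<^bsub>B\<^esub> \<oplus>\<^bsub>B\<^esub>
      (\<Oplus>\<^bsub>B\<^esub>s\<in>{1..d}. (v * const (1 / of_nat d)) \<odot>\<^bsub>B\<^esub> (tB i [^]\<^bsub>B\<^esub> s \<otimes>\<^bsub>B\<^esub> (tB (Suc i) [^]\<^bsub>B\<^esub> (d - s) \<otimes>\<^bsub>B\<^esub> gB i)))"
proof -
  have ii: "i \<in> {1..n}" "Suc i \<in> {1..n}" using i by auto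
  let ?k = "v * const (1 / of_nat d)"
  define cs where "cs s \<chi> = ?k \<odot>\<^bsub>Hc \<chi>\<^esub> ((const (\<chi> i ^ s) \<odot>\<^bsub>Hc \<chi>\<^esub> \<one>\<^bsub>Hc \<chi>\<^esub>) \<otimes>\<^bsub>Hc \<chi>\<^esub>
    ((const (\<chi> (Suc i) ^ (d - s)) \<odot>\<^bsub>Hc \<chi>\<^esub> \<one>\<^bsub>Hc \<chi>\<^esub>) \<otimes>\<^bsub>Hc \<chi>\<^esub> gc i \<chi>))" for s \<chi>
  have cs: "cs s \<in> coeffs" for s
    unfolding cs_def by (intro coeffs_ops gc_coeffs[OF i])
  have "?k \<odot>\<^bsub>B\<^esub> (tB i [^]\<^bsub>B\<^esub> s \<otimes>\<^bsub>B\<^esub> (tB (Suc i) [^]\<^bsub>B\<^esub> (d - s) \<otimes>\<^bsub>B\<^esub> gB i)) = monomial (sw i) (cs s)" for s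
    using i unfolding tB_pow gB_def cs_def
    by (simp add: monomial_id_mult monomial_smult gc_coeffs)
  then have "(\<Oplus>\<^bsub>B\<^esub>s\<in>{1..d}. ?k \<odot>\<^bsub>B\<^esub> (tB i [^]\<^bsub>B\<^esub> s \<otimes>\<^bsub>B\<^esub> (tB (Suc i) [^]\<^bsub>B\<^esub> (d - s) \<otimes>\<^bsub>B\<^esub> gB i))) =
      monomial (sw i) (\<lambda>\<chi>. \<Oplus>\<^bsub>Hc \<chi>\<^esub>s\<in>{1..d}. cs s \<chi>)"
    using monomial_finsum[of "{1..d}" cs "sw i"] cs by simp
  \<comment> \<open>The average over \<open>s\<close> vanishes unless the two values of
    \<open>\<chi>\<close> agree, and then the swap fixes \<open>\<chi>\<close>; so the shape of a
    swap may be replaced by the diagonal.\<close>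
  also have "\<dots> = diag (\<lambda>\<chi>. (if \<chi> i = \<chi> (Suc i) then v else 0) \<odot>\<^bsub>Hc \<chi>\<^esub> gc i \<chi>)"
  proof (rule monomial_eqI)
    show "(\<lambda>\<chi>. \<Oplus>\<^bsub>Hc \<chi>\<^esub>s\<in>{1..d}. cs s \<chi>) \<in> coeffs"
      using monomial_finsum[of "{1..d}" cs "sw i"] cs by simp
    fix \<chi> assume \<chi>: "\<chi> \<in> Irr"
    interpret H: kalgebra "Hc \<chi>" by (rule kalgebra_Hc[OF \<chi>])
    have g: "gc i \<chi> \<in> carrier (Hc \<chi>)" by (rule gc_closed[OF i \<chi>])
    let ?z = "\<chi> i" and ?w = "\<chi> (Suc i)"
    have zw: "?z ^ d = 1" "?w ^ d = 1" "?w \<noteq> 0" using Irr_root[OF \<chi>] Irr_nonzero[OF \<chi>] ii by auto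
    have "cs s \<chi> = (?k * const ((?z / ?w) ^ s)) \<odot>\<^bsub>Hc \<chi>\<^esub> gc i \<chi>" if "s \<le> d" for s
    proof -
      have "?w ^ s * ?w ^ (d - s) = 1" using zw that by (simp flip: power_add)
      then have "?w ^ (d - s) * ?z ^ s = (?z / ?w) ^ s"
        using zw(3) by (simp add: power_divide field_simps)
      then show ?thesis using g by (simp add: cs_def mult.assoc)
    qed
    then have "(\<Oplus>\<^bsub>Hc \<chi>\<^esub>s\<in>{1..d}. cs s \<chi>) = (\<Oplus>\<^bsub>Hc \<chi>\<^esub>s\<in>{1..d}. (?k * const ((?z / ?w) ^ s)) \<odot>\<^bsub>Hc \<chi>\<^esub> gc i \<chi>)"
      using g by (intro H.finsum_cong') auto
    also have "\<dots> = (?k * const (\<Sum>s=1..d. (?z / ?w) ^ s)) \<odot>\<^bsub>Hc \<chi>\<^esub> gc i \<chi>"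
      using g by (simp only: H.smult_sum[symmetric] const_sum sum_distrib_left)
    also have "(\<Sum>s=1..d. (?z / ?w) ^ s) = (if ?z = ?w then of_nat d else 0)"
    proof -
      have "(?z / ?w) ^ d = 1" using zw by (simp add: power_divide)
      have "(\<Sum>s=1..d. (?z / ?w) ^ s) = (\<Sum>s<d. (?z / ?w) ^ Suc s)"
        by (rule sum.reindex_bij_witness[of _ Suc "\<lambda>s. s - 1"]) auto
      also have "\<dots> = ?z / ?w * (\<Sum>s<d. (?z / ?w) ^ s)" by (simp add: sum_distrib_left)
      also have "\<dots> = (if ?z = ?w then of_nat d else 0)"
        using root_of_unity_sum[OF \<open>(?z / ?w) ^ d = 1\<close>] zw by simp
      finally show ?thesis .
    qed
    also have "?k * const (if ?z = ?w then of_nat d else 0) = (if ?z = ?w then v else 0)"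
      using d by (simp add: mult.assoc)
    finally have eq: "(\<Oplus>\<^bsub>Hc \<chi>\<^esub>s\<in>{1..d}. cs s \<chi>) = (if ?z = ?w then v else 0) \<odot>\<^bsub>Hc \<chi>\<^esub> gc i \<chi>" .
    show "(\<Oplus>\<^bsub>Hc \<chi>\<^esub>s\<in>{1..d}. cs s \<chi>) = (if ?z = ?w then v else 0) \<odot>\<^bsub>Hc \<chi>\<^esub> gc i \<chi> \<and>
        (\<chi> \<circ> simple_refl i = \<chi> \<or> (\<Oplus>\<^bsub>Hc \<chi>\<^esub>s\<in>{1..d}. cs s \<chi>) = \<zero>\<^bsub>Hc \<chi>\<^esub>)"
      unfolding eq using swap_same[of \<chi> i] g by simp
  qed
  finally have sum: "(\<Oplus>\<^bsub>B\<^esub>s\<in>{1..d}. ?k \<odot>\<^bsub>B\<^esub> (tB i [^]\<^bsub>B\<^esub> s \<otimes>\<^bsub>B\<^esub> (tB (Suc i) [^]\<^bsub>B\<^esub> (d - s) \<otimes>\<^bsub>B\<^esub> gB i))) =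
    diag (\<lambda>\<chi>. (if \<chi> i = \<chi> (Suc i) then v else 0) \<odot>\<^bsub>Hc \<chi>\<^esub> gc i \<chi>)" .
  have "gB i \<otimes>\<^bsub>B\<^esub> gB i = diag (\<lambda>\<chi>. u_pow 2 \<odot>\<^bsub>Hc \<chi>\<^esub> \<one>\<^bsub>Hc \<chi>\<^esub> \<oplus>\<^bsub>Hc \<chi>\<^esub> (if \<chi> i = \<chi> (Suc i) then v else 0) \<odot>\<^bsub>Hc \<chi>\<^esub> gc i \<chi>)"
    using i unfolding gB_def
  proof (simp only: if_True, intro monomial_comp(1) sw_shifts gc_coeffs)
    fix \<chi> assume \<chi>: "\<chi> \<in> Irr"
    interpret H: kalgebra "Hc \<chi>" by (rule kalgebra_Hc[OF \<chi>])
    show "gc i \<chi> \<otimes>\<^bsub>Hc \<chi>\<^esub> gc i (\<chi> \<circ> simple_refl i) =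
        u_pow 2 \<odot>\<^bsub>Hc \<chi>\<^esub> \<one>\<^bsub>Hc \<chi>\<^esub> \<oplus>\<^bsub>Hc \<chi>\<^esub> (if \<chi> i = \<chi> (Suc i) then v else 0) \<odot>\<^bsub>Hc \<chi>\<^esub> gc i \<chi>"
      unfolding gc_gc[OF \<chi> i] using gc_closed[OF i \<chi>] by simp
  qed simp_all
  then show ?thesis
    unfolding sum monomial_one
    by (simp add: monomial_smult monomial_add gc_coeffs[OF i])
qed

lemma yokonuma_B: "yokonuma B d n gB tB xB xiB"
proof
  show "1 \<le> d" by (rule d)
  show "gB i \<in> carrier B" for i using gc_coeffs by (simp add: gB_def)
  show "tB i \<in> carrier B" for i by (simp add: tB_def tc_coeffs)
  show "xB \<in> carrier B" by (simp add: xB_def xc_coeffs[OF in_one])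
  show "xiB \<in> carrier B"
    unfolding xiB_def by (rule monomial_closed[OF monomial_id_inv(3)]) (rule xc_Units[OF _ in_one])
next
  fix i j assume i: "i \<in> {1..<n}" and j: "j \<in> {1..<n}" and ij: "Suc i < j"
  have "monomial (sw i) (gc i) \<otimes>\<^bsub>B\<^esub> monomial (sw j) (gc j) =
      monomial (\<lambda>\<chi>. \<chi> \<circ> simple_refl j \<circ> simple_refl i) (\<lambda>\<chi>. gc j \<chi> \<otimes>\<^bsub>Hc \<chi>\<^esub> gc i (\<chi> \<circ> simple_refl j))"
    by (rule monomial_comp(1)[OF sw_shifts[OF i] gc_coeffs[OF i] gc_coeffs[OF j]])
      (use gc_far[OF _ i j ij] in \<open>auto simp: comp_assoc simple_refl_far[OF ij]\<close>)
  also have "\<dots> = monomial (sw j) (gc j) \<otimes>\<^bsub>B\<^esub> monomial (sw i) (gc i)"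
    by (rule monomial_comp(1)[symmetric, OF sw_shifts[OF j] gc_coeffs[OF j] gc_coeffs[OF i]]) auto
  finally show "gB i \<otimes>\<^bsub>B\<^esub> gB j = gB j \<otimes>\<^bsub>B\<^esub> gB i" using i j by (simp add: gB_def)
next
  fix i assume i: "i \<in> {1..<n}" and j: "Suc i \<in> {1..<n}"
  let ?s = "simple_refl i" and ?r = "simple_refl (Suc i)"
  have c: "(\<lambda>\<chi>. gc (Suc i) \<chi> \<otimes>\<^bsub>Hc \<chi>\<^esub> gc i (\<chi> \<circ> ?r)) \<in> coeffs" "(\<lambda>\<chi>. gc i \<chi> \<otimes>\<^bsub>Hc \<chi>\<^esub> gc (Suc i) (\<chi> \<circ> ?s)) \<in> coeffs"
    by (intro coeffs_ops gc_coeffs i j coeffs_shift[OF _ sw_shifts])+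
  have 1: "monomial (sw (Suc i)) (gc (Suc i)) \<otimes>\<^bsub>B\<^esub> monomial (sw i) (gc i) =
      monomial (\<lambda>\<chi>. \<chi> \<circ> ?r \<circ> ?s) (\<lambda>\<chi>. gc (Suc i) \<chi> \<otimes>\<^bsub>Hc \<chi>\<^esub> gc i (\<chi> \<circ> ?r))"
    by (rule monomial_comp(1)[OF sw_shifts[OF j] gc_coeffs[OF j] gc_coeffs[OF i]]) auto
  have 2: "monomial (sw i) (gc i) \<otimes>\<^bsub>B\<^esub> monomial (sw (Suc i)) (gc (Suc i)) =
      monomial (\<lambda>\<chi>. \<chi> \<circ> ?s \<circ> ?r) (\<lambda>\<chi>. gc i \<chi> \<otimes>\<^bsub>Hc \<chi>\<^esub> gc (Suc i) (\<chi> \<circ> ?s))"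
    by (rule monomial_comp(1)[OF sw_shifts[OF i] gc_coeffs[OF i] gc_coeffs[OF j]]) auto
  have br: "\<chi> \<circ> ?s \<circ> ?r \<circ> ?s = \<chi> \<circ> ?r \<circ> ?s \<circ> ?r" for \<chi> :: "nat \<Rightarrow> complex"
    using simple_refl_braid[of i] by (simp add: comp_assoc)
  have "monomial (sw i) (gc i) \<otimes>\<^bsub>B\<^esub> (monomial (sw (Suc i)) (gc (Suc i)) \<otimes>\<^bsub>B\<^esub> monomial (sw i) (gc i)) =
      monomial (\<lambda>\<chi>. \<chi> \<circ> ?r \<circ> ?s \<circ> ?r) (\<lambda>\<chi>. gc (Suc i) \<chi> \<otimes>\<^bsub>Hc \<chi>\<^esub> (gc i (\<chi> \<circ> ?r) \<otimes>\<^bsub>Hc \<chi>\<^esub> gc (Suc i) (\<chi> \<circ> ?r \<circ> ?s)))"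
    unfolding 1
  proof (rule monomial_comp(1)[OF sw_shifts[OF i] gc_coeffs[OF i] c(1)])
    fix \<chi> assume \<chi>: "\<chi> \<in> Irr"
    show "gc i \<chi> \<otimes>\<^bsub>Hc \<chi>\<^esub> (gc (Suc i) (\<chi> \<circ> ?s) \<otimes>\<^bsub>Hc (\<chi> \<circ> ?s)\<^esub> gc i (\<chi> \<circ> ?s \<circ> ?r)) =
        gc (Suc i) \<chi> \<otimes>\<^bsub>Hc \<chi>\<^esub> (gc i (\<chi> \<circ> ?r) \<otimes>\<^bsub>Hc \<chi>\<^esub> gc (Suc i) (\<chi> \<circ> ?r \<circ> ?s))"
      unfolding comp_sw[OF i \<chi>] by (rule gc_braid[OF \<chi> i j])
  qed (rule br)
  also have "\<dots> = monomial (sw (Suc i)) (gc (Suc i)) \<otimes>\<^bsub>B\<^esub> (monomial (sw i) (gc i) \<otimes>\<^bsub>B\<^esub> monomial (sw (Suc i)) (gc (Suc i)))"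
    unfolding 2
  proof (rule monomial_comp(1)[symmetric, OF sw_shifts[OF j] gc_coeffs[OF j] c(2)])
    fix \<chi> assume \<chi>: "\<chi> \<in> Irr"
    show "gc (Suc i) \<chi> \<otimes>\<^bsub>Hc \<chi>\<^esub> (gc i (\<chi> \<circ> ?r) \<otimes>\<^bsub>Hc (\<chi> \<circ> ?r)\<^esub> gc (Suc i) (\<chi> \<circ> ?r \<circ> ?s)) =
        gc (Suc i) \<chi> \<otimes>\<^bsub>Hc \<chi>\<^esub> (gc i (\<chi> \<circ> ?r) \<otimes>\<^bsub>Hc \<chi>\<^esub> gc (Suc i) (\<chi> \<circ> ?r \<circ> ?s))"
      unfolding comp_sw[OF j \<chi>] ..
  qed simp
  finally show "gB i \<otimes>\<^bsub>B\<^esub> (gB (Suc i) \<otimes>\<^bsub>B\<^esub> gB i) = gB (Suc i) \<otimes>\<^bsub>B\<^esub> (gB i \<otimes>\<^bsub>B\<^esub> gB (Suc i))"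
    using i j by (simp add: gB_def)
next
  assume "1 < n"
  then have i: "1 \<in> {1..<n}" "Suc 1 \<in> {1..n}" by auto
  have g: "gB 1 \<in> carrier B" "xB \<in> carrier B" "diag (xc (Suc 1)) \<in> carrier B"
    using gc_coeffs[OF i(1)] xc_coeffs[OF in_one] xc_coeffs[OF i(2)] i by (simp_all add: gB_def xB_def)
  \<comment> \<open>By \<open>gB_diag_gB\<close> the product of \<open>gB 1\<close>,
    \<open>xB\<close>, \<open>gB 1\<close> is u^2 times the diagonal matrix of the second X, so the
    relation follows once two diagonal matrices commute.\<close>
  have "xB \<otimes>\<^bsub>B\<^esub> diag (xc (Suc 1)) = diag (xc (Suc 1)) \<otimes>\<^bsub>B\<^esub> xB"
  proof -
    have "xB \<otimes>\<^bsub>B\<^esub> diag (xc (Suc 1)) = diag (\<lambda>\<chi>. xc (Suc 1) \<chi> \<otimes>\<^bsub>Hc \<chi>\<^esub> xc 1 \<chi>)"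
      unfolding xB_def
      by (rule monomial_comp(1)[OF id_shifts xc_coeffs[OF in_one] xc_coeffs[OF i(2)]])
        (use xc_comm[OF _ in_one i(2)] in simp_all)
    then show ?thesis
      unfolding xB_def monomial_id_mult[OF xc_coeffs[OF i(2)] xc_coeffs[OF in_one]] .
  qed
  then have "xB \<otimes>\<^bsub>B\<^esub> (gB 1 \<otimes>\<^bsub>B\<^esub> (xB \<otimes>\<^bsub>B\<^esub> gB 1)) = gB 1 \<otimes>\<^bsub>B\<^esub> (xB \<otimes>\<^bsub>B\<^esub> gB 1) \<otimes>\<^bsub>B\<^esub> xB"
    using gB_diag_gB[OF i(1), folded xB_def] g by simp
  then show "xB \<otimes>\<^bsub>B\<^esub> (gB 1 \<otimes>\<^bsub>B\<^esub> (xB \<otimes>\<^bsub>B\<^esub> gB 1)) = gB 1 \<otimes>\<^bsub>B\<^esub> (xB \<otimes>\<^bsub>B\<^esub> (gB 1 \<otimes>\<^bsub>B\<^esub> xB))"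
    using g by (simp add: B.m_assoc)
next
  fix i assume "i \<in> {2..<n}"
  then show "xB \<otimes>\<^bsub>B\<^esub> gB i = gB i \<otimes>\<^bsub>B\<^esub> xB" by (rule diag_xc_gB)
next
  fix i j
  have "tc i \<chi> \<otimes>\<^bsub>Hc \<chi>\<^esub> tc j \<chi> = tc j \<chi> \<otimes>\<^bsub>Hc \<chi>\<^esub> tc i \<chi>" if "\<chi> \<in> Irr" for \<chi>
  proof -
    interpret H: kalgebra "Hc \<chi>" by (rule kalgebra_Hc[OF that])
    show ?thesis by (simp add: tc_def mult.commute)
  qed
  then have "tB i \<otimes>\<^bsub>B\<^esub> tB j = diag (\<lambda>\<chi>. tc j \<chi> \<otimes>\<^bsub>Hc \<chi>\<^esub> tc i \<chi>)"
    unfolding tB_def by (intro monomial_comp(1)) (simp_all add: tc_coeffs)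
  then show "tB i \<otimes>\<^bsub>B\<^esub> tB j = tB j \<otimes>\<^bsub>B\<^esub> tB i"
    by (simp add: tB_def monomial_id_mult tc_coeffs)
next
  fix i j assume i: "i \<in> {1..<n}" and j: "j \<in> {1..n}"
  have "gc i \<chi> \<otimes>\<^bsub>Hc \<chi>\<^esub> tc j (\<chi> \<circ> simple_refl i) = tc (simple_refl i j) \<chi> \<otimes>\<^bsub>Hc \<chi>\<^esub> gc i \<chi>" if \<chi>: "\<chi> \<in> Irr" for \<chi>
  proof -
    interpret H: kalgebra "Hc \<chi>" by (rule kalgebra_Hc[OF that])
    show ?thesis using gc_closed[OF i \<chi>] by (simp add: tc_def comp_sw[OF i \<chi>])
  qed
  then have "monomial (sw i) (gc i) \<otimes>\<^bsub>B\<^esub> tB j = monomial (sw i) (\<lambda>\<chi>. tc (simple_refl i j) \<chi> \<otimes>\<^bsub>Hc \<chi>\<^esub> gc i \<chi>)"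
    unfolding tB_def by (intro monomial_comp(1) sw_shifts gc_coeffs tc_coeffs i) simp_all
  then show "gB i \<otimes>\<^bsub>B\<^esub> tB j = tB (simple_refl i j) \<otimes>\<^bsub>B\<^esub> gB i"
    using i by (simp add: gB_def tB_def monomial_id_mult tc_coeffs gc_coeffs)
next
  fix j assume j: "j \<in> {1..n}"
  show "tB j [^]\<^bsub>B\<^esub> d = \<one>\<^bsub>B\<^esub>"
    unfolding tB_pow monomial_one
    by (rule monomial_eqI) (use Irr_root[OF _ j] kalgebra.smult_one[OF kalgebra_Hc Hc_one] in simp_all)
  have "xc 1 \<chi> \<otimes>\<^bsub>Hc \<chi>\<^esub> tc j \<chi> = tc j \<chi> \<otimes>\<^bsub>Hc \<chi>\<^esub> xc 1 \<chi>" if \<chi>: "\<chi> \<in> Irr" for \<chi>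
  proof -
    interpret H: kalgebra "Hc \<chi>" by (rule kalgebra_Hc[OF that])
    show ?thesis using coeffsD[OF xc_coeffs[OF in_one] \<chi>] by (simp add: tc_def)
  qed
  then have "xB \<otimes>\<^bsub>B\<^esub> tB j = diag (\<lambda>\<chi>. tc j \<chi> \<otimes>\<^bsub>Hc \<chi>\<^esub> xc 1 \<chi>)"
    unfolding tB_def xB_def by (intro monomial_comp(1) id_shifts xc_coeffs in_one tc_coeffs) simp_all
  then show "xB \<otimes>\<^bsub>B\<^esub> tB j = tB j \<otimes>\<^bsub>B\<^esub> xB"
    by (simp add: xB_def tB_def monomial_id_mult tc_coeffs xc_coeffs[OF in_one])
next
  have u: "xB \<in> Units B" "inv\<^bsub>B\<^esub> xB = xiB"
    unfolding xB_def xiB_def using monomial_id_inv(1,2)[of "xc 1"] xc_Units[OF _ in_one] by blast+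
  show "xB \<otimes>\<^bsub>B\<^esub> xiB = \<one>\<^bsub>B\<^esub>" "xiB \<otimes>\<^bsub>B\<^esub> xB = \<one>\<^bsub>B\<^esub>"
    using B.Units_r_inv[OF u(1)] B.Units_l_inv[OF u(1)] u(2) by simp_all
next
  fix i assume "i \<in> {1..<n}"
  then show "gB i \<otimes>\<^bsub>B\<^esub> gB i = u_pow 2 \<odot>\<^bsub>B\<^esub> \<one>\<^bsub>B\<^esub> \<oplus>\<^bsub>B\<^esub>
      (\<Oplus>\<^bsub>B\<^esub>s\<in>{1..d}. (v * const (1 / of_nat d)) \<odot>\<^bsub>B\<^esub> (tB i [^]\<^bsub>B\<^esub> s \<otimes>\<^bsub>B\<^esub> (tB (Suc i) [^]\<^bsub>B\<^esub> (d - s) \<otimes>\<^bsub>B\<^esub> gB i)))"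
    by (rule gB_quadratic)
qed

section \<open>The homomorphism to matrices\<close>

sublocale YB: yokonuma B d n gB tB xB xiB
  by (rule yokonuma_B)

sublocale YY: yokonuma "YH d n" d n "gY d n" "tY d n" "xY d n" "xiY d n"
  by (rule yokonuma_YH[OF d])

definition Psi where
  "Psi = (SOME h. h \<in> alg_hom (YH d n) B \<and> (\<forall>i\<in>{1..<n}. h (gY d n i) = gB i) \<and>
     (\<forall>j\<in>{1..n}. h (tY d n j) = tB j) \<and> h (xY d n) = xB \<and> h (xiY d n) = xiB)"

lemma Psi_props: "Psi \<in> alg_hom (YH d n) B \<and> (\<forall>i\<in>{1..<n}. Psi (gY d n i) = gB i) \<and>
     (\<forall>j\<in>{1..n}. Psi (tY d n j) = tB j) \<and> Psi (xY d n) = xB \<and> Psi (xiY d n) = xiB"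
proof -
  obtain h where "h \<in> alg_hom (YH d n) B" "\<And>i. i \<in> {1..<n} \<Longrightarrow> h (yh_elt d n (G i)) = gB i"
    "\<And>j. j \<in> {1..n} \<Longrightarrow> h (yh_elt d n (T j)) = tB j"
    "1 \<le> n \<Longrightarrow> h (yh_elt d n X1) = xB" "1 \<le> n \<Longrightarrow> h (yh_elt d n X1_inv) = xiB"
    by (rule YB.hom_exists) blast
  then have "\<exists>h. h \<in> alg_hom (YH d n) B \<and> (\<forall>i\<in>{1..<n}. h (gY d n i) = gB i) \<and>
     (\<forall>j\<in>{1..n}. h (tY d n j) = tB j) \<and> h (xY d n) = xB \<and> h (xiY d n) = xiB"
    using n by (intro exI[of _ h]) (simp add: gY_def tY_def xY_def xiY_def)
  then show ?thesis unfolding Psi_def by (rule someI_ex)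
qed

sublocale Psi: kalgebra_hom "YH d n" B Psi
  by (intro kalgebra_hom.intro kalgebra_YH kalgebra_B kalgebra_hom_axioms.intro) (use Psi_props in blast)

lemma Psi_g: "i \<in> {1..<n} \<Longrightarrow> Psi (gY d n i) = monomial (sw i) (gc i)"
  using Psi_props by (simp add: gB_def)

lemma Psi_t: "j \<in> {1..n} \<Longrightarrow> Psi (tY d n j) = diag (tc j)"
  using Psi_props unfolding tB_def by blast

lemma Psi_X:
  assumes "j \<in> {1..n}" shows "Psi (YY.X j) = diag (xc j)"
  using assms
proof (induct j rule: nat_induct)
  case (Suc j)
  show ?case
  proof (cases "j = 0")
    case True
    have "Psi (xY d n) = diag (xc 1)" using Psi_props unfolding xB_def by blast
    then show ?thesis using True YY.X_one by (simp add: One_nat_def)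
  next
    case False
    then have j: "j \<in> {1..<n}" "j \<in> {1..n}" "1 \<le> j" using Suc(2) by auto
    have "Psi (YY.X (Suc j)) = u_pow (-2) \<odot>\<^bsub>B\<^esub> (gB j \<otimes>\<^bsub>B\<^esub> (diag (xc j) \<otimes>\<^bsub>B\<^esub> gB j))"
      using Suc(1)[OF j(2)] Psi_props j by (simp add: YY.X_Suc)
    also have "\<dots> = diag (xc (Suc j))"
      unfolding gB_diag_gB[OF j(1)] using Suc(2) xc_coeffs by simp
    finally show ?thesis .
  qed
qed simp

text \<open>In row \<open>\<psi>\<close> the image of \<open>t j\<close> is the scalar
  \<open>\<psi> j\<close>, so the average over its powers tests whether this value is
  \<open>z\<close>.\<close>

lemma Psi_P:
  assumes j: "j \<in> {1..n}" and z: "z ^ d = 1"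
  shows "Psi (YY.P j z) = diag (\<lambda>\<psi>. if \<psi> j = z then \<one>\<^bsub>Hc \<psi>\<^esub> else \<zero>\<^bsub>Hc \<psi>\<^esub>)"
proof -
  define c where "c s \<psi> = const (inverse (z ^ s)) \<odot>\<^bsub>Hc \<psi>\<^esub> (const (\<psi> j ^ s) \<odot>\<^bsub>Hc \<psi>\<^esub> \<one>\<^bsub>Hc \<psi>\<^esub>)" for s \<psi>
  have c: "c s \<in> coeffs" for s unfolding c_def by (intro coeffs_ops)
  have "Psi (YY.P j z) = const (1 / of_nat d) \<odot>\<^bsub>B\<^esub> (\<Oplus>\<^bsub>B\<^esub>s\<in>{0..<d}. const (inverse (z ^ s)) \<odot>\<^bsub>B\<^esub> tB j [^]\<^bsub>B\<^esub> s)"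
    unfolding YY.P_def using Psi_props j by (simp add: Psi.finsum Psi.nat_pow)
  also have "\<dots> = const (1 / of_nat d) \<odot>\<^bsub>B\<^esub> (\<Oplus>\<^bsub>B\<^esub>s\<in>{0..<d}. diag (c s))"
    unfolding tB_pow c_def by (simp add: monomial_smult)
  also have "\<dots> = diag (\<lambda>\<psi>. const (1 / of_nat d) \<odot>\<^bsub>Hc \<psi>\<^esub> (\<Oplus>\<^bsub>Hc \<psi>\<^esub>s\<in>{0..<d}. c s \<psi>))"
    using monomial_finsum[of "{0..<d}" c "\<lambda>\<chi>. \<chi>"] c by (simp add: monomial_smult)
  also have "\<dots> = diag (\<lambda>\<psi>. if \<psi> j = z then \<one>\<^bsub>Hc \<psi>\<^esub> else \<zero>\<^bsub>Hc \<psi>\<^esub>)"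
  proof (rule monomial_eqI)
    show "(\<lambda>\<psi>. const (1 / of_nat d) \<odot>\<^bsub>Hc \<psi>\<^esub> (\<Oplus>\<^bsub>Hc \<psi>\<^esub>s\<in>{0..<d}. c s \<psi>)) \<in> coeffs"
      using monomial_finsum[of "{0..<d}" c "\<lambda>\<chi>. \<chi>"] c by (intro coeffs_ops(3)) simp
    fix \<psi> assume \<psi>: "\<psi> \<in> Irr"
    interpret H: kalgebra "Hc \<psi>" by (rule kalgebra_Hc[OF \<psi>])
    have z0: "z \<noteq> 0" using z d by (auto simp: power_0_left)
    have "(\<psi> j / z) ^ d = 1" using Irr_root[OF \<psi> j] z by (simp add: power_divide)
    from root_of_unity_sum[OF this] z0
    have sum: "(\<Sum>s<d. (\<psi> j / z) ^ s) = (if \<psi> j = z then of_nat d else 0)" by simp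
    have "(\<Oplus>\<^bsub>Hc \<psi>\<^esub>s\<in>{0..<d}. c s \<psi>) = (\<Oplus>\<^bsub>Hc \<psi>\<^esub>s\<in>{0..<d}. (const (inverse (z ^ s)) * const (\<psi> j ^ s)) \<odot>\<^bsub>Hc \<psi>\<^esub> \<one>\<^bsub>Hc \<psi>\<^esub>)"
      unfolding c_def by (simp add: Hc_one[OF \<psi>])
    also have "\<dots> = const (if \<psi> j = z then of_nat d else 0) \<odot>\<^bsub>Hc \<psi>\<^esub> \<one>\<^bsub>Hc \<psi>\<^esub>"
      by (simp only: H.smult_sum[OF H.one_closed, symmetric] YB.const_average sum)
    finally show "const (1 / of_nat d) \<odot>\<^bsub>Hc \<psi>\<^esub> (\<Oplus>\<^bsub>Hc \<psi>\<^esub>s\<in>{0..<d}. c s \<psi>) =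
        (if \<psi> j = z then \<one>\<^bsub>Hc \<psi>\<^esub> else \<zero>\<^bsub>Hc \<psi>\<^esub>) \<and> (\<psi> = \<psi> \<or>
        const (1 / of_nat d) \<odot>\<^bsub>Hc \<psi>\<^esub> (\<Oplus>\<^bsub>Hc \<psi>\<^esub>s\<in>{0..<d}. c s \<psi>) = \<zero>\<^bsub>Hc \<psi>\<^esub>)"
      using d by simp
  qed
  finally show ?thesis .
qed

section \<open>The matrix of a basis element\<close>

definition row_at :: "(nat \<Rightarrow> complex) \<Rightarrow> tensor_elt \<Rightarrow> (nat \<Rightarrow> complex) \<Rightarrow> _" where
  "row_at \<chi> h = (\<lambda>\<psi>. if \<psi> = \<chi> then h else \<zero>\<^bsub>Hc \<psi>\<^esub>)"

lemma row_at_coeffs: "h \<in> carrier (Hc \<chi>) \<Longrightarrow> row_at \<chi> h \<in> coeffs"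
  using coeffsD[OF coeffs_ops(2)] by (auto simp: row_at_def coeffs_def)

lemma Psi_E:
  assumes \<chi>: "\<chi> \<in> Irr"
  shows "Psi (YY.E \<chi>) = diag (row_at \<chi> \<one>\<^bsub>Hc \<chi>\<^esub>)"
proof -
  define c where "c j \<psi> = (if \<psi> j = \<chi> j then \<one>\<^bsub>Hc \<psi>\<^esub> else \<zero>\<^bsub>Hc \<psi>\<^esub>)" for j and \<psi> :: "nat \<Rightarrow> complex"
  have c: "c j \<in> coeffs" for j
    using coeffsD[OF coeffs_ops(1)] coeffsD[OF coeffs_ops(2)] by (simp add: coeffs_def c_def)
  have "Psi (YY.E \<chi>) = list_prod B (map (\<lambda>j. Psi (YY.P j (\<chi> j))) [1..<Suc n])"
    unfolding YY.E_def by (subst Psi.list_prod) (auto simp: comp_def simp del: upt_Suc)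
  also have "\<dots> = list_prod B (map (\<lambda>j. diag (c j)) [1..<Suc n])"
    unfolding c_def by (intro arg_cong[where f = "list_prod B"] map_cong refl Psi_P)
      (auto intro: Irr_root[OF \<chi>] simp del: upt_Suc)
  also have "\<dots> = diag (\<lambda>\<psi>. list_prod (Hc \<psi>) (map (\<lambda>j. c j \<psi>) [1..<Suc n]))"
    by (rule monomial_id_list_prod[of "[1..<Suc n]" c, OF c, THEN conjunct1])
  also have "\<dots> = diag (row_at \<chi> \<one>\<^bsub>Hc \<chi>\<^esub>)"
  proof (rule monomial_eqI)
    show "(\<lambda>\<psi>. list_prod (Hc \<psi>) (map (\<lambda>j. c j \<psi>) [1..<Suc n])) \<in> coeffs"
      by (rule monomial_id_list_prod[of "[1..<Suc n]" c, OF c, THEN conjunct2])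
    fix \<psi> assume \<psi>: "\<psi> \<in> Irr"
    interpret H: kalgebra "Hc \<psi>" by (rule kalgebra_Hc[OF \<psi>])
    have lp: "list_prod (Hc \<psi>) (map (\<lambda>j. c j \<psi>) js) = (if \<forall>j\<in>set js. \<psi> j = \<chi> j then \<one>\<^bsub>Hc \<psi>\<^esub> else \<zero>\<^bsub>Hc \<psi>\<^esub>)" for js
      by (induct js) (auto simp: c_def)
    have "(\<forall>j\<in>set [1..<Suc n]. \<psi> j = \<chi> j) \<longleftrightarrow> \<psi> = \<chi>"
    proof
      assume "\<forall>j\<in>set [1..<Suc n]. \<psi> j = \<chi> j"
      then have "\<And>j. j \<in> {1..n} \<Longrightarrow> \<psi> j = \<chi> j" by auto
      then show "\<psi> = \<chi>" using \<chi> \<psi> unfolding Irr_T_def by (intro PiE_ext) auto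
    qed auto
    then show "list_prod (Hc \<psi>) (map (\<lambda>j. c j \<psi>) [1..<Suc n]) = row_at \<chi> \<one>\<^bsub>Hc \<chi>\<^esub> \<psi> \<and>
       (\<psi> = \<psi> \<or> list_prod (Hc \<psi>) (map (\<lambda>j. c j \<psi>) [1..<Suc n]) = \<zero>\<^bsub>Hc \<psi>\<^esub>)"
      unfolding lp by (simp add: row_at_def)
  qed
  finally show ?thesis .
qed

abbreviation "cw \<chi> is \<equiv> colour_word n (colour \<chi>) is"

lemma cw_young:
  assumes "set is \<subseteq> {1..<n}" "\<chi> \<in> Irr"
  shows "set (cw \<chi> is) \<subseteq> young n (comp_of \<chi>)"
  using assms
proof (induct "is" arbitrary: \<chi>)
  case (Cons i "is")
  then have i: "i \<in> {1..<n}" "i \<in> {1..n}" "Suc i \<in> {1..n}" and s: "set is \<subseteq> {1..<n}" by auto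
  show ?case
  proof (cases "\<chi> i = \<chi> (Suc i)")
    case True
    then show ?thesis
      using Cons(1)[OF s Cons(3)] pos_Suc(2)[OF Cons(3) i(1) True] colour_eq_iff[OF Cons(3) i(2,3)]
      by (simp add: pos_def)
  next
    case False
    then show ?thesis
      using Cons(1)[OF s Irr_swap(1)[OF Cons(3) i(1)]] colour_eq_iff[OF Cons(3) i(2,3)]
      by (simp only: colour_word.simps if_False Irr_swap(2,3)[OF Cons(3) i(1)])
  qed
qed simp

text \<open>The entry in row \<open>\<chi>\<close> of the product of g along the word: a factor u
  for each letter that drops out of the colour word, a Hecke generator for each that stays.\<close>

definition wt :: "nat list \<Rightarrow> (nat \<Rightarrow> complex) \<Rightarrow> _" where
  "wt is \<chi> = u_pow (int (length is) - int (length (cw \<chi> is))) \<odot>\<^bsub>Hc \<chi>\<^esub>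
     list_prod (Hc \<chi>) (map (H_mu_gen d (comp_of \<chi>)) (cw \<chi> is))"

lemma cw_list_prod_closed:
  assumes "set is \<subseteq> {1..<n}" "\<chi> \<in> Irr"
  shows "list_prod (Hc \<chi>) (map (H_mu_gen d (comp_of \<chi>)) (cw \<chi> is)) \<in> carrier (Hc \<chi>)"
  using cw_young[OF assms] H_mu_closed(2)[OF Comp_compositions[OF assms(2)]]
  by (intro kalgebra.list_prod_closed[OF kalgebra_Hc[OF assms(2)]]) auto

lemma wt_coeffs: "set is \<subseteq> {1..<n} \<Longrightarrow> wt is \<in> coeffs"
  unfolding coeffs_def wt_def
  using kalgebra.smult_closed[OF kalgebra_Hc cw_list_prod_closed] by blast

lemma wt_Cons:
  assumes i: "i \<in> {1..<n}" and s: "set is \<subseteq> {1..<n}" and \<chi>: "\<chi> \<in> Irr"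
  shows "gc i \<chi> \<otimes>\<^bsub>Hc \<chi>\<^esub> wt is (\<chi> \<circ> simple_refl i) = wt (i # is) \<chi>"
proof -
  interpret H: kalgebra "Hc \<chi>" by (rule kalgebra_Hc[OF \<chi>])
  have ii: "i \<in> {1..n}" "Suc i \<in> {1..n}" using i by auto
  show ?thesis
  proof (cases "\<chi> i = \<chi> (Suc i)")
    case True
    have "H_mu_gen d (comp_of \<chi>) (pos \<chi> i) \<in> carrier (Hc \<chi>)"
      using H_mu_closed(2)[OF Comp_compositions[OF \<chi>] pos_Suc(2)[OF \<chi> i True]] .
    moreover have "cw \<chi> (i # is) = pos \<chi> i # cw \<chi> is"
      using True colour_eq_iff[OF \<chi> ii] by (simp add: pos_def)
    ultimately show ?thesis
      using cw_list_prod_closed[OF s \<chi>] swap_same[OF True] True by (simp add: wt_def gc_def)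
  next
    case False
    define \<psi> where "\<psi> = \<chi> \<circ> simple_refl i"
    have \<psi>: "\<psi> \<in> Irr" "comp_of \<psi> = comp_of \<chi>" "colour \<psi> = colour \<chi> \<circ> simple_refl i"
      unfolding \<psi>_def by (rule Irr_swap[OF \<chi> i])+
    have "cw \<chi> (i # is) = cw \<psi> is"
      unfolding \<psi>(3) using False colour_eq_iff[OF \<chi> ii] by simp
    then show ?thesis
      using cw_list_prod_closed[OF s \<psi>(1)] False \<psi>(2) unfolding \<psi>_def[symmetric]
      by (simp add: wt_def gc_def algebra_simps)
  qed
qed

lemma Psi_word:
  assumes "set is \<subseteq> {1..<n}"
  shows "Psi (list_prod (YH d n) (map (gY d n) is)) = monomial (\<lambda>\<chi>. \<chi> \<circ> word_perm is) (wt is)"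
  using assms
proof (induct "is")
  case Nil
  have "wt [] \<chi> = \<one>\<^bsub>Hc \<chi>\<^esub>" if "\<chi> \<in> Irr" for \<chi>
    using kalgebra.smult_one[OF kalgebra_Hc[OF that] Hc_one[OF that]] by (simp add: wt_def)
  then show ?case
    by (simp add: monomial_one) (rule monomial_eqI; simp)
next
  case (Cons i "is")
  then have i: "i \<in> {1..<n}" and s: "set is \<subseteq> {1..<n}" by auto
  have cl: "set (map (gY d n) is) \<subseteq> carrier (YH d n)" by auto
  have "Psi (list_prod (YH d n) (map (gY d n) (i # is))) =
      monomial (sw i) (gc i) \<otimes>\<^bsub>B\<^esub> monomial (\<lambda>\<chi>. \<chi> \<circ> word_perm is) (wt is)"
    using Cons(1)[OF s] Psi_g[OF i] YY.list_prod_closed[OF cl] i by (simp add: comp_def)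
  also have "\<dots> = monomial (\<lambda>\<chi>. \<chi> \<circ> word_perm (i # is)) (wt (i # is))"
    by (rule monomial_comp(1)[OF sw_shifts[OF i] gc_coeffs[OF i] wt_coeffs[OF s] wt_Cons[OF i s]])
      (simp_all add: comp_def)
  finally show ?case .
qed

lemma Psi_X_power:
  "Psi (yh_X_power d n l) = diag (\<lambda>\<chi>. H_mu_X_power d n (comp_of \<chi>) (perm_act (pos \<chi>) l))"
  "(\<lambda>\<chi>. H_mu_X_power d n (comp_of \<chi>) (perm_act (pos \<chi>) l)) \<in> coeffs"
proof -
  have s: "set [1..<Suc n] = {1..n}" by auto
  define c where "c j \<chi> = (if j \<in> {1..n} then xc j \<chi> [^]\<^bsub>Hc \<chi>\<^esub> l j else \<one>\<^bsub>Hc \<chi>\<^esub>)" for j \<chi>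
  have c: "c j \<in> coeffs" for j
    unfolding coeffs_def c_def using kalgebra.int_pow_closed[OF kalgebra_Hc xc_Units] Hc_one by simp
  have u: "YY.X j \<in> Units (YH d n)" if "j \<in> {1..n}" for j using YY.X_Units[OF that] .
  have X: "yh_X_power d n l = list_prod (YH d n) (map (\<lambda>j. YY.X j [^]\<^bsub>YH d n\<^esub> l j) [1..<Suc n])"
    unfolding yh_X_power_def
    by (intro arg_cong[where f = "list_prod (YH d n)"] map_cong refl) (simp add: yh_X_eq[OF d] s del: upt_Suc)
  have "Psi (yh_X_power d n l) = list_prod B (map (\<lambda>j. diag (c j)) [1..<Suc n])"
  proof -
    have "set (map (\<lambda>j. YY.X j [^]\<^bsub>YH d n\<^esub> l j) [1..<Suc n]) \<subseteq> carrier (YH d n)"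
      using YY.int_pow_closed[OF u] s by (auto simp del: upt_Suc)
    then have "Psi (list_prod (YH d n) (map (\<lambda>j. YY.X j [^]\<^bsub>YH d n\<^esub> l j) [1..<Suc n])) =
        list_prod B (map (\<lambda>j. Psi (YY.X j [^]\<^bsub>YH d n\<^esub> l j)) [1..<Suc n])"
      by (subst Psi.list_prod) (simp_all add: comp_def del: upt_Suc)
    also have "map (\<lambda>j. Psi (YY.X j [^]\<^bsub>YH d n\<^esub> l j)) [1..<Suc n] = map (\<lambda>j. diag (c j)) [1..<Suc n]"
    proof (rule map_cong[OF refl])
      fix j assume "j \<in> set [1..<Suc n]"
      then have j: "j \<in> {1..n}" using s by blast
      have "Psi (YY.X j [^]\<^bsub>YH d n\<^esub> l j) = diag (\<lambda>\<chi>. xc j \<chi> [^]\<^bsub>Hc \<chi>\<^esub> l j)"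
        unfolding Psi.int_pow[OF u[OF j]] Psi_X[OF j] by (rule monomial_id_int_pow[OF xc_Units[OF _ j]])
      moreover have "c j = (\<lambda>\<chi>. xc j \<chi> [^]\<^bsub>Hc \<chi>\<^esub> l j)" using j by (simp add: c_def fun_eq_iff)
      ultimately show "Psi (YY.X j [^]\<^bsub>YH d n\<^esub> l j) = diag (c j)" by simp
    qed
    finally show ?thesis unfolding X .
  qed
  also have "\<dots> = diag (\<lambda>\<chi>. list_prod (Hc \<chi>) (map (\<lambda>j. c j \<chi>) [1..<Suc n]))"
    by (rule monomial_id_list_prod[of "[1..<Suc n]" c, OF c, THEN conjunct1])
  finally have 1: "Psi (yh_X_power d n l) = diag (\<lambda>\<chi>. list_prod (Hc \<chi>) (map (\<lambda>j. c j \<chi>) [1..<Suc n]))" .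
  have 2: "list_prod (Hc \<chi>) (map (\<lambda>j. c j \<chi>) [1..<Suc n]) = H_mu_X_power d n (comp_of \<chi>) (perm_act (pos \<chi>) l)"
    if \<chi>: "\<chi> \<in> Irr" for \<chi>
  proof -
    interpret H: kalgebra "Hc \<chi>" by (rule kalgebra_Hc[OF \<chi>])
    note \<mu> = Comp_compositions[OF \<chi>]
    let ?f = "\<lambda>p. H_mu_X d (comp_of \<chi>) p [^]\<^bsub>Hc \<chi>\<^esub> perm_act (pos \<chi>) l p"
    have xs: "set (map (pos \<chi>) [1..<Suc n]) = {1..n}" "distinct (map (pos \<chi>) [1..<Suc n])"
      using permutes_image[OF pos_permutes[of \<chi>]] s
      by (simp_all add: distinct_map inj_on_def del: upt_Suc)
    have inv: "inv_into UNIV (pos \<chi>) (pos \<chi> j) = j" for j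
      using permutes_inj[OF pos_permutes[of \<chi>]] by simp
    have "map (\<lambda>j. c j \<chi>) [1..<Suc n] = map ?f (map (pos \<chi>) [1..<Suc n])"
      by (simp add: c_def xc_def perm_act_def inv s del: upt_Suc)
    \<comment> \<open>The factors come in the order of the original positions; since the X commute
      they may be listed by sorted place, which is the action of \<open>pos \<chi>\<close> on the
      exponent.\<close>
    moreover have "list_prod (Hc \<chi>) (map ?f (map (pos \<chi>) [1..<Suc n])) = list_prod (Hc \<chi>) (map ?f [1..<Suc n])"
    proof (rule H.list_prod_reorder)
      have xU: "p \<in> {1..n} \<Longrightarrow> H_mu_X d (comp_of \<chi>) p \<in> Units (Hc \<chi>)" for p by (rule H_mu_X_Units[OF \<mu>])
      show "?f \<in> set (map (pos \<chi>) [1..<Suc n]) \<rightarrow> carrier (Hc \<chi>)"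
        unfolding xs using H.int_pow_closed[OF xU] by blast
      fix p q assume "p \<in> set (map (pos \<chi>) [1..<Suc n])" "q \<in> set (map (pos \<chi>) [1..<Suc n])"
      then have pq: "p \<in> {1..n}" "q \<in> {1..n}" unfolding xs by auto
      show "?f p \<otimes>\<^bsub>Hc \<chi>\<^esub> ?f q = ?f q \<otimes>\<^bsub>Hc \<chi>\<^esub> ?f p"
        by (intro H.comm_int_pow H.comm_int_pow[symmetric] H_mu_X_comm[OF \<mu>] xU pq H.int_pow_closed H_mu_closed(1)[OF \<mu>])
    qed (use xs s in \<open>simp_all del: upt_Suc\<close>)
    ultimately show ?thesis by (simp only: H_mu_X_power_def)
  qed
  have 3: "(\<lambda>\<chi>. list_prod (Hc \<chi>) (map (\<lambda>j. c j \<chi>) [1..<Suc n])) \<in> coeffs"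
    by (rule monomial_id_list_prod[of "[1..<Suc n]" c, OF c, THEN conjunct2])
  show "Psi (yh_X_power d n l) = diag (\<lambda>\<chi>. H_mu_X_power d n (comp_of \<chi>) (perm_act (pos \<chi>) l))"
    unfolding 1 by (rule monomial_eqI[OF 3]) (use 2 in blast)
  show "(\<lambda>\<chi>. H_mu_X_power d n (comp_of \<chi>) (perm_act (pos \<chi>) l)) \<in> coeffs"
    unfolding coeffs_def using coeffsD[OF 3] 2 by fastforce
qed

lemma elem_mat_monomial:
  assumes \<chi>: "\<chi> \<in> Irr" "\<chi>' \<in> Irr" "comp_of \<chi>' = comp_of \<chi>" and h: "h \<in> carrier (Hc \<chi>)" and \<sigma>: "\<sigma> \<chi> = \<chi>'"
  shows "direct_sum_embed (compositions d n) (mat_H d n \<xi>) (comp_of \<chi>)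
      (c \<odot>\<^bsub>mat_H d n \<xi> (comp_of \<chi>)\<^esub> elem_mat (chars (comp_of \<chi>)) (H_mu d (comp_of \<chi>)) \<chi> \<chi>' h) =
    monomial \<sigma> (row_at \<chi> (c \<odot>\<^bsub>Hc \<chi>\<^esub> h))" (is "?L = ?R")
proof -
  have ent: "?L (comp_of \<psi>) (\<psi>, \<phi>) = (if \<psi> = \<chi> \<and> \<phi> = \<chi>' then c \<odot>\<^bsub>Hc \<chi>\<^esub> h else \<zero>\<^bsub>Hc \<psi>\<^esub>)"
    if "\<psi> \<in> Irr" "\<phi> \<in> Irr" "comp_of \<phi> = comp_of \<psi>" for \<psi> \<phi>
    using that \<chi> Comp_compositions[OF that(1)] kalgebra.smult_zero_right[OF kalgebra_Hc[OF that(1)]]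
    by (auto simp: direct_sum_embed_def elem_mat_def mat_H_def chars_iff)
  have ch: "c \<odot>\<^bsub>Hc \<chi>\<^esub> h \<in> carrier (Hc \<chi>)" by (rule kalgebra.smult_closed[OF kalgebra_Hc[OF \<chi>(1)] h])
  show ?thesis
  proof (rule B_ext)
    show "?R \<in> carrier B" by (intro monomial_closed row_at_coeffs ch)
    show "?L \<in> carrier B"
    proof (rule B_closedI)
      show "?L \<in> extensional (compositions d n)" by (simp add: direct_sum_embed_def)
      show "?L \<mu> \<in> extensional (chars \<mu> \<times> chars \<mu>)" if "\<mu> \<in> compositions d n" for \<mu>
        using that by (simp add: direct_sum_embed_def mat_H_def)
      fix \<psi> \<phi> assume \<psi>: "\<psi> \<in> Irr" "\<phi> \<in> Irr" "comp_of \<phi> = comp_of \<psi>"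
      show "?L (comp_of \<psi>) (\<psi>, \<phi>) \<in> carrier (Hc \<psi>)"
        unfolding ent[OF \<psi>] using ch coeffsD[OF coeffs_ops(2) \<psi>(1)] by auto
    qed
    fix \<psi> \<phi> assume \<psi>: "\<psi> \<in> Irr" "\<phi> \<in> Irr" "comp_of \<phi> = comp_of \<psi>"
    show "?L (comp_of \<psi>) (\<psi>, \<phi>) = ?R (comp_of \<psi>) (\<psi>, \<phi>)"
      unfolding ent[OF \<psi>] monomial_entry[OF \<psi>] row_at_def using \<sigma> by auto
  qed
qed

text \<open>The idempotent selects the row, the powers of X are diagonal, and
  \<open>Psi_word\<close> gives the rest. The colour word of a reduced word of \<open>w'\<close> is
  a reduced word of \<open>z\<close>, so the lengths give the exponent of u and the product is the
  Hecke element of \<open>z\<close>.\<close>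

lemma Psi_formula:
  assumes \<chi>: "\<chi> \<in> Irr" and w: "w permutes {1..n}"
  shows "(let \<mu> = comp_of \<chi>; w' = inv_into UNIV w; \<chi>' = perm_act w \<chi>;
           p' = inv_into UNIV (pi_chi d n \<xi> \<chi>); z = p' \<circ> w' \<circ> pi_chi d n \<xi> \<chi>'
       in Psi (yh_E d n \<chi> \<otimes>\<^bsub>YH d n\<^esub> yh_X_power d n l \<otimes>\<^bsub>YH d n\<^esub> yh_g d n w') =
          direct_sum_embed (compositions d n) (mat_H d n \<xi>) \<mu>
            (u_pow (int (perm_length n w') - int (perm_length n z)) \<odot>\<^bsub>mat_H d n \<xi> \<mu>\<^esub>
              elem_mat (chars \<mu>) (H_mu d \<mu>) \<chi> \<chi>'
                (H_mu_X_power d n \<mu> (perm_act p' l) \<otimes>\<^bsub>H_mu d \<mu>\<^esub> H_mu_g d n \<mu> z)))"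
proof -
  interpret H: kalgebra "Hc \<chi>" by (rule kalgebra_Hc[OF \<chi>])
  define w' where "w' = inv_into UNIV w"
  define \<chi>' where "\<chi>' = \<chi> \<circ> w'"
  define z where "z = pos \<chi> \<circ> w' \<circ> inv_into UNIV (pos \<chi>')"
  define "is" where "is = reduced_word n w'"
  have w': "w' permutes {1..n}" "inv_into UNIV w' = w"
    unfolding w'_def using permutes_inv[OF w] permutes_inv_inv[OF w] by auto
  have \<chi>': "\<chi>' \<in> Irr" "comp_of \<chi>' = comp_of \<chi>" "colour \<chi>' = colour \<chi> \<circ> w'"
    unfolding \<chi>'_def by (rule Irr_comp[OF \<chi> w'(1)])+
  have srt: "sorts n w is" using sorts_reduced_word[OF w'(1)] w'(2) by (simp add: is_def)
  have iss: "set is \<subseteq> {1..<n}" by (rule sorts_set[OF srt])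
  have wp: "word_perm is = w'" using sorts_word_perm[OF srt w] by (simp add: w'_def)
  have w'w: "w' (w j) = j" for j unfolding w'_def using permutes_inj[OF w] by simp
  note bijs = permutes_bij[OF pos_permutes[of \<chi>]] permutes_bij[OF pos_permutes[of \<chi>']] permutes_bij[OF w'(1)]
  have z: "z permutes {1..n}"
    unfolding z_def by (intro permutes_compose pos_permutes w'(1) permutes_inv)
  have inv_z: "inv_into UNIV z = pos \<chi>' \<circ> w \<circ> inv_into UNIV (pos \<chi>)"
  proof -
    have "inv_into UNIV z = inv_into UNIV (inv_into UNIV (pos \<chi>')) \<circ> (inv_into UNIV w' \<circ> inv_into UNIV (pos \<chi>))"
      unfolding z_def using bijs by (simp add: o_inv_distrib bij_comp bij_imp_bij_inv comp_assoc)
    then show ?thesis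
      using w'(2) permutes_inv_inv[OF pos_permutes[of \<chi>']] by (simp add: comp_assoc)
  qed
  \<comment> \<open>The colouring of \<open>\<chi>'\<close> is the one reached at the end of the
    word, as \<open>sorts_colour_word\<close> requires.\<close>
  have "colour \<chi>' \<circ> w = colour \<chi>" unfolding \<chi>'(3) by (simp add: fun_eq_iff w'w)
  from sorts_colour_word[OF srt w this] have srt_z: "sorts n (inv_into UNIV z) (cw \<chi> is)"
    unfolding inv_z pos_def .
  \<comment> \<open>Both places are sorted places of letters of one colour; hence \<open>z\<close>
    lies in the Young subgroup.\<close>
  have blk: "block (comp_of \<chi>) (inv_into UNIV z j) = block (comp_of \<chi>) j" if "j \<in> {1..n}" for j
  proof -
    obtain k where k: "j = pos \<chi> k" using bijs(1) by (metis bij_pointE)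
    then have kn: "k \<in> {1..n}" using that pos_in by blast
    have wk: "w k \<in> {1..n}" using kn permutes_in_image[OF w] by blast
    have "inv_into UNIV z j = pos \<chi>' (w k)"
      unfolding inv_z k using permutes_inj[OF pos_permutes[of \<chi>]] by simp
    then show ?thesis
      using block_pos_eq[OF \<chi>'(1) wk] block_pos_eq[OF \<chi> kn] \<chi>'(2,3) w'w k by simp
  qed
  have lenz: "length (cw \<chi> is) = perm_length n z"
    using sorts_length[OF srt_z] perm_length_eq[OF z] by simp
  have lenw: "length is = perm_length n w'" unfolding is_def by (rule length_reduced_word[OF w'(1)])
  have Hg: "list_prod (Hc \<chi>) (map (H_mu_gen d (comp_of \<chi>)) (cw \<chi> is)) = H_mu_g d n (comp_of \<chi>) z"
    by (rule H_mu_g_word[OF Comp_compositions[OF \<chi>] z blk srt_z])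
  have Hg_cl: "H_mu_g d n (comp_of \<chi>) z \<in> carrier (Hc \<chi>)"
    using cw_list_prod_closed[OF iss \<chi>] Hg by simp
  define Xp where "Xp = H_mu_X_power d n (comp_of \<chi>) (perm_act (pos \<chi>) l)"
  have Xp: "Xp \<in> carrier (Hc \<chi>)" unfolding Xp_def using coeffsD[OF Psi_X_power(2) \<chi>] .
  define k where "k = int (perm_length n w') - int (perm_length n z)"
  have "yh_g d n w' = list_prod (YH d n) (map (gY d n) is)"
    unfolding yh_g_def is_def[symmetric] using iss
    by (intro arg_cong[where f = "list_prod (YH d n)"] map_cong) (auto simp: gY_def)
  then have Pg: "Psi (yh_g d n w') = monomial (\<lambda>\<chi>. \<chi> \<circ> w') (wt is)" and g: "yh_g d n w' \<in> carrier (YH d n)"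
    using Psi_word[OF iss] wp by (auto intro!: YY.list_prod_closed)
  have E: "yh_E d n \<chi> = YY.E \<chi>" using yh_E_eq[OF d] by simp
  have Xcl: "yh_X_power d n l \<in> carrier (YH d n)"
    unfolding yh_X_power_def
    by (intro YY.list_prod_closed) (auto simp: yh_X_eq[OF d, symmetric] YY.int_pow_closed YY.X_Units simp del: upt_Suc)
  have "Psi (yh_E d n \<chi> \<otimes>\<^bsub>YH d n\<^esub> yh_X_power d n l \<otimes>\<^bsub>YH d n\<^esub> yh_g d n w') =
      diag (row_at \<chi> \<one>\<^bsub>Hc \<chi>\<^esub>) \<otimes>\<^bsub>B\<^esub> diag (\<lambda>\<chi>. H_mu_X_power d n (comp_of \<chi>) (perm_act (pos \<chi>) l)) \<otimes>\<^bsub>B\<^esub>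
      monomial (\<lambda>\<chi>. \<chi> \<circ> w') (wt is)"
    unfolding E using g Xcl by (simp add: Psi_E[OF \<chi>] Psi_X_power(1) Pg)
  also have "diag (row_at \<chi> \<one>\<^bsub>Hc \<chi>\<^esub>) \<otimes>\<^bsub>B\<^esub> diag (\<lambda>\<chi>. H_mu_X_power d n (comp_of \<chi>) (perm_act (pos \<chi>) l)) = diag (row_at \<chi> Xp)"
    by (rule monomial_comp(1)[OF id_shifts row_at_coeffs[OF H.one_closed] Psi_X_power(2)])
      (use Xp ring.ring_simprules(24)[OF kalgebra.axioms(1)[OF kalgebra_Hc]] coeffsD[OF Psi_X_power(2)]
        in \<open>auto simp: row_at_def Xp_def\<close>)
  also have "diag (row_at \<chi> Xp) \<otimes>\<^bsub>B\<^esub> monomial (\<lambda>\<chi>. \<chi> \<circ> w') (wt is) =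
      monomial (\<lambda>\<chi>. \<chi> \<circ> w') (row_at \<chi> (u_pow k \<odot>\<^bsub>Hc \<chi>\<^esub> (Xp \<otimes>\<^bsub>Hc \<chi>\<^esub> H_mu_g d n (comp_of \<chi>) z)))"
  proof (rule monomial_comp(1)[OF id_shifts row_at_coeffs[OF Xp] wt_coeffs[OF iss]])
    fix \<psi> assume \<psi>: "\<psi> \<in> Irr"
    show "row_at \<chi> Xp \<psi> \<otimes>\<^bsub>Hc \<psi>\<^esub> wt is \<psi> = row_at \<chi> (u_pow k \<odot>\<^bsub>Hc \<chi>\<^esub> (Xp \<otimes>\<^bsub>Hc \<chi>\<^esub> H_mu_g d n (comp_of \<chi>) z)) \<psi>"
    proof (cases "\<psi> = \<chi>")
      case True
      then show ?thesis using Xp Hg_cl by (simp add: row_at_def wt_def Hg k_def lenw lenz)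
    next
      case False
      interpret H': kalgebra "Hc \<psi>" by (rule kalgebra_Hc[OF \<psi>])
      show ?thesis using False coeffsD[OF wt_coeffs[OF iss] \<psi>] by (simp add: row_at_def)
    qed
  qed simp
  also have "\<dots> = direct_sum_embed (compositions d n) (mat_H d n \<xi>) (comp_of \<chi>)
      (u_pow k \<odot>\<^bsub>mat_H d n \<xi> (comp_of \<chi>)\<^esub> elem_mat (chars (comp_of \<chi>)) (H_mu d (comp_of \<chi>)) \<chi> \<chi>'
        (Xp \<otimes>\<^bsub>Hc \<chi>\<^esub> H_mu_g d n (comp_of \<chi>) z))"
    by (rule elem_mat_monomial[symmetric, OF \<chi> \<chi>'(1,2) H.m_closed[OF Xp Hg_cl]]) (simp add: \<chi>'_def)
  finally have main: "Psi (yh_E d n \<chi> \<otimes>\<^bsub>YH d n\<^esub> yh_X_power d n l \<otimes>\<^bsub>YH d n\<^esub> yh_g d n w') = \<dots>" .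
  have "perm_act w \<chi> = \<chi>'" by (simp add: perm_act_def \<chi>'_def w'_def comp_def)
  moreover have "inv_into UNIV (pi_chi d n \<xi> \<chi>) = pos \<chi>" "pi_chi d n \<xi> \<chi>' = inv_into UNIV (pos \<chi>')"
    using permutes_inv_inv[OF pos_permutes[of \<chi>]] by (simp_all add: pi_chi_eq \<chi> \<chi>'(1))
  ultimately show ?thesis
    unfolding Let_def w'_def[symmetric] using main by (simp only: z_def k_def Xp_def)
qed

subsection \<open>Surjectivity\<close>

text \<open>A matrix unit with entry \<open>h\<close>, in monomial form: the other rows have
  coefficient zero, and their columns are put on the diagonal to obtain an element of
  \<open>shifts\<close>.\<close>

definition cell where
  "cell \<chi> \<chi>' h = monomial (\<lambda>\<psi>. if \<psi> = \<chi> then \<chi>' else \<psi>) (row_at \<chi> h)"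

definition conn :: "(nat \<Rightarrow> complex) \<Rightarrow> (nat \<Rightarrow> complex) \<Rightarrow> bool" where
  "conn \<chi> \<chi>' \<longleftrightarrow> \<chi> \<in> Irr \<and> \<chi>' \<in> Irr \<and> comp_of \<chi>' = comp_of \<chi>"

lemma cell_shifts: "conn \<chi> \<chi>' \<Longrightarrow> (\<lambda>\<psi>. if \<psi> = \<chi> then \<chi>' else \<psi>) \<in> shifts"
  by (auto simp: conn_def shifts_def)

lemma cell_closed: "h \<in> carrier (Hc \<chi>) \<Longrightarrow> cell \<chi> \<chi>' h \<in> carrier B"
  unfolding cell_def by (intro monomial_closed row_at_coeffs)

lemma cell_entry:
  assumes "conn \<chi> \<chi>'" "\<psi> \<in> Irr" "\<phi> \<in> Irr" "comp_of \<phi> = comp_of \<psi>"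
  shows "cell \<chi> \<chi>' h (comp_of \<psi>) (\<psi>, \<phi>) = (if \<psi> = \<chi> \<and> \<phi> = \<chi>' then h else \<zero>\<^bsub>Hc \<psi>\<^esub>)"
  unfolding cell_def monomial_entry[OF assms(2-4)] by (auto simp: row_at_def)

lemma cell_mult_monomial:
  assumes "conn \<chi> \<chi>'" "h \<in> carrier (Hc \<chi>)" "c \<in> coeffs" "\<sigma> \<in> shifts"
  shows "cell \<chi> \<chi>' h \<otimes>\<^bsub>B\<^esub> monomial \<sigma> c = cell \<chi> (\<sigma> \<chi>') (h \<otimes>\<^bsub>Hc \<chi>\<^esub> c \<chi>')"
proof -
  have \<chi>: "\<chi> \<in> Irr" "\<chi>' \<in> Irr" "comp_of \<chi>' = comp_of \<chi>" using assms(1) by (auto simp: conn_def)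
  interpret H: kalgebra "Hc \<chi>" by (rule kalgebra_Hc[OF \<chi>(1)])
  have "c \<chi>' \<in> carrier (Hc \<chi>)" using coeffsD[OF assms(3) \<chi>(2)] \<chi>(3) by simp
  then have h: "h \<otimes>\<^bsub>Hc \<chi>\<^esub> c \<chi>' \<in> carrier (Hc \<chi>)" using assms(2) by simp
  note s = shiftsD[OF assms(4) \<chi>(2)]
  have c': "conn \<chi> (\<sigma> \<chi>')" using \<chi> s by (simp add: conn_def)
  show ?thesis
  proof (rule B_ext)
    show "cell \<chi> \<chi>' h \<otimes>\<^bsub>B\<^esub> monomial \<sigma> c \<in> carrier B"
      using cell_closed[OF assms(2)] assms(3) by (intro B.m_closed monomial_closed)
    show "cell \<chi> (\<sigma> \<chi>') (h \<otimes>\<^bsub>Hc \<chi>\<^esub> c \<chi>') \<in> carrier B" by (rule cell_closed[OF h])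
    fix \<psi> \<phi> assume \<psi>: "\<psi> \<in> Irr" "\<phi> \<in> Irr" "comp_of \<phi> = comp_of \<psi>"
    interpret H': kalgebra "Hc \<psi>" by (rule kalgebra_Hc[OF \<psi>(1)])
    let ?s = "\<lambda>\<psi>. if \<psi> = \<chi> then \<chi>' else \<psi>"
    have "monomial \<sigma> c (comp_of \<psi>) (?s \<psi>, \<phi>) = (if \<phi> = \<sigma> (?s \<psi>) then c (?s \<psi>) else \<zero>\<^bsub>Hc \<psi>\<^esub>)"
      using monomial_entry[of "?s \<psi>" \<phi> \<sigma> c] \<psi> \<chi> by auto
    moreover have "c \<psi> \<in> carrier (Hc \<psi>)" "c \<chi>' \<in> carrier (Hc \<chi>)"
      using coeffsD[OF assms(3)] \<psi> \<chi> by metis+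
    ultimately show "(cell \<chi> \<chi>' h \<otimes>\<^bsub>B\<^esub> monomial \<sigma> c) (comp_of \<psi>) (\<psi>, \<phi>) = cell \<chi> (\<sigma> \<chi>') (h \<otimes>\<^bsub>Hc \<chi>\<^esub> c \<chi>') (comp_of \<psi>) (\<psi>, \<phi>)"
      unfolding cell_entry[OF c' \<psi>] unfolding cell_def
      using monomial_mult_entry[OF cell_shifts[OF assms(1)] row_at_coeffs[OF assms(2)] monomial_closed[OF assms(3)] \<psi>, of \<sigma>] assms(2)
      by (auto simp: row_at_def)
  qed
qed

lemma cell_mult:
  assumes "conn \<chi> \<chi>'" "conn \<chi>' \<chi>''" "h \<in> carrier (Hc \<chi>)" "h' \<in> carrier (Hc \<chi>)"
  shows "cell \<chi> \<chi>' h \<otimes>\<^bsub>B\<^esub> cell \<chi>' \<chi>'' h' = cell \<chi> \<chi>'' (h \<otimes>\<^bsub>Hc \<chi>\<^esub> h')"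
proof -
  have "h' \<in> carrier (Hc \<chi>')" using assms by (simp add: conn_def)
  from cell_mult_monomial[OF assms(1,3) row_at_coeffs[OF this] cell_shifts[OF assms(2)]]
  show ?thesis by (simp add: cell_def row_at_def)
qed

lemma cell_linear:
  assumes "conn \<chi> \<chi>'" "h \<in> carrier (Hc \<chi>)" "h' \<in> carrier (Hc \<chi>)"
  shows "cell \<chi> \<chi>' h \<oplus>\<^bsub>B\<^esub> cell \<chi> \<chi>' h' = cell \<chi> \<chi>' (h \<oplus>\<^bsub>Hc \<chi>\<^esub> h')"
    "c \<odot>\<^bsub>B\<^esub> cell \<chi> \<chi>' h = cell \<chi> \<chi>' (c \<odot>\<^bsub>Hc \<chi>\<^esub> h)"
proof -
  interpret H: kalgebra "Hc \<chi>" using kalgebra_Hc assms(1) by (simp add: conn_def)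
  have H: "\<zero>\<^bsub>Hc \<psi>\<^esub> \<oplus>\<^bsub>Hc \<psi>\<^esub> \<zero>\<^bsub>Hc \<psi>\<^esub> = \<zero>\<^bsub>Hc \<psi>\<^esub>" "c \<odot>\<^bsub>Hc \<psi>\<^esub> \<zero>\<^bsub>Hc \<psi>\<^esub> = \<zero>\<^bsub>Hc \<psi>\<^esub>" if "\<psi> \<in> Irr" for \<psi>
    using kalgebra_Hc[OF that] by (simp_all add: kalgebra.smult_zero_right ring.ring_simprules[OF kalgebra.axioms(1)])
  show "cell \<chi> \<chi>' h \<oplus>\<^bsub>B\<^esub> cell \<chi> \<chi>' h' = cell \<chi> \<chi>' (h \<oplus>\<^bsub>Hc \<chi>\<^esub> h')"
    using assms by (intro B_ext B.a_closed cell_closed H.a_closed) (auto simp: B_add_entry cell_entry H)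
  show "c \<odot>\<^bsub>B\<^esub> cell \<chi> \<chi>' h = cell \<chi> \<chi>' (c \<odot>\<^bsub>Hc \<chi>\<^esub> h)"
    using assms by (intro B_ext B.smult_closed cell_closed H.smult_closed) (auto simp: B_smult_entry cell_entry H)
qed

abbreviation "im \<equiv> Psi ` carrier (YH d n)"

lemma im_mult: "x \<in> im \<Longrightarrow> y \<in> im \<Longrightarrow> x \<otimes>\<^bsub>B\<^esub> y \<in> im"
  by (auto simp flip: Psi.mult)

lemma im_add: "x \<in> im \<Longrightarrow> y \<in> im \<Longrightarrow> x \<oplus>\<^bsub>B\<^esub> y \<in> im"
  by (auto simp flip: Psi.add)

lemma im_smult: "x \<in> im \<Longrightarrow> c \<odot>\<^bsub>B\<^esub> x \<in> im"
  by (auto simp flip: Psi.smult)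

lemma conn_sw: "i \<in> {1..<n} \<Longrightarrow> \<chi> \<in> Irr \<Longrightarrow> conn \<chi> (\<chi> \<circ> simple_refl i)"
  using Irr_swap(1,2)[of \<chi> i] by (simp add: conn_def)

text \<open>Multiplication by the image of E_\<chi> on the left cuts out row \<open>\<chi>\<close>,
  so a monomial matrix in the image yields each of its entries separately.\<close>

lemma im_monomial:
  assumes "monomial \<sigma> c \<in> im" "c \<in> coeffs" "\<sigma> \<in> shifts" "\<chi> \<in> Irr"
  shows "cell \<chi> (\<sigma> \<chi>) (c \<chi>) \<in> im"
proof -
  interpret H: kalgebra "Hc \<chi>" by (rule kalgebra_Hc[OF assms(4)])
  have "diag (row_at \<chi> \<one>\<^bsub>Hc \<chi>\<^esub>) = cell \<chi> \<chi> \<one>\<^bsub>Hc \<chi>\<^esub>"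
    unfolding cell_def by (rule monomial_eqI[OF row_at_coeffs]) auto
  with Psi_E[OF assms(4)] have "cell \<chi> \<chi> \<one>\<^bsub>Hc \<chi>\<^esub> \<in> im" by (metis YY.E_closed imageI)
  moreover have "conn \<chi> \<chi>" using assms(4) by (simp add: conn_def)
  ultimately have "cell \<chi> (\<sigma> \<chi>) (\<one>\<^bsub>Hc \<chi>\<^esub> \<otimes>\<^bsub>Hc \<chi>\<^esub> c \<chi>) \<in> im"
    using cell_mult_monomial[OF _ H.one_closed assms(2,3)] im_mult[OF _ assms(1)] by metis
  then show ?thesis using coeffsD[OF assms(2,4)] by simp
qed

text \<open>Row \<open>\<chi>\<close> of the image of \<open>g i\<close> is u times the matrix unit,
  and u is invertible in the base ring.\<close>

lemma im_swap:
  assumes i: "i \<in> {1..<n}" and \<chi>: "\<chi> \<in> Irr" "\<chi> i \<noteq> \<chi> (Suc i)"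
  shows "cell \<chi> (\<chi> \<circ> simple_refl i) \<one>\<^bsub>Hc \<chi>\<^esub> \<in> im"
proof -
  interpret H: kalgebra "Hc \<chi>" by (rule kalgebra_Hc[OF \<chi>(1)])
  have "monomial (sw i) (gc i) \<in> im" using Psi_g[OF i] YY.g_closed by (metis imageI)
  from im_monomial[OF this gc_coeffs[OF i] sw_shifts[OF i] \<chi>(1)]
  have "cell \<chi> (\<chi> \<circ> simple_refl i) (u_pow 1 \<odot>\<^bsub>Hc \<chi>\<^esub> \<one>\<^bsub>Hc \<chi>\<^esub>) \<in> im"
    using \<chi>(2) by (simp add: gc_def)
  from im_smult[OF this, of "u_pow (-1)"] show ?thesis
    unfolding cell_linear(2)[OF conn_sw[OF i \<chi>(1)] H.smult_closed[OF H.one_closed] H.one_closed] by simp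
qed

text \<open>Along a sorting word of the colouring every swap exchanges different values, so matrix
  units in the image join \<open>\<chi>\<close> to the sorted character, and each swap can be
  reversed.\<close>

lemma im_chi0:
  assumes "\<chi> \<in> Irr"
  shows "cell \<chi> (chi0 n \<xi> (comp_of \<chi>)) \<one>\<^bsub>Hc \<chi>\<^esub> \<in> im \<and> cell (chi0 n \<xi> (comp_of \<chi>)) \<chi> \<one>\<^bsub>Hc \<chi>\<^esub> \<in> im"
proof -
  obtain "is" f where "sorts n f is" "f = colour \<chi>" using sorts_exists by blast
  then show ?thesis
    using assms
  proof (induct arbitrary: \<chi> rule: sorts_induct)
    case (Nil f)
    interpret H: kalgebra "Hc \<chi>" by (rule kalgebra_Hc[OF Nil(3)])
    have "\<one>\<^bsub>B\<^esub> \<in> im" using Psi.one by (metis YY.one_closed imageI)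
    then have "cell \<chi> \<chi> \<one>\<^bsub>Hc \<chi>\<^esub> \<in> im"
      using im_monomial[OF _ coeffs_ops(1) id_shifts Nil(3)] by (simp add: monomial_one)
    then show ?case using sorted_eq_chi0[OF Nil(3)] Nil by simp
  next
    case (Cons i f "is")
    interpret H: kalgebra "Hc \<chi>" by (rule kalgebra_Hc[OF Cons(6)])
    define \<psi> where "\<psi> = \<chi> \<circ> simple_refl i"
    have \<psi>: "\<psi> \<in> Irr" "comp_of \<psi> = comp_of \<chi>" "colour \<psi> = colour \<chi> \<circ> simple_refl i"
      unfolding \<psi>_def by (rule Irr_swap[OF Cons(6,1)])+
    have ne: "\<chi> i \<noteq> \<chi> (Suc i)" using Cons(2,5) by (auto simp: colour_def)
    have \<chi>\<psi>: "\<chi> = \<psi> \<circ> simple_refl i" by (simp add: \<psi>_def comp_assoc)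
    have IH: "cell \<psi> (chi0 n \<xi> (comp_of \<chi>)) \<one>\<^bsub>Hc \<chi>\<^esub> \<in> im \<and> cell (chi0 n \<xi> (comp_of \<chi>)) \<psi> \<one>\<^bsub>Hc \<chi>\<^esub> \<in> im"
      using Cons(4)[of \<psi>] Cons(5) \<psi> by simp
    have c0: "chi0 n \<xi> (comp_of \<chi>) \<in> Irr" "comp_of (chi0 n \<xi> (comp_of \<chi>)) = comp_of \<chi>"
      using chi0_Irr[OF Comp_compositions[OF Cons(6)]] by blast+
    have 1: "cell \<chi> \<psi> \<one>\<^bsub>Hc \<chi>\<^esub> \<in> im" unfolding \<psi>_def by (rule im_swap[OF Cons(1,6) ne])
    have "\<psi> i \<noteq> \<psi> (Suc i)" using ne by (simp add: \<psi>_def)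
    from im_swap[OF Cons(1) \<psi>(1) this] have 2: "cell \<psi> \<chi> \<one>\<^bsub>Hc \<chi>\<^esub> \<in> im" using \<psi>(2) \<chi>\<psi> by simp
    have conns: "conn \<chi> \<psi>" "conn \<psi> (chi0 n \<xi> (comp_of \<chi>))" "conn (chi0 n \<xi> (comp_of \<chi>)) \<psi>" "conn \<psi> \<chi>"
      using \<psi> c0 Cons(6) by (simp_all add: conn_def)
    show ?case
      using im_mult[OF 1 conjunct1[OF IH]] im_mult[OF conjunct2[OF IH] 2]
        cell_mult[OF conns(1,2), of "\<one>\<^bsub>Hc \<chi>\<^esub>" "\<one>\<^bsub>Hc \<chi>\<^esub>"] cell_mult[OF conns(3,4), of "\<one>\<^bsub>Hc \<chi>\<^esub>" "\<one>\<^bsub>Hc \<chi>\<^esub>"] c0(2)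
      by simp
  qed
qed

text \<open>At the sorted character \<open>pos\<close> is the identity, so the corner entries of the
  X_p and of the g_p from the Young subgroup are the generators of \<open>H_mu\<close>
  themselves.\<close>

lemma im_corner:
  assumes \<mu>: "\<mu> \<in> compositions d n" and h: "h \<in> carrier (H_mu d \<mu>)"
  shows "cell (chi0 n \<xi> \<mu>) (chi0 n \<xi> \<mu>) h \<in> im"
proof -
  note \<chi>0 = chi0_Irr[OF \<mu>]
  let ?\<chi> = "chi0 n \<xi> \<mu>"
  have conn: "conn ?\<chi> ?\<chi>" using \<chi>0(1) by (simp add: conn_def)
  interpret H: kalgebra "H_mu d \<mu>" by (rule kalgebra_H_mu[OF \<mu>])
  show ?thesis
    using h
  proof (induct rule: H_mu_induct[OF \<mu>, consumes 1, case_names one X X_inv gen smult add mult])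
    case one
    have "\<one>\<^bsub>B\<^esub> \<in> im" using Psi.one by (metis YY.one_closed imageI)
    then show ?case
      using im_monomial[OF _ coeffs_ops(1) id_shifts \<chi>0(1)] \<chi>0(3) by (simp add: monomial_one)
  next
    case (X p)
    have "diag (xc p) \<in> im" using Psi_X[OF X] by (metis YY.X_closed imageI)
    from im_monomial[OF this xc_coeffs[OF X] id_shifts \<chi>0(1)] show ?case
      using \<chi>0(3,4) by (simp add: xc_def)
  next
    case (X_inv p)
    have "diag (\<lambda>\<chi>. inv\<^bsub>Hc \<chi>\<^esub> xc p \<chi>) \<in> im"
    proof (rule rev_image_eqI)
      show "inv\<^bsub>YH d n\<^esub> YY.X p \<in> carrier (YH d n)" by (rule YY.Units_inv_closed[OF YY.X_Units[OF X_inv]])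
      show "diag (\<lambda>\<chi>. inv\<^bsub>Hc \<chi>\<^esub> xc p \<chi>) = Psi (inv\<^bsub>YH d n\<^esub> YY.X p)"
        unfolding Psi.inv[OF YY.X_Units[OF X_inv]] Psi_X[OF X_inv]
        by (rule monomial_id_inv(2)[OF xc_Units[OF _ X_inv], symmetric])
    qed
    from im_monomial[OF this monomial_id_inv(3)[OF xc_Units[OF _ X_inv]] id_shifts \<chi>0(1)] show ?case
      using \<chi>0(3,4) by (simp add: xc_def)
  next
    case (gen p)
    then have p: "p \<in> {1..<n}" "p \<in> {1..n}" "Suc p \<in> {1..n}" "block \<mu> p = block \<mu> (Suc p)" by (auto simp: young_def)
    then have eq: "?\<chi> p = ?\<chi> (Suc p)" using \<chi>0(2) colour_eq_iff[OF \<chi>0(1) p(2,3)] by simp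
    have "monomial (sw p) (gc p) \<in> im" using Psi_g[OF p(1)] YY.g_closed by (metis imageI)
    from im_monomial[OF this gc_coeffs[OF p(1)] sw_shifts[OF p(1)] \<chi>0(1)] show ?case
      using \<chi>0(3,4) eq swap_same[of ?\<chi>, OF eq] by (simp add: gc_def)
  next
    case (smult c x)
    then show ?case using im_smult cell_linear(2)[OF conn] \<chi>0(3) by metis
  next
    case (add x y)
    then show ?case using im_add cell_linear(1)[OF conn] \<chi>0(3) by metis
  next
    case (mult x y)
    then show ?case using im_mult cell_mult[OF conn conn] \<chi>0(3) by metis
  qed
qed

text \<open>An arbitrary entry is a corner entry at the sorted character, moved into place by matrix
  units on both sides.\<close>

lemma im_cell:
  assumes "conn \<chi> \<chi>'" "h \<in> carrier (Hc \<chi>)"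
  shows "cell \<chi> \<chi>' h \<in> im"
proof -
  have \<chi>: "\<chi> \<in> Irr" "\<chi>' \<in> Irr" "comp_of \<chi>' = comp_of \<chi>" using assms(1) by (auto simp: conn_def)
  note \<mu> = Comp_compositions[OF \<chi>(1)]
  interpret H: kalgebra "Hc \<chi>" by (rule kalgebra_Hc[OF \<chi>(1)])
  note \<chi>0 = chi0_Irr(1,3)[OF \<mu>]
  let ?\<chi> = "chi0 n \<xi> (comp_of \<chi>)"
  have c: "conn \<chi> ?\<chi>" "conn ?\<chi> ?\<chi>" "conn ?\<chi> \<chi>'" using \<chi> \<chi>0 by (simp_all add: conn_def)
  have "cell \<chi> ?\<chi> \<one>\<^bsub>Hc \<chi>\<^esub> \<otimes>\<^bsub>B\<^esub> (cell ?\<chi> ?\<chi> h \<otimes>\<^bsub>B\<^esub> cell ?\<chi> \<chi>' \<one>\<^bsub>Hc \<chi>\<^esub>) \<in> im"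
    using im_chi0[OF \<chi>(1)] im_chi0[OF \<chi>(2)] im_corner[OF \<mu> assms(2)] \<chi>(3) by (intro im_mult) auto
  moreover have "cell ?\<chi> ?\<chi> h \<otimes>\<^bsub>B\<^esub> cell ?\<chi> \<chi>' \<one>\<^bsub>Hc \<chi>\<^esub> = cell ?\<chi> \<chi>' h"
    using cell_mult[OF c(2,3), of h "\<one>\<^bsub>Hc \<chi>\<^esub>"] assms(2) \<chi>0(2) by simp
  moreover have "cell \<chi> ?\<chi> \<one>\<^bsub>Hc \<chi>\<^esub> \<otimes>\<^bsub>B\<^esub> cell ?\<chi> \<chi>' h = cell \<chi> \<chi>' h"
    using cell_mult[OF c(1,3), of "\<one>\<^bsub>Hc \<chi>\<^esub>" h] assms(2) by simp
  ultimately show ?thesis by simp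
qed

lemma B_finsum_entry:
  assumes "\<chi> \<in> Irr" "\<psi> \<in> Irr" "comp_of \<psi> = comp_of \<chi>" "finite S" "\<And>s. s \<in> S \<Longrightarrow> f s \<in> carrier B"
  shows "(\<Oplus>\<^bsub>B\<^esub>s\<in>S. f s) (comp_of \<chi>) (\<chi>, \<psi>) = (\<Oplus>\<^bsub>Hc \<chi>\<^esub>s\<in>S. f s (comp_of \<chi>) (\<chi>, \<psi>))"
proof -
  interpret H: kalgebra "Hc \<chi>" by (rule kalgebra_Hc[OF assms(1)])
  show ?thesis
    using assms(4,5)
  proof (induct S rule: finite_induct)
    case empty
    then show ?case by (simp add: B_zero_entry[OF assms(1-3)])
  next
    case (insert s S)
    have "(\<Oplus>\<^bsub>B\<^esub>s\<in>insert s S. f s) = f s \<oplus>\<^bsub>B\<^esub> (\<Oplus>\<^bsub>B\<^esub>s\<in>S. f s)"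
      using insert by (intro B.finsum_insert) auto
    moreover have "(\<Oplus>\<^bsub>Hc \<chi>\<^esub>s\<in>insert s S. f s (comp_of \<chi>) (\<chi>, \<psi>)) =
        f s (comp_of \<chi>) (\<chi>, \<psi>) \<oplus>\<^bsub>Hc \<chi>\<^esub> (\<Oplus>\<^bsub>Hc \<chi>\<^esub>s\<in>S. f s (comp_of \<chi>) (\<chi>, \<psi>))"
      using insert B_entry_closed[OF _ assms(1-3)] by (intro H.finsum_insert) auto
    ultimately show ?case using insert by (simp add: B_add_entry[OF assms(1-3)])
  qed
qed

lemma Psi_surj: "im = carrier B"
proof
  show "im \<subseteq> carrier B" using Psi.closed by auto
  show "carrier B \<subseteq> im"
  proof
    fix x assume x: "x \<in> carrier B"
    define S where "S = {p \<in> Irr \<times> Irr. comp_of (snd p) = comp_of (fst p)}"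
    define f where "f p = cell (fst p) (snd p) (x (comp_of (fst p)) p)" for p
    have fin: "finite S" unfolding S_def using finite_Irr by simp
    have Sc: "conn (fst p) (snd p)" "x (comp_of (fst p)) p \<in> carrier (Hc (fst p))" if "p \<in> S" for p
      using that B_entry_closed[OF x, of "fst p" "snd p"] by (auto simp: S_def conn_def)
    have f: "f p \<in> im" "f p \<in> carrier B" if "p \<in> S" for p
      unfolding f_def using im_cell[OF Sc[OF that]] cell_closed[OF Sc(2)[OF that]] by auto
    have "S' \<subseteq> S \<Longrightarrow> finite S' \<Longrightarrow> (\<Oplus>\<^bsub>B\<^esub>p\<in>S'. f p) \<in> im" for S'
    proof (induct S' rule: infinite_finite_induct)
      case empty
      then show ?case using Psi.zero YY.zero_closed by (metis B.finsum_empty imageI)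
    next
      case (insert p S')
      then have p: "p \<in> S" "(\<Oplus>\<^bsub>B\<^esub>p\<in>S'. f p) \<in> im" by auto
      have "(\<Oplus>\<^bsub>B\<^esub>p\<in>insert p S'. f p) = f p \<oplus>\<^bsub>B\<^esub> (\<Oplus>\<^bsub>B\<^esub>p\<in>S'. f p)"
        using insert f(2) by (intro B.finsum_insert Pi_I) blast+
      then show ?case using im_add[OF f(1)[OF p(1)] p(2)] by simp
    qed simp
    moreover have "(\<Oplus>\<^bsub>B\<^esub>p\<in>S. f p) = x"
    proof (rule B_ext)
      show "(\<Oplus>\<^bsub>B\<^esub>p\<in>S. f p) \<in> carrier B" using f by (intro B.finsum_closed) auto
      fix \<chi> \<psi> assume \<chi>\<psi>: "\<chi> \<in> Irr" "\<psi> \<in> Irr" "comp_of \<psi> = comp_of \<chi>"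
      interpret H: kalgebra "Hc \<chi>" by (rule kalgebra_Hc[OF \<chi>\<psi>(1)])
      have e: "f p (comp_of \<chi>) (\<chi>, \<psi>) = (if p = (\<chi>, \<psi>) then x (comp_of \<chi>) (\<chi>, \<psi>) else \<zero>\<^bsub>Hc \<chi>\<^esub>)" if "p \<in> S" for p
        unfolding f_def cell_entry[OF Sc(1)[OF that] \<chi>\<psi>] by (cases p) auto
      have "(\<Oplus>\<^bsub>Hc \<chi>\<^esub>p\<in>S. f p (comp_of \<chi>) (\<chi>, \<psi>)) = f (\<chi>, \<psi>) (comp_of \<chi>) (\<chi>, \<psi>)"
      proof (rule H.finsum_single[OF fin])
        show "(\<chi>, \<psi>) \<in> S" using \<chi>\<psi> by (simp add: S_def)
      qed (use e B_entry_closed[OF x \<chi>\<psi>] in \<open>auto simp: S_def \<chi>\<psi>\<close>)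
      then show "(\<Oplus>\<^bsub>B\<^esub>p\<in>S. f p) (comp_of \<chi>) (\<chi>, \<psi>) = x (comp_of \<chi>) (\<chi>, \<psi>)"
        using B_finsum_entry[OF \<chi>\<psi> fin f(2)] e[of "(\<chi>, \<psi>)"] \<chi>\<psi> by (simp add: S_def)
    qed (rule x)
    ultimately show "x \<in> im" using fin by (metis order_refl)
  qed
qed

end

subsection \<open>Injectivity\<close>

context yokonuma
begin

text \<open>Where the values differ, g_i^2 is the scalar u^2, so the recursion for X becomes a
  conjugation: \<open>g i\<close> interchanges \<open>X i\<close> with \<open>X (Suc i)\<close> and
  commutes with the others.\<close>

lemma gXE:
  assumes \<psi>: "\<psi> \<in> Irr_T d n" "\<psi> \<circ> simple_refl i \<in> Irr_T d n" and i: "i \<in> {1..<n}"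
    and ne: "\<psi> i \<noteq> \<psi> (Suc i)" and j: "j \<in> {1..n}"
  shows "X j \<otimes> (g i \<otimes> E \<psi>) = g i \<otimes> (X (simple_refl i j) \<otimes> E \<psi>)"
proof -
  let ?\<chi> = "\<psi> \<circ> simple_refl i"
  have ii: "i \<in> {1..n}" "Suc i \<in> {1..n}" using i by auto
  have \<chi>: "?\<chi> \<circ> simple_refl i \<in> Irr_T d n" "?\<chi> i \<noteq> ?\<chi> (Suc i)"
    using \<psi>(1) ne by (simp_all add: comp_assoc)
  have gg: "g i \<otimes> (g i \<otimes> E \<psi>) = u_pow 2 \<odot> E \<psi>" "g i \<otimes> (g i \<otimes> E ?\<chi>) = u_pow 2 \<odot> E ?\<chi>"
    using ggE[OF \<psi> i] ggE[OF \<psi>(2) \<chi>(1) i] ne \<chi>(2) by simp_all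
  have gE: "g i \<otimes> E \<psi> = E ?\<chi> \<otimes> g i" by (rule gE[OF \<psi> i])
  consider "j \<noteq> i" "j \<noteq> Suc i" | "j = Suc i" | "j = i" by blast
  then show ?thesis
  proof cases
    case 1
    then have "g i \<otimes> X j = X j \<otimes> g i" using gX[OF j i] by simp
    moreover have "simple_refl i j = j" using 1 by (simp add: simple_refl_def)
    ultimately show ?thesis by (simp flip: m_assoc)
  next
    case 2
    have "X (Suc i) \<otimes> (g i \<otimes> E \<psi>) = u_pow (-2) \<odot> (g i \<otimes> (X i \<otimes> (g i \<otimes> (g i \<otimes> E \<psi>))))"
      using X_Suc[of i] i by (simp add: m_assoc)
    then show ?thesis using 2 by (simp add: gg)
  next
    case 3
    have "g i \<otimes> (X (Suc i) \<otimes> E \<psi>) = u_pow (-2) \<odot> (g i \<otimes> (g i \<otimes> (X i \<otimes> (g i \<otimes> E \<psi>))))"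
      using X_Suc[of i] i by (simp add: m_assoc)
    \<comment> \<open>The idempotent is moved to the left of \<open>X i\<close>, next to the two
      \<open>g i\<close>, whose product there is u^2.\<close>
    also have "X i \<otimes> (g i \<otimes> E \<psi>) = E ?\<chi> \<otimes> (X i \<otimes> g i)"
      using EX[OF \<psi>(2) ii(1)] by (simp add: gE flip: m_assoc)
    also have "u_pow (-2) \<odot> (g i \<otimes> (g i \<otimes> (E ?\<chi> \<otimes> (X i \<otimes> g i)))) = u_pow (-2) \<odot> (g i \<otimes> (g i \<otimes> E ?\<chi>) \<otimes> (X i \<otimes> g i))"
      by (simp add: m_assoc)
    also have "\<dots> = X i \<otimes> (g i \<otimes> E \<psi>)"
      unfolding gg(2) using EX[OF \<psi>(2) ii(1)] by (simp add: gE flip: m_assoc)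
    finally show ?thesis using 3 by simp
  qed
qed

text \<open>Normalised to square to the identity on eigenspaces with different values at
  \<open>i\<close> and \<open>Suc i\<close>; the braid relations are homogeneous and survive the
  scaling.\<close>

definition \<tau> :: "nat \<Rightarrow> 'a" where "\<tau> i = u_pow (-1) \<odot> g i"

definition T_word :: "nat list \<Rightarrow> 'a" where "T_word is = list_prod A (map \<tau> is)"

lemma \<tau>_closed [simp]: "\<tau> i \<in> carrier A" by (simp add: \<tau>_def)

lemma T_word_closed [simp]: "T_word is \<in> carrier A"
  unfolding T_word_def by (rule list_prod_closed) auto

lemma T_word_simps [simp]: "T_word [] = \<one>" "T_word (i # is) = \<tau> i \<otimes> T_word is"
  by (simp_all add: T_word_def)

lemma T_word_Units: "set is \<subseteq> {1..<n} \<Longrightarrow> T_word is \<in> Units A"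
  by (induct "is") (auto simp: \<tau>_def g_Units intro!: smult_Units Units_m_closed)

lemma T_word_unique:
  assumes "sorts n f is" "sorts n f js" shows "T_word is = T_word js"
  unfolding T_word_def
proof (rule sorts_unique[where P = "\<lambda>_. True" and J = "{1..<n}", OF _ _ _ _ assms])
  fix i assume "i \<in> {1..<n}" "Suc i \<in> {1..<n}"
  then show "\<tau> i \<otimes> (\<tau> (Suc i) \<otimes> \<tau> i) = \<tau> (Suc i) \<otimes> (\<tau> i \<otimes> \<tau> (Suc i))"
    using ggg[of i] by (simp add: \<tau>_def)
next
  fix i j assume "i \<in> {1..<n}" "j \<in> {1..<n}" "Suc i < j"
  then show "\<tau> i \<otimes> \<tau> j = \<tau> j \<otimes> \<tau> i" using gg_far[of i j] by (simp add: \<tau>_def)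
qed auto

lemma \<tau>E:
  assumes "\<chi> \<in> Irr_T d n" "\<chi> \<circ> simple_refl i \<in> Irr_T d n" "i \<in> {1..<n}"
  shows "\<tau> i \<otimes> E \<chi> = E (\<chi> \<circ> simple_refl i) \<otimes> \<tau> i"
  using gE[OF assms] by (simp add: \<tau>_def)

end

section \<open>Left multiplication by the generators on the columns attached to characters\<close>

context root_enumeration
begin

abbreviation "Y \<equiv> YH d n"
abbreviation "g \<equiv> gY d n"
abbreviation "\<chi>0 \<chi> \<equiv> chi0 n \<xi> (comp_of \<chi>)"

text \<open>\<open>col \<chi>\<close> is an element of \<open>E\<^sub>\<chi> Y E\<^sub>0\<close>, obtained from \<open>E\<^sub>0\<close> by a unit, where \<open>E\<^sub>0\<close> belongs to
  the sorted rearrangement of \<open>\<chi>\<close>.\<close>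

definition col :: "(nat \<Rightarrow> complex) \<Rightarrow> (yh_gen list \<Rightarrow>\<^sub>0 K) set" where
  "col \<chi> = YY.T_word (SOME is. sorts n (colour \<chi>) is) \<otimes>\<^bsub>Y\<^esub> YY.E (\<chi>0 \<chi>)"

lemma col_closed [simp]: "col \<chi> \<in> carrier Y"
  by (simp add: col_def)

lemma col_eq: "sorts n (colour \<chi>) is \<Longrightarrow> col \<chi> = YY.T_word is \<otimes>\<^bsub>Y\<^esub> YY.E (\<chi>0 \<chi>)"
  unfolding col_def by (metis YY.T_word_unique someI)

text \<open>Each letter carries the idempotent of one character to that of its swap, so the whole
  word transports the sorted idempotent to \<open>E \<chi>\<close>.\<close>

lemma T_word_E:
  assumes "sorts n f is" "f = colour \<chi>" "\<chi> \<in> Irr"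
  shows "YY.T_word is \<otimes>\<^bsub>Y\<^esub> YY.E (\<chi>0 \<chi>) = YY.E \<chi> \<otimes>\<^bsub>Y\<^esub> YY.T_word is"
  using assms
proof (induct arbitrary: \<chi> rule: sorts_induct)
  case (Nil f)
  then show ?case using sorted_eq_chi0[of \<chi>] by simp
next
  case (Cons i f "is")
  define \<psi> where "\<psi> = \<chi> \<circ> simple_refl i"
  have \<psi>: "\<psi> \<in> Irr" "comp_of \<psi> = comp_of \<chi>" "colour \<psi> = colour \<chi> \<circ> simple_refl i"
    unfolding \<psi>_def by (rule Irr_swap[OF Cons(6,1)])+
  have \<chi>: "\<psi> \<circ> simple_refl i = \<chi>" by (simp add: \<psi>_def comp_assoc)
  have IH: "YY.T_word is \<otimes>\<^bsub>Y\<^esub> YY.E (\<chi>0 \<chi>) = YY.E \<psi> \<otimes>\<^bsub>Y\<^esub> YY.T_word is"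
    using Cons(4)[of \<psi>] Cons(5) \<psi> by simp
  have "YY.\<tau> i \<otimes>\<^bsub>Y\<^esub> YY.E \<psi> = YY.E \<chi> \<otimes>\<^bsub>Y\<^esub> YY.\<tau> i"
    using YY.\<tau>E[OF \<psi>(1) _ Cons(1)] Cons(6) unfolding \<chi> by blast
  then have "YY.\<tau> i \<otimes>\<^bsub>Y\<^esub> (YY.E \<psi> \<otimes>\<^bsub>Y\<^esub> YY.T_word is) = YY.E \<chi> \<otimes>\<^bsub>Y\<^esub> (YY.\<tau> i \<otimes>\<^bsub>Y\<^esub> YY.T_word is)"
    by (simp flip: YY.m_assoc)
  then show ?case by (simp add: YY.m_assoc IH)
qed

context
  fixes \<chi> assumes \<chi>: "\<chi> \<in> Irr"
begin

lemma col_E: "YY.E \<chi> \<otimes>\<^bsub>Y\<^esub> col \<chi> = col \<chi>" "col \<chi> \<otimes>\<^bsub>Y\<^esub> YY.E (\<chi>0 \<chi>) = col \<chi>"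
proof -
  obtain "is" where "is": "sorts n (colour \<chi>) is" using sorts_exists by blast
  have c: "\<chi>0 \<chi> \<in> Irr" using chi0_Irr(1)[OF Comp_compositions[OF \<chi>]] .
  show "YY.E \<chi> \<otimes>\<^bsub>Y\<^esub> col \<chi> = col \<chi>"
    unfolding col_eq[OF "is"] T_word_E[OF "is" refl \<chi>] using YY.EE[OF \<chi>] by (simp flip: YY.m_assoc)
  show "col \<chi> \<otimes>\<^bsub>Y\<^esub> YY.E (\<chi>0 \<chi>) = col \<chi>"
    unfolding col_eq[OF "is"] using YY.EE[OF c] by (simp add: YY.m_assoc)
qed

text \<open>\<open>col \<chi>\<close> is \<open>E \<chi>\<close> times a unit, and the unit can be
  cancelled on the right.\<close>

lemma col_cancel:
  assumes "y \<in> carrier Y" "y \<otimes>\<^bsub>Y\<^esub> col \<chi> = \<zero>\<^bsub>Y\<^esub>"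
  shows "y \<otimes>\<^bsub>Y\<^esub> YY.E \<chi> = \<zero>\<^bsub>Y\<^esub>"
proof -
  obtain "is" where "is": "sorts n (colour \<chi>) is" using sorts_exists by blast
  have u: "YY.T_word is \<in> Units Y" by (rule YY.T_word_Units[OF sorts_set[OF "is"]])
  have "y \<otimes>\<^bsub>Y\<^esub> YY.E \<chi> = y \<otimes>\<^bsub>Y\<^esub> (YY.E \<chi> \<otimes>\<^bsub>Y\<^esub> YY.T_word is) \<otimes>\<^bsub>Y\<^esub> inv\<^bsub>Y\<^esub> YY.T_word is"
    using u assms(1) by (simp add: YY.m_assoc)
  also have "y \<otimes>\<^bsub>Y\<^esub> (YY.E \<chi> \<otimes>\<^bsub>Y\<^esub> YY.T_word is) = \<zero>\<^bsub>Y\<^esub>"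
    using assms(2) unfolding col_eq[OF "is"] T_word_E[OF "is" refl \<chi>] .
  finally show ?thesis using u by simp
qed

lemma t_col: "j \<in> {1..n} \<Longrightarrow> tY d n j \<otimes>\<^bsub>Y\<^esub> col \<chi> = const (\<chi> j) \<odot>\<^bsub>Y\<^esub> col \<chi>"
  using YY.tE(1)[OF \<chi>, of j] col_E(1)
  by (metis YY.E_closed YY.m_assoc YY.smult_mult_left YY.t_closed col_closed)

lemma col_sorted: "(\<And>i. i \<in> {1..<n} \<Longrightarrow> colour \<chi> i \<le> colour \<chi> (Suc i)) \<Longrightarrow> \<chi>0 \<chi> = \<chi> \<and> col \<chi> = YY.E \<chi> \<and> pos \<chi> = id"
  using sorted_eq_chi0[OF \<chi>] col_eq[OF sorts.Nil, of \<chi>] chi0_Irr(4)[OF Comp_compositions[OF \<chi>]] by simp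

lemma col_descent:
  assumes "i \<in> {1..<n}" "colour \<chi> (Suc i) < colour \<chi> i"
  shows "col \<chi> = YY.\<tau> i \<otimes>\<^bsub>Y\<^esub> col (\<chi> \<circ> simple_refl i)"
proof -
  obtain "is" where "is": "sorts n (colour (\<chi> \<circ> simple_refl i)) is" using sorts_exists by blast
  have "sorts n (colour \<chi>) (i # is)"
    by (rule sorts.Cons[OF assms]) (use "is" Irr_swap(3)[OF \<chi> assms(1)] in simp)
  from col_eq[OF this] col_eq[OF "is"] show ?thesis
    unfolding Irr_swap(2)[OF \<chi> assms(1)] by (simp add: YY.m_assoc)
qed

end

text \<open>Either \<open>\<chi>\<close> or its swap has a descent at \<open>i\<close>. If the swap
  has it, its column starts with this very letter; if \<open>\<chi>\<close> has it, the doubled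
  letter reduces by g_i^2 = u^2.\<close>

lemma g_col_diff:
  assumes \<chi>: "\<chi> \<in> Irr" and i: "i \<in> {1..<n}" and ne: "\<chi> i \<noteq> \<chi> (Suc i)"
  shows "g i \<otimes>\<^bsub>Y\<^esub> col \<chi> = u_pow 1 \<odot>\<^bsub>Y\<^esub> col (\<chi> \<circ> simple_refl i)"
proof -
  define \<psi> where "\<psi> = \<chi> \<circ> simple_refl i"
  have \<psi>: "\<psi> \<in> Irr" "comp_of \<psi> = comp_of \<chi>" "colour \<psi> = colour \<chi> \<circ> simple_refl i"
    unfolding \<psi>_def by (rule Irr_swap[OF \<chi> i])+
  have \<psi>\<chi>: "\<psi> \<circ> simple_refl i = \<chi>" by (simp add: \<psi>_def comp_assoc)
  have ii: "i \<in> {1..n}" "Suc i \<in> {1..n}" using i by auto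
  have "colour \<chi> i \<noteq> colour \<chi> (Suc i)" using colour_eq_iff[OF \<chi> ii] ne by simp
  then consider "colour \<chi> (Suc i) < colour \<chi> i" | "colour \<psi> (Suc i) < colour \<psi> i"
    unfolding \<psi>(3) by fastforce
  then show ?thesis
  proof cases
    case 1
    have "g i \<otimes>\<^bsub>Y\<^esub> (g i \<otimes>\<^bsub>Y\<^esub> YY.E \<psi>) = u_pow 2 \<odot>\<^bsub>Y\<^esub> YY.E \<psi>"
      using YY.ggE[OF \<psi>(1) _ i] \<chi> ne unfolding \<psi>\<chi> by (auto simp: \<psi>_def)
    then have "g i \<otimes>\<^bsub>Y\<^esub> (g i \<otimes>\<^bsub>Y\<^esub> YY.E \<psi>) \<otimes>\<^bsub>Y\<^esub> col \<psi> = u_pow 2 \<odot>\<^bsub>Y\<^esub> (YY.E \<psi> \<otimes>\<^bsub>Y\<^esub> col \<psi>)" by simp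
    then have "g i \<otimes>\<^bsub>Y\<^esub> (g i \<otimes>\<^bsub>Y\<^esub> col \<psi>) = u_pow 2 \<odot>\<^bsub>Y\<^esub> col \<psi>"
      using col_E(1)[OF \<psi>(1)] by (simp add: YY.m_assoc)
    then show ?thesis
      unfolding col_descent[OF \<chi> i 1] \<psi>_def[symmetric] by (simp add: YY.\<tau>_def)
  next
    case 2
    show ?thesis
      unfolding \<psi>_def[symmetric] col_descent[OF \<psi>(1) i 2] \<psi>\<chi> by (simp add: YY.\<tau>_def)
  qed
qed

text \<open>Each letter of a sorting word exchanges different values, so \<open>gXE\<close> applies
  letter by letter and carries the index of X to its sorted place.\<close>

lemma X_col:
  assumes "\<chi> \<in> Irr" "j \<in> {1..n}"
  shows "YY.X j \<otimes>\<^bsub>Y\<^esub> col \<chi> = col \<chi> \<otimes>\<^bsub>Y\<^esub> YY.X (pos \<chi> j)"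
proof -
  obtain "is" f where "sorts n f is" "f = colour \<chi>" using sorts_exists by blast
  then show ?thesis
    using assms
  proof (induct arbitrary: \<chi> j rule: sorts_induct)
    case (Nil f)
    then show ?case using col_sorted[of \<chi>] YY.EX[of \<chi> j] by simp
  next
    case (Cons i f "is")
    define \<psi> where "\<psi> = \<chi> \<circ> simple_refl i"
    have \<psi>: "\<psi> \<in> Irr" "colour \<psi> = colour \<chi> \<circ> simple_refl i"
      unfolding \<psi>_def by (rule Irr_swap[OF Cons(6,1)])+
    have \<psi>\<chi>: "\<psi> \<circ> simple_refl i = \<chi>" by (simp add: \<psi>_def comp_assoc)
    have ne: "\<chi> i \<noteq> \<chi> (Suc i)" using Cons(2,5) by (auto simp: colour_def)
    have sj: "simple_refl i j \<in> {1..n}" using simple_refl_in[OF Cons(1)] Cons(7) by blast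
    have IH: "YY.X (simple_refl i j) \<otimes>\<^bsub>Y\<^esub> col \<psi> = col \<psi> \<otimes>\<^bsub>Y\<^esub> YY.X (pos \<chi> j)"
      using Cons(4)[OF _ \<psi>(1) sj] Cons(5) \<psi>(2) pos_swap[OF Cons(6,1) ne, folded \<psi>_def] by simp
    have "YY.X j \<otimes>\<^bsub>Y\<^esub> (g i \<otimes>\<^bsub>Y\<^esub> YY.E \<psi>) = g i \<otimes>\<^bsub>Y\<^esub> (YY.X (simple_refl i j) \<otimes>\<^bsub>Y\<^esub> YY.E \<psi>)"
      using YY.gXE[OF \<psi>(1) _ Cons(1) _ Cons(7)] Cons(6) ne unfolding \<psi>\<chi> by (auto simp: \<psi>_def)
    then have "YY.X j \<otimes>\<^bsub>Y\<^esub> (g i \<otimes>\<^bsub>Y\<^esub> YY.E \<psi>) \<otimes>\<^bsub>Y\<^esub> col \<psi> = g i \<otimes>\<^bsub>Y\<^esub> (YY.X (simple_refl i j) \<otimes>\<^bsub>Y\<^esub> YY.E \<psi>) \<otimes>\<^bsub>Y\<^esub> col \<psi>" by simp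
    then have "YY.X j \<otimes>\<^bsub>Y\<^esub> (g i \<otimes>\<^bsub>Y\<^esub> col \<psi>) = g i \<otimes>\<^bsub>Y\<^esub> (col \<psi> \<otimes>\<^bsub>Y\<^esub> YY.X (pos \<chi> j))"
      using col_E(1)[OF \<psi>(1)] IH by (simp add: YY.m_assoc)
    then show ?case
      unfolding col_descent[OF Cons(6,1) Cons(2)[unfolded Cons(5)]] \<psi>_def[symmetric]
      by (simp add: YY.\<tau>_def YY.m_assoc)
  qed
qed

text \<open>Induction on the inversions of the colouring. A descent far from \<open>i\<close>
  commutes with \<open>g i\<close>; a neighbouring one is resolved by two swaps that carry the equal
  pair past the third letter, and the braid relation turns \<open>g i\<close> into
  \<open>g k\<close>.\<close>

lemma g_col_same:
  assumes "\<chi> \<in> Irr" "i \<in> {1..<n}" "\<chi> i = \<chi> (Suc i)"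
  shows "g i \<otimes>\<^bsub>Y\<^esub> col \<chi> = col \<chi> \<otimes>\<^bsub>Y\<^esub> g (pos \<chi> i)"
  using assms
proof (induct "card (inversions n (colour \<chi>))" arbitrary: \<chi> i rule: less_induct)
  case less
  note \<chi> = less(2) and i = less(3) and eq = less(4)
  have step: "colour (\<chi> \<circ> simple_refl k) = colour \<chi> \<circ> simple_refl k" "\<chi> \<circ> simple_refl k \<in> Irr"
    "card (inversions n (colour (\<chi> \<circ> simple_refl k))) < card (inversions n (colour \<chi>))"
    "pos (\<chi> \<circ> simple_refl k) = pos \<chi> \<circ> simple_refl k"
    "col \<chi> = YY.\<tau> k \<otimes>\<^bsub>Y\<^esub> col (\<chi> \<circ> simple_refl k)"
    if k: "k \<in> {1..<n}" "colour \<chi> (Suc k) < colour \<chi> k" and \<chi>: "\<chi> \<in> Irr" for k \<chi>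
  proof -
    show c: "colour (\<chi> \<circ> simple_refl k) = colour \<chi> \<circ> simple_refl k" "\<chi> \<circ> simple_refl k \<in> Irr"
      using Irr_swap(3,1)[OF \<chi> k(1)] .
    show "card (inversions n (colour (\<chi> \<circ> simple_refl k))) < card (inversions n (colour \<chi>))"
      unfolding c using card_inversions_descent[OF k] by simp
    show "pos (\<chi> \<circ> simple_refl k) = pos \<chi> \<circ> simple_refl k"
      using k by (intro pos_swap \<chi>) (auto simp: colour_def)
    show "col \<chi> = YY.\<tau> k \<otimes>\<^bsub>Y\<^esub> col (\<chi> \<circ> simple_refl k)" by (rule col_descent[OF \<chi> k])
  qed
  show ?case
  proof (cases "\<exists>k\<in>{1..<n}. colour \<chi> (Suc k) < colour \<chi> k")
    case False
    then have "\<chi>0 \<chi> = \<chi>" "col \<chi> = YY.E \<chi>" "pos \<chi> = id" using col_sorted[OF \<chi>] by force+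
    then show ?thesis using YY.gE[OF \<chi> _ i] \<chi> swap_same[OF eq] by simp
  next
    case True
    then obtain k where k: "k \<in> {1..<n}" "colour \<chi> (Suc k) < colour \<chi> k" by blast
    have ceq: "colour \<chi> i = colour \<chi> (Suc i)" using eq by (simp add: colour_def)
    define \<psi> where "\<psi> = \<chi> \<circ> simple_refl k"
    note s1 = step[OF k \<chi>, folded \<psi>_def]
    have "k \<noteq> i" using k(2) ceq by auto
    then consider "Suc k < i \<or> Suc i < k" | "k = Suc i \<or> i = Suc k" by linarith
    then show ?thesis
    proof cases
      case 1
      have fix_i: "simple_refl k i = i" "simple_refl k (Suc i) = Suc i" using 1 by (auto simp: simple_refl_def transpose_def)
      have "g i \<otimes>\<^bsub>Y\<^esub> col \<psi> = col \<psi> \<otimes>\<^bsub>Y\<^esub> g (pos \<chi> i)"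
        using less(1)[OF s1(3,2) i] eq fix_i s1(4) by (simp add: \<psi>_def)
      moreover have "g i \<otimes>\<^bsub>Y\<^esub> YY.\<tau> k = YY.\<tau> k \<otimes>\<^bsub>Y\<^esub> g i"
        using YY.gg_far'[OF i k(1)] 1 by (auto simp: YY.\<tau>_def)
      then have "g i \<otimes>\<^bsub>Y\<^esub> (YY.\<tau> k \<otimes>\<^bsub>Y\<^esub> col \<psi>) = YY.\<tau> k \<otimes>\<^bsub>Y\<^esub> (g i \<otimes>\<^bsub>Y\<^esub> col \<psi>)"
        by (rule YY.comm_left) simp_all
      ultimately show ?thesis unfolding s1(5) by (simp add: YY.m_assoc)
    next
      case 2
      \<comment> \<open>After the swap at \<open>k\<close> the third colour stands between the two
        equal ones, which creates a descent at \<open>i\<close>; the second swap leaves the equal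
        pair at \<open>k\<close> and \<open>Suc k\<close>.\<close>
      have d2: "colour \<psi> (Suc i) < colour \<psi> i"
        using 2 k(2) ceq unfolding s1(1) by (auto simp: simple_refl_def transpose_def)
      define \<phi> where "\<phi> = \<psi> \<circ> simple_refl i"
      note s2 = step[OF i d2 s1(2), folded \<phi>_def]
      have "g k \<otimes>\<^bsub>Y\<^esub> col \<phi> = col \<phi> \<otimes>\<^bsub>Y\<^esub> g (pos \<phi> k)"
      proof (rule less(1)[OF _ s2(2) k(1)])
        show "card (inversions n (colour \<phi>)) < card (inversions n (colour \<chi>))" using s1(3) s2(3) by simp
        show "\<phi> k = \<phi> (Suc k)" using 2 eq unfolding \<phi>_def \<psi>_def by (auto simp: simple_refl_def transpose_def)
      qed
      moreover have "pos \<phi> k = pos \<chi> i" unfolding s2(4) s1(4) using 2 by (auto simp: simple_refl_def transpose_def)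
      moreover have "g i \<otimes>\<^bsub>Y\<^esub> (YY.\<tau> k \<otimes>\<^bsub>Y\<^esub> YY.\<tau> i) = YY.\<tau> k \<otimes>\<^bsub>Y\<^esub> (YY.\<tau> i \<otimes>\<^bsub>Y\<^esub> g k)"
        using 2 YY.ggg[of i] YY.ggg[of k] i k(1) by (auto simp: YY.\<tau>_def)
      then have "g i \<otimes>\<^bsub>Y\<^esub> (YY.\<tau> k \<otimes>\<^bsub>Y\<^esub> YY.\<tau> i) \<otimes>\<^bsub>Y\<^esub> col \<phi> = YY.\<tau> k \<otimes>\<^bsub>Y\<^esub> (YY.\<tau> i \<otimes>\<^bsub>Y\<^esub> g k) \<otimes>\<^bsub>Y\<^esub> col \<phi>" by simp
      ultimately show ?thesis unfolding s1(5) s2(5) by (simp add: YY.m_assoc)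
    qed
  qed
qed

end

section \<open>The Hecke algebra inside the corner of the sorted idempotent\<close>

context root_enumeration
begin

context
  fixes \<mu> assumes \<mu>: "\<mu> \<in> compositions d n"
begin

abbreviation "c0 \<equiv> chi0 n \<xi> \<mu>"
abbreviation "E0 \<equiv> YY.E c0"

lemma kalgebra_corner_E0: "kalgebra (corner Y E0)"
  by (rule YY.kalgebra_corner[OF YY.E_closed YY.EE[OF chi0_Irr(1)[OF \<mu>]]])

lemma young_chi0:
  assumes "p \<in> young n \<mu>"
  shows "p \<in> {1..<n}" "p \<in> {1..n}" "Suc p \<in> {1..n}" "c0 p = c0 (Suc p)" "c0 \<circ> simple_refl p = c0"
proof -
  show p: "p \<in> {1..<n}" "p \<in> {1..n}" "Suc p \<in> {1..n}" using assms by (auto simp: young_def)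
  show eq: "c0 p = c0 (Suc p)"
    using assms chi0_Irr(2)[OF \<mu>] p colour_eq_iff[OF chi0_Irr(1)[OF \<mu>] p(2,3)] by (simp add: young_def)
  show "c0 \<circ> simple_refl p = c0" by (rule swap_same[OF eq])
qed

lemma E0_E0: "E0 \<otimes>\<^bsub>Y\<^esub> E0 = E0"
  by (rule YY.EE[OF chi0_Irr(1)[OF \<mu>]])

lemma g_E0: "p \<in> young n \<mu> \<Longrightarrow> g p \<otimes>\<^bsub>Y\<^esub> E0 = E0 \<otimes>\<^bsub>Y\<^esub> g p"
  using YY.gE[OF chi0_Irr(1)[OF \<mu>] _ young_chi0(1)] chi0_Irr(1)[OF \<mu>] young_chi0(5) by metis

lemma X_E0: "p \<in> {1..n} \<Longrightarrow> YY.X p \<otimes>\<^bsub>Y\<^esub> E0 = E0 \<otimes>\<^bsub>Y\<^esub> YY.X p"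
  using YY.EX[OF chi0_Irr(1)[OF \<mu>]] by simp

text \<open>When the right factor commutes with \<open>E0\<close>, products in the corner are formed
  as outside, so relations of the large algebra transfer.\<close>

lemma corner_mult:
  assumes "a \<in> carrier Y" "b \<in> carrier Y" "b \<otimes>\<^bsub>Y\<^esub> E0 = E0 \<otimes>\<^bsub>Y\<^esub> b"
  shows "(a \<otimes>\<^bsub>Y\<^esub> E0) \<otimes>\<^bsub>Y\<^esub> (b \<otimes>\<^bsub>Y\<^esub> E0) = (a \<otimes>\<^bsub>Y\<^esub> b) \<otimes>\<^bsub>Y\<^esub> E0"
proof -
  have "E0 \<otimes>\<^bsub>Y\<^esub> (b \<otimes>\<^bsub>Y\<^esub> E0) = b \<otimes>\<^bsub>Y\<^esub> E0"
    using YY.comm_left[of E0 b E0] assms E0_E0 by simp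
  then show ?thesis using assms by (simp add: YY.m_assoc)
qed

lemma corner_closed:
  assumes "a \<in> carrier Y" "a \<otimes>\<^bsub>Y\<^esub> E0 = E0 \<otimes>\<^bsub>Y\<^esub> a"
  shows "a \<otimes>\<^bsub>Y\<^esub> E0 \<in> carrier (corner Y E0)"
  using YY.comm_left[of E0 a E0] assms E0_E0 by (simp add: YY.m_assoc)

lemma corner_Units:
  assumes "a \<in> Units Y" "a \<otimes>\<^bsub>Y\<^esub> E0 = E0 \<otimes>\<^bsub>Y\<^esub> a"
  shows "a \<otimes>\<^bsub>Y\<^esub> E0 \<in> Units (corner Y E0)"
proof -
  have b: "inv\<^bsub>Y\<^esub> a \<otimes>\<^bsub>Y\<^esub> E0 = E0 \<otimes>\<^bsub>Y\<^esub> inv\<^bsub>Y\<^esub> a"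
    by (rule YY.inv_comm[OF assms(2)[symmetric] YY.E_closed assms(1), symmetric])
  have cl: "a \<in> carrier Y" "inv\<^bsub>Y\<^esub> a \<in> carrier Y" using assms(1) by auto
  have "inv\<^bsub>Y\<^esub> a \<otimes>\<^bsub>Y\<^esub> E0 \<otimes>\<^bsub>Y\<^esub> (a \<otimes>\<^bsub>Y\<^esub> E0) = E0" "a \<otimes>\<^bsub>Y\<^esub> E0 \<otimes>\<^bsub>Y\<^esub> (inv\<^bsub>Y\<^esub> a \<otimes>\<^bsub>Y\<^esub> E0) = E0"
    unfolding corner_mult[OF cl(2,1) assms(2)] corner_mult[OF cl b] using assms(1) by simp_all
  then show ?thesis
    unfolding Units_def using corner_closed[OF cl(1) assms(2)] corner_closed[OF cl(2) b] by auto
qed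

text \<open>The Young subgroup fixes the sorted character, so its g and all X commute with
  \<open>E0\<close>; on this eigenspace \<open>ggE\<close> supplies the Hecke form of the quadratic
  relation.\<close>

lemma Phi_exists: "\<exists>\<phi>. \<phi> \<in> alg_hom (H_mu d \<mu>) (corner Y E0) \<and>
    (\<forall>p\<in>young n \<mu>. \<phi> (H_mu_gen d \<mu> p) = g p \<otimes>\<^bsub>Y\<^esub> E0) \<and> (\<forall>p\<in>{1..n}. \<phi> (H_mu_X d \<mu> p) = YY.X p \<otimes>\<^bsub>Y\<^esub> E0)"
proof -
  note y = young_chi0
  have gcl: "g p \<in> carrier Y" for p by simp
  obtain \<phi> where "\<phi> \<in> alg_hom (H_mu d \<mu>) (corner Y E0)"
    "\<And>p. p \<in> young n \<mu> \<Longrightarrow> \<phi> (H_mu_gen d \<mu> p) = g p \<otimes>\<^bsub>Y\<^esub> E0"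
    "\<And>p. p \<in> {1..n} \<Longrightarrow> \<phi> (H_mu_X d \<mu> p) = YY.X p \<otimes>\<^bsub>Y\<^esub> E0"
  proof (rule H_mu_hom_exists[OF \<mu> kalgebra_corner_E0,
        where \<gamma> = "\<lambda>p. g p \<otimes>\<^bsub>Y\<^esub> E0" and \<zeta> = "\<lambda>p. YY.X p \<otimes>\<^bsub>Y\<^esub> E0"], unfold corner_simps(2-))
    fix p assume p: "p \<in> young n \<mu>"
    show "g p \<otimes>\<^bsub>Y\<^esub> E0 \<in> carrier (corner Y E0)" by (rule corner_closed[OF gcl g_E0[OF p]])
    have c0: "c0 \<circ> simple_refl p \<in> Irr" using y(5)[OF p] chi0_Irr(1)[OF \<mu>] by simp
    show "g p \<otimes>\<^bsub>Y\<^esub> E0 \<otimes>\<^bsub>Y\<^esub> (g p \<otimes>\<^bsub>Y\<^esub> E0) = u_pow 2 \<odot>\<^bsub>Y\<^esub> E0 \<oplus>\<^bsub>Y\<^esub> v \<odot>\<^bsub>Y\<^esub> (g p \<otimes>\<^bsub>Y\<^esub> E0)"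
      unfolding corner_mult[OF gcl gcl g_E0[OF p]]
      using YY.ggE[OF chi0_Irr(1)[OF \<mu>] c0 y(1)[OF p]] y(4)[OF p] by (simp add: YY.m_assoc)
    show "g p \<otimes>\<^bsub>Y\<^esub> E0 \<otimes>\<^bsub>Y\<^esub> (YY.X p \<otimes>\<^bsub>Y\<^esub> E0 \<otimes>\<^bsub>Y\<^esub> (g p \<otimes>\<^bsub>Y\<^esub> E0)) = u_pow 2 \<odot>\<^bsub>Y\<^esub> (YY.X (Suc p) \<otimes>\<^bsub>Y\<^esub> E0)"
    proof -
      have Xg: "YY.X p \<otimes>\<^bsub>Y\<^esub> g p \<otimes>\<^bsub>Y\<^esub> E0 = E0 \<otimes>\<^bsub>Y\<^esub> (YY.X p \<otimes>\<^bsub>Y\<^esub> g p)"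
        using g_E0[OF p] X_E0[OF y(2)[OF p]] YY.comm_left[of "YY.X p" E0 "g p"] by (simp add: YY.m_assoc)
      show ?thesis
        unfolding corner_mult[OF YY.X_closed gcl g_E0[OF p]] corner_mult[OF gcl YY.m_closed[OF YY.X_closed gcl] Xg]
        using YY.gXg[of p] y(1)[OF p] by simp
    qed
    fix q assume q: "q \<in> young n \<mu>"
    show "g p \<otimes>\<^bsub>Y\<^esub> E0 \<otimes>\<^bsub>Y\<^esub> (g q \<otimes>\<^bsub>Y\<^esub> E0) = g q \<otimes>\<^bsub>Y\<^esub> E0 \<otimes>\<^bsub>Y\<^esub> (g p \<otimes>\<^bsub>Y\<^esub> E0)" if "Suc p < q"
      unfolding corner_mult[OF gcl gcl g_E0[OF p]] corner_mult[OF gcl gcl g_E0[OF q]]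
      using YY.gg_far[OF y(1)[OF p] y(1)[OF q] that] by simp
  next
    fix p assume p: "p \<in> {1..n}"
    show "YY.X p \<otimes>\<^bsub>Y\<^esub> E0 \<in> Units (corner Y E0)" by (rule corner_Units[OF YY.X_Units[OF p] X_E0[OF p]])
    fix q assume q: "q \<in> {1..n}"
    show "YY.X p \<otimes>\<^bsub>Y\<^esub> E0 \<otimes>\<^bsub>Y\<^esub> (YY.X q \<otimes>\<^bsub>Y\<^esub> E0) = YY.X q \<otimes>\<^bsub>Y\<^esub> E0 \<otimes>\<^bsub>Y\<^esub> (YY.X p \<otimes>\<^bsub>Y\<^esub> E0)"
      unfolding corner_mult[OF YY.X_closed YY.X_closed X_E0[OF p]] corner_mult[OF YY.X_closed YY.X_closed X_E0[OF q]]
      using YY.XX[OF p q] by simp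
  next
    fix p q assume p: "p \<in> young n \<mu>" and q: "q \<in> {1..n}" and pq: "p \<noteq> q" "Suc p \<noteq> q"
    show "g p \<otimes>\<^bsub>Y\<^esub> E0 \<otimes>\<^bsub>Y\<^esub> (YY.X q \<otimes>\<^bsub>Y\<^esub> E0) = YY.X q \<otimes>\<^bsub>Y\<^esub> E0 \<otimes>\<^bsub>Y\<^esub> (g p \<otimes>\<^bsub>Y\<^esub> E0)"
      unfolding corner_mult[OF gcl YY.X_closed X_E0[OF q]] corner_mult[OF YY.X_closed gcl g_E0[OF p]]
      using YY.gX[OF q y(1)[OF p] pq] by simp
  next
    fix p assume p: "p \<in> young n \<mu>" and q: "Suc p \<in> young n \<mu>"
    have gg: "g r \<otimes>\<^bsub>Y\<^esub> g s \<otimes>\<^bsub>Y\<^esub> E0 = E0 \<otimes>\<^bsub>Y\<^esub> (g r \<otimes>\<^bsub>Y\<^esub> g s)" if "r \<in> young n \<mu>" "s \<in> young n \<mu>" for r s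
      using g_E0[OF that(1)] g_E0[OF that(2)] YY.comm_left[of "g r" E0 "g s"] by (simp add: YY.m_assoc)
    show "g p \<otimes>\<^bsub>Y\<^esub> E0 \<otimes>\<^bsub>Y\<^esub> (g (Suc p) \<otimes>\<^bsub>Y\<^esub> E0 \<otimes>\<^bsub>Y\<^esub> (g p \<otimes>\<^bsub>Y\<^esub> E0)) =
        g (Suc p) \<otimes>\<^bsub>Y\<^esub> E0 \<otimes>\<^bsub>Y\<^esub> (g p \<otimes>\<^bsub>Y\<^esub> E0 \<otimes>\<^bsub>Y\<^esub> (g (Suc p) \<otimes>\<^bsub>Y\<^esub> E0))"
      unfolding corner_mult[OF gcl gcl g_E0[OF p]] corner_mult[OF gcl gcl g_E0[OF q]]
        corner_mult[OF gcl YY.m_closed[OF gcl gcl] gg[OF p q]] corner_mult[OF gcl YY.m_closed[OF gcl gcl] gg[OF q p]]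
      using YY.ggg[OF y(1)[OF p] y(1)[OF q]] by simp
  qed blast
  then show ?thesis by blast
qed

definition Phi where
  "Phi = (SOME \<phi>. \<phi> \<in> alg_hom (H_mu d \<mu>) (corner Y E0) \<and>
    (\<forall>p\<in>young n \<mu>. \<phi> (H_mu_gen d \<mu> p) = g p \<otimes>\<^bsub>Y\<^esub> E0) \<and> (\<forall>p\<in>{1..n}. \<phi> (H_mu_X d \<mu> p) = YY.X p \<otimes>\<^bsub>Y\<^esub> E0))"

lemma Phi_hom: "kalgebra_hom (H_mu d \<mu>) (corner Y E0) Phi"
  using someI_ex[OF Phi_exists] unfolding Phi_def[symmetric]
  by (intro kalgebra_hom.intro kalgebra_H_mu[OF \<mu>] kalgebra_corner_E0 kalgebra_hom_axioms.intro) blast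

lemma Phi_gen: "p \<in> young n \<mu> \<Longrightarrow> Phi (H_mu_gen d \<mu> p) = g p \<otimes>\<^bsub>Y\<^esub> E0"
  and Phi_X: "p \<in> {1..n} \<Longrightarrow> Phi (H_mu_X d \<mu> p) = YY.X p \<otimes>\<^bsub>Y\<^esub> E0"
  using someI_ex[OF Phi_exists] unfolding Phi_def[symmetric] by blast+

interpretation H: kalgebra "H_mu d \<mu>" by (rule kalgebra_H_mu[OF \<mu>])
interpretation Phi: kalgebra_hom "H_mu d \<mu>" "corner Y E0" Phi by (rule Phi_hom)

lemma Phi_closed [simp]: "h \<in> carrier (H_mu d \<mu>) \<Longrightarrow> Phi h \<in> carrier Y"
  using Phi.closed[of h] by simp

text \<open>Sums in the corner and in \<open>Y\<close> belong to different structures that share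
  addition and zero; the induction passes from one to the other.\<close>

lemma Phi_finsum:
  assumes "finite S" "f \<in> S \<rightarrow> carrier (H_mu d \<mu>)"
  shows "Phi (\<Oplus>\<^bsub>H_mu d \<mu>\<^esub>s\<in>S. f s) = (\<Oplus>\<^bsub>Y\<^esub>s\<in>S. Phi (f s))"
  using assms
proof (induct S)
  case empty
  then show ?case using Phi.zero by simp
next
  case (insert s S)
  then have f: "f s \<in> carrier (H_mu d \<mu>)" "f \<in> S \<rightarrow> carrier (H_mu d \<mu>)" by auto
  then have "(\<lambda>s. Phi (f s)) \<in> S \<rightarrow> carrier Y" by (simp add: Pi_iff)
  then show ?case
    using insert(1-3) f Phi.add[OF f(1) H.finsum_closed[OF f(2)]] by simp
qed

abbreviation "entry y \<chi> \<chi>' \<equiv> Psi y \<mu> (\<chi>, \<chi>')"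

lemma entry_closed: "y \<in> carrier Y \<Longrightarrow> \<chi> \<in> chars \<mu> \<Longrightarrow> \<chi>' \<in> chars \<mu> \<Longrightarrow> entry y \<chi> \<chi>' \<in> carrier (H_mu d \<mu>)"
  using B_entry_closed[OF Psi.closed, of y \<chi> \<chi>'] by (auto simp: chars_iff)

text \<open>\<open>acts y\<close> says that \<open>Psi y\<close>, pushed into the corner, is the matrix of left multiplication
  by \<open>y\<close> in terms of the \<open>col \<chi>\<close>; hence \<open>y\<close> annihilates the columns when \<open>Psi y = 0\<close>.\<close>

definition acts :: "(yh_gen list \<Rightarrow>\<^sub>0 K) set \<Rightarrow> bool" where
  "acts y \<longleftrightarrow> (\<forall>\<chi>'\<in>chars \<mu>. y \<otimes>\<^bsub>Y\<^esub> col \<chi>' = (\<Oplus>\<^bsub>Y\<^esub>\<chi>\<in>chars \<mu>. col \<chi> \<otimes>\<^bsub>Y\<^esub> Phi (entry y \<chi> \<chi>')))"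

text \<open>The last assumption says that \<open>\<psi>\<close> is the only row whose entry can lie
  in column \<open>\<chi>'\<close>, so the sum over rows collapses.\<close>

lemma acts_monomial:
  assumes "Psi y = monomial \<sigma> c" "c \<in> coeffs"
    "\<And>\<chi>'. \<chi>' \<in> chars \<mu> \<Longrightarrow> \<exists>\<psi>\<in>chars \<mu>. \<sigma> \<psi> = \<chi>' \<and> (\<forall>\<chi>\<in>chars \<mu>. \<sigma> \<chi> = \<chi>' \<longrightarrow> \<chi> = \<psi>) \<and>
      y \<otimes>\<^bsub>Y\<^esub> col \<chi>' = col \<psi> \<otimes>\<^bsub>Y\<^esub> Phi (c \<psi>)"
  shows "acts y"
  unfolding acts_def
proof
  fix \<chi>' assume \<chi>': "\<chi>' \<in> chars \<mu>"
  then obtain \<psi> where \<psi>: "\<psi> \<in> chars \<mu>" "\<sigma> \<psi> = \<chi>'" "\<And>\<chi>. \<chi> \<in> chars \<mu> \<Longrightarrow> \<sigma> \<chi> = \<chi>' \<Longrightarrow> \<chi> = \<psi>"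
    "y \<otimes>\<^bsub>Y\<^esub> col \<chi>' = col \<psi> \<otimes>\<^bsub>Y\<^esub> Phi (c \<psi>)"
    using assms(3)[OF \<chi>'] by blast
  have e: "entry y \<chi> \<chi>' = (if \<chi> = \<psi> then c \<psi> else \<zero>\<^bsub>H_mu d \<mu>\<^esub>)" if \<chi>: "\<chi> \<in> chars \<mu>" for \<chi>
  proof -
    have c: "\<chi> \<in> Irr" "\<chi>' \<in> Irr" "comp_of \<chi>' = comp_of \<chi>" "comp_of \<chi> = \<mu>"
      using \<chi> \<chi>' by (simp_all add: chars_iff)
    have "\<chi>' = \<sigma> \<chi> \<longleftrightarrow> \<chi> = \<psi>" using \<psi>(2) \<psi>(3)[OF \<chi>] by blast
    then show ?thesis using monomial_entry[OF c(1-3), of \<sigma> c] unfolding assms(1) c(4) by simp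
  qed
  have c: "c \<psi> \<in> carrier (H_mu d \<mu>)" using coeffsD[OF assms(2)] \<psi>(1) by (auto simp: chars_iff)
  have "(\<Oplus>\<^bsub>Y\<^esub>\<chi>\<in>chars \<mu>. col \<chi> \<otimes>\<^bsub>Y\<^esub> Phi (entry y \<chi> \<chi>')) = col \<psi> \<otimes>\<^bsub>Y\<^esub> Phi (entry y \<psi> \<chi>')"
    by (rule YY.finsum_single[OF finite_chars \<psi>(1)]) (use e \<psi>(1) c Phi.zero in \<open>simp_all\<close>)
  then show "y \<otimes>\<^bsub>Y\<^esub> col \<chi>' = (\<Oplus>\<^bsub>Y\<^esub>\<chi>\<in>chars \<mu>. col \<chi> \<otimes>\<^bsub>Y\<^esub> Phi (entry y \<chi> \<chi>'))"
    using e[OF \<psi>(1)] \<psi>(4) by simp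
qed

lemma acts_diag:
  assumes "Psi y = diag c" "c \<in> coeffs" "\<And>\<chi>. \<chi> \<in> chars \<mu> \<Longrightarrow> y \<otimes>\<^bsub>Y\<^esub> col \<chi> = col \<chi> \<otimes>\<^bsub>Y\<^esub> Phi (c \<chi>)"
  shows "acts y"
  by (rule acts_monomial[OF assms(1,2)]) (use assms(3) in blast)

lemma col_Phi_one: "\<chi> \<in> chars \<mu> \<Longrightarrow> col \<chi> \<otimes>\<^bsub>Y\<^esub> E0 = col \<chi>"
  using col_E(2)[of \<chi>] by (auto simp: chars_iff)

text \<open>The elements acting on the columns by their matrices form a subalgebra, so generators
  suffice. Their matrices are monomial, and the required equations are the rules for g, X and t on
  columns.\<close>

lemma acts_all:
  assumes "y \<in> carrier Y" shows "acts y"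
  using assms
proof (induct rule: YH_induct)
  case one
  show ?case
    by (rule acts_diag[of _ "\<lambda>\<chi>. \<one>\<^bsub>Hc \<chi>\<^esub>"]) (use Phi.one col_Phi_one in \<open>auto simp: monomial_one chars_iff\<close>)
next
  case (gen s)
  have n1: "1 \<in> {1..n}" by (rule in_one)
  have XP: "YY.X j \<otimes>\<^bsub>Y\<^esub> col \<chi> = col \<chi> \<otimes>\<^bsub>Y\<^esub> Phi (xc j \<chi>)" if "\<chi> \<in> chars \<mu>" "j \<in> {1..n}" for \<chi> j
  proof -
    have \<chi>: "\<chi> \<in> Irr" "comp_of \<chi> = \<mu>" "pos \<chi> j \<in> {1..n}" using that pos_in by (auto simp: chars_iff)
    have "col \<chi> \<otimes>\<^bsub>Y\<^esub> Phi (xc j \<chi>) = col \<chi> \<otimes>\<^bsub>Y\<^esub> (E0 \<otimes>\<^bsub>Y\<^esub> YY.X (pos \<chi> j))"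
      unfolding xc_def \<chi>(2) Phi_X[OF \<chi>(3)] X_E0[OF \<chi>(3)] ..
    also have "\<dots> = col \<chi> \<otimes>\<^bsub>Y\<^esub> YY.X (pos \<chi> j)"
      using col_Phi_one[OF that(1)] by (simp flip: YY.m_assoc)
    finally show ?thesis using X_col[OF \<chi>(1) that(2)] by simp
  qed
  show ?case
  proof (cases s)
    case (G i)
    then have i: "i \<in> {1..<n}" "i \<in> {1..n}" "Suc i \<in> {1..n}" and y: "yh_elt d n s = g i" using gen by (auto simp: yh_gens_def gY_def split: if_splits)
    show ?thesis
      unfolding y
    proof (rule acts_monomial[OF Psi_g[OF i(1)] gc_coeffs[OF i(1)]])
      fix \<chi> assume "\<chi> \<in> chars \<mu>"
      then have \<chi>: "\<chi> \<in> Irr" "comp_of \<chi> = \<mu>" by (auto simp: chars_iff)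
      define \<psi> where "\<psi> = \<chi> \<circ> simple_refl i"
      have \<psi>: "\<psi> \<in> chars \<mu>" "\<psi> \<circ> simple_refl i = \<chi>" "\<psi> i = \<chi> (Suc i)" "\<psi> (Suc i) = \<chi> i"
        using Irr_swap(1,2)[OF \<chi>(1) i(1)] \<chi>(2) by (simp_all add: \<psi>_def chars_iff comp_assoc)
      have u: "\<phi> = \<psi>" if "\<phi> \<circ> simple_refl i = \<chi>" for \<phi> using that by (auto simp: \<psi>_def comp_assoc)
      have "g i \<otimes>\<^bsub>Y\<^esub> col \<chi> = col \<psi> \<otimes>\<^bsub>Y\<^esub> Phi (gc i \<psi>)"
      proof (cases "\<chi> i = \<chi> (Suc i)")
        case True
        then have eq: "\<psi> = \<chi>" using swap_same[OF True] by (simp add: \<psi>_def)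
        have p: "pos \<chi> i \<in> young n \<mu>" using pos_Suc(2)[OF \<chi>(1) i(1) True] \<chi>(2) by simp
        have "col \<chi> \<otimes>\<^bsub>Y\<^esub> Phi (gc i \<chi>) = col \<chi> \<otimes>\<^bsub>Y\<^esub> E0 \<otimes>\<^bsub>Y\<^esub> g (pos \<chi> i)"
          using True \<chi>(2) by (simp add: gc_def Phi_gen[OF p] g_E0[OF p] YY.m_assoc)
        then show ?thesis
          unfolding eq using g_col_same[OF \<chi>(1) i(1) True] col_Phi_one \<psi>(1) eq by simp
      next
        case False
        have "gc i \<psi> = u_pow 1 \<odot>\<^bsub>H_mu d \<mu>\<^esub> \<one>\<^bsub>H_mu d \<mu>\<^esub>" using False \<psi> by (simp add: gc_def chars_iff)
        then have "Phi (gc i \<psi>) = u_pow 1 \<odot>\<^bsub>Y\<^esub> E0" using Phi.smult[of "\<one>\<^bsub>H_mu d \<mu>\<^esub>"] Phi.one by simp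
        then show ?thesis
          using g_col_diff[OF \<chi>(1) i(1) False, folded \<psi>_def] col_Phi_one[OF \<psi>(1)] by simp
      qed
      then show "\<exists>\<psi>\<in>chars \<mu>. \<psi> \<circ> simple_refl i = \<chi> \<and> (\<forall>\<chi>'\<in>chars \<mu>. \<chi>' \<circ> simple_refl i = \<chi> \<longrightarrow> \<chi>' = \<psi>) \<and>
          g i \<otimes>\<^bsub>Y\<^esub> col \<chi> = col \<psi> \<otimes>\<^bsub>Y\<^esub> Phi (gc i \<psi>)"
        using \<psi>(1,2) u by blast
    qed
  next
    case (T j)
    then have j: "j \<in> {1..n}" and y: "yh_elt d n s = tY d n j" using gen by (auto simp: yh_gens_def tY_def split: if_splits)
    show ?thesis
      unfolding y
    proof (rule acts_diag[OF Psi_t[OF j] tc_coeffs])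
      fix \<chi> assume \<chi>: "\<chi> \<in> chars \<mu>"
      have "Phi (tc j \<chi>) = const (\<chi> j) \<odot>\<^bsub>Y\<^esub> E0"
        using \<chi> Phi.smult[of "\<one>\<^bsub>H_mu d \<mu>\<^esub>"] Phi.one by (simp add: tc_def chars_iff)
      then show "tY d n j \<otimes>\<^bsub>Y\<^esub> col \<chi> = col \<chi> \<otimes>\<^bsub>Y\<^esub> Phi (tc j \<chi>)"
        using t_col[OF _ j] \<chi> col_Phi_one[OF \<chi>] by (simp add: chars_iff)
    qed
  next
    case X1
    then have y: "yh_elt d n s = YY.X 1" using n unfolding YY.X_one by (simp add: xY_def)
    show ?thesis unfolding y by (rule acts_diag[OF Psi_X[OF n1] xc_coeffs[OF n1] XP[OF _ n1]])
  next
    case X1_inv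
    then have y: "yh_elt d n s = xiY d n" using n by (simp add: xiY_def)
    have x: "xiY d n \<in> carrier Y" "xiY d n \<otimes>\<^bsub>Y\<^esub> YY.X 1 = \<one>\<^bsub>Y\<^esub>" using YY.x_inv n unfolding YY.X_one by simp_all
    have xU: "xc 1 \<chi> \<in> Units (Hc \<chi>)" if "\<chi> \<in> Irr" for \<chi> by (rule xc_Units[OF that n1])
    have P: "Psi (xiY d n) = diag (\<lambda>\<chi>. inv\<^bsub>Hc \<chi>\<^esub> xc 1 \<chi>)" using Psi_props unfolding xiB_def by blast
    show ?thesis
      unfolding y
    proof (rule acts_diag[OF P monomial_id_inv(3)[OF xU]])
      fix \<chi> assume \<chi>: "\<chi> \<in> chars \<mu>"
      let ?z = "xc 1 \<chi>" and ?w = "inv\<^bsub>Hc \<chi>\<^esub> xc 1 \<chi>"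
      have z: "?z \<in> Units (H_mu d \<mu>)" "Hc \<chi> = H_mu d \<mu>" using xU \<chi> by (auto simp: chars_iff)
      then have zc: "?z \<in> carrier (H_mu d \<mu>)" "?w \<in> carrier (H_mu d \<mu>)"
        using H.Units_closed[OF z(1)] H.Units_inv_closed[OF z(1)] z(2) by simp_all
      have zw: "Phi ?z \<otimes>\<^bsub>Y\<^esub> Phi ?w = E0" using Phi.inv_Units(1)[OF z(1)] unfolding z(2) by simp
      \<comment> \<open>The rule for the inverse is deduced from that for \<open>X 1\<close> by
        inserting \<open>E0\<close> as \<open>Phi ?z \<otimes> Phi ?w\<close>.\<close>
      have "xiY d n \<otimes>\<^bsub>Y\<^esub> col \<chi> = xiY d n \<otimes>\<^bsub>Y\<^esub> (col \<chi> \<otimes>\<^bsub>Y\<^esub> Phi ?z) \<otimes>\<^bsub>Y\<^esub> Phi ?w"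
        using x(1) zc zw col_Phi_one[OF \<chi>] by (simp add: YY.m_assoc)
      also have "\<dots> = xiY d n \<otimes>\<^bsub>Y\<^esub> YY.X 1 \<otimes>\<^bsub>Y\<^esub> col \<chi> \<otimes>\<^bsub>Y\<^esub> Phi ?w"
        using x(1) zc by (simp add: YY.m_assoc flip: XP[OF \<chi> n1])
      also have "\<dots> = col \<chi> \<otimes>\<^bsub>Y\<^esub> Phi ?w" unfolding x(2) using zc by simp
      finally show "xiY d n \<otimes>\<^bsub>Y\<^esub> col \<chi> = col \<chi> \<otimes>\<^bsub>Y\<^esub> Phi ?w" .
    qed blast
  qed
next
  case (smult c y)
  show ?case
    unfolding acts_def
  proof
    fix \<chi>' assume \<chi>': "\<chi>' \<in> chars \<mu>"
    note ec = entry_closed[OF smult(1) _ \<chi>']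
    have "entry (c \<odot>\<^bsub>Y\<^esub> y) \<chi> \<chi>' = c \<odot>\<^bsub>H_mu d \<mu>\<^esub> entry y \<chi> \<chi>'" if "\<chi> \<in> chars \<mu>" for \<chi>
      using B_smult_entry[of \<chi> \<chi>' c "Psi y"] that \<chi>' smult(1) by (auto simp: chars_iff)
    then have "(\<Oplus>\<^bsub>Y\<^esub>\<chi>\<in>chars \<mu>. col \<chi> \<otimes>\<^bsub>Y\<^esub> Phi (entry (c \<odot>\<^bsub>Y\<^esub> y) \<chi> \<chi>')) =
        (\<Oplus>\<^bsub>Y\<^esub>\<chi>\<in>chars \<mu>. c \<odot>\<^bsub>Y\<^esub> (col \<chi> \<otimes>\<^bsub>Y\<^esub> Phi (entry y \<chi> \<chi>')))"
      using ec Phi.smult[OF ec] by (intro YY.finsum_cong') (simp_all add: Pi_iff)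
    also have "\<dots> = c \<odot>\<^bsub>Y\<^esub> (\<Oplus>\<^bsub>Y\<^esub>\<chi>\<in>chars \<mu>. col \<chi> \<otimes>\<^bsub>Y\<^esub> Phi (entry y \<chi> \<chi>'))"
      using ec by (intro YY.smult_finsum[symmetric]) simp
    finally show "c \<odot>\<^bsub>Y\<^esub> y \<otimes>\<^bsub>Y\<^esub> col \<chi>' = (\<Oplus>\<^bsub>Y\<^esub>\<chi>\<in>chars \<mu>. col \<chi> \<otimes>\<^bsub>Y\<^esub> Phi (entry (c \<odot>\<^bsub>Y\<^esub> y) \<chi> \<chi>'))"
      using smult \<chi>' by (simp add: acts_def)
  qed
next
  case (add y z)
  show ?case
    unfolding acts_def
  proof
    fix \<chi>' assume \<chi>': "\<chi>' \<in> chars \<mu>"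
    note ec = entry_closed[OF add(1) _ \<chi>'] entry_closed[OF add(2) _ \<chi>']
    have "entry (y \<oplus>\<^bsub>Y\<^esub> z) \<chi> \<chi>' = entry y \<chi> \<chi>' \<oplus>\<^bsub>H_mu d \<mu>\<^esub> entry z \<chi> \<chi>'" if "\<chi> \<in> chars \<mu>" for \<chi>
      using B_add_entry[of \<chi> \<chi>' "Psi y" "Psi z"] that \<chi>' add(1,2) by (auto simp: chars_iff)
    then have "(\<Oplus>\<^bsub>Y\<^esub>\<chi>\<in>chars \<mu>. col \<chi> \<otimes>\<^bsub>Y\<^esub> Phi (entry (y \<oplus>\<^bsub>Y\<^esub> z) \<chi> \<chi>')) =
        (\<Oplus>\<^bsub>Y\<^esub>\<chi>\<in>chars \<mu>. col \<chi> \<otimes>\<^bsub>Y\<^esub> Phi (entry y \<chi> \<chi>') \<oplus>\<^bsub>Y\<^esub> col \<chi> \<otimes>\<^bsub>Y\<^esub> Phi (entry z \<chi> \<chi>'))"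
      using ec Phi.add[OF ec] by (intro YY.finsum_cong') (simp_all add: Pi_iff YY.r_distr)
    also have "\<dots> = (\<Oplus>\<^bsub>Y\<^esub>\<chi>\<in>chars \<mu>. col \<chi> \<otimes>\<^bsub>Y\<^esub> Phi (entry y \<chi> \<chi>')) \<oplus>\<^bsub>Y\<^esub> (\<Oplus>\<^bsub>Y\<^esub>\<chi>\<in>chars \<mu>. col \<chi> \<otimes>\<^bsub>Y\<^esub> Phi (entry z \<chi> \<chi>'))"
      using ec by (intro YY.finsum_addf) simp_all
    finally show "(y \<oplus>\<^bsub>Y\<^esub> z) \<otimes>\<^bsub>Y\<^esub> col \<chi>' = (\<Oplus>\<^bsub>Y\<^esub>\<chi>\<in>chars \<mu>. col \<chi> \<otimes>\<^bsub>Y\<^esub> Phi (entry (y \<oplus>\<^bsub>Y\<^esub> z) \<chi> \<chi>'))"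
      using add \<chi>' by (simp add: acts_def YY.l_distr)
  qed
next
  case (mult y z)
  show ?case
    unfolding acts_def
  proof
    fix \<chi>' assume \<chi>': "\<chi>' \<in> chars \<mu>"
    note zc = entry_closed[OF mult(2) _ \<chi>'] and yc = entry_closed[OF mult(1)]
    let ?t = "\<lambda>\<chi> \<psi>. col \<chi> \<otimes>\<^bsub>Y\<^esub> (Phi (entry y \<chi> \<psi>) \<otimes>\<^bsub>Y\<^esub> Phi (entry z \<psi> \<chi>'))"
    have "y \<otimes>\<^bsub>Y\<^esub> z \<otimes>\<^bsub>Y\<^esub> col \<chi>' = y \<otimes>\<^bsub>Y\<^esub> (\<Oplus>\<^bsub>Y\<^esub>\<psi>\<in>chars \<mu>. col \<psi> \<otimes>\<^bsub>Y\<^esub> Phi (entry z \<psi> \<chi>'))"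
      using mult \<chi>' by (simp add: acts_def YY.m_assoc)
    also have "\<dots> = (\<Oplus>\<^bsub>Y\<^esub>\<psi>\<in>chars \<mu>. y \<otimes>\<^bsub>Y\<^esub> (col \<psi> \<otimes>\<^bsub>Y\<^esub> Phi (entry z \<psi> \<chi>')))"
      using mult(1) zc by (intro YY.finsum_rdistr finite_chars) simp_all
    also have "\<dots> = (\<Oplus>\<^bsub>Y\<^esub>\<psi>\<in>chars \<mu>. \<Oplus>\<^bsub>Y\<^esub>\<chi>\<in>chars \<mu>. ?t \<chi> \<psi>)"
    proof (rule YY.finsum_cong'[OF refl])
      fix \<psi> assume \<psi>: "\<psi> \<in> chars \<mu>"
      have "y \<otimes>\<^bsub>Y\<^esub> (col \<psi> \<otimes>\<^bsub>Y\<^esub> Phi (entry z \<psi> \<chi>')) =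
          (\<Oplus>\<^bsub>Y\<^esub>\<chi>\<in>chars \<mu>. col \<chi> \<otimes>\<^bsub>Y\<^esub> Phi (entry y \<chi> \<psi>)) \<otimes>\<^bsub>Y\<^esub> Phi (entry z \<psi> \<chi>')"
        using mult(1,3) \<psi> zc[OF \<psi>] by (simp add: acts_def flip: YY.m_assoc)
      also have "\<dots> = (\<Oplus>\<^bsub>Y\<^esub>\<chi>\<in>chars \<mu>. col \<chi> \<otimes>\<^bsub>Y\<^esub> Phi (entry y \<chi> \<psi>) \<otimes>\<^bsub>Y\<^esub> Phi (entry z \<psi> \<chi>'))"
        using yc[OF _ \<psi>] zc[OF \<psi>] by (intro YY.finsum_ldistr finite_chars) simp_all
      also have "\<dots> = (\<Oplus>\<^bsub>Y\<^esub>\<chi>\<in>chars \<mu>. ?t \<chi> \<psi>)"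
        using yc[OF _ \<psi>] zc[OF \<psi>] by (intro YY.finsum_cong') (simp_all add: Pi_iff YY.m_assoc)
      finally show "y \<otimes>\<^bsub>Y\<^esub> (col \<psi> \<otimes>\<^bsub>Y\<^esub> Phi (entry z \<psi> \<chi>')) = (\<Oplus>\<^bsub>Y\<^esub>\<chi>\<in>chars \<mu>. ?t \<chi> \<psi>)" .
    qed (use yc zc in \<open>auto intro!: YY.finsum_closed\<close>)
    \<comment> \<open>Exchanging the two sums turns the composition of the actions into the matrix
      product, on which \<open>Phi\<close> is multiplicative.\<close>
    also have "\<dots> = (\<Oplus>\<^bsub>Y\<^esub>\<chi>\<in>chars \<mu>. \<Oplus>\<^bsub>Y\<^esub>\<psi>\<in>chars \<mu>. ?t \<chi> \<psi>)"
      using yc zc by (intro YY.finsum_swap finite_chars) simp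
    also have "\<dots> = (\<Oplus>\<^bsub>Y\<^esub>\<chi>\<in>chars \<mu>. col \<chi> \<otimes>\<^bsub>Y\<^esub> Phi (entry (y \<otimes>\<^bsub>Y\<^esub> z) \<chi> \<chi>'))"
    proof (rule YY.finsum_cong'[OF refl])
      fix \<chi> assume \<chi>: "\<chi> \<in> chars \<mu>"
      have "entry (y \<otimes>\<^bsub>Y\<^esub> z) \<chi> \<chi>' = (\<Oplus>\<^bsub>H_mu d \<mu>\<^esub>\<psi>\<in>chars \<mu>. entry y \<chi> \<psi> \<otimes>\<^bsub>H_mu d \<mu>\<^esub> entry z \<psi> \<chi>')"
        using B_mult_entry[of \<chi> \<chi>' "Psi y" "Psi z"] \<chi> \<chi>' mult(1,2) by (auto simp: chars_iff)
      moreover have "Phi (\<Oplus>\<^bsub>H_mu d \<mu>\<^esub>\<psi>\<in>chars \<mu>. entry y \<chi> \<psi> \<otimes>\<^bsub>H_mu d \<mu>\<^esub> entry z \<psi> \<chi>') =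
          (\<Oplus>\<^bsub>Y\<^esub>\<psi>\<in>chars \<mu>. Phi (entry y \<chi> \<psi>) \<otimes>\<^bsub>Y\<^esub> Phi (entry z \<psi> \<chi>'))"
      proof (subst Phi_finsum[OF finite_chars])
        show "(\<Oplus>\<^bsub>Y\<^esub>\<psi>\<in>chars \<mu>. Phi (entry y \<chi> \<psi> \<otimes>\<^bsub>H_mu d \<mu>\<^esub> entry z \<psi> \<chi>')) =
            (\<Oplus>\<^bsub>Y\<^esub>\<psi>\<in>chars \<mu>. Phi (entry y \<chi> \<psi>) \<otimes>\<^bsub>Y\<^esub> Phi (entry z \<psi> \<chi>'))"
          using yc[OF \<chi>] zc Phi.mult[OF yc[OF \<chi>] zc] by (intro YY.finsum_cong') simp_all
      qed (use yc[OF \<chi>] zc in simp)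
      moreover have "col \<chi> \<otimes>\<^bsub>Y\<^esub> \<dots> = (\<Oplus>\<^bsub>Y\<^esub>\<psi>\<in>chars \<mu>. ?t \<chi> \<psi>)"
        using yc[OF \<chi>] zc by (intro YY.finsum_rdistr finite_chars) simp_all
      ultimately show "(\<Oplus>\<^bsub>Y\<^esub>\<psi>\<in>chars \<mu>. ?t \<chi> \<psi>) = col \<chi> \<otimes>\<^bsub>Y\<^esub> Phi (entry (y \<otimes>\<^bsub>Y\<^esub> z) \<chi> \<chi>')" by simp
    qed (intro Pi_I YY.m_closed col_closed Phi_closed entry_closed \<chi>' mult(1,2))
    finally show "y \<otimes>\<^bsub>Y\<^esub> z \<otimes>\<^bsub>Y\<^esub> col \<chi>' = (\<Oplus>\<^bsub>Y\<^esub>\<chi>\<in>chars \<mu>. col \<chi> \<otimes>\<^bsub>Y\<^esub> Phi (entry (y \<otimes>\<^bsub>Y\<^esub> z) \<chi> \<chi>'))" .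
  qed
qed

lemma kernel_col:
  assumes "y \<in> carrier Y" "Psi y = \<zero>\<^bsub>B\<^esub>" "\<chi> \<in> chars \<mu>"
  shows "y \<otimes>\<^bsub>Y\<^esub> col \<chi> = \<zero>\<^bsub>Y\<^esub>"
proof -
  have "entry y \<psi> \<chi> = \<zero>\<^bsub>H_mu d \<mu>\<^esub>" if "\<psi> \<in> chars \<mu>" for \<psi>
    using B_zero_entry[of \<psi> \<chi>] that assms(3) unfolding assms(2) by (auto simp: chars_iff)
  moreover have "y \<otimes>\<^bsub>Y\<^esub> col \<chi> = (\<Oplus>\<^bsub>Y\<^esub>\<psi>\<in>chars \<mu>. col \<psi> \<otimes>\<^bsub>Y\<^esub> Phi (entry y \<psi> \<chi>))"
    using acts_all[OF assms(1)] assms(3) by (simp add: acts_def)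
  moreover have "\<dots> = (\<Oplus>\<^bsub>Y\<^esub>\<psi>\<in>chars \<mu>. \<zero>\<^bsub>Y\<^esub>)"
    using calculation(1) Phi.zero by (intro YY.finsum_cong') simp_all
  ultimately show ?thesis by simp
qed

end

lemma Psi_inj: "inj_on Psi (carrier Y)"
proof (rule inj_onI)
  fix x y assume xy: "x \<in> carrier Y" "y \<in> carrier Y" "Psi x = Psi y"
  then have z: "x \<ominus>\<^bsub>Y\<^esub> y \<in> carrier Y" "Psi (x \<ominus>\<^bsub>Y\<^esub> y) = \<zero>\<^bsub>B\<^esub>"
    by (simp_all add: a_minus_def B.r_neg)
  have "x \<ominus>\<^bsub>Y\<^esub> y = \<zero>\<^bsub>Y\<^esub>"
  proof (rule YY.E_separates[OF z(1)])
    fix \<chi> assume \<chi>: "\<chi> \<in> Irr"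
    then have "\<chi> \<in> chars (comp_of \<chi>)" by (simp add: chars_iff)
    from col_cancel[OF \<chi> z(1) kernel_col[OF Comp_compositions[OF \<chi>] z this]]
    show "(x \<ominus>\<^bsub>Y\<^esub> y) \<otimes>\<^bsub>Y\<^esub> YY.E \<chi> = \<zero>\<^bsub>Y\<^esub>" .
  qed
  then show "x = y" using YY.minus_equality[of x "\<ominus>\<^bsub>Y\<^esub> y"] xy by (simp add: a_minus_def)
qed

lemma Psi_iso: "Psi \<in> alg_iso Y B"
  unfolding alg_iso_def ring_iso_def ring_hom_def
  using Psi_inj Psi_surj by (auto simp: bij_betw_def)

end

theorem theorem3p1:
  fixes d n :: nat and \<xi> :: "nat \<Rightarrow> complex"
  assumes "d \<ge> 1" and "n \<ge> 1"
    and "bij_betw \<xi> {1..d} {z. z ^ d = 1}"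
  shows "\<exists>\<Psi> \<in> alg_iso (YH d n) (direct_sum_algebra (compositions d n) (mat_H d n \<xi>)).
    \<forall>\<chi> \<in> Irr_T d n. \<forall>l :: nat \<Rightarrow> int. \<forall>w. w permutes {1..n} \<longrightarrow>
      (let \<mu> = Comp d n \<xi> \<chi>;
           w' = inv_into UNIV w;
           \<chi>' = perm_act w \<chi>;
           p' = inv_into UNIV (pi_chi d n \<xi> \<chi>);
           z = p' \<circ> w' \<circ> pi_chi d n \<xi> \<chi>'
       in \<Psi> (yh_E d n \<chi> \<otimes>\<^bsub>YH d n\<^esub> yh_X_power d n l \<otimes>\<^bsub>YH d n\<^esub> yh_g d n w') =
          direct_sum_embed (compositions d n) (mat_H d n \<xi>) \<mu>
            (u_pow (int (perm_length n w') - int (perm_length n z)) \<odot>\<^bsub>mat_H d n \<xi> \<mu>\<^esub>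
              elem_mat (chars_of_comp d n \<xi> \<mu>) (H_mu d \<mu>) \<chi> \<chi>'
                (H_mu_X_power d n \<mu> (perm_act p' l) \<otimes>\<^bsub>H_mu d \<mu>\<^esub> H_mu_g d n \<mu> z)))"
proof -
  interpret root_enumeration d n \<xi> by unfold_locales (use assms in auto)
  show ?thesis using Psi_iso Psi_formula by blast
qed

end
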